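(* Let $d\ge1$, $T>0$, $d\mu(x,v)=dx\,d\gamma_d(v)$ on $\mathbb T^d\times\mathbb R^d$. For every $u_0\in L^2(\mathbb T^d\times\mathbb R^d,dx\,d\gamma_d(v))$, the energy weak solution, with initial value $u_0$, of the force-free kinetic Fokker--Planck equation $$(\partial_t+v\cdot D_x)u=\Delta_vu-v\cdot D_vu\quad\text{on }(0,T)\times\mathbb T^d_x\times\mathbb R^d_v$$ is the unique variational solution with initial value $u_0$. In particular, the weak and variational formulations coincide.
   Context: $\mathbb T^d$ is the $d$-dimensional torus with Lebesgue measure $dx$, and $d\gamma_d(v)=(2\pi)^{-d/2}e^{-|v|^2/2}dv$ on $\mathbb R^d$. Set $Q_\tau:=(0,\tau)\times\mathbb T^d\times\mathbb R^d$, $H:=L^2(\mathbb T^d\times\mathbb R^d,d\mu)$, $V:=L^2(\mathbb T^d;H^1(\mathbb R^d,\gamma_d))$ with norm $\|u\|_V^2=\|u\|_H^2+\|D_vu\|_{L^2(\mu)}^2$, where $H^1(\mathbb R^d,\gamma_d)$ is the Gaussian Sobolev space of $q\in L^2(\gamma_d)$ with weak gradient in $L^2(\gamma_d)$. $V\hookrightarrow H\equiv H^*\hookrightarrow V^*$, and $\langle\cdot,\cdot\rangle_V$ is the pairing of $V^*$ with $V$. Unlabelled integrals $\int\cdot\,d\mu$ are over $\mathbb T^d\times\mathbb R^d$. Let $Y:=\partial_t+v\cdot D_x$. For $u\in L^2(0,\tau;V)$, $Yu$ is understood in the distributional sense: $Yu=F\in L^2(0,\tau;V^* )$ means $\int_0^\tau\langle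 F,\varphi\rangle_V\,dt=-\int_{Q_\tau}u\,Y\varphi\,d\mu\,dt$ for all smooth $\varphi$ periodic in $x$ and compactly supported in time (in $(0,\tau)$) and velocity. Set $$H^1_{\mathrm{kin}}(Q_\tau):=\{u\in L^2(0,\tau;V):\ Yu\in L^2(0,\tau;V^* )\}.$$ Every $u\in H^1_{\mathrm{kin}}(Q_\tau)$ has a unique representative in $C([0,\tau];H)$, which is used for all pointwise-in-time values. Energy weak solution with initial value $u_0\in H$: $u\in H^1_{\mathrm{kin}}(Q_T)$ with $u(0)=u_0$ and $$\int_0^T\langle Yu,\varphi\rangle_V\,dt+\int_0^T\!\!\int D_vu\cdot D_v\varphi\,d\mu\,dt=0\quad\text{for every }\varphi\in L^2(0,T;V).$$ By the known linear kinetic Cauchy theory, for every $u_0\in H$ there is exactly one such solution. Variational solution with initial value $u_0\in H$: $u\in L^2(0,T;V)\cap C([0,T];H)$ with $u(0)=u_0$ such that, for every $\tau\in(0,T]$ and every $w\in H^1_{\mathrm{kin}}(Q_\tau)$, $$\int_0^\tau\langle Yw,w-u\rangle_V\,dt+\tfrac12\int_0^\tau\!\!\int(|D_vw|^2-|D_vu|^2)\,d\mu\,dt\ge\tfrac12\|(w-u)(\tau)\|_H^2-\tfrac12\|w(0)-u_0\|_H^2.$$ *)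

theory Defs
  imports "HOL-Analysis.Analysis"
begin

section \<open>The phase space\<close>

text \<open>The torus is \<open>\<real>\<^sup>d / \<int>\<^sup>d\<close> with \<open>d = CARD('n)\<close>. Measurable functions on it are functions on the
  fundamental domain \<open>[0,1)\<^sup>d\<close>; smooth functions on it are smooth \<open>\<int>\<^sup>d\<close>-periodic functions on \<open>\<real>\<^sup>d\<close>
  (see \<open>test_fun\<close>).\<close>

type_synonym 'n phase = "(real^'n) \<times> (real^'n)"

definition torus :: "(real^'n::finite) measure" where
  "torus = restrict_space lborel {x. \<forall>i. 0 \<le> x $ i \<and> x $ i < 1}"

definition gauss :: "(real^'n::finite) measure" where
  "gauss = density lborel
     (\<lambda>v. ennreal ((2 * pi) powr (- real CARD('n) / 2) * exp (- (norm v)\<^sup>2 / 2)))"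

definition mu :: "('n::finite) phase measure" where
  "mu = torus \<Otimes>\<^sub>M gauss"


section \<open>Smooth functions\<close>

fun iter_deriv :: "'a list \<Rightarrow> ('a::real_normed_vector \<Rightarrow> real) \<Rightarrow> 'a \<Rightarrow> real" where
  "iter_deriv [] f = f"
| "iter_deriv (b # bs) f = (\<lambda>x. frechet_derivative (iter_deriv bs f) (at x) b)"

text \<open>Used for finite-dimensional domains only, where this is \<open>C\<^sup>\<infinity>\<close>: the iterated directional
  derivatives of all orders exist and are differentiable, hence continuous.\<close>

definition smooth :: "('a::real_normed_vector \<Rightarrow> real) \<Rightarrow> bool" where
  "smooth f \<longleftrightarrow> (\<forall>bs x. iter_deriv bs f differentiable (at x))"


section \<open>The spaces \<open>H\<close>, \<open>V\<close> and the dual of \<open>V\<close>\<close>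

text \<open>The elements of all function spaces below are functions, not classes modulo null sets.\<close>

definition L2 :: "'a measure \<Rightarrow> ('a \<Rightarrow> 'b::{second_countable_topology, real_normed_vector}) set" where
  "L2 M = {f. f \<in> borel_measurable M \<and> integrable M (\<lambda>x. (norm (f x))\<^sup>2)}"

definition L2_norm :: "'a measure \<Rightarrow> ('a \<Rightarrow> 'b::{second_countable_topology, real_normed_vector}) \<Rightarrow> real" where
  "L2_norm M f = sqrt (LINT x|M. (norm (f x))\<^sup>2)"

text \<open>\<open>q\<close> is in the Gaussian Sobolev space \<open>H\<^sup>1(\<real>\<^sup>d, \<gamma>\<^sub>d)\<close> and has weak gradient \<open>g\<close>. The weak
  gradient is the distributional one (with respect to Lebesgue measure); only integrability is
  weighted.\<close>

definition H1_gauss_grad :: "((real^'n::finite) \<Rightarrow> real) \<Rightarrow> ((real^'n) \<Rightarrow> (real^'n)) \<Rightarrow> bool" where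
  "H1_gauss_grad q g \<longleftrightarrow> q \<in> L2 gauss \<and> g \<in> L2 gauss \<and>
     (\<forall>\<psi>. smooth \<psi> \<and> (\<exists>R. \<forall>v. norm v > R \<longrightarrow> \<psi> v = 0) \<longrightarrow>
       (\<forall>i. (LINT v|lborel. q v * frechet_derivative \<psi> (at v) (axis i 1))
          = - (LINT v|lborel. g v $ i * \<psi> v)))"

text \<open>\<open>u\<close> is in \<open>L\<^sup>2(\<bbbT>\<^sup>d; H\<^sup>1(\<real>\<^sup>d, \<gamma>\<^sub>d))\<close> and has velocity gradient \<open>g\<close>. A square-integrable map
  from the torus into the separable space \<open>H\<^sup>1(\<real>\<^sup>d, \<gamma>\<^sub>d)\<close> is identified with the jointly measurable
  function \<open>(x, v) \<mapsto> u (x, v)\<close>.\<close>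

definition has_v_grad :: "('n::finite phase \<Rightarrow> real) \<Rightarrow> ('n phase \<Rightarrow> (real^'n)) \<Rightarrow> bool" where
  "has_v_grad u g \<longleftrightarrow> u \<in> L2 mu \<and> g \<in> L2 mu \<and>
     (AE x in torus. H1_gauss_grad (\<lambda>v. u (x, v)) (\<lambda>v. g (x, v)))"

definition V :: "('n::finite phase \<Rightarrow> real) set" where
  "V = {u. \<exists>g. has_v_grad u g}"

definition Dv :: "('n::finite phase \<Rightarrow> real) \<Rightarrow> ('n phase \<Rightarrow> (real^'n))" where
  "Dv u = (SOME g. has_v_grad u g)"

definition V_norm :: "('n::finite phase \<Rightarrow> real) \<Rightarrow> real" where
  "V_norm u = sqrt ((L2_norm mu u)\<^sup>2 + (L2_norm mu (Dv u))\<^sup>2)"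

text \<open>Bounded linear functionals on \<open>V\<close>. Boundedness makes them respect equality almost everywhere.
  The pairing of \<open>F\<close> with \<open>u \<in> V\<close> is \<open>F u\<close>; the values of \<open>F\<close> outside \<open>V\<close> are irrelevant.\<close>

definition V_dual :: "(('n::finite phase \<Rightarrow> real) \<Rightarrow> real) set" where
  "V_dual = {F. (\<forall>u\<in>V. \<forall>w\<in>V. \<forall>a b. F (\<lambda>z. a * u z + b * w z) = a * F u + b * F w) \<and>
                (\<exists>C. \<forall>u\<in>V. \<bar>F u\<bar> \<le> C * V_norm u)}"

definition V_dual_norm :: "(('n::finite phase \<Rightarrow> real) \<Rightarrow> real) \<Rightarrow> real" where
  "V_dual_norm F = (SUP u\<in>{u \<in> V. V_norm u \<le> 1}. \<bar>F u\<bar>)"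


section \<open>Functions of time\<close>

text \<open>Lebesgue measure (and not its restriction to the Borel sets) is used in time because elements
  of the spaces below are only determined up to null sets of times.\<close>

abbreviation time :: "real \<Rightarrow> real measure" where
  "time \<tau> \<equiv> lebesgue_on {0<..<\<tau>}"

text \<open>The Bochner space \<open>L\<^sup>2(0,\<tau>; X)\<close> for a (semi)normed space \<open>X\<close> of real functions with norm \<open>N\<close>:
  strongly measurable maps, i.e. limits almost everywhere of \<open>X\<close>-valued simple functions, with
  square-integrable norm.\<close>

definition bochner_L2 ::
  "('b \<Rightarrow> real) set \<Rightarrow> (('b \<Rightarrow> real) \<Rightarrow> real) \<Rightarrow> real \<Rightarrow> (real \<Rightarrow> 'b \<Rightarrow> real) set" where
  "bochner_L2 X N \<tau> = {f. (AE t in time \<tau>. f t \<in> X) \<and>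
     (\<exists>s. (\<forall>n. simple_function (time \<tau>) (s n) \<and> (\<forall>t\<in>{0<..<\<tau>}. s n t \<in> X)) \<and>
          (AE t in time \<tau>. (\<lambda>n::nat. N (\<lambda>y. s n t y - f t y)) \<longlonglongrightarrow> 0)) \<and>
     integrable (time \<tau>) (\<lambda>t. (N (f t))\<^sup>2)}"

abbreviation L2_V :: "real \<Rightarrow> (real \<Rightarrow> 'n::finite phase \<Rightarrow> real) set" where
  "L2_V \<equiv> bochner_L2 V V_norm"

abbreviation L2_V_dual :: "real \<Rightarrow> (real \<Rightarrow> ('n::finite phase \<Rightarrow> real) \<Rightarrow> real) set" where
  "L2_V_dual \<equiv> bochner_L2 V_dual V_dual_norm"

definition C_H :: "real \<Rightarrow> (real \<Rightarrow> 'n::finite phase \<Rightarrow> real) set" where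
  "C_H \<tau> = {u. (\<forall>t\<in>{0..\<tau>}. u t \<in> L2 mu) \<and>
     (\<forall>t\<in>{0..\<tau>}. ((\<lambda>s. L2_norm mu (\<lambda>z. u s z - u t z)) \<longlongrightarrow> 0) (at t within {0..\<tau>}))}"

definition test_fun :: "real \<Rightarrow> (real \<times> (real^'n::finite) \<times> (real^'n) \<Rightarrow> real) \<Rightarrow> bool" where
  "test_fun \<tau> \<phi> \<longleftrightarrow> smooth \<phi> \<and>
     (\<forall>t x v i. \<phi> (t, x + axis i 1, v) = \<phi> (t, x, v)) \<and>
     (\<exists>a b R. 0 < a \<and> b < \<tau> \<and> (\<forall>t x v. \<phi> (t, x, v) \<noteq> 0 \<longrightarrow> a \<le> t \<and> t \<le> b \<and> norm v \<le> R))"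

text \<open>\<open>\<partial>\<^sub>t \<phi> + v \<cdot> D\<^sub>x \<phi>\<close> at \<open>(t, x, v)\<close>, for differentiable \<open>\<phi>\<close>.\<close>

definition Y_classical :: "(real \<times> (real^'n::finite) \<times> (real^'n) \<Rightarrow> real) \<Rightarrow> real \<Rightarrow> 'n phase \<Rightarrow> real" where
  "Y_classical \<phi> t = (\<lambda>(x, v). frechet_derivative \<phi> (at (t, x, v)) (1, 0, 0)
                             + frechet_derivative \<phi> (at (t, x, v)) (0, v, 0))"

text \<open>\<open>has_Y \<tau> u F\<close>: \<open>Y u = F \<in> L\<^sup>2(0,\<tau>; V\<^sup>*)\<close> in the sense of distributions. Test functions being dense
  in \<open>L\<^sup>2(0,\<tau>; V)\<close>, \<open>F\<close> is determined by \<open>u\<close>: for almost every time, as a functional on \<open>V\<close>.\<close>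

definition has_Y ::
  "real \<Rightarrow> (real \<Rightarrow> 'n::finite phase \<Rightarrow> real) \<Rightarrow> (real \<Rightarrow> ('n phase \<Rightarrow> real) \<Rightarrow> real) \<Rightarrow> bool" where
  "has_Y \<tau> u F \<longleftrightarrow> F \<in> L2_V_dual \<tau> \<and>
     (\<forall>\<phi>. test_fun \<tau> \<phi> \<longrightarrow>
       (LINT t|time \<tau>. F t (\<lambda>z. \<phi> (t, z)))
         = - (LINT t|time \<tau>. LINT z|mu. u t z * Y_classical \<phi> t z))"

definition H1_kin :: "real \<Rightarrow> (real \<Rightarrow> 'n::finite phase \<Rightarrow> real) set" where
  "H1_kin \<tau> = {u \<in> L2_V \<tau>. \<exists>F. has_Y \<tau> u F}"


section \<open>The two notions of solution\<close>

text \<open>Membership in \<open>H1_kin \<tau>\<close> only depends on the values at almost every time. That the continuous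
  representative of an element of \<open>H1_kin \<tau>\<close> is used for values at single times is expressed by
  membership in \<open>H1_kin \<tau> \<inter> C_H \<tau>\<close>.\<close>

definition energy_weak_solution ::
  "real \<Rightarrow> ('n::finite phase \<Rightarrow> real) \<Rightarrow> (real \<Rightarrow> 'n phase \<Rightarrow> real) \<Rightarrow> bool" where
  "energy_weak_solution T u0 u \<longleftrightarrow>
     u \<in> H1_kin T \<inter> C_H T \<and> (AE z in mu. u 0 z = u0 z) \<and>
     (\<exists>F. has_Y T u F \<and>
       (\<forall>\<phi>\<in>L2_V T.
         (LINT t|time T. F t (\<phi> t))
           + (LINT t|time T. LINT z|mu. Dv (u t) z \<bullet> Dv (\<phi> t) z) = 0))"

definition variational_solution ::
  "real \<Rightarrow> ('n::finite phase \<Rightarrow> real) \<Rightarrow> (real \<Rightarrow> 'n phase \<Rightarrow> real) \<Rightarrow> bool" where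
  "variational_solution T u0 u \<longleftrightarrow>
     u \<in> L2_V T \<inter> C_H T \<and> (AE z in mu. u 0 z = u0 z) \<and>
     (\<forall>\<tau>\<in>{0<..T}. \<forall>w\<in>H1_kin \<tau> \<inter> C_H \<tau>. \<forall>F. has_Y \<tau> w F \<longrightarrow>
       (LINT t|time \<tau>. F t (\<lambda>z. w t z - u t z))
         + 1/2 * (LINT t|time \<tau>. LINT z|mu. (norm (Dv (w t) z))\<^sup>2 - (norm (Dv (u t) z))\<^sup>2)
       \<ge> 1/2 * (L2_norm mu (\<lambda>z. w \<tau> z - u \<tau> z))\<^sup>2 - 1/2 * (L2_norm mu (\<lambda>z. w 0 z - u0 z))\<^sup>2)"

text \<open>Equality in \<open>C([0,\<tau>]; H)\<close>.\<close>

definition eq_C_H :: "real \<Rightarrow> (real \<Rightarrow> 'n::finite phase \<Rightarrow> real) \<Rightarrow> (real \<Rightarrow> 'n phase \<Rightarrow> real) \<Rightarrow> bool" where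
  "eq_C_H \<tau> u w \<longleftrightarrow> (\<forall>t\<in>{0..\<tau>}. AE z in mu. u t z = w t z)"

end

theory Submission
  imports Defs "HOL-Probability.Probability" "HOL-Real_Asymp.Real_Asymp" "HOL-Computational_Algebra.Polynomial"
begin

text \<open>On the basis functions \<open>cas (2\<pi>k \<cdot> x) h\<^sub>\<alpha>(v)\<close>, with \<open>cas = cos + sin\<close> and Hermite polynomials
\<open>h\<^sub>\<alpha>\<close>, the transport operator \<open>v \<cdot> D\<^sub>x\<close> is skew-symmetric and shifts the Hermite degree by one.
Testing \<open>Y w = F\<close> with a function of time times a basis function gives an ordinary differential
equation for each coefficient of \<open>w\<close>. Multiplied by the coefficient and summed over a finite box of
indices, the transport terms cancel except on the outermost Hermite layer, where they are bounded by
tails of \<open>\<parallel>w\<parallel>\<^sup>2\<close> and \<open>\<parallel>D\<^sub>v w\<parallel>\<^sup>2\<close>. As the box grows this yields the energy identity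
\<open>\<integral> \<langle>Y w, w\<rangle> dt = 1/2 \<parallel>w(\<tau>)\<parallel>\<^sup>2 - 1/2 \<parallel>w(0)\<parallel>\<^sup>2\<close>.

The functions \<open>a(t) cos (2\<pi>k \<cdot> x + \<beta>(t) \<cdot> v + \<theta>)\<close> with suitable explicit \<open>a\<close> and \<open>\<beta>\<close> are solutions; their
initial values span a dense subspace of \<open>H\<close>, and by the energy identity the solution depends
continuously on its initial value, so solutions exist for all \<open>u\<^sub>0\<close>.

Applied to \<open>w - u\<close> with \<open>u\<close> a weak solution, the energy identity gives the variational inequality with
surplus \<open>1/2 \<integral> |D\<^sub>v(w - u)|\<^sup>2\<close>. Conversely, inserting the weak solution \<open>u\<close> as test function into the
variational inequality for \<open>w\<close> leaves \<open>\<parallel>(u - w)(\<tau>)\<parallel>\<^sup>2 \<le> 0\<close>.\<close>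

text \<open>Membership in \<open>H1_kin\<close> controls neither the time derivative nor v . D_x w
  separately; only their sum lies in the dual of V. Hence the two parts cannot be integrated one at
  a time against \<open>w\<close>. A finite box of indices makes this possible, at the price of an
  error on its outermost Hermite layer, and that error carries a factor |k|. Frequencies and degrees
  are therefore cut off at different levels: for a fixed frequency cutoff, layers of different
  degree are disjoint, Bessel's inequality makes their contributions summable, and the degree cutoff
  is chosen only after the frequency cutoff. In this way the missing regularity in x does no harm.

  The waves used for existence come from following one Fourier mode in (x, v). Its velocity
  frequency obeys a linear differential equation and its amplitude decays explicitly, so a cosine
  remains a cosine.

  All elements are functions and not classes, so every norm is a seminorm, and statements about
  single times and statements about almost every time have to be kept apart throughout.\<close>

abbreviation (input) pointwise_diff (infixl "-." 65) where
  "f -. g \<equiv> %z. f z - g z"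

abbreviation (input) seq_tendsto (infix "\<leadsto>" 60) where
 "X \<leadsto> L \<equiv> X \<longlonglongrightarrow> L"

lemmas LINT_cong = Bochner_Integration.integral_cong
 and LINT_add = Bochner_Integration.integral_add
 and LINT_diff = Bochner_Integration.integral_diff
 and integrable_plus = Bochner_Integration.integrable_add
 and integrable_minus = Bochner_Integration.integrable_diff
 and integrable_dominated = Bochner_Integration.integrable_bound

section \<open>Square-integrable functions\<close>

definition ip :: "'a measure => ('a => 'b::euclidean_space) => ('a => 'b) => real" where
 "ip M f g = (LINT x|M. f x \<bullet> g x)"

lemma L2_measurable: "f \<in> L2 M ==> f \<in> borel_measurable M"
 by (simp add: L2_def)

lemma L2_integrable_sq: "f \<in> L2 M ==> integrable M (%x. (norm (f x))^2)"
 by (simp add: L2_def)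

lemma L2_I: "f \<in> borel_measurable M ==> integrable M (%x. (norm (f x))^2) ==> f \<in> L2 M"
 by (simp add: L2_def)

lemma L2_dominated:
 assumes "f \<in> borel_measurable M" "integrable M w" "AE x in M. (norm (f x))^2 <= w x"
 shows "f \<in> L2 M"
 using assms
 by (intro L2_I integrable_dominated[OF assms(2)]) (auto elim!: eventually_mono)

lemma L2_add:
 fixes f g :: "'a => 'b::euclidean_space"
 assumes "f \<in> L2 M" "g \<in> L2 M"
 shows "(%x. f x + g x) \<in> L2 M"
proof (rule L2_dominated)
 show "(%x. f x + g x) \<in> borel_measurable M"
  using assms by (auto simp: L2_def)
 show "integrable M (%x. 2 * (norm (f x))^2 + 2 * (norm (g x))^2)"
  using assms by (auto simp: L2_def)
 have "(norm (f x + g x))^2 <= 2 * (norm (f x))^2 + 2 * (norm (g x))^2" for x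
 proof -
  have "(norm (f x + g x))^2 <= (norm (f x) + norm (g x))^2"
   by (intro power_mono norm_triangle_ineq) auto
  also have "\<dots> <= 2 * (norm (f x))^2 + 2 * (norm (g x))^2"
   using sum_squares_ge_zero[of "norm (f x) - norm (g x)" 0]
   by (simp add: power2_eq_square algebra_simps)
  finally show ?thesis .
 qed
 then show "AE x in M. (norm (f x + g x))^2 <= 2 * (norm (f x))^2 + 2 * (norm (g x))^2" by simp
qed

lemma L2_scaleR:
 fixes f :: "'a => 'b::euclidean_space"
 assumes "f \<in> L2 M"
 shows "(%x. c *\<^sub>R f x) \<in> L2 M"
 using assms by (auto simp: L2_def power_mult_distrib)

lemma L2_scale:
 fixes f :: "'a => real"
 assumes "f \<in> L2 M"
 shows "(%x. c * f x) \<in> L2 M"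
 using L2_scaleR[OF assms, of c] by simp

lemma L2_zero [simp]: "(%x. 0::'b::euclidean_space) \<in> L2 M"
 by (auto simp: L2_def)

lemma L2_diff:
 fixes f g :: "'a => 'b::euclidean_space"
 assumes "f \<in> L2 M" "g \<in> L2 M"
 shows "(f -. g) \<in> L2 M"
 using L2_add[OF assms(1) L2_scaleR[OF assms(2), of "-1"]] by simp

lemma L2_comb:
 fixes f g :: "'a => real"
 assumes "f \<in> L2 M" "g \<in> L2 M"
 shows "(%x. a * f x + b * g x) \<in> L2 M"
 by (intro L2_add L2_scale assms)

lemma L2_sum:
 fixes f :: "'i => 'a => 'b::euclidean_space"
 assumes "!!i. i \<in> I ==> f i \<in> L2 M"
 shows "(%x. \<Sum>i\<in>I. f i x) \<in> L2 M"
 using assms by (induction I rule: infinite_finite_induct) (auto intro!: L2_add)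

lemma L2_integrable_inner:
 fixes f g :: "'a => 'b::euclidean_space"
 assumes "f \<in> L2 M" "g \<in> L2 M"
 shows "integrable M (%x. f x \<bullet> g x)"
proof (rule integrable_dominated)
 show "integrable M (%x. (norm (f x))^2 + (norm (g x))^2)"
  using assms by (auto simp: L2_def)
 show "(%x. f x \<bullet> g x) \<in> borel_measurable M"
  using assms by (auto simp: L2_def)
 have "norm (f x \<bullet> g x) <= norm ((norm (f x))^2 + (norm (g x))^2)" for x
 proof -
  have "norm (f x \<bullet> g x) <= norm (f x) * norm (g x)"
   using Cauchy_Schwarz_ineq2 by auto
  also have "\<dots> <= (norm (f x))^2 + (norm (g x))^2"
  proof -
   have "2 * (norm (f x) * norm (g x)) <= (norm (f x))^2 + (norm (g x))^2"
    using sum_squares_bound[of "norm (f x)" "norm (g x)"] by (simp add: mult.assoc)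
   moreover have "0 <= norm (f x) * norm (g x)" by simp
   ultimately show ?thesis by linarith
  qed
  finally show ?thesis by simp
 qed
 then show "AE x in M. norm (f x \<bullet> g x) <= norm ((norm (f x))^2 + (norm (g x))^2)" by simp
qed

lemma L2_integrable_mult:
 fixes f g :: "'a => real"
 assumes "f \<in> L2 M" "g \<in> L2 M"
 shows "integrable M (%x. f x * g x)"
 using L2_integrable_inner[OF assms] by simp

lemma L2_norm_nonneg [simp]: "0 <= L2_norm M f"
 unfolding L2_norm_def by (auto intro!: integral_nonneg_AE)

lemma L2_norm_ip: "(L2_norm M f)^2 = ip M f f"
 unfolding L2_norm_def ip_def
 by (subst real_sqrt_pow2) (auto intro!: integral_nonneg_AE simp: dot_square_norm)

lemma L2_norm_sq: "(L2_norm M f)^2 = (LINT x|M. (norm (f x))^2)"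
 unfolding L2_norm_def by (subst real_sqrt_pow2) (auto intro!: integral_nonneg_AE)

lemma ip_commute: "ip M f g = ip M g f"
 by (simp add: ip_def inner_commute)

lemma ip_add_left:
 assumes "f \<in> L2 M" "g \<in> L2 M" "h \<in> L2 M"
 shows "ip M (%x. f x + g x) h = ip M f h + ip M g h"
 unfolding ip_def using assms
 by (subst LINT_add[symmetric])
  (auto intro!: L2_integrable_inner simp: inner_add_left)

lemma ip_scaleR_left: "ip M (%x. c *\<^sub>R f x) h = c * ip M f h"
 unfolding ip_def by simp

lemma ip_scale_left: "ip M (%x. c * f x) h = c * ip M f h" for f h :: "'a => real"
 using ip_scaleR_left[of M c f h] by simp

lemma ip_scale_right: "ip M h (%x. c * f x) = c * ip M h f" for f h :: "'a => real"
 using ip_scale_left[of M c f h] by (simp add: ip_commute)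

lemma ip_diff_left:
 assumes "f \<in> L2 M" "g \<in> L2 M" "h \<in> L2 M"
 shows "ip M (f -. g) h = ip M f h - ip M g h"
 unfolding ip_def using assms
 by (subst LINT_diff[symmetric])
  (auto intro!: L2_integrable_inner simp: inner_diff_left)

lemma ip_add_right:
 assumes "f \<in> L2 M" "g \<in> L2 M" "h \<in> L2 M"
 shows "ip M h (%x. f x + g x) = ip M h f + ip M h g"
 using ip_add_left[OF assms] by (simp add: ip_commute)

lemma ip_diff_right:
 assumes "f \<in> L2 M" "g \<in> L2 M" "h \<in> L2 M"
 shows "ip M h (f -. g) = ip M h f - ip M h g"
 using ip_diff_left[OF assms] by (simp add: ip_commute)

lemma ip_zero_left [simp]: "ip M (%x. 0) h = 0"
 by (simp add: ip_def)

lemma ip_zero_right [simp]: "ip M h (%x. 0) = 0"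
 by (simp add: ip_def)

lemma ip_sum_left:
 assumes "!!i. i \<in> I ==> f i \<in> L2 M" "h \<in> L2 M"
 shows "ip M (%x. \<Sum>i\<in>I. f i x) h = (\<Sum>i\<in>I. ip M (f i) h)"
 using assms
 by (induction I rule: infinite_finite_induct) (auto simp: ip_add_left L2_sum)

lemma ip_sum_right:
 assumes "!!i. i \<in> I ==> f i \<in> L2 M" "h \<in> L2 M"
 shows "ip M h (%x. \<Sum>i\<in>I. f i x) = (\<Sum>i\<in>I. ip M h (f i))"
 using ip_sum_left[OF assms] by (simp add: ip_commute)

lemma L2_norm_eq_0_iff:
 assumes "f \<in> L2 M"
 shows "L2_norm M f = 0 \<longleftrightarrow> (AE x in M. f x = 0)"
proof -
 have "L2_norm M f = 0 \<longleftrightarrow> (LINT x|M. (norm (f x))^2) = 0"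
  unfolding L2_norm_def by simp
 also have "\<dots> \<longleftrightarrow> (AE x in M. (norm (f x))^2 = 0)"
  using assms by (intro integral_nonneg_eq_0_iff_AE) (auto simp: L2_def)
 finally show ?thesis by simp
qed

lemma L2_norm_cong_AE:
 assumes "f \<in> borel_measurable M" "g \<in> borel_measurable M" "AE x in M. f x = g x"
 shows "L2_norm M f = L2_norm M g"
 unfolding L2_norm_def using assms by (intro arg_cong[where f=sqrt] integral_cong_AE) auto

lemma ip_cong_AE:
 assumes "f \<in> L2 M" "f' \<in> L2 M" "g \<in> L2 M" "g' \<in> L2 M" "AE x in M. f x = f' x" "AE x in M. g x = g' x"
 shows "ip M f g = ip M f' g'"
 unfolding ip_def using assms by (intro integral_cong_AE) (auto simp: L2_def)

lemma ip_Cauchy_Schwarz: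
 assumes "f \<in> L2 M" "g \<in> L2 M"
 shows "abs (ip M f g) <= L2_norm M f * L2_norm M g"
proof (cases "L2_norm M g = 0")
 case True
 then have "AE x in M. g x = 0" using assms L2_norm_eq_0_iff by blast
 then have "ip M f g = ip M f (%x. 0)"
  using assms by (intro ip_cong_AE) auto
 then show ?thesis by simp
next
 case False
 \<comment> \<open>The minimiser of the norm of \<open>f - t g\<close>; the case split keeps the
   denominator positive.\<close>
 define t where "t = ip M f g / ip M g g"
 have pos: "ip M g g > 0"
  using False by (simp add: L2_norm_ip[symmetric])
 have tg: "(%x. t *\<^sub>R g x) \<in> L2 M" by (rule L2_scaleR[OF assms(2)])
 have "0 <= ip M (%x. f x - t *\<^sub>R g x) (%x. f x - t *\<^sub>R g x)"
  unfolding ip_def by (auto intro!: integral_nonneg_AE)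
 also have "\<dots> = ip M f f - 2 * t * ip M f g + t * t * ip M g g"
  using assms tg ip_scaleR_left[of M t g]
  by (simp add: ip_diff_left ip_diff_right L2_diff ip_scaleR_left ip_commute[of M f "%x. t *\<^sub>R g x"]
    ip_commute[of M g "%x. t *\<^sub>R g x"] ip_commute[of M g f] algebra_simps)
 also have "\<dots> = ip M f f - (ip M f g)^2 / ip M g g"
  using pos by (simp add: t_def field_simps power2_eq_square)
 finally have "(ip M f g)^2 <= ip M f f * ip M g g"
  using pos by (simp add: field_simps)
 also have "\<dots> = (L2_norm M f * L2_norm M g)^2"
  by (simp add: power_mult_distrib L2_norm_ip)
 finally show ?thesis
  by (simp add: abs_le_square_iff[symmetric])
qed

lemma L2_norm_triangle:
 fixes f g :: "'a => 'b::euclidean_space"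
 assumes "f \<in> L2 M" "g \<in> L2 M"
 shows "L2_norm M (%x. f x + g x) <= L2_norm M f + L2_norm M g"
proof (rule power2_le_imp_le)
 have "(L2_norm M (%x. f x + g x))^2 = (L2_norm M f)^2 + 2 * ip M f g + (L2_norm M g)^2"
  unfolding L2_norm_ip using assms
  by (simp add: ip_add_left ip_add_right L2_add ip_commute[of M g f])
 also have "\<dots> <= (L2_norm M f + L2_norm M g)^2"
  using ip_Cauchy_Schwarz[OF assms] by (simp add: power2_sum)
 finally show "(L2_norm M (%x. f x + g x))^2 <= (L2_norm M f + L2_norm M g)^2" .
qed auto

lemma L2_norm_scaleR: "L2_norm M (%x. c *\<^sub>R f x) = abs c * L2_norm M f"
 unfolding L2_norm_def by (simp add: power_mult_distrib real_sqrt_mult)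

lemma L2_norm_scale: "L2_norm M (%x. c * f x) = abs c * L2_norm M f" for f :: "'a => real"
 using L2_norm_scaleR[of M c f] by simp

lemma L2_norm_zero [simp]: "L2_norm M (%x. 0) = 0"
 by (simp add: L2_norm_def)

lemma L2_norm_minus_commute: "L2_norm M (f -. g) = L2_norm M (g -. f)"
 unfolding L2_norm_def by (simp add: norm_minus_commute)

lemma L2_norm_triangle_diff:
 fixes f g h :: "'a => 'b::euclidean_space"
 assumes "f \<in> L2 M" "g \<in> L2 M" "h \<in> L2 M"
 shows "L2_norm M (f -. h) <= L2_norm M (f -. g) + L2_norm M (g -. h)"
 using L2_norm_triangle[OF L2_diff[OF assms(1,2)] L2_diff[OF assms(2,3)]] by simp

lemma L2_norm_diff_ineq:
 fixes f g :: "'a => 'b::euclidean_space"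
 assumes "f \<in> L2 M" "g \<in> L2 M"
 shows "abs (L2_norm M f - L2_norm M g) <= L2_norm M (f -. g)"
 using L2_norm_triangle[OF L2_diff[OF assms] assms(2)]
  L2_norm_triangle[OF L2_diff[OF assms(2,1)] assms(1)] L2_norm_minus_commute[of M f g]
 by simp

lemma L2_tendsto_dominated:
 fixes f :: "'a => 'b::euclidean_space"
 assumes meas: "!!n. s n \<in> borel_measurable M" "f \<in> borel_measurable M"
  and w: "integrable M w"
  and lim: "AE x in M. (%n. s n x) \<leadsto> f x"
  and bd: "!!n. AE x in M. (norm (s n x - f x))^2 <= w x"
 shows "(%n. L2_norm M (s n -. f)) \<leadsto> 0"
proof -
 have "(%n. LINT x|M. (norm (s n x - f x))^2) \<leadsto> (LINT x|M. 0::real)"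
 proof (rule integral_dominated_convergence[where w=w])
  show "AE x in M. (%n. (norm (s n x - f x))^2) \<leadsto> 0"
   using lim
  proof eventually_elim
   case (elim x)
   then have "(%n. s n x - f x) \<leadsto> 0" by (simp add: LIM_zero_iff)
   then have "(%n. (norm (s n x - f x))^2) \<leadsto> 0\<^sup>2"
    by (intro tendsto_power tendsto_norm_zero)
   then show ?case by simp
  qed
  show "AE x in M. norm ((norm (s n x - f x))^2) <= w x" for n
   using bd[of n] by simp
 qed (use meas w in auto)
 then have "(%n. sqrt (LINT x|M. (norm (s n x - f x))^2)) \<leadsto> sqrt 0"
  by (intro tendsto_real_sqrt) simp
 then show ?thesis by (simp add: L2_norm_def)
qed

section \<open>Almost everywhere convergence and completeness of L2\<close>

text \<open>By monotone convergence the sum of the series has a finite integral, so it is finite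
  almost everywhere.\<close>

lemma AE_summable_of_integrals:
 fixes a :: "nat => 'a => real"
 assumes meas: "!!n. integrable M (a n)" and nn: "!!n x. 0 <= a n x"
  and sm: "summable (%n. LINT x|M. a n x)"
 shows "AE x in M. summable (%n. a n x)"
proof -
 have [measurable]: "!!n. a n \<in> borel_measurable M" using meas by auto
 have "(\<integral>\<^sup>+x. (\<Sum>n. ennreal (a n x)) \<partial>M) = (\<Sum>n. \<integral>\<^sup>+x. ennreal (a n x) \<partial>M)"
  by (intro nn_integral_suminf) auto
 also have "\<dots> = (\<Sum>n. ennreal (LINT x|M. a n x))"
  using meas nn by (simp add: nn_integral_eq_integral)
 also have "\<dots> \<noteq> \<infinity>"
  using sm nn by (subst suminf_ennreal2) (auto intro!: integral_nonneg_AE)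
 finally have "AE x in M. (\<Sum>n. ennreal (a n x)) \<noteq> \<infinity>"
  by (intro nn_integral_noteq_infinite) auto
 then show ?thesis
 proof eventually_elim
  case (elim x)
  show ?case
  proof (rule summable_suminf_not_top)
   show "(\<Sum>n. ennreal (a n x)) \<noteq> top" using elim by simp
  qed (use nn in auto)
 qed
qed

text \<open>The weights \<open>2 ^ n\<close> let squared norms control the increments themselves: a
  weighted square plus a geometric term dominates each increment, so the telescoping series
  converges absolutely at almost every point.\<close>

lemma L2_rapid_convergent:
 fixes f :: "nat => 'a => 'b::euclidean_space"
 assumes L: "!!n. f n \<in> L2 M" and sm: "summable (%n. 2 ^ n * (L2_norm M (f (Suc n) -. f n))^2)"
 shows "AE x in M. convergent (%n. f n x)"
proof -
 have "AE x in M. summable (%n. 2 ^ n * (norm (f (Suc n) x - f n x))^2)"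
 proof (rule AE_summable_of_integrals)
  show "integrable M (%x. 2 ^ n * (norm (f (Suc n) x - f n x))^2)" for n
   using L2_diff[OF L L, of "Suc n" n] by (auto simp: L2_def)
  show "summable (%n. LINT x|M. 2 ^ n * (norm (f (Suc n) x - f n x))^2)"
   using sm by (simp add: L2_norm_sq)
 qed auto
 then show ?thesis
 proof eventually_elim
  case (elim x)
  define c where "c n = norm (f (Suc n) x - f n x)" for n
  have "summable c"
  proof (rule summable_comparison_test')
   show "summable (%n. 2 ^ n * (c n)^2 + (1/2) ^ n)"
    using elim unfolding c_def by (intro summable_add summable_geometric) auto
   fix n :: nat
   \<comment> \<open>Expanding the square gives x \<le> x^2 + 1 for x = \<open>2 ^ n * c n\<close>;
     dividing by \<open>2 ^ n\<close> yields the bound of \<open>c n\<close>.\<close>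
   have "0 <= (2 ^ n * c n - 1)^2 + 2 ^ n * c n" by (simp add: c_def)
   then have "2 ^ n * c n <= 2^n * (2 ^ n * (c n)^2 + (1/2) ^ n)"
    by (simp add: power2_eq_square algebra_simps power_one_over flip: power_mult_distrib)
   then have "c n <= 2 ^ n * (c n)^2 + (1/2) ^ n"
    by (simp add: mult_le_cancel_left)
   then show "norm (c n) <= 2 ^ n * (c n)^2 + (1/2) ^ n" by (simp add: c_def)
  qed
  then have "summable (%n. f (Suc n) x - f n x)"
   unfolding c_def by (rule summable_norm_cancel)
  then have "convergent (%n. \<Sum>i<n. f (Suc i) x - f i x)"
   by (simp add: summable_iff_convergent)
  then have "convergent (%n. f n x - f 0 x)"
   by (simp add: sum_lessThan_telescope[of "%n. f n x"])
  then show ?case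
   using convergent_add_const_right_iff[of "%n. f n x" "- f 0 x"] by simp
 qed
qed

text \<open>Applied to differences with one index sent to infinity, this turns Cauchy bounds into
  bounds of the distance to the limit.\<close>

lemma L2_Fatou:
 fixes f :: "nat => 'a => 'b::euclidean_space"
 assumes L: "!!n. f n \<in> L2 M" and g: "g \<in> borel_measurable M"
  and lim: "AE x in M. (%n. f n x) \<leadsto> g x"
  and bd: "!!n. n \<ge> N ==> L2_norm M (f n) <= B"
 shows "g \<in> L2 M" "L2_norm M g <= B"
proof -
 have [measurable]: "!!n. f n \<in> borel_measurable M" "g \<in> borel_measurable M"
  using L g by (auto simp: L2_def)
 have B0: "0 <= B" using bd[of N] L2_norm_nonneg[of M "f N"] by linarith
 have "(\<integral>\<^sup>+x. ennreal ((norm (g x))^2) \<partial>M) = (\<integral>\<^sup>+x. liminf (%n. ennreal ((norm (f n x))^2)) \<partial>M)"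
 proof (rule nn_integral_cong_AE)
  show "AE x in M. ennreal ((norm (g x))^2) = liminf (%n. ennreal ((norm (f n x))^2))"
   using lim
  proof eventually_elim
   case (elim x)
   then have "(%n. ennreal ((norm (f n x))^2)) \<leadsto> ennreal ((norm (g x))^2)"
    by (intro tendsto_ennrealI tendsto_power tendsto_norm)
   then show ?case by (intro lim_imp_Liminf[symmetric]) auto
  qed
 qed
 also have "\<dots> <= liminf (%n. \<integral>\<^sup>+x. ennreal ((norm (f n x))^2) \<partial>M)"
  by (intro nn_integral_liminf) auto
 also have "\<dots> <= ennreal (B\<^sup>2)"
 proof (rule Liminf_le)
  show "\<forall>\<^sub>F n in sequentially. (\<integral>\<^sup>+x. ennreal ((norm (f n x))^2) \<partial>M) <= ennreal (B\<^sup>2)"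
   using eventually_ge_at_top[of N]
  proof eventually_elim
   case (elim n)
   have "(\<integral>\<^sup>+x. ennreal ((norm (f n x))^2) \<partial>M) = ennreal ((L2_norm M (f n))^2)"
    unfolding L2_norm_sq using L by (intro nn_integral_eq_integral) (auto simp: L2_def)
   also have "\<dots> <= ennreal (B\<^sup>2)"
    using bd[OF elim] by (intro ennreal_leI power_mono) auto
   finally show ?case .
  qed
 qed auto
 finally have le: "(\<integral>\<^sup>+x. ennreal ((norm (g x))^2) \<partial>M) <= ennreal (B\<^sup>2)" .
 then have int: "integrable M (%x. (norm (g x))^2)"
  by (intro integrableI_nonneg) (auto simp: less_top[symmetric] top_unique)
 then show "g \<in> L2 M" by (auto simp: L2_def)
 have "(L2_norm M g)^2 <= B\<^sup>2"
  using le B0 unfolding L2_norm_sq by (simp add: nn_integral_eq_integral[OF int])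
 then show "L2_norm M g <= B" using B0 power2_le_imp_le by blast
qed

text \<open>Riesz-Fischer: a rapidly converging subsequence has an almost everywhere limit, and
  Fatou's lemma along that subsequence bounds the distance of every late \<open>f n\<close> to
  it.\<close>

lemma L2_complete:
 fixes f :: "nat => 'a => 'b::euclidean_space"
 assumes L: "!!n. f n \<in> L2 M"
  and C: "!!e. e > 0 ==> \<exists>N. \<forall>m\<ge>N. \<forall>n\<ge>N. L2_norm M (f m -. f n) < e"
 obtains g where "g \<in> L2 M" "(%n. L2_norm M (f n -. g)) \<leadsto> 0"
proof -
 have "\<forall>k. \<exists>N. \<forall>m\<ge>N. \<forall>n\<ge>N. L2_norm M (f m -. f n) < (1/2)^k"
  using C by auto
 then obtain N where N: "!!k m n. m \<ge> N k ==> n \<ge> N k ==> L2_norm M (f m -. f n) < (1/2)^k"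
  by metis
 \<comment> \<open>Partial sums are at least \<open>N k\<close> and nondecreasing in k, which is all
   that the subsequence has to satisfy.\<close>
 define r where "r k = (\<Sum>i\<le>k. N i)" for k
 have rN: "r k \<ge> N k" for k unfolding r_def by (intro member_le_sum) auto
 have rmono: "r k <= r (Suc k)" for k unfolding r_def by simp
 have "AE x in M. convergent (%k. f (r k) x)"
 proof (rule L2_rapid_convergent)
  show "summable (%n. 2 ^ n * (L2_norm M (%x. f (r (Suc n)) x - f (r n) x))^2)"
  proof (rule summable_comparison_test')
   show "summable (%n. (1/2::real)^n)" by (intro summable_geometric) auto
   fix n :: nat
   have "L2_norm M (%x. f (r (Suc n)) x - f (r n) x) <= (1/2)^n"
    using N[of n "r (Suc n)" "r n"] rN[of n] rmono[of n] by fastforce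
   then have "2 ^ n * (L2_norm M (%x. f (r (Suc n)) x - f (r n) x))^2 <= 2 ^ n * ((1/2)^n)^2"
    by (intro mult_left_mono power_mono) auto
   also have "\<dots> = (1/2)^n"
    by (simp add: power2_eq_square power_one_over field_simps)
   finally show "norm (2 ^ n * (L2_norm M (%x. f (r (Suc n)) x - f (r n) x))^2) <= (1/2)^n" by simp
  qed
 qed (rule L)
 then have lim: "AE x in M. (%k. f (r k) x) \<leadsto> lim (%k. f (r k) x)"
  by eventually_elim (simp add: convergent_LIMSEQ_iff)
 define g where "g x = lim (%k. f (r k) x)" for x
 have [measurable]: "!!n. f n \<in> borel_measurable M" using L by (auto simp: L2_def)
 have gm [measurable]: "g \<in> borel_measurable M" unfolding g_def by measurable
 have key: "(f n -. g) \<in> L2 M \<and> L2_norm M (f n -. g) <= (1/2)^k" if "n \<ge> N k" for n k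
 proof -
  have "AE x in M. (%j. f n x - f (r j) x) \<leadsto> f n x - g x"
   using lim unfolding g_def by eventually_elim (intro tendsto_intros)
  moreover have "L2_norm M (f n -. f (r j)) <= (1/2)^k" if "j \<ge> k" for j
  proof -
   have "r j \<ge> N k" using rN[of k] lift_Suc_mono_le[of r, OF rmono that] by linarith
   then show ?thesis using N[of k n "r j"] \<open>n \<ge> N k\<close> by fastforce
  qed
  ultimately show ?thesis
   using L2_Fatou[of "%j x. f n x - f (r j) x" M "%x. f n x - g x" k "(1/2)^k"] L2_diff[OF L L]
   by auto
 qed
 have "(%x. f (N 0) x - (f (N 0) x - g x)) \<in> L2 M"
  using key[of 0 "N 0"] L by (rule_tac L2_diff) auto
 then have "g \<in> L2 M" by simp
 moreover have "(%n. L2_norm M (f n -. g)) \<leadsto> 0"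
 proof (rule LIMSEQ_I)
  fix e :: real assume "e > 0"
  then obtain k where k: "(1/2::real)^k < e"
   using real_arch_pow_inv[of e "1/2"] by auto
  show "\<exists>no. \<forall>n\<ge>no. norm (L2_norm M (f n -. g) - 0) < e"
   using key[of k] k by (intro exI[of _ "N k"]) fastforce
 qed
 ultimately show thesis by (rule that)
qed

text \<open>The geometric rate makes the norms summable, which later gives convergence of almost
  every velocity slice.\<close>

lemma L2_AE_subseq:
 fixes f :: "nat => 'a => 'b::euclidean_space"
 assumes "(%n. L2_norm M (f n -. g)) \<leadsto> 0"
 obtains r :: "nat => nat" where "strict_mono r"
  "!!n. L2_norm M (f (r n) -. g) <= (1/2)^n"
proof -
 have ev: "\<forall>\<^sub>F n in sequentially. L2_norm M (f n -. g) < (1/2)^k" for k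
  using order_tendstoD(2)[OF assms, of "(1/2)^k"] by auto
 have "\<exists>r::nat=>nat. strict_mono r \<and> (\<forall>k. L2_norm M (f (r k) -. g) < (1/2)^k)"
 proof -
  have "\<exists>r. \<forall>k. L2_norm M (f (r k) -. g) < (1/2)^k \<and> r k < r (Suc k)"
  proof (rule dependent_nat_choice)
   show "\<exists>x. L2_norm M (f x -. g) < (1/2)^0"
    using ev[of 0] by (auto simp: eventually_sequentially)
  next
   fix x k
   have "\<forall>\<^sub>F n in sequentially. L2_norm M (f n -. g) < (1/2)^(Suc k) \<and> x < n"
    using ev[of "Suc k"] eventually_gt_at_top[of x] by eventually_elim auto
   then show "\<exists>y. L2_norm M (f y -. g) < (1/2)^(Suc k) \<and> x < y"
    by (auto simp: eventually_sequentially)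
  qed
  then show ?thesis by (auto simp: strict_mono_Suc_iff)
 qed
 then show thesis using that less_imp_le by metis
qed

lemma ip_tendsto:
 assumes L: "!!n. f n \<in> L2 M" "g \<in> L2 M" "h \<in> L2 M" and lim: "(%n. L2_norm M (f n -. g)) \<leadsto> 0"
 shows "(%n. ip M (f n) h) \<leadsto> ip M g h"
proof -
 have "(%n. ip M (f n) h - ip M g h) \<leadsto> 0"
 proof (rule Lim_null_comparison)
  show "\<forall>\<^sub>F n in sequentially. norm (ip M (f n) h - ip M g h) <= L2_norm M (f n -. g) * L2_norm M h"
   using ip_Cauchy_Schwarz[OF L2_diff[OF L(1,2)] L(3)]
   by (simp add: ip_diff_left[OF L])
  show "(%n. L2_norm M (f n -. g) * L2_norm M h) \<leadsto> 0"
   using tendsto_mult_left_zero[OF lim] by simp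
 qed
 then show ?thesis by (simp add: LIM_zero_iff)
qed

lemma L2_norm_tendsto:
 fixes f :: "_ => 'a => 'b::euclidean_space"
 assumes L: "!!n. f n \<in> L2 M" "g \<in> L2 M" and lim: "((%n. L2_norm M (f n -. g)) \<longlongrightarrow> 0) F"
 shows "((%n. L2_norm M (f n)) \<longlongrightarrow> L2_norm M g) F"
proof -
 have "((%n. L2_norm M (f n) - L2_norm M g) \<longlongrightarrow> 0) F"
  using L2_norm_diff_ineq[OF L(1,2)] by (intro Lim_null_comparison[OF _ lim]) auto
 then show ?thesis by (simp add: LIM_zero_iff)
qed

section \<open>Strongly measurable functions of time\<close>

text \<open>V and its dual consist of functions and functionals without identification, so only a
  seminorm is available. The axioms are restricted to X because the norms have no meaning outside
  it. Both spaces are instances, so the theory of Bochner spaces is developed once.\<close>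

locale seminormed =
 fixes X :: "('b => real) set" and N :: "('b => real) => real"
 assumes zero_mem: "(%_. 0) \<in> X"
  and comb_mem: "u \<in> X ==> w \<in> X ==> (%z. a * u z + b * w z) \<in> X"
  and N_nonneg: "u \<in> X ==> 0 <= N u"
  and N_comb: "u \<in> X ==> w \<in> X ==> N (%z. a * u z + b * w z) <= abs a * N u + abs b * N w"
begin

lemma diff_mem: "u \<in> X ==> w \<in> X ==> (u -. w) \<in> X"
 using comb_mem[of u w 1 "-1"] by simp

lemma scale_mem: "u \<in> X ==> (%z. a * u z) \<in> X"
 using comb_mem[of u u a 0] by simp

lemma N_triangle: "u \<in> X ==> w \<in> X ==> N (%z. u z + w z) <= N u + N w"
 using N_comb[of u w 1 1] by simp

lemma N_triangle_diff:
 assumes "u \<in> X" "w \<in> X" "y \<in> X"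
 shows "N (u -. y) <= N (u -. w) + N (w -. y)"
 using N_triangle[OF diff_mem[OF assms(1,2)] diff_mem[OF assms(2,3)]] by simp

lemma N_zero: "N (%_. 0) = 0"
 using N_comb[OF zero_mem zero_mem, of 0 0] N_nonneg[OF zero_mem] by simp

lemma N_minus_commute:
 assumes "u \<in> X" "w \<in> X"
 shows "N (u -. w) = N (w -. u)"
proof -
 have "N (u -. w) <= N (w -. u)" if "u \<in> X" "w \<in> X" for u w
  using N_comb[OF diff_mem[OF that(2,1)] diff_mem[OF that(2,1)], of "-1" 0] by (simp add: minus_diff_eq)
 then show ?thesis using assms by (simp add: order_antisym)
qed

lemma N_diff_ineq:
 assumes "u \<in> X" "w \<in> X"
 shows "abs (N u - N w) <= N (u -. w)"
 using N_triangle[OF diff_mem[OF assms] assms(2)] N_triangle[OF diff_mem[OF assms(2,1)] assms(1)]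
  N_minus_commute[OF assms] by simp

end

text \<open>The part of \<open>bochner_L2\<close> without integrability, split off so that
  measurability of a limit can be settled before its norm is estimated.\<close>

definition strongly_measurable ::
 "('b => real) set => (('b => real) => real) => real => (real => 'b => real) => bool" where
 "strongly_measurable X N T f \<longleftrightarrow> (AE t in time T. f t \<in> X) \<and>
  (\<exists>s. (\<forall>n. simple_function (time T) (s n) \<and> (\<forall>t\<in>{0<..<T}. s n t \<in> X)) \<and>
     (AE t in time T. (%n::nat. N (s n t -. f t)) \<leadsto> 0))"

lemma strongly_measurableE:
 assumes "strongly_measurable X N T f"
 obtains s where "!!n. simple_function (time T) (s n)" "!!n t. 0 < t ==> t < T ==> s n t \<in> X"
  "AE t in time T. (%n::nat. N (s n t -. f t)) \<leadsto> 0"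
proof -
 have "\<exists>s. (\<forall>n. simple_function (time T) (s n) \<and> (\<forall>t\<in>{0<..<T}. s n t \<in> X)) \<and>
     (AE t in time T. (%n::nat. N (s n t -. f t)) \<leadsto> 0)"
  using assms unfolding strongly_measurable_def by (rule conjunct2)
 then obtain s where "(\<forall>n. simple_function (time T) (s n) \<and> (\<forall>t\<in>{0<..<T}. s n t \<in> X)) \<and>
     (AE t in time T. (%n::nat. N (s n t -. f t)) \<leadsto> 0)" by (rule exE)
 then show thesis by (intro that[of s]) simp_all
qed

lemma bochner_L2_iff:
 "f \<in> bochner_L2 X N T \<longleftrightarrow> strongly_measurable X N T f \<and> integrable (time T) (%t. (N (f t))^2)"
 by (simp add: bochner_L2_def strongly_measurable_def conj_assoc)

lemma bochner_L2_mem: "f \<in> bochner_L2 X N T ==> AE t in time T. f t \<in> X"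
 by (simp add: bochner_L2_def)

section \<open>Lebesgue measure on a time interval\<close>

lemma space_time [simp]: "space (time T) = {0<..<T}"
 by (simp add: space_restrict_space)

lemma AE_time: "(!!t. 0 < t ==> t < T ==> P t) ==> AE t in time T. P t"
 by (intro AE_I2) simp

text \<open>Completeness of Lebesgue measure enters here: a change on a null set of times preserves
  measurability.\<close>

lemma borel_measurable_time_AE:
 fixes f g :: "real => real"
 assumes f: "f \<in> borel_measurable (time T)" and ae: "AE t in time T. f t = g t"
 shows "g \<in> borel_measurable (time T)"
proof -
 have "(%t. if t \<in> {0<..<T} then f t else 0) \<in> borel_measurable lebesgue"
  using f by (subst borel_measurable_if) auto
 moreover have "AE t in lebesgue. (if t \<in> {0<..<T} then f t else 0) = (if t \<in> {0<..<T} then g t else 0)"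
  using ae by (subst (asm) AE_restrict_space_iff) (auto elim!: eventually_mono)
 ultimately have "(%t. if t \<in> {0<..<T} then g t else 0) \<in> borel_measurable lebesgue"
  by (rule borel_measurable_AE)
 then show ?thesis by (subst (asm) borel_measurable_if) auto
qed

lemma borel_measurable_time_limit:
 fixes f :: "nat => real => real"
 assumes f: "!!n. f n \<in> borel_measurable (time T)" and lim: "AE t in time T. (%n. f n t) \<leadsto> g t"
 shows "g \<in> borel_measurable (time T)"
proof (rule borel_measurable_time_AE)
 show "(%t. lim (%n. f n t)) \<in> borel_measurable (time T)"
  using f by (intro borel_measurable_lim_metric) auto
 show "AE t in time T. lim (%n. f n t) = g t"
  using lim by eventually_elim (simp add: limI)
qed

lemma finite_measure_time: "finite_measure (time T)"
 by (cases "0 <= T") (auto intro!: finite_measureI simp: emeasure_restrict_space)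

lemma integrable_time_bounded:
 fixes f :: "real => real"
 assumes "f \<in> borel_measurable (time T)" "!!t. 0 < t ==> t < T ==> abs (f t) <= B"
 shows "integrable (time T) f"
proof -
 interpret finite_measure "time T" by (rule finite_measure_time)
 show ?thesis using assms by (intro integrable_const_bound[of _ B]) (auto intro!: AE_time)
qed

lemma borel_measurable_time_continuous:
 fixes f :: "real => real"
 assumes "continuous_on {0<..<T} f"
 shows "f \<in> borel_measurable (time T)"
 using assms by (intro continuous_imp_measurable_on_sets_lebesgue) auto

lemma integrable_time_continuous:
 fixes f :: "real => real"
 assumes "continuous_on {0..T} f"
 shows "integrable (time T) f"
proof -
 have "compact (f ` {0..T})" using assms by (intro compact_continuous_image) auto
 then obtain B where "!!t. t \<in> {0..T} ==> abs (f t) <= B"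
  using compact_imp_bounded[of "f ` {0..T}"] unfolding bounded_iff by (metis image_eqI real_norm_def)
 moreover have "continuous_on {0<..<T} f" using assms by (rule continuous_on_subset) auto
 ultimately show ?thesis
  by (intro integrable_time_bounded[of f T B] borel_measurable_time_continuous) auto
qed

lemma simple_function_lebesgue_on_subset:
 assumes f: "simple_function (lebesgue_on A) f" and AB: "B \<subseteq> A" "A \<in> sets lebesgue" "B \<in> sets lebesgue"
 shows "simple_function (lebesgue_on B) f"
 unfolding simple_function_def
proof (intro conjI ballI)
 have "f ` B \<subseteq> f ` A" using AB by auto
 then show "finite (f ` space (lebesgue_on B))"
  using f by (auto simp: simple_function_def space_restrict_space intro: finite_subset)
 fix x assume "x \<in> f ` space (lebesgue_on B)"
 then have "f -` {x} \<inter> A \<in> sets (lebesgue_on A)"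
  using f AB by (auto simp: simple_function_def space_restrict_space)
 then have "f -` {x} \<inter> A \<in> sets lebesgue"
  using AB by (auto simp: sets_restrict_space_iff)
 then have "(f -` {x} \<inter> A) \<inter> B \<in> sets lebesgue" using AB by auto
 moreover have "(f -` {x} \<inter> A) \<inter> B = f -` {x} \<inter> B" using AB by auto
 ultimately show "f -` {x} \<inter> space (lebesgue_on B) \<in> sets (lebesgue_on B)"
  using AB by (auto simp: sets_restrict_space_iff space_restrict_space)
qed

lemma simple_function_lebesgue_on_extend:
 assumes f: "simple_function (lebesgue_on A) f" and AB: "A \<subseteq> B" "A \<in> sets lebesgue" "B \<in> sets lebesgue"
 shows "simple_function (lebesgue_on B) (%t. if t \<in> A then f t else c)"
 unfolding simple_function_def
proof (intro conjI ballI)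
 let ?g = "%t. if t \<in> A then f t else c"
 have "?g ` B \<subseteq> insert c (f ` A)" using AB by auto
 then show "finite (?g ` space (lebesgue_on B))"
  using f by (auto simp: simple_function_def space_restrict_space intro: finite_subset)
 fix x assume x: "x \<in> ?g ` space (lebesgue_on B)"
 have *: "f -` {x} \<inter> A \<in> sets lebesgue"
 proof (cases "x \<in> f ` A")
  case True
  then have "f -` {x} \<inter> A \<in> sets (lebesgue_on A)"
   using f AB by (auto simp: simple_function_def space_restrict_space)
  then show ?thesis using AB by (auto simp: sets_restrict_space_iff)
 next
  case False
  then have "f -` {x} \<inter> A = {}" by auto
  then show ?thesis by simp
 qed
 have "?g -` {x} \<inter> B = (f -` {x} \<inter> A) \<union> (if x = c then B - A else {})" using AB by (auto split: if_splits)
 also have "\<dots> \<in> sets lebesgue" using * AB by auto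
 finally show "?g -` {x} \<inter> space (lebesgue_on B) \<in> sets (lebesgue_on B)"
  using AB by (auto simp: sets_restrict_space_iff space_restrict_space)
qed

lemma AE_time_subset:
 assumes "AE t in time T. P t" "\<tau> <= T"
 shows "AE t in time \<tau>. P t"
proof -
 have "AE t in lebesgue. t \<in> {0<..<T} \<longrightarrow> P t"
  using assms by (subst (asm) AE_restrict_space_iff) auto
 then have "AE t in lebesgue. t \<in> {0<..<\<tau>} \<longrightarrow> P t"
  using assms(2) by (auto elim!: eventually_mono)
 then show ?thesis by (subst AE_restrict_space_iff) auto
qed

lemma AE_time_extend:
 assumes "AE t in time \<tau>. P t" "\<tau> <= T" "!!t. t \<ge> \<tau> ==> P t"
 shows "AE t in time T. P t"
proof -
 have "AE t in lebesgue. t \<in> {0<..<\<tau>} \<longrightarrow> P t"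
  using assms by (subst (asm) AE_restrict_space_iff) auto
 then have "AE t in lebesgue. t \<in> {0<..<T} \<longrightarrow> P t"
  using assms(2,3) by (auto elim!: eventually_mono) (meson linorder_not_le)
 then show ?thesis by (subst AE_restrict_space_iff) auto
qed

lemma integrable_time_subset:
 fixes f :: "real => real"
 assumes "integrable (time T) f" "\<tau> <= T"
 shows "integrable (time \<tau>) f"
proof -
 have "set_integrable lebesgue {0<..<T} f"
  using assms(1) by (subst (asm) integrable_restrict_space) (auto simp: set_integrable_def)
 then have "set_integrable lebesgue {0<..<\<tau>} f"
  by (rule set_integrable_subset) (use assms(2) in auto)
 then show ?thesis by (subst integrable_restrict_space) (auto simp: set_integrable_def)
qed

text \<open>Extension by zero turns integrals over (0,\<tau>) into integrals over (0,T), so a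
  function on the shorter interval can serve as test function on the longer one.\<close>

lemma integrable_time_extend:
 fixes f :: "real => real"
 assumes "\<tau> <= T"
 shows "integrable (time T) (%t. if t < \<tau> then f t else 0) \<longleftrightarrow> integrable (time \<tau>) f"
  and "(LINT t|time T. (if t < \<tau> then f t else 0)) = (LINT t|time \<tau>. f t)"
proof -
 have *: "(%t. indicator {0<..<T} t *\<^sub>R (if t < \<tau> then f t else 0)) = (%t. indicator {0<..<\<tau>} t *\<^sub>R f t)"
  using assms by (auto simp: indicator_def fun_eq_iff)
 show "integrable (time T) (%t. if t < \<tau> then f t else 0) \<longleftrightarrow> integrable (time \<tau>) f"
  by (subst (1 2) integrable_restrict_space) (simp_all only: *, auto)
 show "(LINT t|time T. (if t < \<tau> then f t else 0)) = (LINT t|time \<tau>. f t)"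
  by (subst (1 2) integral_restrict_space) (simp_all only: *, auto)
qed

section \<open>Pairings, combinations and limits of strongly measurable maps\<close>

text \<open>Approximate both arguments by simple functions and split the error as \<beta>(s - f, q)
  + \<beta>(f, q - g). One statement covers the duality between \<open>V_dual\<close> and V as well
  as the Dirichlet form in the velocity.\<close>

lemma strongly_measurable_pairing:
 assumes X: "seminormed X N" and Z: "seminormed Z P"
  and f: "strongly_measurable X N T f" and g: "strongly_measurable Z P T g"
  and bd: "!!u w. u \<in> X ==> w \<in> Z ==> abs (\<beta> u w) <= N u * P w"
  and l: "!!u u' w. u \<in> X ==> u' \<in> X ==> w \<in> Z ==> \<beta> (u -. u') w = \<beta> u w - \<beta> u' w"
  and r: "!!u w w'. u \<in> X ==> w \<in> Z ==> w' \<in> Z ==> \<beta> u (w -. w') = \<beta> u w - \<beta> u w'"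
 shows "(%t. \<beta> (f t) (g t) :: real) \<in> borel_measurable (time T)"
proof -
 interpret X: seminormed X N by fact
 interpret Z: seminormed Z P by fact
 obtain s where s: "!!n. simple_function (time T) (s n)" "!!n t. 0 < t ==> t < T ==> s n t \<in> X"
  "AE t in time T. (%n::nat. N (s n t -. f t)) \<leadsto> 0"
  by (rule strongly_measurableE[OF f]) (rule that)
 obtain q where q: "!!n. simple_function (time T) (q n)" "!!n t. 0 < t ==> t < T ==> q n t \<in> Z"
  "AE t in time T. (%n::nat. P (q n t -. g t)) \<leadsto> 0"
  by (rule strongly_measurableE[OF g]) (rule that)
 have fX: "AE t in time T. f t \<in> X" and gZ: "AE t in time T. g t \<in> Z"
  using f g by (auto simp: strongly_measurable_def)
 show ?thesis
 proof (rule borel_measurable_time_limit)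
  show "(%t. \<beta> (s n t) (q n t)) \<in> borel_measurable (time T)" for n
   by (rule borel_measurable_simple_function, rule simple_function_compose2[OF s(1) q(1)])
  have sp: "AE t in time T. t \<in> space (time T)" by (rule AE_space)
  show "AE t in time T. (%n. \<beta> (s n t) (q n t)) \<leadsto> \<beta> (f t) (g t)"
   using s(3) q(3) fX gZ sp
  proof eventually_elim
   case (elim t)
   note t = s(2)[of t] q(2)[of t]
   have bound: "norm (\<beta> (s n t) (q n t) - \<beta> (f t) (g t)) <=
     N (s n t -. f t) * (P (g t) + P (q n t -. g t)) + N (f t) * P (q n t -. g t)" for n
   proof -
    have "\<beta> (s n t) (q n t) - \<beta> (f t) (g t) =
     \<beta> (s n t -. f t) (q n t) + \<beta> (f t) (q n t -. g t)"
     using elim t by (simp add: l r)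
    moreover have "abs (\<beta> (s n t -. f t) (q n t)) <= N (s n t -. f t) * P (q n t)"
     using elim t by (intro bd X.diff_mem) auto
    moreover have "N (s n t -. f t) * P (q n t) <=
      N (s n t -. f t) * (P (g t) + P (q n t -. g t))"
     using elim t Z.N_diff_ineq[of "q n t" "g t"]
     by (intro mult_left_mono X.N_nonneg X.diff_mem) auto
    moreover have "abs (\<beta> (f t) (q n t -. g t)) <= N (f t) * P (q n t -. g t)"
     using elim t by (intro bd Z.diff_mem) auto
    ultimately show ?thesis unfolding real_norm_def by linarith
   qed
   have "(%n. N (s n t -. f t) * (P (g t) + P (q n t -. g t)) + N (f t) * P (q n t -. g t))
     \<leadsto> 0 * (P (g t) + 0) + N (f t) * 0"
    using elim by (intro tendsto_intros) auto
   then have "(%n. \<beta> (s n t) (q n t) - \<beta> (f t) (g t)) \<leadsto> 0"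
    by (intro Lim_null_comparison[OF always_eventually[OF allI[OF bound]]]) simp
   then show ?case by (simp add: LIM_zero_iff)
  qed
 qed
qed

lemma Lim_null_sandwich:
 fixes f g :: "nat => real"
 assumes "!!n. 0 <= f n" "!!n. f n <= g n" "g \<leadsto> 0"
 shows "f \<leadsto> 0"
 by (rule real_tendsto_sandwich[OF _ _ tendsto_const assms(3)]) (use assms in auto)

context seminormed
begin

lemma strongly_measurable_norm:
 assumes f: "strongly_measurable X N T f"
 shows "(%t. N (f t)) \<in> borel_measurable (time T)"
proof -
 obtain s where s: "!!n. simple_function (time T) (s n)" "!!n t. 0 < t ==> t < T ==> s n t \<in> X"
  "AE t in time T. (%n::nat. N (s n t -. f t)) \<leadsto> 0"
  by (rule strongly_measurableE[OF f]) (rule that)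
 have fX: "AE t in time T. f t \<in> X"
  using f by (auto simp: strongly_measurable_def)
 show ?thesis
 proof (rule borel_measurable_time_limit)
  show "(%t. N (s n t)) \<in> borel_measurable (time T)" for n
   by (rule borel_measurable_simple_function, rule simple_function_compose1[OF s(1)])
  have sp: "AE t in time T. t \<in> space (time T)" by (rule AE_space)
  show "AE t in time T. (%n. N (s n t)) \<leadsto> N (f t)"
   using s(3) fX sp
  proof eventually_elim
   case (elim t)
   have "(%n. N (s n t) - N (f t)) \<leadsto> 0"
    using elim s(2)[of t] N_diff_ineq
    by (intro Lim_null_comparison[OF always_eventually elim(1)]) auto
   then show ?case by (simp add: LIM_zero_iff)
  qed
 qed
qed

lemma strongly_measurable_comb:
 assumes f: "strongly_measurable X N T f" and g: "strongly_measurable X N T g"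
 shows "strongly_measurable X N T (%t z. a * f t z + b * g t z)"
proof -
 obtain s where s: "!!n. simple_function (time T) (s n)" "!!n t. 0 < t ==> t < T ==> s n t \<in> X"
  "AE t in time T. (%n::nat. N (s n t -. f t)) \<leadsto> 0"
  by (rule strongly_measurableE[OF f]) (rule that)
 obtain q where q: "!!n. simple_function (time T) (q n)" "!!n t. 0 < t ==> t < T ==> q n t \<in> X"
  "AE t in time T. (%n::nat. N (q n t -. g t)) \<leadsto> 0"
  by (rule strongly_measurableE[OF g]) (rule that)
 have fX: "AE t in time T. f t \<in> X" and gX: "AE t in time T. g t \<in> X"
  using f g by (auto simp: strongly_measurable_def)
 have sp: "AE t in time T. t \<in> space (time T)" by (rule AE_space)
 have 1: "AE t in time T. (%n. N (%y. (a * s n t y + b * q n t y) - (a * f t y + b * g t y))) \<leadsto> 0"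
  using s(3) q(3) fX gX sp
 proof eventually_elim
  case (elim t)
  show ?case
  proof (rule Lim_null_sandwich)
   show "N (%y. (a * s n t y + b * q n t y) - (a * f t y + b * g t y)) \<ge> 0" for n
    using elim s(2)[of t n] q(2)[of t n] by (auto intro!: N_nonneg diff_mem comb_mem)
   show "N (%y. (a * s n t y + b * q n t y) - (a * f t y + b * g t y)) <=
    abs a * N (s n t -. f t) + abs b * N (q n t -. g t)" for n
   proof -
    have *: "(s n t -. f t) \<in> X" "(q n t -. g t) \<in> X"
     using elim s(2)[of t n] q(2)[of t n] by (auto intro!: diff_mem)
    show ?thesis using N_comb[OF *, of a b] by (simp add: algebra_simps)
   qed
   have "(%n. abs a * N (s n t -. f t) + abs b * N (q n t -. g t)) \<leadsto> abs a * 0 + abs b * 0"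
    by (intro tendsto_intros elim)
   then show "(%n. abs a * N (s n t -. f t) + abs b * N (q n t -. g t)) \<leadsto> 0"
    by simp
  qed
 qed
 have 2: "simple_function (time T) (%t y. a * s n t y + b * q n t y)" for n
  using simple_function_compose2[OF s(1)[of n] q(1)[of n], of "%u w y. a * u y + b * w y"] by simp
 have 3: "AE t in time T. (%z. a * f t z + b * g t z) \<in> X"
  using fX gX by eventually_elim (rule comb_mem)
 show ?thesis
  unfolding strongly_measurable_def
  using 1 2 3 s(2) q(2) comb_mem
  by (intro conjI exI[of _ "%n t y. a * s n t y + b * q n t y"]) auto
qed

lemma bochner_L2_comb:
 assumes f: "f \<in> bochner_L2 X N T" and g: "g \<in> bochner_L2 X N T"
 shows "(%t z. a * f t z + b * g t z) \<in> bochner_L2 X N T"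
proof -
 have sm: "strongly_measurable X N T (%t z. a * f t z + b * g t z)"
  using f g by (intro strongly_measurable_comb) (auto simp: bochner_L2_iff)
 have "integrable (time T) (%t. (N (%z. a * f t z + b * g t z))^2)"
 proof (rule integrable_dominated)
  show "integrable (time T) (%t. 2 * a\<^sup>2 * (N (f t))^2 + 2 * b\<^sup>2 * (N (g t))^2)"
   using f g by (auto simp: bochner_L2_iff)
  show "(%t. (N (%z. a * f t z + b * g t z))^2) \<in> borel_measurable (time T)"
   using strongly_measurable_norm[OF sm] by measurable
  show "AE t in time T. norm ((N (%z. a * f t z + b * g t z))^2)
    <= norm (2 * a\<^sup>2 * (N (f t))^2 + 2 * b\<^sup>2 * (N (g t))^2)"
   using bochner_L2_mem[OF f] bochner_L2_mem[OF g]
  proof eventually_elim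
   case (elim t)
   have "(N (%z. a * f t z + b * g t z))^2 <= (abs a * N (f t) + abs b * N (g t))^2"
    using elim by (intro power_mono N_comb N_nonneg comb_mem)
   also have "\<dots> <= 2 * a\<^sup>2 * (N (f t))^2 + 2 * b\<^sup>2 * (N (g t))^2"
    using sum_squares_bound[of "abs a * N (f t)" "abs b * N (g t)"]
    by (simp add: power2_sum power_mult_distrib)
   finally show ?case by simp
  qed
 qed
 with sm show ?thesis by (simp add: bochner_L2_iff)
qed

lemma bochner_L2_diff:
 "f \<in> bochner_L2 X N T ==> g \<in> bochner_L2 X N T ==> (%t z. f t z - g t z) \<in> bochner_L2 X N T"
 using bochner_L2_comb[of f T g 1 "-1"] by simp

text \<open>Sampling on a grid of mesh 1/(n+1) gives simple functions that converge at every time by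
  continuity.\<close>

lemma bochner_L2_continuous:
 assumes mem: "!!t. t \<in> {0..T} ==> f t \<in> X"
  and cont: "!!t. t \<in> {0..T} ==> ((%s. N (f s -. f t)) \<longlongrightarrow> 0) (at t within {0..T})"
 shows "f \<in> bochner_L2 X N T"
proof -
 \<comment> \<open>Rounding down keeps the sample point in [0,T], where continuity is
   assumed.\<close>
 define p where "p n t = real_of_int \<lfloor>real (Suc n) * t\<rfloor> / real (Suc n)" for n t
 have p_bounds: "p n t <= t" "t - 1 / real (Suc n) <= p n t" for n t
 proof -
  have N: "real (Suc n) > 0" by simp
  have "real_of_int \<lfloor>real (Suc n) * t\<rfloor> <= t * real (Suc n)"
   by (simp only: mult.commute[of t] of_int_floor_le)
  then show "p n t <= t" unfolding p_def pos_divide_le_eq[OF N] .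
  have "real (Suc n) * t - 1 <= real_of_int \<lfloor>real (Suc n) * t\<rfloor>"
   using floor_correct[of "real (Suc n) * t"] by linarith
  moreover have "(t - 1 / real (Suc n)) * real (Suc n) = real (Suc n) * t - 1"
   using N by (simp add: left_diff_distrib right_diff_distrib mult.commute del: of_nat_Suc)
  ultimately show "t - 1 / real (Suc n) <= p n t"
   unfolding p_def pos_le_divide_eq[OF N] by simp
 qed
 have p_mem: "p n t \<in> {0..T}" if "0 < t" "t < T" for n t
  using p_bounds(1)[of n t] that by (auto simp: p_def)
 have p_lim: "(%n. p n t) \<leadsto> t" for t
 proof (rule real_tendsto_sandwich)
  have "(%n. t - 1 / real (Suc n)) \<leadsto> t - 0"
   by (intro tendsto_diff tendsto_const LIMSEQ_Suc[OF lim_1_over_n])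
  then show "(%n. t - 1 / real (Suc n)) \<leadsto> t" by simp
  show "(%n. t) \<leadsto> t" by simp
 qed (use p_bounds in auto)
 have simp: "simple_function (time T) (%t. f (p n t))" for n
 proof -
  have "simple_function (time T) (%t. \<lfloor>real (Suc n) * t\<rfloor>)"
  proof (subst simple_function_eq_measurable, intro conjI)
   have "(%t. \<lfloor>real (Suc n) * t\<rfloor>) ` space (time T) \<subseteq> {0..\<lfloor>real (Suc n) * T\<rfloor>}"
    by (auto intro!: floor_mono mult_left_mono)
   then show "finite ((%t. \<lfloor>real (Suc n) * t\<rfloor>) ` space (time T))"
    by (rule finite_subset) auto
   have "(%t. \<lfloor>real (Suc n) * t\<rfloor>) \<in> measurable lborel (count_space UNIV)" by measurable
   then have "(%t. \<lfloor>real (Suc n) * t\<rfloor>) \<in> measurable lebesgue (count_space UNIV)"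
    by (rule measurable_completion)
   then show "(%t. \<lfloor>real (Suc n) * t\<rfloor>) \<in> measurable (time T) (count_space UNIV)"
    by (rule measurable_restrict_space1)
  qed
  then have "simple_function (time T) (%t. (%i. f (real_of_int i / real (Suc n))) \<lfloor>real (Suc n) * t\<rfloor>)"
   by (rule simple_function_compose1)
  then show ?thesis by (simp add: p_def)
 qed
 have lim: "(%n. N (f (p n t) -. f t)) \<leadsto> 0" if t: "0 < t" "t < T" for t
 proof (rule LIMSEQ_I)
  fix e :: real assume e: "e > 0"
  have "\<forall>\<^sub>F s in at t within {0..T}. N (f s -. f t) < e"
   using order_tendstoD(2)[OF cont[of t] e] t by auto
  then obtain d where d: "d > 0" "!!s. s \<in> {0..T} ==> s \<noteq> t ==> dist s t < d ==> N (f s -. f t) < e"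
   unfolding eventually_at by blast
  obtain no where no: "!!n. n \<ge> no ==> dist (p n t) t < d"
   using p_lim[of t] d(1) unfolding lim_sequentially by blast
  have "norm (N (f (p n t) -. f t) - 0) < e" if "n \<ge> no" for n
  proof (cases "p n t = t")
   case True
   then show ?thesis using e N_zero by simp
  next
   case False
   then have "N (f (p n t) -. f t) < e"
    using d(2)[of "p n t"] no[OF that] p_mem[OF t] by simp
   moreover have "0 <= N (f (p n t) -. f t)"
    using mem p_mem[OF t] t by (intro N_nonneg diff_mem) auto
   ultimately show ?thesis by simp
  qed
  then show "\<exists>no. \<forall>n\<ge>no. norm (N (f (p n t) -. f t) - 0) < e" by blast
 qed
 have sm: "strongly_measurable X N T f"
  unfolding strongly_measurable_def
  using simp lim mem p_mem by (intro conjI exI[of _ "%n t. f (p n t)"]) (auto intro!: AE_time)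
 have "continuous_on {0..T} (%t. N (f t))"
  unfolding continuous_on_def
 proof
  fix t assume t: "t \<in> {0..T}"
  have "((%s. N (f s) - N (f t)) \<longlongrightarrow> 0) (at t within {0..T})"
  proof (rule Lim_null_comparison[OF _ cont[OF t]])
   show "\<forall>\<^sub>F s in at t within {0..T}. norm (N (f s) - N (f t)) <= N (f s -. f t)"
    using N_diff_ineq mem t by (auto simp: eventually_at_filter)
  qed
  then show "((%t. N (f t)) \<longlongrightarrow> N (f t)) (at t within {0..T})" by (simp add: LIM_zero_iff)
 qed
 then have "integrable (time T) (%t. (N (f t))^2)"
  by (intro integrable_time_continuous continuous_intros)
 with sm show ?thesis by (simp add: bochner_L2_iff)
qed

text \<open>A diagonal argument: each \<open>g n\<close> is replaced by a simple function so close
  in mean that the errors are summable, hence tend to 0 almost everywhere.\<close>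

lemma strongly_measurable_limit:
 assumes fn: "!!n. strongly_measurable X N T (g n)"
  and fX: "AE t in time T. f t \<in> X"
  and lim: "AE t in time T. (%n::nat. N (g n t -. f t)) \<leadsto> 0"
 shows "strongly_measurable X N T f"
proof -
 interpret T: finite_measure "time T" by (rule finite_measure_time)
 have "\<forall>n. \<exists>s. (\<forall>k. simple_function (time T) (s k) \<and> (\<forall>t\<in>{0<..<T}. s k t \<in> X)) \<and>
     (AE t in time T. (%k::nat. N (s k t -. g n t)) \<leadsto> 0)"
  by (intro allI conjunct2[OF fn[unfolded strongly_measurable_def]])
 from choice[OF this] obtain s where s0: "\<forall>n. (\<forall>k. simple_function (time T) (s n k) \<and> (\<forall>t\<in>{0<..<T}. s n k t \<in> X)) \<and>
     (AE t in time T. (%k::nat. N (s n k t -. g n t)) \<leadsto> 0)"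
  by (rule exE)
 have s: "simple_function (time T) (s n k)"
   "0 < t ==> t < T ==> s n k t \<in> X"
   "AE t in time T. (%k::nat. N (s n k t -. g n t)) \<leadsto> 0" for n k t
  using s0 by simp_all
 have gX: "!!n. AE t in time T. g n t \<in> X"
  using fn by (auto simp: strongly_measurable_def)
 have ssm: "strongly_measurable X N T (s n k)" for n k
  unfolding strongly_measurable_def using s N_zero
  by (intro conjI exI[of _ "%_. s n k"]) (auto intro!: AE_time)
 \<comment> \<open>Truncation at 1 makes the distance integrable over a finite interval; the
   absolute value covers the null set of times where \<open>g n t\<close> lies outside X and N might
   be negative.\<close>
 define D where "D n k t = min 1 (abs (N (s n k t -. g n t)))" for n k t
 have Dm [measurable]: "D n k \<in> borel_measurable (time T)" for n k
 proof -
  have "strongly_measurable X N T (%t y. s n k t y - g n t y)"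
   using strongly_measurable_comb[OF ssm[of n k] fn[of n], of 1 "-1"] by simp
  from strongly_measurable_norm[OF this] show ?thesis unfolding D_def by measurable
 qed
 have Dlim: "(%k. LINT t|time T. D n k t) \<leadsto> (LINT t|time T. 0)" for n
 proof (rule integral_dominated_convergence[where w="%_. 1"])
  show "AE t in time T. (%k. D n k t) \<leadsto> 0"
   using s(3)[of n]
  proof eventually_elim
   case (elim t)
   then have "(%k. D n k t) \<leadsto> min 1 (abs (0))"
    unfolding D_def by (intro tendsto_intros)
   then show ?case by simp
  qed
 qed (auto intro: Dm, auto simp: D_def)
 have "\<exists>k. (LINT t|time T. D n k t) < (1/2)^n" for n
  using order_tendstoD(2)[OF Dlim, of "(1/2)^n" n] by (auto simp: eventually_sequentially)
 then obtain k where k: "!!n. (LINT t|time T. D n (k n) t) < (1/2)^n" by metis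
 have "AE t in time T. summable (%n. D n (k n) t)"
 proof (rule AE_summable_of_integrals)
  show "integrable (time T) (D n (k n))" for n
   by (rule T.integrable_const_bound[where B=1]) (auto simp: D_def)
  show "summable (%n. LINT t|time T. D n (k n) t)"
  proof (rule summable_comparison_test')
   show "summable (%n. (1/2::real)^n)" by (intro summable_geometric) auto
   show "norm (LINT t|time T. D n (k n) t) <= (1/2)^n" for n
   proof -
    have "0 <= (LINT t|time T. D n (k n) t)" by (intro integral_nonneg_AE) (auto simp: D_def)
    with k[of n] show ?thesis by simp
   qed
  qed
 qed (auto simp: D_def)
 then have sl: "AE t in time T. (%n. N (s n (k n) t -. g n t)) \<leadsto> 0"
 proof eventually_elim
  case (elim t)
  then have D0: "(%n. D n (k n) t) \<leadsto> 0" by (rule summable_LIMSEQ_zero)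
  then have "\<forall>\<^sub>F n in sequentially. D n (k n) t < 1" by (rule order_tendstoD(2)) simp
  then have "\<forall>\<^sub>F n in sequentially. norm (N (s n (k n) t -. g n t)) <= D n (k n) t"
   by eventually_elim (auto simp: D_def min_def split: if_splits)
  then show ?case by (rule Lim_null_comparison[OF _ D0])
 qed
 have sp: "AE t in time T. t \<in> space (time T)" by (rule AE_space)
 have gX': "AE t in time T. \<forall>n. g n t \<in> X" using gX by (simp add: AE_all_countable)
 have fin: "AE t in time T. (%n. N (s n (k n) t -. f t)) \<leadsto> 0"
  using sl lim gX' fX sp
 proof eventually_elim
  case (elim t)
  show ?case
  proof (rule Lim_null_sandwich)
   show "N (s n (k n) t -. f t) <= N (s n (k n) t -. g n t) + N (g n t -. f t)" for n
    using elim s(2)[of t] by (intro N_triangle_diff) auto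
   show "N (s n (k n) t -. f t) \<ge> 0" for n
    using elim s(2)[of t] by (intro N_nonneg diff_mem) auto
   have "(%n. N (s n (k n) t -. g n t) + N (g n t -. f t)) \<leadsto> 0 + 0"
    by (intro tendsto_add elim)
   then show "(%n. N (s n (k n) t -. g n t) + N (g n t -. f t)) \<leadsto> 0" by simp
  qed
 qed
 show ?thesis
  unfolding strongly_measurable_def
  using s(1,2) fin fX by (intro conjI exI[of _ "%n. s n (k n)"]) auto
qed

lemma bochner_L2_subset:
 assumes f: "f \<in> bochner_L2 X N T" and "\<tau> <= T"
 shows "f \<in> bochner_L2 X N \<tau>"
proof -
 have fsm: "strongly_measurable X N T f" using f by (simp add: bochner_L2_iff)
 obtain s where s: "!!n. simple_function (time T) (s n)" "!!n t. 0 < t ==> t < T ==> s n t \<in> X"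
  "AE t in time T. (%n::nat. N (s n t -. f t)) \<leadsto> 0"
  by (rule strongly_measurableE[OF fsm]) (rule that)
 have "simple_function (time \<tau>) (s n)" for n
  by (rule simple_function_lebesgue_on_subset[OF s(1)]) (use assms(2) in auto)
 then have "strongly_measurable X N \<tau> f"
  unfolding strongly_measurable_def
  using s(2) assms(2) AE_time_subset[OF s(3) assms(2)] AE_time_subset[OF bochner_L2_mem[OF f] assms(2)]
  by (intro conjI exI[of _ s]) auto
 moreover have "integrable (time \<tau>) (%t. (N (f t))^2)"
  using f assms(2) by (auto simp: bochner_L2_iff intro: integrable_time_subset)
 ultimately show ?thesis by (simp add: bochner_L2_iff)
qed

lemma bochner_L2_extend:
 assumes f: "f \<in> bochner_L2 X N \<tau>" and "\<tau> <= T"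
 shows "(%t. if t < \<tau> then f t else (%_. 0)) \<in> bochner_L2 X N T"
proof -
 have fsm: "strongly_measurable X N \<tau> f" using f by (simp add: bochner_L2_iff)
 obtain s where s: "!!n. simple_function (time \<tau>) (s n)" "!!n t. 0 < t ==> t < \<tau> ==> s n t \<in> X"
  "AE t in time \<tau>. (%n::nat. N (s n t -. f t)) \<leadsto> 0"
  by (rule strongly_measurableE[OF fsm]) (rule that)
 define s' where "s' n t = (if t \<in> {0<..<\<tau>} then s n t else (%_. 0))" for n t
 let ?f = "%t. if t < \<tau> then f t else (%_. 0)"
 have "simple_function (time T) (s' n)" for n
  unfolding s'_def by (rule simple_function_lebesgue_on_extend[OF s(1)]) (use assms(2) in auto)
 moreover have "AE t in time T. (%n::nat. N (s' n t -. ?f t)) \<leadsto> 0"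
 proof (rule AE_time_extend[OF _ assms(2)])
  have sp: "AE t in time \<tau>. t \<in> space (time \<tau>)" by (rule AE_space)
  show "AE t in time \<tau>. (%n::nat. N (s' n t -. ?f t)) \<leadsto> 0"
   using s(3) sp by eventually_elim (simp add: s'_def)
 qed (simp add: s'_def N_zero)
 moreover have "AE t in time T. ?f t \<in> X"
 proof (rule AE_time_extend[OF _ assms(2)])
  have sp: "AE t in time \<tau>. t \<in> space (time \<tau>)" by (rule AE_space)
  show "AE t in time \<tau>. ?f t \<in> X"
   using bochner_L2_mem[OF f] sp by eventually_elim simp
 qed (simp add: zero_mem)
 ultimately have "strongly_measurable X N T ?f"
  unfolding strongly_measurable_def using s(2) zero_mem
  by (intro conjI exI[of _ s']) (auto simp: s'_def)
 moreover have "integrable (time T) (%t. (N (?f t))^2)"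
 proof -
  have "(%t. (N (?f t))^2) = (%t. if t < \<tau> then (N (f t))\<^sup>2 else 0)"
   by (auto simp: N_zero)
  then show ?thesis using f assms(2) by (simp add: integrable_time_extend(1) bochner_L2_iff)
 qed
 ultimately show ?thesis by (simp add: bochner_L2_iff)
qed

end

section \<open>Directional derivatives and integration by parts\<close>

text \<open>A derivative along every line in direction b, defined at all points at once. It is
  weaker than Frechet differentiability and can be computed one coordinate at a time for products
  such as Hermite functions and cutoffs.\<close>

definition has_dd :: "('a::real_normed_vector => real) => 'a => ('a => real) => bool" where
 "has_dd f b f' \<longleftrightarrow> (\<forall>x. ((%s. f (x + s *\<^sub>R b)) has_real_derivative f' x) (at 0))"

lemma has_dd_line:
 assumes "has_dd f b f'"
 shows "((%s. f (x + s *\<^sub>R b)) has_real_derivative f' (x + s *\<^sub>R b)) (at s)"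
proof -
 have "((%r. f ((x + s *\<^sub>R b) + r *\<^sub>R b)) has_real_derivative f' (x + s *\<^sub>R b)) (at 0)"
  using assms unfolding has_dd_def by blast
 moreover have "(%r. f ((x + s *\<^sub>R b) + r *\<^sub>R b)) = (%r. (%s. f (x + s *\<^sub>R b)) (r + s))"
  by (simp add: scaleR_add_left add_ac)
 ultimately show ?thesis
  using DERIV_shift[of "%s. f (x + s *\<^sub>R b)" "f' (x + s *\<^sub>R b)" 0 s] by simp
qed

lemma has_dd_const: "has_dd (%_. c) b (%_. 0)"
 by (simp add: has_dd_def)

lemma has_dd_add: "has_dd f b f' ==> has_dd g b g' ==> has_dd (%x. f x + g x) b (%x. f' x + g' x)"
 unfolding has_dd_def by (auto intro!: DERIV_add)

lemma has_dd_mult: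
 assumes "has_dd f b f'" "has_dd g b g'"
 shows "has_dd (%x. f x * g x) b (%x. f' x * g x + f x * g' x)"
 unfolding has_dd_def
proof
 fix x
 have "((%s. f (x + s *\<^sub>R b) * g (x + s *\<^sub>R b)) has_real_derivative
   f' x * g (x + 0 *\<^sub>R b) + g' x * f (x + 0 *\<^sub>R b)) (at 0)"
  using assms unfolding has_dd_def by (intro DERIV_mult) blast+
 then show "((%s. f (x + s *\<^sub>R b) * g (x + s *\<^sub>R b)) has_real_derivative f' x * g x + f x * g' x) (at 0)"
  by (simp add: mult.commute)
qed

lemma has_dd_cmult: "has_dd f b f' ==> has_dd (%x. c * f x) b (%x. c * f' x)"
 using has_dd_mult[OF has_dd_const[of c b]] by simp

lemma has_dd_sum:
 "(!!i. i \<in> I ==> has_dd (f i) b (f' i)) ==> has_dd (%x. \<Sum>i\<in>I. f i x) b (%x. \<Sum>i\<in>I. f' i x)"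
 by (induction I rule: infinite_finite_induct) (simp_all add: has_dd_const has_dd_add)

lemma has_dd_chain:
 assumes "has_dd f b f'" "!!y. (g has_real_derivative g' y) (at y)"
 shows "has_dd (%x. g (f x)) b (%x. g' (f x) * f' x)"
 unfolding has_dd_def
proof
 fix x
 have "((%s. g (f (x + s *\<^sub>R b))) has_real_derivative g' (f (x + 0 *\<^sub>R b)) * f' x) (at 0)"
  using assms(1) unfolding has_dd_def by (intro DERIV_chain2[OF assms(2)]) blast
 then show "((%s. g (f (x + s *\<^sub>R b))) has_real_derivative g' (f x) * f' x) (at 0)" by simp
qed

lemma has_dd_has_derivative:
 assumes "!!x. (f has_derivative D x) (at x)"
 shows "has_dd f b (%x. D x b)"
 unfolding has_dd_def
proof
 fix x
 have l: "((%s. x + s *\<^sub>R b) has_derivative (%s. s *\<^sub>R b)) (at 0)"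
  by (auto intro!: derivative_eq_intros)
 have "(f has_derivative D x) (at (x + 0 *\<^sub>R b))" using assms by simp
 from has_derivative_compose[OF l this]
 have "((%s. f (x + s *\<^sub>R b)) has_derivative (%s. D x (s *\<^sub>R b))) (at 0)" .
 moreover have "(%s. D x (s *\<^sub>R b)) = (*) (D x b)"
  using linear_scale[OF has_derivative_linear[OF assms[of x]]] by (auto simp: fun_eq_iff)
 ultimately show "((%s. f (x + s *\<^sub>R b)) has_real_derivative D x b) (at 0)"
  by (simp add: has_field_derivative_def)
qed

lemma has_dd_linear:
 assumes "bounded_linear f"
 shows "has_dd f b (%_. f b)"
 using has_dd_has_derivative[OF bounded_linear_imp_has_derivative[OF assms]] .

section \<open>Integration by parts for Lebesgue measure\<close>

lemma lborel_translation_integral: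
 fixes f :: "'a::euclidean_space => real"
 assumes "f \<in> borel_measurable borel"
 shows "(LINT x|lborel. f (x + c)) = (LINT x|lborel. f x)"
  and "integrable lborel (%x. f (x + c)) \<longleftrightarrow> integrable lborel f"
proof -
 have "(LINT x|lborel. f x) = (LINT x|distr lborel borel ((+) c). f x)"
  by (simp add: lborel_distr_plus)
 also have "\<dots> = (LINT x|lborel. f (c + x))"
  using assms by (intro integral_distr) auto
 finally show "(LINT x|lborel. f (x + c)) = (LINT x|lborel. f x)" by (simp add: add.commute)
 have "integrable lborel f \<longleftrightarrow> integrable (distr lborel borel ((+) c)) f"
  by (simp add: lborel_distr_plus)
 also have "\<dots> \<longleftrightarrow> integrable lborel (%x. f (c + x))"
  using assms by (intro integrable_distr_eq) auto
 finally show "integrable lborel (%x. f (x + c)) \<longleftrightarrow> integrable lborel f" by (simp add: add.commute)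
qed

text \<open>Fubini applied to \<open>F (x + b) - F x = \<integral>\<^sub>0\<^sup>1 F' (x + s b) ds\<close>.\<close>

lemma lborel_integral_dd_eq_0:
 fixes F :: "'a::euclidean_space => real"
 assumes dd: "has_dd F b F'" and int: "integrable lborel F" "integrable lborel F'"
  and cont: "continuous_on UNIV F'"
 shows "(LINT x|lborel. F' x) = 0"
proof -
 have Fm: "F \<in> borel_measurable borel" using int(1) borel_measurable_integrable by fastforce
 have Fm' [measurable]: "F' \<in> borel_measurable borel" using cont by (rule borel_measurable_continuous_onI)
 have hm: "(%(s::real, x::'a). indicator {0..1} s * F' (x + s *\<^sub>R b)) \<in> borel_measurable (lborel \<Otimes>\<^sub>M lborel)"
  by measurable
 have nt: "(LINT x|lborel. abs (F' (x + c))) = (LINT x|lborel. abs (F' x))" for c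
  using lborel_translation_integral(1)[of "%x. abs (F' x)" c] by simp
 have "integrable (lborel \<Otimes>\<^sub>M lborel) (%(s::real, x::'a). indicator {0..1} s * F' (x + s *\<^sub>R b))"
 proof (rule lborel_pair.Fubini_integrable[OF hm])
  have "(%s::real. LINT y|lborel. norm (case (s, y) of (s, x) => indicator {0..1} s * F' (x + s *\<^sub>R b)))
    = (%s. indicator {0..1} s *\<^sub>R (LINT x|lborel. abs (F' x)))"
   by (auto simp: fun_eq_iff abs_mult nt indicator_def)
  then show "integrable lborel (%s::real. LINT y|lborel. norm (case (s, y) of (s, x) => indicator {0..1} s * F' (x + s *\<^sub>R b)))"
   by simp
  show "AE s in lborel. integrable lborel (%y. case (s::real, y) of (s, x) => indicator {0..1} s * F' (x + s *\<^sub>R b))"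
   using int(2) by (auto intro!: AE_I2 simp: lborel_translation_integral(2))
 qed
 then have hint: "integrable (lborel \<Otimes>\<^sub>M lborel) (case_prod (%(s::real) (x::'a). indicator {0..1} s * F' (x + s *\<^sub>R b)))" .
 have inner: "(LINT s|lborel. indicator {0..1} s * F' (x + s *\<^sub>R b)) = F (x + b) - F x" for x
 proof -
  have "(LINT s|lborel. indicator {0..1} s *\<^sub>R F' (x + s *\<^sub>R b)) = F (x + 1 *\<^sub>R b) - F (x + 0 *\<^sub>R b)"
  proof (rule integral_FTC_atLeastAtMost)
   fix s :: real
   show "((%s. F (x + s *\<^sub>R b)) has_vector_derivative F' (x + s *\<^sub>R b)) (at s within {0..1})"
    using has_dd_line[OF dd, of x s]
    by (auto simp: has_real_derivative_iff_has_vector_derivative intro: has_vector_derivative_at_within)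
   show "continuous_on {0..1} (%s. F' (x + s *\<^sub>R b))"
    by (rule continuous_on_compose2[OF cont]) (auto intro!: continuous_intros)
  qed auto
  then show ?thesis by simp
 qed
 have "0 = (LINT x|lborel. F (x + b)) - (LINT x|lborel. F x)"
  using lborel_translation_integral(1)[OF Fm] by simp
 also have "\<dots> = (LINT x|lborel. F (x + b) - F x)"
  using int(1) lborel_translation_integral(2)[OF Fm] by (intro LINT_diff[symmetric]) auto
 also have "\<dots> = (LINT x|lborel. LINT s|lborel. indicator {0..1} s * F' (x + s *\<^sub>R b))"
  by (simp add: inner)
 also have "\<dots> = (LINT s|lborel. LINT x|lborel. indicator {0..1} s * F' (x + s *\<^sub>R b))"
  by (rule lborel_pair.Fubini_integral[OF hint])
 also have "\<dots> = (LINT s|lborel. indicator {0..1::real} s *\<^sub>R (LINT x|lborel. F' x))"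
  using lborel_translation_integral(1)[OF Fm'] by simp
 also have "\<dots> = (LINT x|lborel. F' x)" by (simp add: content_real)
 finally show ?thesis by simp
qed

lemma integrable_continuous_bounded_support:
 fixes f :: "'a::euclidean_space => real"
 assumes cont: "continuous_on UNIV f" and supp: "!!x. norm x > R ==> f x = 0"
 shows "integrable lborel f"
proof -
 have "set_integrable lborel (cball 0 R) f"
  unfolding set_integrable_def
  by (intro borel_integrable_compact continuous_on_subset[OF cont]) auto
 moreover have "(%x. indicator (cball 0 R) x *\<^sub>R f x) = f"
  using supp by (auto simp: fun_eq_iff indicator_def not_le)
 ultimately show ?thesis by (simp add: set_integrable_def)
qed

text \<open>The derivative of g vanishes where g does outside the ball, so all products are
  integrable and the integral of the derivative of f g is 0.\<close>

lemma lborel_by_parts_compact: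
 fixes f g :: "'a::euclidean_space => real"
 assumes dd: "has_dd f b f'" "has_dd g b g'"
  and cont: "continuous_on UNIV f" "continuous_on UNIV f'" "continuous_on UNIV g" "continuous_on UNIV g'"
  and supp: "!!x. norm x > R ==> g x = 0"
 shows "(LINT x|lborel. f x * g' x) = - (LINT x|lborel. f' x * g x)"
proof -
 have supp': "g' x = 0" if "norm x > R" for x
 proof -
  have "open (- cball (0::'a) R)" "x \<in> - cball 0 R" using that by auto
  then obtain e where e: "e > 0" "ball x e \<subseteq> - cball 0 R" by (rule openE)
  have "((%s. x + s *\<^sub>R b) \<longlongrightarrow> x + 0 *\<^sub>R b) (at 0)"
   by (intro tendsto_intros)
  then have "\<forall>\<^sub>F s in at 0. x + s *\<^sub>R b \<in> ball x e"
   using e(1) by (intro topological_tendstoD) auto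
  then have ev: "\<forall>\<^sub>F s in at 0. g (x + s *\<^sub>R b) = 0"
   using e(2) supp by (auto elim!: eventually_mono simp: subset_eq not_le)
  have 1: "((%s. g (x + s *\<^sub>R b)) has_real_derivative g' x) (at 0)"
   using dd(2) by (auto simp: has_dd_def)
  have "((%s. 0) has_real_derivative g' x) (at 0)"
   using has_field_derivative_transform_within_open has_field_derivative_def[of _ "g' x"]
    has_derivative_transform_eventually[OF 1[unfolded has_field_derivative_def] ev] supp that by simp
  then show ?thesis using DERIV_unique[OF _ DERIV_const] by blast
 qed
 have i1: "integrable lborel (%x. f' x * g x)" and i2: "integrable lborel (%x. f x * g' x)"
  using supp supp' cont
  by (auto intro!: integrable_continuous_bounded_support[where R=R] continuous_intros)
 have "(LINT x|lborel. f' x * g x + f x * g' x) = 0"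
 proof (rule lborel_integral_dd_eq_0[OF has_dd_mult[OF dd]])
  show "integrable lborel (%x. f x * g x)"
   using supp cont by (auto intro!: integrable_continuous_bounded_support[where R=R] continuous_intros)
  show "integrable lborel (%x. f' x * g x + f x * g' x)" using i1 i2 by auto
  show "continuous_on UNIV (%x. f' x * g x + f x * g' x)" using cont by (auto intro!: continuous_intros)
 qed
 then show ?thesis using i1 i2 by simp
qed

section \<open>The Gaussian measure\<close>

definition gdens :: "real^'n::finite => real" where
 "gdens v = (2 * pi) powr (- real CARD('n) / 2) * exp (- (norm v)\<^sup>2 / 2)"

lemma gauss_eq: "gauss = density lborel (%v. ennreal (gdens v))"
 by (simp add: gauss_def gdens_def)

lemma gdens_pos: "0 < gdens v"
 by (simp add: gdens_def)

lemma continuous_gdens: "continuous_on A gdens"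
 unfolding gdens_def by (intro continuous_intros) auto

lemma borel_measurable_gdens [measurable]: "gdens \<in> borel_measurable borel"
 by (intro borel_measurable_continuous_onI continuous_gdens)

lemma sets_gauss [simp, measurable_cong]: "sets gauss = sets borel"
 by (simp add: gauss_eq)

lemma space_gauss [simp]: "space gauss = UNIV"
 by (simp add: gauss_eq)

lemma LINT_gauss:
 fixes f :: "real^'n::finite => real"
 assumes "f \<in> borel_measurable borel"
 shows "(LINT v|gauss. f v) = (LINT v|lborel. gdens v * f v)"
  and "integrable gauss f \<longleftrightarrow> integrable lborel (%v. gdens v * f v)"
proof -
 have nn: "AE v in lborel. 0 <= gdens v" by (intro AE_I2 less_imp_le gdens_pos)
 show "(LINT v|gauss. f v) = (LINT v|lborel. gdens v * f v)"
  unfolding gauss_eq using assms by (subst integral_density[OF _ _ nn]) auto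
 show "integrable gauss f \<longleftrightarrow> integrable lborel (%v. gdens v * f v)"
  unfolding gauss_eq using assms by (subst integrable_density[OF _ _ nn]) auto
qed

lemma norm_sq_Basis: "(norm (v::'a::euclidean_space))^2 = (\<Sum>b\<in>Basis. (v \<bullet> b)^2)"
 using euclidean_inner[of v v] by (simp add: dot_square_norm power2_eq_square)

text \<open>The product form reduces integrability over the velocity space to one dimension.\<close>

lemma gdens_prod: "gdens (v::real^'n::finite) = (\<Prod>b\<in>Basis. std_normal_density (v \<bullet> b))"
proof -
 have "(\<Prod>b\<in>Basis. std_normal_density (v \<bullet> b)) =
  (\<Prod>b\<in>(Basis::(real^'n) set). 1 / sqrt (2 * pi)) * (\<Prod>b\<in>Basis. exp (- (v \<bullet> b)\<^sup>2 / 2))"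
  unfolding std_normal_density_def by (rule prod.distrib)
 also have "(\<Prod>b\<in>Basis. exp (- (v \<bullet> b)\<^sup>2 / 2)) = exp (- (norm v)\<^sup>2 / 2)"
  by (simp add: exp_sum[symmetric] norm_sq_Basis sum_negf sum_divide_distrib)
 also have "(\<Prod>b\<in>(Basis::(real^'n) set). 1 / sqrt (2 * pi)) = (1 / sqrt (2 * pi)) ^ CARD('n)"
  by simp
 also have "\<dots> = (2 * pi) powr (- real CARD('n) / 2)"
 proof -
  have "1 / sqrt (2 * pi) = (2 * pi) powr (-1/2)"
   by (simp add: powr_minus_divide powr_half_sqrt)
  also have "\<dots> ^ CARD('n) = (2 * pi) powr (- real CARD('n) / 2)"
   by (subst powr_power) (auto simp: mult.commute)
  finally show ?thesis .
 qed
 finally show ?thesis by (simp add: gdens_def)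
qed

text \<open>Completing the square turns the standard density times exp(a x) into exp(a^2/2) times
  the normal density with mean a, and exp(c |x|) is at most exp(c x) + exp(-c x).\<close>

lemma std_normal_exp_finite:
 "(\<integral>\<^sup>+x. ennreal (std_normal_density x * exp (c * abs x)) \<partial>lborel) < \<infinity>"
proof -
 have shift: "std_normal_density x * exp (a * x) = exp (a\<^sup>2 / 2) * normal_density a 1 x" for a x :: real
  unfolding normal_density_def
  by (simp add: exp_add[symmetric] field_simps power2_eq_square flip: exp_add)
 have one: "(\<integral>\<^sup>+x. ennreal (normal_density a 1 x) \<partial>lborel) = 1" for a
  using prob_space.emeasure_space_1[OF prob_space_normal_density[of 1 a]]
  by (simp add: emeasure_density)
 have "(\<integral>\<^sup>+x. ennreal (std_normal_density x * exp (c * abs x)) \<partial>lborel)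
  <= (\<integral>\<^sup>+x. ennreal (exp (c\<^sup>2 / 2) * normal_density c 1 x) + ennreal (exp (c\<^sup>2 / 2) * normal_density (-c) 1 x) \<partial>lborel)"
 proof (rule nn_integral_mono)
  fix x :: real
  have "std_normal_density x * exp (c * abs x) <= std_normal_density x * exp (c * x) + std_normal_density x * exp ((-c) * x)"
   by (auto simp: abs_if distrib_left[symmetric] intro!: mult_left_mono)
  also have "\<dots> = exp (c\<^sup>2 / 2) * normal_density c 1 x + exp (c\<^sup>2 / 2) * normal_density (-c) 1 x"
   by (simp only: shift power2_minus)
  finally show "ennreal (std_normal_density x * exp (c * abs x)) <=
    ennreal (exp (c\<^sup>2 / 2) * normal_density c 1 x) + ennreal (exp (c\<^sup>2 / 2) * normal_density (-c) 1 x)"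
   by (simp add: ennreal_leI flip: ennreal_plus)
 qed
 also have "\<dots> = (\<integral>\<^sup>+x. ennreal (exp (c\<^sup>2 / 2)) * ennreal (normal_density c 1 x) \<partial>lborel)
   + (\<integral>\<^sup>+x. ennreal (exp (c\<^sup>2 / 2)) * ennreal (normal_density (-c) 1 x) \<partial>lborel)"
  by (subst nn_integral_add) (simp_all add: ennreal_mult)
 also have "\<dots> = ennreal (exp (c\<^sup>2 / 2)) + ennreal (exp (c\<^sup>2 / 2))"
  by (simp add: nn_integral_cmult one)
 also have "\<dots> < \<infinity>" by simp
 finally show ?thesis .
qed

lemma nn_integral_gauss_prod:
 fixes f :: "real => real"
 assumes [measurable]: "f \<in> borel_measurable borel" and nn: "!!x. 0 <= f x"
 shows "(\<integral>\<^sup>+v. ennreal (\<Prod>b\<in>Basis. f (v \<bullet> b)) \<partial>(gauss :: (real^'n::finite) measure)) =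
  (\<integral>\<^sup>+x. ennreal (std_normal_density x * f x) \<partial>lborel) ^ CARD('n)"
proof -
 have "(\<integral>\<^sup>+v. ennreal (\<Prod>b\<in>Basis. f (v \<bullet> b)) \<partial>(gauss :: (real^'n) measure))
   = (\<integral>\<^sup>+v. ennreal (gdens v) * ennreal (\<Prod>b\<in>Basis. f (v \<bullet> b)) \<partial>(lborel :: (real^'n) measure))"
  unfolding gauss_eq by (rule nn_integral_density) auto
 also have "\<dots> = (\<integral>\<^sup>+v. (\<Prod>b\<in>Basis. ennreal (std_normal_density (v \<bullet> b) * f (v \<bullet> b))) \<partial>(lborel :: (real^'n) measure))"
 proof (rule nn_integral_cong)
  fix v :: "real^'n"
  have "ennreal (gdens v) * ennreal (\<Prod>b\<in>Basis. f (v \<bullet> b)) =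
   ennreal ((\<Prod>b\<in>Basis. std_normal_density (v \<bullet> b)) * (\<Prod>b\<in>Basis. f (v \<bullet> b)))"
   unfolding gdens_prod using nn by (intro ennreal_mult[symmetric] prod_nonneg) auto
  also have "\<dots> = ennreal (\<Prod>b\<in>Basis. std_normal_density (v \<bullet> b) * f (v \<bullet> b))"
   by (simp only: prod.distrib)
  also have "\<dots> = (\<Prod>b\<in>Basis. ennreal (std_normal_density (v \<bullet> b) * f (v \<bullet> b)))"
   using nn by (intro prod_ennreal[symmetric]) auto
  finally show "ennreal (gdens v) * ennreal (\<Prod>b\<in>Basis. f (v \<bullet> b)) =
   (\<Prod>b\<in>Basis. ennreal (std_normal_density (v \<bullet> b) * f (v \<bullet> b)))" .
 qed
 also have "\<dots> = (\<Prod>b\<in>(Basis::(real^'n) set). \<integral>\<^sup>+x. ennreal (std_normal_density x * f x) \<partial>lborel)"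
  by (rule nn_integral_lborel_prod[of "%_ x. ennreal (std_normal_density x * f x)"]) auto
 also have "\<dots> = (\<integral>\<^sup>+x. ennreal (std_normal_density x * f x) \<partial>lborel) ^ CARD('n)" by simp
 finally show ?thesis .
qed

lemma prob_space_gauss: "prob_space (gauss :: (real^'n::finite) measure)"
proof
 have one: "(\<integral>\<^sup>+x. ennreal (std_normal_density x * 1) \<partial>lborel) = 1"
  using prob_space.emeasure_space_1[OF prob_space_normal_density[of 1 0]]
  by (simp add: emeasure_density)
 show "emeasure (gauss :: (real^'n) measure) (space gauss) = 1"
  using nn_integral_gauss_prod[where 'n='n, of "%_. 1"] unfolding one by simp
qed

text \<open>The Euclidean norm is at most the sum of the absolute coordinates, whose exponential is
  a product of one-dimensional factors.\<close>

lemma integrable_gauss_exp: "integrable gauss (%v::real^'n::finite. exp (c * norm v))"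
proof -
 define d where "d = abs c"
 have "(\<integral>\<^sup>+v. ennreal (\<Prod>b\<in>Basis. exp (d * abs (v \<bullet> b))) \<partial>(gauss :: (real^'n) measure)) =
  (\<integral>\<^sup>+x. ennreal (std_normal_density x * exp (d * abs x)) \<partial>lborel) ^ CARD('n)"
  by (rule nn_integral_gauss_prod) auto
 also have "\<dots> < \<infinity>"
  using std_normal_exp_finite[of d] by (simp add: power_less_top_ennreal)
 finally have fin: "(\<integral>\<^sup>+v. ennreal (\<Prod>b\<in>Basis. exp (d * abs (v \<bullet> b))) \<partial>(gauss :: (real^'n) measure)) < \<infinity>" .
 have int: "integrable gauss (%v::real^'n. \<Prod>b\<in>Basis. exp (d * abs (v \<bullet> b)))"
  using fin by (intro integrableI_nonneg) (auto intro!: prod_nonneg AE_I2)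
 show ?thesis
 proof (rule integrable_dominated[OF int])
  have "norm (exp (c * norm v)) <= norm (\<Prod>b\<in>Basis. exp (d * abs (v \<bullet> b)))" for v :: "real^'n"
  proof -
   have "c * norm v <= d * norm v" by (simp add: d_def mult_right_mono)
   also have "\<dots> <= d * (\<Sum>b\<in>Basis. abs (v \<bullet> b))"
    using norm_le_l1[of v] by (intro mult_left_mono) (auto simp: d_def)
   finally have "exp (c * norm v) <= exp (\<Sum>b\<in>Basis. d * abs (v \<bullet> b))"
    by (simp add: sum_distrib_left)
   also have "\<dots> = (\<Prod>b\<in>Basis. exp (d * abs (v \<bullet> b)))" by (simp add: exp_sum)
   finally show ?thesis by simp
  qed
  then show "AE v in (gauss :: (real^'n) measure). norm (exp (c * norm v)) <= norm (\<Prod>b\<in>Basis. exp (d * abs (v \<bullet> b)))" by simp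
 qed measurable
qed

section \<open>Functions of at most exponential growth\<close>

text \<open>A class that contains polynomials and bounded functions, is closed under sums and
  products, and is integrable for the Gaussian measure; it supplies the dominating functions in
  velocity.\<close>

definition exp_bounded :: "(real^'n::finite => real) => bool" where
 "exp_bounded f \<longleftrightarrow> (\<exists>C c. \<forall>v. abs (f v) <= C * exp (c * norm v))"

lemma exp_bounded_integrable:
 assumes "f \<in> borel_measurable borel" "exp_bounded f"
 shows "integrable gauss f"
proof -
 obtain C c where b: "!!v. abs (f v) <= C * exp (c * norm v)" using assms(2) by (auto simp: exp_bounded_def)
 show ?thesis
 proof (rule integrable_dominated)
  show "integrable gauss (%v. C * exp (c * norm v))" using integrable_gauss_exp by auto
  show "AE v in gauss. norm (f v) <= norm (C * exp (c * norm v))"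
   using b by (auto intro!: AE_I2 order_trans[OF b])
 qed (use assms in simp)
qed

lemma exp_bounded_mult:
 assumes "exp_bounded f" "exp_bounded g"
 shows "exp_bounded (%v. f v * g v)"
proof -
 obtain C c D d where b: "!!v. abs (f v) <= C * exp (c * norm v)" "!!v. abs (g v) <= D * exp (d * norm v)"
  using assms by (auto simp: exp_bounded_def)
 have "abs (f v * g v) <= (C * D) * exp ((c + d) * norm v)" for v
 proof -
  have "abs (f v * g v) <= (C * exp (c * norm v)) * (D * exp (d * norm v))"
   unfolding abs_mult by (intro mult_mono b) (use b(1)[of v] in linarith, simp)
  also have "\<dots> = (C * D) * exp ((c + d) * norm v)" by (simp add: exp_add algebra_simps)
  finally show ?thesis .
 qed
 then show ?thesis unfolding exp_bounded_def by blast
qed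

lemma exp_bounded_add:
 assumes "exp_bounded f" "exp_bounded g"
 shows "exp_bounded (%v. f v + g v)"
proof -
 obtain C c D d where b: "!!v. abs (f v) <= C * exp (c * norm v)" "!!v. abs (g v) <= D * exp (d * norm v)"
  using assms by (auto simp: exp_bounded_def)
 have CD: "0 <= C" "0 <= D" using b(1)[of 0] b(2)[of 0] by auto
 have "abs (f v + g v) <= (C + D) * exp (max c d * norm v)" for v
 proof -
  have "abs (f v + g v) <= C * exp (c * norm v) + D * exp (d * norm v)"
   using b(1)[of v] b(2)[of v] by linarith
  also have "\<dots> <= C * exp (max c d * norm v) + D * exp (max c d * norm v)"
   using CD by (intro add_mono mult_left_mono) (auto intro!: mult_right_mono)
  finally show ?thesis by (simp add: distrib_right)
 qed
 then show ?thesis unfolding exp_bounded_def by blast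
qed

lemma exp_bounded_bounded: "(!!v. abs (f v) <= C) ==> exp_bounded f"
 unfolding exp_bounded_def by (intro exI[of _ C] exI[of _ 0]) auto

lemma exp_bounded_const: "exp_bounded (%_. c)"
 by (rule exp_bounded_bounded[of _ "abs c"]) simp

lemma exp_bounded_component: "exp_bounded (%v::real^'n::finite. v $ i)"
 unfolding exp_bounded_def
proof (intro exI[of _ 1] allI)
 fix v :: "real^'n"
 have "abs (v $ i) <= norm v" by (rule component_le_norm_cart)
 also have "\<dots> <= exp (norm v)" by (rule order_trans[OF _ exp_ge_add_one_self]) simp
 finally show "abs (v $ i) <= 1 * exp (1 * norm v)" by simp
qed

lemma exp_bounded_sum: "(!!i. i \<in> I ==> exp_bounded (f i)) ==> exp_bounded (%v. \<Sum>i\<in>I. f i v)"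
 by (induction I rule: infinite_finite_induct) (auto intro: exp_bounded_const exp_bounded_add)

lemma exp_bounded_prod: "(!!i. i \<in> I ==> exp_bounded (f i)) ==> exp_bounded (%v. \<Prod>i\<in>I. f i v)"
 by (induction I rule: infinite_finite_induct) (auto intro: exp_bounded_const exp_bounded_mult)

lemma exp_bounded_power: "exp_bounded f ==> exp_bounded (%v. f v ^ n)"
 by (induction n) (auto intro: exp_bounded_const exp_bounded_mult)

lemma exp_bounded_inner: "exp_bounded (%v::real^'n::finite. \<beta> \<bullet> v)"
 unfolding exp_bounded_def
proof (rule exI[of _ "norm \<beta>"], rule exI[of _ 1], rule allI)
 fix v :: "real^'n"
 have "abs (\<beta> \<bullet> v) <= norm \<beta> * norm v" by (rule Cauchy_Schwarz_ineq2)
 also have "\<dots> <= norm \<beta> * exp (1 * norm v)"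
  by (intro mult_left_mono order_trans[OF _ exp_ge_add_one_self]) auto
 finally show "abs (\<beta> \<bullet> v) <= norm \<beta> * exp (1 * norm v)" .
qed

lemma exp_bounded_L2:
 assumes "f \<in> borel_measurable borel" "exp_bounded f"
 shows "f \<in> L2 gauss"
 using exp_bounded_integrable[of "%v. (f v)^2"] assms exp_bounded_power[OF assms(2), of 2]
 by (auto simp: L2_def)

lemma has_dd_component: "has_dd (%v::real^'n::finite. v $ j) (axis i 1) (%_. if i = j then 1 else 0)"
proof -
 have "axis i (1::real) $ j = (if i = j then 1 else 0)" by (simp add: axis_def)
 then show ?thesis using has_dd_linear[OF bounded_linear_vec_nth[of j], of "axis i 1"] by simp
qed

lemma has_dd_gdens: "has_dd (gdens :: real^'n::finite => real) (axis i 1) (%v. - v $ i * gdens v)"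
proof -
 have "has_dd (%v::real^'n. \<Sum>j\<in>UNIV. v $ j * v $ j) (axis i 1)
   (%v. \<Sum>j\<in>UNIV. (if i = j then 1 else 0) * v $ j + v $ j * (if i = j then 1 else 0))"
  by (intro has_dd_sum has_dd_mult has_dd_component)
 moreover have "(%v::real^'n. \<Sum>j\<in>UNIV. (if i = j then 1 else 0) * v $ j + v $ j * (if i = j then 1 else 0)) = (%v. 2 * v $ i)"
  by (simp add: sum.distrib if_distrib[of "%c. c * _"] if_distrib[of "%c. _ * c"] cong: if_cong)
 moreover have "(%v::real^'n. \<Sum>j\<in>UNIV. v $ j * v $ j) = (%v. (norm v)^2)"
  by (simp add: power2_norm_eq_inner inner_vec_def)
 ultimately have n: "has_dd (%v::real^'n. (norm v)^2) (axis i 1) (%v. 2 * v $ i)" by simp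
 have e: "((%y. (2 * pi) powr (- real CARD('n) / 2) * exp (- y / 2)) has_real_derivative
   (2 * pi) powr (- real CARD('n) / 2) * (exp (- y / 2) * (-1/2))) (at y)" for y :: real
  by (auto intro!: derivative_eq_intros)
 have "has_dd (%v::real^'n. gdens v) (axis i 1) (%v. (2 * pi) powr (- real CARD('n) / 2) * (exp (- (norm v)\<^sup>2 / 2) * (-1/2)) * (2 * v $ i))"
  unfolding gdens_def using has_dd_chain[OF n e] by simp
 moreover have "(%v::real^'n. (2 * pi) powr (- real CARD('n) / 2) * (exp (- (norm v)\<^sup>2 / 2) * (-1/2)) * (2 * v $ i)) = (%v. - v $ i * gdens v)"
  by (simp add: gdens_def fun_eq_iff)
 ultimately show ?thesis by simp
qed

text \<open>The product rule for \<open>gdens * f\<close>, whose derivative integrates to 0; the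
  density contributes the factor \<open>- v $ i\<close>. This is the origin of the drift v . D_v in
  the equation.\<close>

lemma gauss_by_parts:
 fixes f :: "real^'n::finite => real"
 assumes dd: "has_dd f (axis i 1) f'" and cont: "continuous_on UNIV f" "continuous_on UNIV f'"
  and eb: "exp_bounded f" "exp_bounded f'"
 shows "(LINT v|gauss. f' v) = (LINT v|gauss. v $ i * f v)"
proof -
 have m [measurable]: "f \<in> borel_measurable borel" "f' \<in> borel_measurable borel"
  using cont by (auto intro: borel_measurable_continuous_onI)
 have i1: "integrable lborel (%v. gdens v * f v)"
  using exp_bounded_integrable[of f] eb by (simp add: LINT_gauss)
 have i2: "integrable lborel (%v. gdens v * f' v)"
  using exp_bounded_integrable[of f'] eb by (simp add: LINT_gauss)
 have m3: "(%v. v $ i * f v) \<in> borel_measurable borel"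
  using cont by (intro borel_measurable_continuous_onI continuous_intros)
 have i3: "integrable lborel (%v. gdens v * (v $ i * f v))"
  using exp_bounded_integrable[OF m3 exp_bounded_mult[OF exp_bounded_component eb(1)]]
  by (simp add: LINT_gauss[OF m3])
 have "(LINT v|lborel. - v $ i * gdens v * f v + gdens v * f' v) = 0"
 proof (rule lborel_integral_dd_eq_0[OF has_dd_mult[OF has_dd_gdens dd] i1])
  have "integrable lborel (%v. gdens v * f' v - gdens v * (v $ i * f v))"
   using i2 i3 by auto
  then show "integrable lborel (%v. - v $ i * gdens v * f v + gdens v * f' v)"
   by (simp add: algebra_simps)
  show "continuous_on UNIV (%v. - v $ i * gdens v * f v + gdens v * f' v)"
   using cont by (intro continuous_intros continuous_gdens)
 qed
 moreover have "(%v. - v $ i * gdens v * f v + gdens v * f' v) = (%v. gdens v * f' v - gdens v * (v $ i * f v))"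
  by (auto simp: algebra_simps)
 ultimately have "(LINT v|lborel. gdens v * f' v) - (LINT v|lborel. gdens v * (v $ i * f v)) = 0"
  using i2 i3 by simp
 then show ?thesis by (simp add: LINT_gauss m3)
qed

section \<open>The torus and the phase space measure\<close>

definition cube :: "(real^'n::finite) set" where
 "cube = {x. \<forall>i. 0 <= x $ i \<and> x $ i < 1}"

lemma torus_eq: "torus = restrict_space lborel cube"
 by (simp add: torus_def cube_def)

lemma cube_measurable [measurable]: "cube \<in> sets (borel :: (real^'n::finite) measure)"
 unfolding cube_def by measurable

lemma space_torus [simp]: "space torus = cube"
 by (simp add: torus_eq space_restrict_space)

lemma emeasure_cube: "emeasure lborel (cube :: (real^'n::finite) set) = 1"
proof -
 have B: "(1::real^'n) \<bullet> b = 1" "(0::real^'n) \<bullet> b = 0" if "b \<in> Basis" for b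
  using that by (auto simp: Basis_vec_def inner_axis)
 have "emeasure lborel (cube :: (real^'n) set) <= emeasure lborel (cbox (0::real^'n) 1)"
  by (intro emeasure_mono) (auto simp: cube_def mem_box_cart less_imp_le)
 also have "\<dots> = 1" using B by (subst emeasure_lborel_cbox) (auto simp: inner_diff_left)
 finally have 1: "emeasure lborel (cube :: (real^'n) set) <= 1" .
 have "1 = emeasure lborel (box (0::real^'n) 1)" using B by (subst emeasure_lborel_box) (auto simp: inner_diff_left)
 also have "\<dots> <= emeasure lborel (cube :: (real^'n) set)"
  by (intro emeasure_mono) (auto simp: cube_def mem_box_cart less_imp_le)
 finally show ?thesis using 1 by (rule order_antisym[rotated])
qed

lemma prob_space_torus: "prob_space (torus :: (real^'n::finite) measure)"
proof
 show "emeasure (torus :: (real^'n) measure) (space torus) = 1"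
  unfolding space_torus by (simp add: torus_eq emeasure_restrict_space emeasure_cube)
qed

lemma borel_measurable_torus: "f \<in> borel_measurable borel ==> f \<in> borel_measurable torus"
 unfolding torus_eq by (intro measurable_restrict_space1) simp

definition zvec :: "('n => int) => real^'n::finite" where
 "zvec k = (\<chi> i. of_int (k i))"

lemma periodic_zvec:
 fixes g :: "real^'n::finite => 'b"
 assumes per: "!!x i. g (x + axis i 1) = g x"
 shows "g (x + zvec k) = g x"
proof -
 have nat: "g (x + real m *\<^sub>R axis i 1) = g x" for x i m
 proof (induction m)
  case (Suc m)
  have "g (x + real (Suc m) *\<^sub>R axis i 1) = g ((x + real m *\<^sub>R axis i 1) + axis i 1)"
   by (simp add: scaleR_add_left algebra_simps)
  then show ?case using Suc per by simp
 qed simp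
 have int: "g (x + of_int m *\<^sub>R axis i 1) = g x" for x i m
 proof (cases "m \<ge> 0")
  case True
  then show ?thesis using nat[of x "nat m" i] by simp
 next
  case False
  then have eq: "x + of_int m *\<^sub>R axis i 1 + real (nat (- m)) *\<^sub>R axis i 1 = x"
   by (simp add: scaleR_add_left[symmetric])
  show ?thesis using nat[of "x + of_int m *\<^sub>R axis i 1" "nat (- m)" i] unfolding eq by (rule sym)
 qed
 have "g (x + (\<Sum>i\<in>S. of_int (k i) *\<^sub>R axis i 1)) = g x" if "finite S" for S x
  using that
 proof (induction S arbitrary: x)
  case (insert i S)
  have "g (x + (\<Sum>i\<in>insert i S. of_int (k i) *\<^sub>R axis i 1)) =
   g ((x + of_int (k i) *\<^sub>R axis i 1) + (\<Sum>i\<in>S. of_int (k i) *\<^sub>R axis i 1))"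
   using insert by (simp add: add.assoc)
  then show ?case using insert.IH int by simp
 qed simp
 from this[OF finite, of x UNIV]
 moreover have "(\<Sum>i\<in>UNIV. of_int (k i) *\<^sub>R axis i 1) = (zvec k :: real^'n)"
  by (auto simp: zvec_def vec_eq_iff axis_def if_distrib sum.delta cong: if_cong)
 ultimately show ?thesis by simp
qed

lemma emeasure_lborel_translate:
 fixes S :: "'a::euclidean_space set"
 assumes "S \<in> sets borel"
 shows "emeasure lborel {x. x + c \<in> S} = emeasure lborel S"
proof -
 have "emeasure lborel S = emeasure (distr lborel borel ((+) c)) S" by (simp add: lborel_distr_plus)
 also have "\<dots> = emeasure lborel ((+) c -` S \<inter> space lborel)"
  using assms by (intro emeasure_distr) auto
 also have "(+) c -` S \<inter> space lborel = {x. x + c \<in> S}" by (auto simp: add.commute)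
 finally show ?thesis by simp
qed

text \<open>The fractional part of \<open>x + a\<close> is \<open>x + a - k\<close> for some \<open>k \<in> \<int>\<^sup>d\<close>; the countably many pieces are
 translated separately.\<close>

lemma distr_torus_frac:
 fixes a :: "real^'n::finite"
 shows "distr torus torus (%x. \<chi> i. frac (x $ i + a $ i)) = torus" and
  "(%x. \<chi> i. frac (x $ i + a $ i)) \<in> measurable torus torus"
proof -
 define fr where "fr x = (\<chi> i. frac (x $ i + a $ i))" for x :: "real^'n"
 have frm: "fr \<in> borel_measurable borel"
  by (subst borel_measurable_euclidean_space)
   (auto simp: fr_def Basis_vec_def inner_axis frac_def)
 have frc: "fr x \<in> cube" for x by (auto simp: fr_def cube_def frac_lt_1)
 have meas: "fr \<in> measurable torus torus"
  unfolding torus_eq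
  by (intro measurable_restrict_space3) (use frm frc in auto)
 then show "(%x. \<chi> i. frac (x $ i + a $ i)) \<in> measurable torus torus" unfolding fr_def .
 have uniq: "k = l" if "y + zvec k \<in> cube" "y + zvec l \<in> cube" for y :: "real^'n" and k l
 proof
  fix i
  have "0 <= y $ i + of_int (k i)" "y $ i + of_int (k i) < 1" "0 <= y $ i + of_int (l i)" "y $ i + of_int (l i) < 1"
   using that by (auto simp: cube_def zvec_def)
  then show "k i = l i" by linarith
 qed
 have ex: "y + zvec (%i. - \<lfloor>y $ i\<rfloor>) \<in> cube" for y :: "real^'n"
 proof -
  have "0 <= y $ i + - real_of_int \<lfloor>y $ i\<rfloor>" "y $ i + - real_of_int \<lfloor>y $ i\<rfloor> < 1" for i by linarith+
  then show ?thesis by (simp add: cube_def zvec_def)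
 qed
 have fr_eq: "fr x = (x + a) + zvec (%i. - \<lfloor>(x + a) $ i\<rfloor>)" for x
  by (simp add: fr_def vec_eq_iff zvec_def frac_def)
 show "distr torus torus (%x. \<chi> i. frac (x $ i + a $ i)) = torus"
  unfolding fr_def[symmetric]
 proof (rule measure_eqI)
  fix A assume "A \<in> sets (distr torus torus fr)"
  then have At: "A \<in> sets torus" by simp
  then have A: "A \<in> sets borel" "A \<subseteq> cube"
   by (auto simp: torus_eq sets_restrict_space)
  \<comment> \<open>\<open>B k\<close> collects the points of the cube that the translation by a + k
    sends into A, and \<open>C k\<close> is the image of \<open>B k\<close> in A. The sets
    \<open>B k\<close> partition the preimage of A, the sets \<open>C k\<close> partition A, and
    corresponding pieces are translates of each other.\<close>
  define B where "B k = {x. x + (a + zvec k) \<in> {y \<in> A. y + (- a + zvec (%i. - k i)) \<in> cube}}" for k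
  define C where "C k = {y \<in> A. y + (- a + zvec (%i. - k i)) \<in> cube}" for k
  have z0: "zvec k + zvec (%i. - k i) = (0::real^'n)" for k :: "'n => int" by (simp add: zvec_def vec_eq_iff)
  have B_alt: "B k = {x \<in> cube. x + a + zvec k \<in> A}" for k
  proof -
   have "x + (a + zvec k) + (- a + zvec (%i. - k i)) = x" for x
    using z0[of k] by (simp add: algebra_simps)
   then show ?thesis by (auto simp: B_def add.assoc)
  qed
  have C_meas: "C k \<in> sets borel" for k
  proof -
   have "{y. y + (- a + zvec (%i. - k i)) \<in> cube} \<in> sets borel" by measurable
   then have "A \<inter> {y. y + (- a + zvec (%i. - k i)) \<in> cube} \<in> sets borel" using A by auto
   then show ?thesis by (simp add: C_def Int_def)
  qed
  have B_C: "emeasure lborel (B k) = emeasure lborel (C k)" for k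
   using emeasure_lborel_translate[OF C_meas[of k], of "a + zvec k"] by (simp add: B_def C_def)
  have B_meas: "B k \<in> sets borel" for k
  proof -
   have "(%x. x + (a + zvec k)) -` C k \<inter> space borel \<in> sets borel"
    by (rule measurable_sets[of _ borel borel]) (auto intro: C_meas)
   then show ?thesis by (simp add: B_def C_def vimage_def)
  qed
  have UB: "fr -` A \<inter> cube = (\<Union>k\<in>UNIV. B k)"
  proof (intro equalityI subsetI)
   fix x assume "x \<in> fr -` A \<inter> cube"
   then show "x \<in> (\<Union>k\<in>UNIV. B k)" using fr_eq[of x] by (auto simp: B_alt)
  next
   fix x assume "x \<in> (\<Union>k\<in>UNIV. B k)"
   then obtain k where k: "x \<in> cube" "x + a + zvec k \<in> A" by (auto simp: B_alt)
   then have "x + a + zvec k \<in> cube" using A by auto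
   then have "k = (%i. - \<lfloor>(x + a) $ i\<rfloor>)" by (rule uniq[OF _ ex])
   then show "x \<in> fr -` A \<inter> cube" using k fr_eq[of x] by auto
  qed
  have UC: "A = (\<Union>k\<in>UNIV. C k)"
  proof (intro equalityI subsetI)
   fix y assume y: "y \<in> A"
   have "(y - a) + zvec (%i. - \<lfloor>(y - a) $ i\<rfloor>) \<in> cube" by (rule ex)
   then have "y \<in> C (%i. \<lfloor>(y - a) $ i\<rfloor>)" using y by (simp add: C_def algebra_simps)
   then show "y \<in> (\<Union>k\<in>UNIV. C k)" by blast
  qed (auto simp: C_def)
  have dB: "disjoint_family_on B UNIV"
   unfolding disjoint_family_on_def
  proof (intro ballI impI)
   fix k l :: "'n => int" assume "k \<noteq> l"
   show "B k \<inter> B l = {}"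
   proof (rule ccontr)
    assume "B k \<inter> B l \<noteq> {}"
    then obtain x where "x + a + zvec k \<in> A" "x + a + zvec l \<in> A" by (auto simp: B_alt)
    then show False using uniq[of "x + a" k l] A \<open>k \<noteq> l\<close> by auto
   qed
  qed
  have dC: "disjoint_family_on C UNIV"
   unfolding disjoint_family_on_def
  proof (intro ballI impI)
   fix k l :: "'n => int" assume "k \<noteq> l"
   show "C k \<inter> C l = {}"
   proof (rule ccontr)
    assume "C k \<inter> C l \<noteq> {}"
    then obtain y where "y + (- a + zvec (%i. - k i)) \<in> cube" "y + (- a + zvec (%i. - l i)) \<in> cube"
     by (auto simp: C_def)
    then have "(y + - a) + zvec (%i. - k i) \<in> cube" "(y + - a) + zvec (%i. - l i) \<in> cube"
     by (simp_all only: add.assoc)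
    then have "(%i. - k i) = (%i. - l i)" by (rule uniq)
    then show False using \<open>k \<noteq> l\<close> by (auto simp: fun_eq_iff)
   qed
  qed
  have UCe: "emeasure lborel A = (\<integral>\<^sup>+k. emeasure lborel (C k) \<partial>count_space UNIV)"
  proof -
   have "emeasure lborel (\<Union>k\<in>UNIV. C k) = (\<integral>\<^sup>+k. emeasure lborel (C k) \<partial>count_space UNIV)"
    using C_meas dC by (intro emeasure_UN_countable) auto
   then show ?thesis using UC by simp
  qed
  have "emeasure (distr torus torus fr) A = emeasure torus (fr -` A \<inter> cube)"
   using At meas by (subst emeasure_distr) auto
  also have "\<dots> = emeasure lborel (fr -` A \<inter> cube)"
   unfolding torus_eq by (intro emeasure_restrict_space) auto
  also have "\<dots> = (\<integral>\<^sup>+k. emeasure lborel (B k) \<partial>count_space UNIV)"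
   unfolding UB using B_meas dB by (intro emeasure_UN_countable) auto
  also have "\<dots> = (\<integral>\<^sup>+k. emeasure lborel (C k) \<partial>count_space UNIV)" by (simp add: B_C)
  also have "\<dots> = emeasure lborel A"
   unfolding UCe ..
  also have "\<dots> = emeasure torus A"
   unfolding torus_eq using A by (intro emeasure_restrict_space[symmetric]) auto
  finally show "emeasure (distr torus torus fr) A = emeasure torus A" .
 qed simp
qed

lemma torus_translation:
 fixes g :: "real^'n::finite => real"
 assumes g: "g \<in> borel_measurable borel" and per: "!!x i. g (x + axis i 1) = g x"
 shows "(LINT x|torus. g (x + a)) = (LINT x|torus. g x)"
proof -
 have "(LINT x|torus. g x) = (LINT x|distr torus torus (%x. \<chi> i. frac (x $ i + a $ i)). g x)"
  by (simp add: distr_torus_frac)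
 also have "\<dots> = (LINT x|torus. g (\<chi> i. frac (x $ i + a $ i)))"
  using distr_torus_frac(2)[of a] borel_measurable_torus[OF g] by (rule integral_distr)
 also have "\<dots> = (LINT x|torus. g (x + a))"
 proof (rule LINT_cong[OF refl])
  fix x :: "real^'n"
  have "(\<chi> i. frac (x $ i + a $ i)) = (x + a) + zvec (%i. - \<lfloor>(x + a) $ i\<rfloor>)"
   by (simp add: vec_eq_iff zvec_def frac_def)
  then show "g (\<chi> i. frac (x $ i + a $ i)) = g (x + a)" using periodic_zvec[OF per] by simp
 qed
 finally show ?thesis by simp
qed

section \<open>The product measure on phase space\<close>

interpretation torus: prob_space "torus :: (real^'n::finite) measure" by (rule prob_space_torus)
interpretation gauss: prob_space "gauss :: (real^'n::finite) measure" by (rule prob_space_gauss)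
interpretation tg: pair_prob_space "torus :: (real^'n::finite) measure" "gauss :: (real^'n) measure" ..

lemma prob_space_mu: "prob_space (mu :: 'n::finite phase measure)"
 unfolding mu_def by unfold_locales

interpretation mu: prob_space "mu :: 'n::finite phase measure" by (rule prob_space_mu)

lemma space_mu [simp]: "space mu = cube \<times> UNIV"
 by (simp add: mu_def space_pair_measure)

lemma borel_measurable_mu:
 fixes f :: "'n::finite phase => 'b::topological_space"
 assumes "f \<in> borel_measurable borel"
 shows "f \<in> borel_measurable mu"
proof -
 have "(%z. (fst z, snd z)) \<in> measurable mu (borel \<Otimes>\<^sub>M borel)"
  unfolding mu_def
  by (intro measurable_Pair measurable_compose[OF measurable_fst borel_measurable_torus]
    measurable_compose[OF measurable_snd]) (auto simp: measurable_cong_sets[OF sets_gauss refl])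
 then have "(%z. z) \<in> measurable mu (borel :: 'n phase measure)" by (simp add: borel_prod)
 from measurable_compose[OF this assms] show ?thesis by simp
qed

lemma borel_measurable_mu_continuous:
 fixes f :: "'n::finite phase => 'b::topological_space"
 shows "continuous_on UNIV f ==> f \<in> borel_measurable mu"
 by (intro borel_measurable_mu borel_measurable_continuous_onI)

lemma mu_Fubini:
 fixes f :: "'n::finite phase => real"
 assumes "integrable mu f"
 shows "(LINT x|torus. LINT v|gauss. f (x, v)) = (LINT z|mu. f z)"
  and "(LINT v|gauss. LINT x|torus. f (x, v)) = (LINT z|mu. f z)"
  and "AE x in torus. integrable gauss (%v. f (x, v))"
proof -
 have i: "integrable (torus \<Otimes>\<^sub>M gauss) f" using assms by (simp add: mu_def)
 show 1: "(LINT x|torus. LINT v|gauss. f (x, v)) = (LINT z|mu. f z)"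
  using tg.integral_fst'[OF i] by (simp add: mu_def)
 show "(LINT v|gauss. LINT x|torus. f (x, v)) = (LINT z|mu. f z)"
  using tg.Fubini_integral[of "%x v. f (x, v)"] i 1 by simp
 show "AE x in torus. integrable gauss (%v. f (x, v))"
  by (rule tg.AE_integrable_fst'[OF i])
qed

lemma mu_measurable_slice:
 assumes "f \<in> borel_measurable mu" "x \<in> cube"
 shows "(%v. f (x, v)) \<in> borel_measurable gauss"
 using assms unfolding mu_def by (intro measurable_compose[OF measurable_Pair1']) auto

lemma mu_L2_slices:
 fixes f :: "'n::finite phase => 'b::euclidean_space"
 assumes "f \<in> L2 mu"
 shows "AE x in torus. (%v. f (x, v)) \<in> L2 gauss"
 using mu_Fubini(3)[OF L2_integrable_sq[OF assms]] AE_space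
proof eventually_elim
 case (elim x)
 then show ?case
  using mu_measurable_slice[OF L2_measurable[OF assms], of x] by (intro L2_I) auto
qed

lemma mu_integrable_snd:
 fixes h :: "real^'n::finite => real"
 assumes "integrable gauss h"
 shows "integrable mu (%z. h (snd z))"
proof -
 have "integrable (torus \<Otimes>\<^sub>M gauss) (%z::'n phase. h (snd z))"
 proof (rule tg.Fubini_integrable)
  show "(%z::'n phase. h (snd z)) \<in> borel_measurable (torus \<Otimes>\<^sub>M gauss)"
   using borel_measurable_integrable[OF assms] by (intro measurable_compose[OF measurable_snd])
 qed (use assms in auto)
 then show ?thesis by (simp add: mu_def)
qed

text \<open>The third conclusion lets one \<open>w\<close> dominate the squares of a whole sequence
  of functions with the common bound g.\<close>

lemma mu_square_dominated:
 fixes f :: "'n::finite phase => 'b::euclidean_space"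
 assumes m: "f \<in> borel_measurable mu" and g: "exp_bounded g" and b: "!!x v. norm (f (x, v)) <= g v"
 obtains w where "integrable mu w" "!!z. (norm (f z))^2 <= w z" "!!z (h::'b). norm h <= g (snd z) ==> (norm h)\<^sup>2 <= w z"
proof -
 obtain C c where C: "!!v. abs (g v * g v) <= C * exp (c * norm v)"
  using exp_bounded_mult[OF g g] by (auto simp: exp_bounded_def)
 have "integrable mu (%z. C * exp (c * norm (snd z)))"
  by (intro mu_integrable_snd[of "%v. C * exp (c * norm v)"] integrable_mult_right integrable_gauss_exp)
 moreover have gw: "r\<^sup>2 <= C * exp (c * norm v)" if "0 <= r" "r <= g v" for r v
 proof -
  have "r\<^sup>2 <= g v * g v" using that by (simp add: power2_eq_square mult_mono)
  also have "\<dots> <= C * exp (c * norm v)" using C[of v] by linarith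
  finally show ?thesis .
 qed
 moreover have "(norm (f z))^2 <= C * exp (c * norm (snd z))" for z
  using b[of "fst z" "snd z"] by (intro gw) auto
 moreover have "(norm h)^2 <= C * exp (c * norm (snd z))" if "norm h <= g (snd z)" for z :: "'n phase" and h :: 'b
  using that by (intro gw) auto
 ultimately show thesis by (intro that[of "%z. C * exp (c * norm (snd z))"]) auto
qed

lemma exp_bounded_L2_mu:
 fixes f :: "'n::finite phase => 'b::euclidean_space"
 assumes m: "f \<in> borel_measurable mu" and g: "exp_bounded g" and b: "!!x v. norm (f (x, v)) <= g v"
 shows "f \<in> L2 mu"
proof -
 obtain w where "integrable mu w" "!!z. (norm (f z))^2 <= w z"
  by (rule mu_square_dominated[OF assms]) (rule that)
 then show ?thesis using m by (intro L2_dominated[of _ _ w]) auto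
qed

lemma exp_bounded_L2_mu_tendsto:
 fixes f :: "'n::finite phase => 'b::euclidean_space"
 assumes m: "!!n. s n \<in> borel_measurable mu" "f \<in> borel_measurable mu" and g: "exp_bounded g"
  and b: "!!n x v. norm (s n (x, v)) <= g v" "!!x v. norm (f (x, v)) <= g v"
  and lim: "!!z. (%n. s n z) \<leadsto> f z"
 shows "(%n. L2_norm mu (s n -. f)) \<leadsto> 0"
proof -
 have g2: "exp_bounded (%v. 2 * g v)" by (intro exp_bounded_mult exp_bounded_const g)
 have b2: "norm (s n (x, v) - f (x, v)) <= 2 * g v" for n x v
  using norm_triangle_ineq4[of "s n (x, v)" "f (x, v)"] b(1)[of n x v] b(2)[of x v] by linarith
 obtain w where w: "integrable mu w" "!!z (h::'b). norm h <= 2 * g (snd z) ==> (norm h)\<^sup>2 <= w z"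
  by (rule mu_square_dominated[where f="%z. s 0 z - f z", OF _ g2 b2]) (use m in simp, rule that)
 show ?thesis
 proof (rule L2_tendsto_dominated[OF m w(1)])
  show "AE z in mu. (norm (s n z - f z))^2 <= w z" for n
   using b2[of n] by (intro AE_I2 w(2)) (metis prod.collapse)
 qed (use lim in auto)
qed

text \<open>Free transport preserves \<open>mu\<close>: for fixed v it is a translation of the
  torus, so Fubini with the velocity integral outside applies.\<close>

lemma mu_kinetic_shift:
 fixes g :: "'n::finite phase => real"
 assumes m: "g \<in> borel_measurable borel" and b: "!!z. abs (g z) <= B"
  and per: "!!x v i. g (x + axis i 1, v) = g (x, v)"
 shows "(LINT z|mu. g (fst z + s *\<^sub>R snd z, snd z)) = (LINT z|mu. g z)"
proof -
 have "(%z::'n phase. (fst z + s *\<^sub>R snd z, snd z)) \<in> borel_measurable borel"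
  by (intro borel_measurable_continuous_onI continuous_intros)
 from measurable_compose[OF this m]
 have m': "(%z. g (fst z + s *\<^sub>R snd z, snd z)) \<in> borel_measurable mu"
  by (intro borel_measurable_mu) simp
 have "integrable mu (%z. g (fst z + s *\<^sub>R snd z, snd z))" and i2: "integrable mu g"
  using b m' borel_measurable_mu[OF m] by (auto intro!: mu.integrable_const_bound[of _ B])
 then have "(LINT z|mu. g (fst z + s *\<^sub>R snd z, snd z)) = (LINT v|gauss. LINT x|torus. g (x + s *\<^sub>R v, v))"
  by (subst mu_Fubini(2)[symmetric]) auto
 also have "\<dots> = (LINT v|gauss. LINT x|torus. g (x, v))"
 proof (rule LINT_cong[OF refl])
  fix v :: "real^'n"
  have "(%x. (x, v)) \<in> borel_measurable borel"
   by (intro borel_measurable_continuous_onI continuous_intros)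
  from measurable_compose[OF this m]
  show "(LINT x|torus. g (x + s *\<^sub>R v, v)) = (LINT x|torus. g (x, v))"
   by (rule torus_translation) (rule per)
 qed
 also have "\<dots> = (LINT z|mu. g z)" by (rule mu_Fubini(2)[OF i2])
 finally show ?thesis .
qed

section \<open>Fourier modes\<close>

definition kdot :: "('n => int) => real^'n::finite => real" where
 "kdot k x = 2 * pi * (\<Sum>i\<in>UNIV. of_int (k i) * x $ i)"

lemma kdot_add: "kdot k (x + y) = kdot k x + kdot k y"
 by (simp add: kdot_def sum.distrib distrib_left)

lemma kdot_scale: "kdot k (c *\<^sub>R x) = c * kdot k x"
 by (simp add: kdot_def sum_distrib_left mult_ac)

lemma kdot_axis: "kdot k (c *\<^sub>R axis i 1) = 2 * pi * (c * of_int (k i))"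
 by (simp add: kdot_def axis_def if_distrib[of "%y. _ * y"] cong: if_cong)

lemma kdot_uminus: "kdot (%i. - k i) x = - kdot k x"
 by (simp add: kdot_def sum_negf)

lemma kdot_plus: "kdot (%i. k i + l i) x = kdot k x + kdot l x"
 by (simp add: kdot_def sum.distrib algebra_simps flip: sum_distrib_left)

lemma kdot_minus: "kdot (k -. l) x = kdot k x - kdot l x"
 by (simp add: kdot_def left_diff_distrib sum_subtractf right_diff_distrib)

lemma bounded_linear_kdot: "bounded_linear (kdot k :: real^'n::finite => real)"
 unfolding kdot_def
 by (intro bounded_linear_const_mult bounded_linear_sum bounded_linear_vec_nth)

lemma continuous_kdot [continuous_intros]: "continuous_on A f ==> continuous_on A (%x. kdot k (f x :: real^'n::finite))"
 using bounded_linear.continuous_on[OF bounded_linear_kdot] .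

lemma kdot_periodic: "cos (kdot k (x + axis i 1) + \<theta>) = cos (kdot k x + \<theta>)"
proof -
 have "kdot k (x + axis i 1) = kdot k x + of_int (k i) * (2 * pi)"
  using kdot_axis[of k 1 i] by (simp add: kdot_add)
 then show ?thesis
  by (simp add: cos_add sin_add add.commute[of _ "of_int (k i) * (2 * pi)"] add.assoc mult.commute[of _ "2 * pi"] sin_int_2pin cos_int_2pin)
qed

text \<open>Translation by half a period changes the sign of the integrand but not its
  integral.\<close>

lemma torus_cos_eq_0:
 assumes "k \<noteq> (%_. 0)"
 shows "(LINT x|torus. cos (kdot k x + \<theta>)) = 0"
proof -
 obtain i where i: "k i \<noteq> 0" using assms by auto
 let ?a = "(1 / (2 * of_int (k i))) *\<^sub>R axis i 1 :: real^'a"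
 have ka: "kdot k ?a = pi" unfolding kdot_axis using i by simp
 have "(LINT x|torus. cos (kdot k x + \<theta>)) = (LINT x|torus. cos (kdot k (x + ?a) + \<theta>))"
  by (intro torus_translation[symmetric] borel_measurable_continuous_onI continuous_intros kdot_periodic)
 also have "\<dots> = (LINT x|torus. - cos (kdot k x + \<theta>))"
  by (simp add: kdot_add ka add.commute[of _ pi] add.assoc)
 finally show ?thesis by simp
qed

text \<open>The Hartley kernel: a real orthonormal system with one function for each wave vector.
  Differentiation sends \<open>cas k\<close> to a multiple of \<open>cas (- k)\<close>, so transport
  has real coefficients in this basis.\<close>

definition cas :: "('n => int) => real^'n::finite => real" where
 "cas k x = cos (kdot k x) + sin (kdot k x)"

lemma continuous_cas: "continuous_on A (cas k)"
 unfolding cas_def by (intro continuous_intros continuous_on_id)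

lemma cas_bound: "abs (cas k x) <= 2"
 using abs_cos_le_one[of "kdot k x"] abs_sin_le_one[of "kdot k x"] unfolding cas_def by linarith

lemma integrable_torus_bounded:
 fixes f :: "real^'n::finite => real"
 assumes "continuous_on UNIV f" "!!x. abs (f x) <= B"
 shows "integrable torus f"
 using assms by (intro torus.integrable_const_bound[of _ B] borel_measurable_torus borel_measurable_continuous_onI) auto

text \<open>The product is cos((k-l).x) + sin((k+l).x) up to the factor 2\<pi> in the phases. The
  sine has mean 0 for every frequency, including 0, and the cosine only for k different from
  l.\<close>

lemma cas_orthonormal: "(LINT x|torus. cas k x * cas l x) = (if k = l then 1 else 0)"
proof -
 have sc: "sin y = cos (y + (- pi/2))" for y :: real by (simp add: cos_diff)
 have "cas k x * cas l x = cos (kdot (k -. l) x + 0) + cos (kdot (%i. k i + l i) x + (- pi / 2))" for x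
  by (simp only: sc[symmetric] kdot_plus kdot_minus)
   (simp add: cas_def cos_diff sin_add algebra_simps)
 then have "(LINT x|torus. cas k x * cas l x) =
   (LINT x|torus. cos (kdot (k -. l) x + 0)) + (LINT x|torus. cos (kdot (%i. k i + l i) x + (- pi / 2)))"
  by (simp only:) (intro LINT_add integrable_torus_bounded[of _ 1] continuous_intros continuous_on_id; simp)
 also have "(LINT x|torus. cos (kdot (%i. k i + l i) x + (- pi / 2))) = 0"
 proof (cases "(%i. k i + l i) = (%_. 0)")
  case True
  have "cos (kdot (%_. 0) x + (- pi / 2)) = 0" for x :: "real^'a" by (simp add: kdot_def)
  then show ?thesis using True by simp
 qed (rule torus_cos_eq_0)
 also have "(LINT x|torus. cos (kdot (k -. l) x + 0)) = (if k = l then 1 else 0)"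
 proof (cases "k = l")
  case True
  then show ?thesis using torus.prob_space by (simp add: kdot_def)
 next
  case False
  then have "(k -. l) \<noteq> (%_. 0)" by (auto simp: fun_eq_iff)
  then show ?thesis using False torus_cos_eq_0[of "%i. k i - l i" 0] by simp
 qed
 finally show ?thesis by simp
qed

section \<open>Hermite functions\<close>

text \<open>The Hermite polynomials, normalised in \<open>L\<^sup>2\<close> of the standard Gaussian.\<close>

fun nh :: "nat => real => real" where
 "nh 0 x = 1"
| "nh (Suc 0) x = x"
| "nh (Suc (Suc n)) x = (x * nh (Suc n) x - sqrt (real (Suc n)) * nh n x) / sqrt (real (Suc (Suc n)))"

text \<open>For n = 0 the truncated difference \<open>n - 1\<close> is multiplied by 0, so one
  formula covers all degrees.\<close>

lemma nh_rec: "x * nh n x = sqrt (real (Suc n)) * nh (Suc n) x + sqrt (real n) * nh (n - 1) x"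
proof (cases n)
 case (Suc m)
 have "sqrt (real (Suc (Suc m))) \<noteq> 0" by simp
 then have "sqrt (real (Suc (Suc m))) * nh (Suc (Suc m)) x = x * nh (Suc m) x - sqrt (real (Suc m)) * nh m x"
  unfolding nh.simps(3) times_divide_eq_right by (rule nonzero_mult_div_cancel_left)
 then show ?thesis unfolding Suc by (simp del: nh.simps)
qed simp

lemma nh_deriv: "(nh n has_real_derivative sqrt (real n) * nh (n - 1) x) (at x)"
proof (induction n x rule: nh.induct)
 case (1 x)
 have "nh 0 = (%_. 1)" by auto
 then show ?case by simp
next
 case (2 x)
 have "nh (Suc 0) = (%x. x)" by auto
 then show ?case by simp
next
 case (3 n x)
 let ?s = "sqrt (real (Suc (Suc n)))"
 have s: "?s * ?s = real (Suc (Suc n))" "?s \<noteq> 0" by simp_all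
 have t: "sqrt (real (Suc n)) * sqrt (real (Suc n)) = real (Suc n)" by simp
 have eq: "nh (Suc (Suc n)) = (%x. (x * nh (Suc n) x - sqrt (real (Suc n)) * nh n x) / ?s)" by auto
 have "((%x. (x * nh (Suc n) x - sqrt (real (Suc n)) * nh n x) / ?s) has_real_derivative
  (1 * nh (Suc n) x + (sqrt (real (Suc n)) * nh (Suc n - 1) x) * x
    - sqrt (real (Suc n)) * (sqrt (real n) * nh (n - 1) x)) / ?s) (at x)"
  by (intro DERIV_cdivide DERIV_diff DERIV_mult DERIV_ident DERIV_cmult 3)
 moreover have "1 * nh (Suc n) x + (sqrt (real (Suc n)) * nh (Suc n - 1) x) * x
    - sqrt (real (Suc n)) * (sqrt (real n) * nh (n - 1) x) = real (Suc (Suc n)) * nh (Suc n) x"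
 proof -
  have "(sqrt (real (Suc n)) * nh n x) * x - sqrt (real (Suc n)) * (sqrt (real n) * nh (n - 1) x) =
   sqrt (real (Suc n)) * (x * nh n x - sqrt (real n) * nh (n - 1) x)"
   by (simp only: right_diff_distrib mult_ac)
  also have "\<dots> = (sqrt (real (Suc n)) * sqrt (real (Suc n))) * nh (Suc n) x"
   unfolding nh_rec by simp
  finally show ?thesis unfolding t by (simp add: algebra_simps del: nh.simps)
 qed
 moreover have "real (Suc (Suc n)) * nh (Suc n) x / ?s = ?s * nh (Suc n) x"
  using s by (metis (no_types, lifting) mult.assoc nonzero_mult_div_cancel_left)
 ultimately show ?case unfolding eq by (simp only: diff_Suc_1)
qed

lemma continuous_nh [continuous_intros]: "continuous_on A f ==> continuous_on A (%x. nh n (f x))"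
proof -
 have "continuous_on UNIV (nh n)"
  by (intro continuous_at_imp_continuous_on ballI DERIV_isCont[OF nh_deriv])
 then show "continuous_on A f ==> continuous_on A (%x. nh n (f x))"
  by (rule continuous_on_compose2) auto
qed

definition nhm :: "('n => nat) => real^'n::finite => real" where
 "nhm m v = (\<Prod>i\<in>UNIV. nh (m i) (v $ i))"

definition up :: "('n => nat) => 'n => 'n => nat" where
 "up m i = m(i := Suc (m i))"

text \<open>At \<open>m i = 0\<close> truncated subtraction leaves m unchanged; in the formulas
  below the accompanying factor sqrt(m i) then vanishes.\<close>

definition dn :: "('n => nat) => 'n => 'n => nat" where
 "dn m i = m(i := m i - 1)"

lemma up_at [simp]: "up m i i = Suc (m i)" by (simp add: up_def)
lemma dn_at [simp]: "dn m i i = m i - 1" by (simp add: dn_def)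
lemma dn_up [simp]: "dn (up m i) i = m" by (simp add: up_def dn_def)
lemma up_dn: "m i > 0 ==> up (dn m i) i = m" by (simp add: up_def dn_def)

lemma nhm_split: "nhm m v = nh (m i) (v $ i) * (\<Prod>j\<in>UNIV - {i}. nh (m j) (v $ j))"
 unfolding nhm_def by (rule prod.remove) auto

lemma nhm_update: "nhm (a(i := m)) v = nh m (v $ i) * (\<Prod>j\<in>UNIV - {i}. nh (a j) (v $ j))"
 by (subst nhm_split[of _ _ i]) (simp cong: prod.cong_simp)

lemma nhm_rec: "v $ i * nhm m v = sqrt (real (Suc (m i))) * nhm (up m i) v + sqrt (real (m i)) * nhm (dn m i) v"
proof -
 let ?P = "\<Prod>j\<in>UNIV - {i}. nh (m j) (v $ j)"
 have "v $ i * nhm m v = (v $ i * nh (m i) (v $ i)) * ?P" by (simp add: nhm_split[of m v i])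
 also have "\<dots> = sqrt (real (Suc (m i))) * (nh (Suc (m i)) (v $ i) * ?P) + sqrt (real (m i)) * (nh (m i - 1) (v $ i) * ?P)"
  unfolding nh_rec by (simp only: distrib_right mult.assoc)
 finally show ?thesis by (simp only: up_def dn_def nhm_update)
qed

lemma has_dd_nhm: "has_dd (nhm m) (axis i 1) (%v. sqrt (real (m i)) * nhm (dn m i) v)"
 unfolding has_dd_def
proof
 fix v :: "real^'a"
 let ?P = "\<Prod>j\<in>UNIV - {i}. nh (m j) (v $ j)"
 have eq: "nhm m (v + s *\<^sub>R axis i 1) = nh (m i) (s + v $ i) * ?P" for s
 proof -
  have "(\<Prod>j\<in>UNIV - {i}. nh (m j) ((v + s *\<^sub>R axis i 1) $ j)) = ?P"
   by (intro prod.cong) (auto simp: axis_def)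
  then show ?thesis by (subst nhm_split[of _ _ i]) (simp add: axis_def add.commute)
 qed
 have "((%s. nh (m i) (s + v $ i)) has_real_derivative sqrt (real (m i)) * nh (m i - 1) (v $ i)) (at 0)"
  using DERIV_shift[of "nh (m i)" "sqrt (real (m i)) * nh (m i - 1) (v $ i)" 0 "v $ i"] nh_deriv[of "m i" "v $ i"] by simp
 then have "((%s. nh (m i) (s + v $ i) * ?P) has_real_derivative (sqrt (real (m i)) * nh (m i - 1) (v $ i)) * ?P) (at 0)"
  by (rule DERIV_cmult_right)
 then show "((%s. nhm m (v + s *\<^sub>R axis i 1)) has_real_derivative sqrt (real (m i)) * nhm (dn m i) v) (at 0)"
  by (simp add: eq dn_def nhm_update mult.assoc)
qed

lemma continuous_nhm: "continuous_on A (nhm m)"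
 unfolding nhm_def by (intro continuous_intros)

lemma exp_bounded_nhm: "exp_bounded (nhm m)"
proof -
 have "exp_bounded (%v::real^'a. nh n (v $ i))" for n i
 proof (induction n "0::real" rule: nh.induct)
  case 1 then show ?case by (simp add: exp_bounded_const)
 next
  case 2 then show ?case by (simp add: exp_bounded_component)
 next
  case (3 n)
  have "nh (Suc (Suc n)) (v $ i) = (1 / sqrt (real (Suc (Suc n)))) * (v $ i * nh (Suc n) (v $ i) + (- sqrt (real (Suc n))) * nh n (v $ i))" for v :: "real^'a"
   by simp
  then show ?case
   by (simp only:) (intro exp_bounded_mult exp_bounded_add exp_bounded_const exp_bounded_component 3)
 qed
 then show ?thesis unfolding nhm_def by (intro exp_bounded_prod)
qed

lemma borel_measurable_nhm: "nhm m \<in> borel_measurable borel"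
 by (intro borel_measurable_continuous_onI continuous_nhm)

lemma nhm_L2: "nhm m \<in> L2 gauss"
 by (intro exp_bounded_L2 borel_measurable_nhm exp_bounded_nhm)

text \<open>Gaussian integration by parts of \<open>nhm m * nhm \<beta>\<close>; the recursion for
  \<open>v $ i * nhm m\<close> produces the lowering term of m on both sides, and it cancels. So
  raising is the adjoint of lowering.\<close>

lemma nhm_ladder:
 "sqrt (real (\<beta> i)) * ip gauss (nhm m) (nhm (dn \<beta> i)) = sqrt (real (Suc (m i))) * ip gauss (nhm (up m i)) (nhm \<beta>)"
proof -
 have I: "integrable gauss (%v. nhm m v * nhm \<beta> v)" for m \<beta> :: "'a => nat"
  by (intro L2_integrable_mult nhm_L2)
 have "(LINT v|gauss. sqrt (real (m i)) * nhm (dn m i) v * nhm \<beta> v + nhm m v * (sqrt (real (\<beta> i)) * nhm (dn \<beta> i) v))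
   = (LINT v|gauss. v $ i * (nhm m v * nhm \<beta> v))"
  by (intro gauss_by_parts has_dd_mult has_dd_nhm continuous_intros continuous_nhm
    exp_bounded_mult exp_bounded_add exp_bounded_const exp_bounded_nhm)
 also have "(%v. v $ i * (nhm m v * nhm \<beta> v)) = (%v. sqrt (real (Suc (m i))) * (nhm (up m i) v * nhm \<beta> v) + sqrt (real (m i)) * (nhm (dn m i) v * nhm \<beta> v))"
  by (simp only: mult.assoc[symmetric] nhm_rec distrib_right)
 also have "(%v. sqrt (real (m i)) * nhm (dn m i) v * nhm \<beta> v + nhm m v * (sqrt (real (\<beta> i)) * nhm (dn \<beta> i) v)) =
  (%v. sqrt (real (m i)) * (nhm (dn m i) v * nhm \<beta> v) + sqrt (real (\<beta> i)) * (nhm m v * nhm (dn \<beta> i) v))"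
  by (simp add: mult_ac)
 finally show ?thesis using I by (simp add: ip_def)
qed

lemma nhm_ladder':
 assumes "\<beta> i > 0"
 shows "sqrt (real (\<beta> i)) * ip gauss (nhm m) (nhm \<beta>) = sqrt (real (m i)) * ip gauss (nhm (dn m i)) (nhm (dn \<beta> i))"
 using nhm_ladder[of m i "dn \<beta> i"] assms by (simp add: up_dn ip_commute)

text \<open>Induction on the total degree of \<beta>. Choosing i with \<open>\<beta> i > 0\<close>,
  the ladder relation lowers both indices, or gives 0 when \<open>a i = 0\<close>.\<close>

lemma nhm_orthonormal: "ip gauss (nhm a) (nhm \<beta>) = (if a = \<beta> then 1 else 0)"
proof (induction "sum \<beta> UNIV" arbitrary: a \<beta>)
 case 0
 then have b: "\<beta> = (%_. 0)" by (auto simp: fun_eq_iff)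
 show ?case
 proof (cases "a = (%_. 0)")
  case True
  then show ?thesis using gauss.prob_space by (simp add: b ip_def nhm_def)
 next
  case False
  then obtain i where "a i > 0" by (auto simp: fun_eq_iff)
  then have "ip gauss (nhm \<beta>) (nhm a) = 0" using nhm_ladder'[of a i \<beta>] by (simp add: b)
  then show ?thesis using False b by (simp add: ip_commute)
 qed
next
 case (Suc m)
 have "\<exists>i. \<beta> i > 0"
 proof (rule ccontr)
  assume "\<not> (\<exists>i. \<beta> i > 0)"
  then have "sum \<beta> UNIV = 0" by (intro sum.neutral) auto
  then show False using Suc.hyps(2) by linarith
 qed
 then obtain i where i: "\<beta> i > 0" by (rule exE)
 have "Suc (sum (dn \<beta> i) UNIV) = sum \<beta> UNIV"
  using i by (simp add: sum.remove[of UNIV i \<beta>] sum.remove[of UNIV i "dn \<beta> i"]) (simp add: dn_def)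
 then have IH: "ip gauss (nhm (dn a i)) (nhm (dn \<beta> i)) = (if dn a i = dn \<beta> i then 1 else 0)"
  using Suc by simp
 show ?case
 proof (cases "a i = 0")
  case True
  then show ?thesis using nhm_ladder'[of \<beta> i a, OF i] i by auto
 next
  case False
  have "dn a i = dn \<beta> i \<longleftrightarrow> a = \<beta>"
   using up_dn[of a i] up_dn[of \<beta> i] False i by (metis not_gr0)
  then show ?thesis using nhm_ladder'[of \<beta> i a, OF i] IH i by auto
 qed
qed

section \<open>Orthonormal systems\<close>

definition closed_span :: "'a measure => ('j => 'a => real) => ('a => real) => bool" where
 "closed_span M e f \<longleftrightarrow> f \<in> L2 M \<and> (\<forall>\<epsilon>>0. \<exists>J c. finite J \<and> L2_norm M (%z. f z - (\<Sum>j\<in>J. c j * e j z)) < \<epsilon>)"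

locale orthonormal_system =
 fixes M :: "'a measure" and e :: "'j => 'a => real"
 assumes e_L2: "e j \<in> L2 M"
  and e_orth: "ip M (e j) (e l) = (if j = l then 1 else 0)"
begin

definition proj :: "'j set => ('a => real) => 'a => real" where
 "proj J f = (%z. \<Sum>j\<in>J. ip M f (e j) * e j z)"

lemma comb_L2: "(%z. \<Sum>j\<in>J. c j * e j z) \<in> L2 M"
 by (intro L2_sum L2_scale e_L2)

lemma proj_L2: "proj J f \<in> L2 M"
 unfolding proj_def by (rule comb_L2)

lemma ip_comb_left: "f \<in> L2 M ==> ip M f (%z. \<Sum>j\<in>J. c j * e j z) = (\<Sum>j\<in>J. c j * ip M f (e j))"
 by (subst ip_sum_right) (simp_all add: ip_scale_right L2_scale e_L2)

lemma ip_comb_e: "finite J ==> ip M (%z. \<Sum>j\<in>J. c j * e j z) (e l) = (if l \<in> J then c l else 0)"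
 by (subst ip_sum_left)
  (simp_all add: ip_scale_left L2_scale e_L2 e_orth if_distrib[of "%x. _ * x"] cong: if_cong)

lemma ip_comb_comb:
 assumes "finite J"
 shows "ip M (%z. \<Sum>j\<in>J. c j * e j z) (%z. \<Sum>j\<in>J. d j * e j z) = (\<Sum>j\<in>J. c j * d j)"
 using assms by (subst ip_comb_left[OF comb_L2]) (simp add: ip_comb_e mult.commute)

lemma norm_proj: "finite J ==> (L2_norm M (proj J f))\<^sup>2 = (\<Sum>j\<in>J. (ip M f (e j))^2)"
 unfolding L2_norm_ip proj_def by (simp add: ip_comb_comb power2_eq_square)

text \<open>Completing the square in the coefficients. Bessel's inequality and the best
  approximation property of \<open>proj\<close> can both be read off from it.\<close>

lemma norm_diff_comb:
 assumes "finite J" "f \<in> L2 M"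
 shows "(L2_norm M (%z. f z - (\<Sum>j\<in>J. c j * e j z)))^2 =
  (L2_norm M f)\<^sup>2 - (\<Sum>j\<in>J. (ip M f (e j))^2) + (\<Sum>j\<in>J. (ip M f (e j) - c j)^2)"
proof -
 have "(L2_norm M (%z. f z - (\<Sum>j\<in>J. c j * e j z)))^2 =
  (L2_norm M f)\<^sup>2 - 2 * (\<Sum>j\<in>J. c j * ip M f (e j)) + (\<Sum>j\<in>J. c j * c j)"
  unfolding L2_norm_ip
  using assms comb_L2[where J=J and c=c]
  by (simp add: ip_diff_left ip_diff_right L2_diff ip_comb_left ip_comb_e
    ip_commute[of M "%z. \<Sum>j\<in>J. c j * e j z" f] cong: sum.cong)
 also have "\<dots> = (L2_norm M f)^2 - (\<Sum>j\<in>J. (ip M f (e j))^2) + (\<Sum>j\<in>J. (ip M f (e j) - c j)^2)"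
  by (simp add: power2_eq_square algebra_simps sum.distrib sum_subtractf sum_distrib_left)
 finally show ?thesis .
qed

lemma norm_diff_proj:
 assumes "finite J" "f \<in> L2 M"
 shows "(L2_norm M (f -. proj J f))^2 = (L2_norm M f)^2 - (\<Sum>j\<in>J. (ip M f (e j))^2)"
 using norm_diff_comb[OF assms, of "%j. ip M f (e j)"] by (simp add: proj_def)

lemma Bessel:
 assumes "finite J" "f \<in> L2 M"
 shows "(\<Sum>j\<in>J. (ip M f (e j))^2) <= (L2_norm M f)^2"
proof -
 have "0 <= (L2_norm M (f -. proj J f))^2" by simp
 then show ?thesis unfolding norm_diff_proj[OF assms] by simp
qed

lemma norm_proj_le: "finite J ==> f \<in> L2 M ==> L2_norm M (proj J f) <= L2_norm M f"
 by (rule power2_le_imp_le) (simp_all add: norm_proj Bessel)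

text \<open>Once \<open>J n\<close> contains the indices of a good approximating combination, the
  projection onto \<open>J n\<close> is at least as good as that combination.\<close>

lemma proj_tendsto:
 assumes f: "closed_span M e f" and fin: "!!n. finite (J n)" and ex: "!!j. \<forall>\<^sub>F n in sequentially. j \<in> J n"
 shows "(%n. L2_norm M (proj (J n) f -. f)) \<leadsto> 0"
proof (rule LIMSEQ_I)
 fix \<epsilon> :: real assume "\<epsilon> > 0"
 have fL: "f \<in> L2 M" using f by (simp add: closed_span_def)
 obtain I c where I: "finite I" "L2_norm M (%z. f z - (\<Sum>j\<in>I. c j * e j z)) < \<epsilon>"
  using f \<open>\<epsilon> > 0\<close> by (auto simp: closed_span_def)
 have "\<forall>\<^sub>F n in sequentially. \<forall>j\<in>I. j \<in> J n"
  using I(1) ex by (simp add: eventually_ball_finite)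
 then obtain N where N: "!!n. n \<ge> N ==> I \<subseteq> J n" by (auto simp: eventually_sequentially subset_eq)
 have "L2_norm M (proj (J n) f -. f) < \<epsilon>" if "n \<ge> N" for n
 proof -
  have "(\<Sum>j\<in>I. (ip M f (e j))^2) <= (\<Sum>j\<in>J n. (ip M f (e j))^2)"
   using N[OF that] fin by (intro sum_mono2) auto
  moreover have "0 <= (\<Sum>j\<in>I. (ip M f (e j) - c j)^2)" by (intro sum_nonneg) auto
  ultimately have "(L2_norm M (f -. proj (J n) f))^2 <= (L2_norm M (%z. f z - (\<Sum>j\<in>I. c j * e j z)))^2"
   unfolding norm_diff_proj[OF fin fL] norm_diff_comb[OF I(1) fL] by linarith
  then have "L2_norm M (f -. proj (J n) f) <= L2_norm M (%z. f z - (\<Sum>j\<in>I. c j * e j z))"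
   by (rule power2_le_imp_le) simp
  then show ?thesis using I(2) by (simp add: L2_norm_minus_commute)
 qed
 then show "\<exists>no. \<forall>n\<ge>no. norm (L2_norm M (proj (J n) f -. f) - 0) < \<epsilon>" by auto
qed

lemma norm_proj_tendsto:
 assumes f: "closed_span M e f" and fin: "!!n. finite (J n)" and ex: "!!j. \<forall>\<^sub>F n in sequentially. j \<in> J n"
 shows "(%n. \<Sum>j\<in>J n. (ip M f (e j))^2) \<leadsto> (L2_norm M f)\<^sup>2"
proof -
 have "(%n. L2_norm M (proj (J n) f)) \<leadsto> L2_norm M f"
  using proj_tendsto[OF assms] f by (intro L2_norm_tendsto proj_L2) (auto simp: closed_span_def)
 from tendsto_power[OF this, of 2] show ?thesis by (simp add: norm_proj fin)
qed

lemma closed_span_orth_eq_0: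
 assumes f: "closed_span M e f" and o: "!!j. ip M f (e j) = 0"
 shows "AE z in M. f z = 0"
proof -
 have fL: "f \<in> L2 M" using f by (simp add: closed_span_def)
 have "L2_norm M f < \<epsilon>" if "\<epsilon> > 0" for \<epsilon>
 proof -
  have "\<exists>I c. finite I \<and> L2_norm M (%z. f z - (\<Sum>j\<in>I. c j * e j z)) < \<epsilon>"
   using f that by (simp add: closed_span_def)
  then obtain I c where I: "finite I" "L2_norm M (%z. f z - (\<Sum>j\<in>I. c j * e j z)) < \<epsilon>"
   by auto
  have "(L2_norm M f)^2 <= (L2_norm M (%z. f z - (\<Sum>j\<in>I. c j * e j z)))^2"
   unfolding norm_diff_comb[OF I(1) fL] by (simp add: o sum_nonneg)
  then show ?thesis using I(2) by (meson L2_norm_nonneg le_less_trans power2_le_imp_le)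
 qed
 then have "L2_norm M f = 0" using L2_norm_nonneg[of M f] by (meson less_irrefl not_le order.order_iff_strict)
 then show ?thesis using L2_norm_eq_0_iff[OF fL] by simp
qed

end

section \<open>The basis of cas times Hermite functions\<close>

type_synonym 'n idx = "('n => int) \<times> ('n => nat)"

definition ebas :: "'n::finite idx => 'n phase => real" where
 "ebas j z = cas (fst j) (fst z) * nhm (snd j) (snd z)"

lemma continuous_ebas: "continuous_on A (ebas j)"
 unfolding ebas_def
 by (intro continuous_intros continuous_on_compose2[OF continuous_cas[of UNIV]]
   continuous_on_compose2[OF continuous_nhm[of UNIV]]) auto

lemma exp_bounded_abs: "exp_bounded f ==> exp_bounded (%v. abs (f v))"
 by (simp add: exp_bounded_def)

lemma ebas_bound: "abs (ebas j (x, v)) <= 2 * abs (nhm (snd j) v)"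
 using cas_bound[of "fst j" x] by (simp add: ebas_def abs_mult mult_right_mono)

lemma exp_bounded_ebas_bound: "exp_bounded (%v. 2 * abs (nhm m v))"
 by (intro exp_bounded_mult exp_bounded_const exp_bounded_abs exp_bounded_nhm)

lemma ebas_L2: "ebas j \<in> L2 mu"
 by (rule exp_bounded_L2_mu[OF borel_measurable_mu_continuous[OF continuous_ebas] exp_bounded_ebas_bound[of "snd j"]])
  (simp add: ebas_bound)

lemma ebas_orthonormal: "ip mu (ebas j) (ebas l) = (if j = l then 1 else 0)"
proof -
 have "ip mu (ebas j) (ebas l) = (LINT z|mu. ebas j z * ebas l z)" by (simp add: ip_def)
 also have "\<dots> = (LINT x|torus. LINT v|gauss. ebas j (x, v) * ebas l (x, v))"
  by (intro mu_Fubini(1)[symmetric] L2_integrable_mult ebas_L2)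
 also have "\<dots> = (LINT x|torus. LINT v|gauss. (cas (fst j) x * cas (fst l) x) * (nhm (snd j) v * nhm (snd l) v))"
  by (simp add: ebas_def mult_ac)
 also have "\<dots> = (LINT x|torus. (cas (fst j) x * cas (fst l) x) * ip gauss (nhm (snd j)) (nhm (snd l)))"
  by (simp add: ip_def)
 also have "\<dots> = (LINT x|torus. (cas (fst j) x * cas (fst l) x)) * ip gauss (nhm (snd j)) (nhm (snd l))"
  by (rule integral_mult_left_zero)
 also have "\<dots> = (if j = l then 1 else 0)"
  by (simp add: cas_orthonormal nhm_orthonormal prod_eq_iff)
 finally show ?thesis .
qed

interpretation eb: orthonormal_system "mu :: 'n::finite phase measure" ebas
 by unfold_locales (rule ebas_L2, rule ebas_orthonormal)

declare space_mu [simp del]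

section \<open>Closed linear spans\<close>

definition fin_span :: "('j => 'a => real) => ('a => real) => bool" where
 "fin_span e f \<longleftrightarrow> (\<exists>J c. finite J \<and> f = (%z. \<Sum>j\<in>J. c j * e j z))"

lemma fin_span_base: "fin_span e (e j)"
 unfolding fin_span_def by (intro exI[of _ "{j}"] exI[of _ "%_. 1"]) simp

lemma fin_span_comb:
 assumes "fin_span e f" "fin_span e g"
 shows "fin_span e (%z. a * f z + b * g z)"
proof -
 obtain J c where J: "finite J" "f = (%z. \<Sum>j\<in>J. c j * e j z)" using assms(1) by (auto simp: fin_span_def)
 obtain K d where K: "finite K" "g = (%z. \<Sum>j\<in>K. d j * e j z)" using assms(2) by (auto simp: fin_span_def)
 have f: "f z = (\<Sum>j\<in>J \<union> K. (if j \<in> J then c j else 0) * e j z)" for z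
  unfolding J(2) using J(1) K(1) by (intro sum.mono_neutral_cong_left) auto
 have g: "g z = (\<Sum>j\<in>J \<union> K. (if j \<in> K then d j else 0) * e j z)" for z
  unfolding K(2) using J(1) K(1) by (intro sum.mono_neutral_cong_left) auto
 have "(%z. a * f z + b * g z) = (%z. \<Sum>j\<in>J \<union> K. (a * (if j \<in> J then c j else 0) + b * (if j \<in> K then d j else 0)) * e j z)"
  unfolding f g by (simp only: sum_distrib_left sum.distrib distrib_right mult.assoc)
 then show ?thesis unfolding fin_span_def using J(1) K(1)
  by (intro exI[of _ "J \<union> K"] exI[of _ "%j. a * (if j \<in> J then c j else 0) + b * (if j \<in> K then d j else 0)"]) auto
qed

lemma fin_span_zero: "fin_span e (%_. 0)"
 unfolding fin_span_def by (intro exI[of _ "{}"]) simp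

lemma fin_span_scale: "fin_span e f ==> fin_span e (%z. a * f z)"
 using fin_span_comb[of e f f a 0] by simp

lemma fin_span_add: "fin_span e f ==> fin_span e g ==> fin_span e (%z. f z + g z)"
 using fin_span_comb[of e f g 1 1] by simp

lemma fin_span_sum: "(!!i. i \<in> I ==> fin_span e (f i)) ==> fin_span e (%z. \<Sum>i\<in>I. f i z)"
 by (induction I rule: infinite_finite_induct) (simp_all add: fin_span_zero fin_span_add)

lemma fin_span_L2: "(!!j. e j \<in> L2 M) ==> fin_span e f ==> f \<in> L2 M"
 by (auto simp: fin_span_def intro!: L2_sum L2_scale)

lemma closed_span_iff:
 "closed_span M e f \<longleftrightarrow> f \<in> L2 M \<and> (\<forall>\<epsilon>>0. \<exists>g. fin_span e g \<and> L2_norm M (f -. g) < \<epsilon>)"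
proof -
 have "(\<exists>J c. finite J \<and> L2_norm M (%z. f z - (\<Sum>j\<in>J. c j * e j z)) < \<epsilon>) \<longleftrightarrow>
   (\<exists>g. fin_span e g \<and> L2_norm M (f -. g) < \<epsilon>)" for \<epsilon>
  unfolding fin_span_def by auto
 then show ?thesis unfolding closed_span_def by simp
qed

lemma closed_span_approx:
 "closed_span M e f ==> \<epsilon> > 0 ==> \<exists>g. fin_span e g \<and> L2_norm M (f -. g) < \<epsilon>"
 by (simp add: closed_span_iff)

lemma closed_span_L2: "closed_span M e f ==> f \<in> L2 M"
 by (simp add: closed_span_def)

lemma closed_span_fin_span:
 assumes "!!j. e j \<in> L2 M" "fin_span e f"
 shows "closed_span M e f"
 unfolding closed_span_iff
proof (intro conjI allI impI)
 show "f \<in> L2 M" by (rule fin_span_L2[OF assms])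
 show "\<exists>g. fin_span e g \<and> L2_norm M (f -. g) < \<epsilon>" if "\<epsilon> > 0" for \<epsilon>
  using that assms(2) by (intro exI[of _ f]) simp
qed

lemma closed_span_limit:
 assumes e: "!!j. e j \<in> L2 M" and F: "!!n. closed_span M e (F n)" and f: "f \<in> L2 M"
  and lim: "(%n. L2_norm M (F n -. f)) \<leadsto> 0"
 shows "closed_span M e f"
 unfolding closed_span_iff
proof (intro conjI allI impI f)
 fix \<epsilon> :: real assume "\<epsilon> > 0"
 then have "\<forall>\<^sub>F n in sequentially. L2_norm M (F n -. f) < \<epsilon> / 2"
  using lim by (intro order_tendstoD(2)) auto
 then obtain n where n: "L2_norm M (F n -. f) < \<epsilon> / 2" by (auto simp: eventually_sequentially)
 have "\<exists>g. fin_span e g \<and> L2_norm M (F n -. g) < \<epsilon> / 2"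
  using \<open>\<epsilon> > 0\<close> by (intro closed_span_approx F) simp
 then obtain g where g: "fin_span e g" "L2_norm M (F n -. g) < \<epsilon> / 2" by auto
 have "L2_norm M (f -. g) <= L2_norm M (f -. F n) + L2_norm M (F n -. g)"
  by (intro L2_norm_triangle_diff f closed_span_L2[OF F] fin_span_L2[OF e g(1)])
 then have "L2_norm M (f -. g) < \<epsilon>"
  using n g(2) L2_norm_minus_commute[of M f "F n"] by linarith
 with g(1) show "\<exists>g. fin_span e g \<and> L2_norm M (f -. g) < \<epsilon>" by blast
qed

lemma closed_span_comb:
 assumes e: "!!j. e j \<in> L2 M" and f: "closed_span M e f" and g: "closed_span M e g"
 shows "closed_span M e (%z. a * f z + b * g z)"
 unfolding closed_span_iff
proof (intro conjI allI impI)
 show "(%z. a * f z + b * g z) \<in> L2 M" by (intro L2_comb closed_span_L2[OF f] closed_span_L2[OF g])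
 fix \<epsilon> :: real assume \<epsilon>: "\<epsilon> > 0"
 \<comment> \<open>The summand 1 keeps the denominator positive when a = b = 0 and makes the final
   estimate strict.\<close>
 define \<delta> where "\<delta> = \<epsilon> / (abs a + abs b + 1)"
 have d: "\<delta> > 0" using \<epsilon> by (simp add: \<delta>_def)
 have "\<exists>h. fin_span e h \<and> L2_norm M (f -. h) < \<delta>" by (rule closed_span_approx[OF f d])
 then obtain h where h: "fin_span e h" "L2_norm M (f -. h) < \<delta>" by auto
 have "\<exists>k. fin_span e k \<and> L2_norm M (g -. k) < \<delta>" by (rule closed_span_approx[OF g d])
 then obtain k where k: "fin_span e k" "L2_norm M (g -. k) < \<delta>" by auto
 have L: "(f -. h) \<in> L2 M" "(g -. k) \<in> L2 M"
  using closed_span_L2[OF f] closed_span_L2[OF g] fin_span_L2[OF e h(1)] fin_span_L2[OF e k(1)]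
  by (simp_all add: L2_diff)
 have "L2_norm M (%z. (a * f z + b * g z) - (a * h z + b * k z)) = L2_norm M (%z. a * (f z - h z) + b * (g z - k z))"
  by (simp add: algebra_simps)
 also have "\<dots> <= L2_norm M (%z. a * (f z - h z)) + L2_norm M (%z. b * (g z - k z))"
  by (intro L2_norm_triangle L2_scale L)
 also have "\<dots> = abs a * L2_norm M (f -. h) + abs b * L2_norm M (g -. k)"
  by (simp only: L2_norm_scale)
 also have "\<dots> <= abs a * \<delta> + abs b * \<delta>"
  using h(2) k(2) by (intro add_mono mult_left_mono) auto
 also have "\<dots> < (abs a + abs b + 1) * \<delta>" using d by (simp add: distrib_right)
 also have "\<dots> = \<epsilon>" by (simp add: \<delta>_def add_nonneg_eq_0_iff)
 finally show "\<exists>g'. fin_span e g' \<and> L2_norm M (%z. (a * f z + b * g z) - g' z) < \<epsilon>"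
  using fin_span_comb[OF h(1) k(1), of a b] by blast
qed

section \<open>Density of trigonometric functions\<close>

definition trig :: "('n => int) => real^'n => real => 'n::finite phase => real" where
 "trig k \<beta> \<theta> z = cos (kdot k (fst z) + \<beta> \<bullet> snd z + \<theta>)"

lemma continuous_trig: "continuous_on A (trig k \<beta> \<theta>)"
 unfolding trig_def by (intro continuous_intros)

lemma trig_bound: "abs (trig k \<beta> \<theta> z) <= 1"
 by (simp add: trig_def)

lemma mu_L2_bounded:
 fixes f :: "'n::finite phase => 'b::euclidean_space"
 assumes "f \<in> borel_measurable mu" "!!z. z \<in> space mu ==> norm (f z) <= B"
 shows "f \<in> L2 mu"
proof (rule L2_dominated[OF assms(1)])
 show "integrable mu (%_. B\<^sup>2)" by simp
 show "AE z in mu. (norm (f z))^2 <= B\<^sup>2"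
  using assms(2) by (intro AE_I2 power_mono) auto
qed

lemma trig_L2: "trig k \<beta> \<theta> \<in> L2 mu"
 by (rule mu_L2_bounded[of _ 1]) (simp_all add: borel_measurable_mu_continuous continuous_trig trig_bound)

text \<open>The closure of the span of the trigonometric functions under bounded pointwise limits is an
 algebra; the sets whose indicator functions belong to it form a \<open>\<sigma>\<close>-algebra.\<close>

inductive trig_gen :: "('n::finite phase => real) => bool" where
 base: "trig_gen (trig k \<beta> \<theta>)"
| comb: "trig_gen f ==> trig_gen g ==> trig_gen (%z. a * f z + b * g z)"
| limit: "(!!n::nat. trig_gen (F n)) ==> (!!n z. z \<in> space mu ==> abs (F n z) <= B) ==>
  (!!z. z \<in> space mu ==> (%n. F n z) \<leadsto> g z) ==> trig_gen g"

lemma trig_gen_bounded: "trig_gen f ==> \<exists>B. \<forall>z\<in>space mu. abs (f z) <= B"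
proof (induction rule: trig_gen.induct)
 case base
 then show ?case using trig_bound by blast
next
 case (comb f g a b)
 then obtain B C where B: "!!z. z \<in> space mu ==> abs (f z) <= B" "!!z. z \<in> space mu ==> abs (g z) <= C" by auto
 have "abs (a * f z + b * g z) <= abs a * B + abs b * C" if "z \<in> space mu" for z
 proof -
  have "abs (a * f z + b * g z) <= abs a * abs (f z) + abs b * abs (g z)"
   using abs_triangle_ineq[of "a * f z" "b * g z"] by (simp add: abs_mult)
  also have "\<dots> <= abs a * B + abs b * C" using B[OF that] by (intro add_mono mult_left_mono) auto
  finally show ?thesis .
 qed
 then show ?case by blast
next
 case (limit F B g)
 have "abs (g z) <= B" if "z \<in> space mu" for z
  by (rule LIMSEQ_le_const2[OF tendsto_rabs[OF limit.hyps(3)[OF that]]]) (use limit.hyps(2) that in auto)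
 then show ?case by blast
qed

lemma trig_gen_measurable: "trig_gen f ==> f \<in> borel_measurable mu"
proof (induction rule: trig_gen.induct)
 case base
 then show ?case by (intro borel_measurable_mu_continuous continuous_trig)
next
 case (limit F B g)
 show ?case by (rule borel_measurable_LIMSEQ_metric[OF limit.IH limit.hyps(3)])
next
 case (comb f g a b)
 then show ?case by (auto intro!: borel_measurable_add borel_measurable_times)
qed

lemma trig_gen_L2: "trig_gen f ==> f \<in> L2 mu"
proof -
 assume f: "trig_gen f"
 obtain B where B: "!!z. z \<in> space mu ==> abs (f z) <= B" using trig_gen_bounded[OF f] by auto
 then show "f \<in> L2 mu" by (intro mu_L2_bounded[of f B] trig_gen_measurable f) simp
qed

lemma trig_gen_const: "trig_gen (%_. c)"
proof -
 have "trig_gen (%z. c * trig (%_. 0) 0 0 z + 0 * trig (%_. 0) 0 0 z)"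
  by (intro trig_gen.comb trig_gen.base)
 then show ?thesis by (simp add: trig_def kdot_def)
qed

lemma trig_gen_scale: "trig_gen f ==> trig_gen (%z. c * f z)"
 using trig_gen.comb[of f f c 0] by simp

lemma trig_gen_add: "trig_gen f ==> trig_gen g ==> trig_gen (%z. f z + g z)"
 using trig_gen.comb[of f g 1 1] by simp

lemma trig_gen_diff: "trig_gen f ==> trig_gen g ==> trig_gen (f -. g)"
 using trig_gen.comb[of f g 1 "-1"] by simp

text \<open>A constant sequence is a bounded sequence converging pointwise on
  \<open>space mu\<close>, so the limit rule lets values outside \<open>space mu\<close> be changed
  freely.\<close>

lemma trig_gen_cong: "trig_gen f ==> (!!z. z \<in> space mu ==> f z = g z) ==> trig_gen g"
proof -
 assume f: "trig_gen f" and eq: "!!z. z \<in> space mu ==> f z = g z"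
 obtain B where B: "!!z. z \<in> space mu ==> abs (f z) <= B" using trig_gen_bounded[OF f] by auto
 show "trig_gen g"
  by (rule trig_gen.limit[of "%_. f" B]) (use f B eq in auto)
qed

lemma trig_mult:
 "trig k \<beta> \<theta> z * trig l \<gamma> \<eta> z =
  (1/2) * trig (k -. l) (\<beta> - \<gamma>) (\<theta> - \<eta>) z + (1/2) * trig (%i. k i + l i) (\<beta> + \<gamma>) (\<theta> + \<eta>) z"
proof -
 let ?a = "kdot k (fst z) + \<beta> \<bullet> snd z + \<theta>" and ?b = "kdot l (fst z) + \<gamma> \<bullet> snd z + \<eta>"
 have 1: "kdot (k -. l) (fst z) + (\<beta> - \<gamma>) \<bullet> snd z + (\<theta> - \<eta>) = ?a - ?b"
  by (simp add: kdot_minus inner_diff_left)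
 have 2: "kdot (%i. k i + l i) (fst z) + (\<beta> + \<gamma>) \<bullet> snd z + (\<theta> + \<eta>) = ?a + ?b"
  by (simp add: kdot_plus inner_add_left)
 show ?thesis unfolding trig_def 1 2 cos_times_cos by simp
qed

lemma trig_gen_mult_trig: "trig_gen f ==> trig_gen (%z. f z * trig l \<gamma> \<eta> z)"
proof (induction rule: trig_gen.induct)
 case base
 show ?case unfolding trig_mult by (intro trig_gen.comb trig_gen.base)
next
 case (comb f g a b)
 have "(%z. (a * f z + b * g z) * trig l \<gamma> \<eta> z) = (%z. a * (f z * trig l \<gamma> \<eta> z) + b * (g z * trig l \<gamma> \<eta> z))"
  by (simp add: algebra_simps)
 then show ?case using trig_gen.comb[OF comb.IH] by simp
next
 case (limit F B g)
 show ?case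
 proof (rule trig_gen.limit[OF limit.IH])
  show "abs (F n z * trig l \<gamma> \<eta> z) <= B" if "z \<in> space mu" for n z
  proof -
   have "abs (F n z) * abs (trig l \<gamma> \<eta> z) <= abs (F n z)" using trig_bound by (rule mult_left_le) simp
   then show ?thesis using limit.hyps(2)[OF that, of n] by (simp add: abs_mult)
  qed
  show "(%n. F n z * trig l \<gamma> \<eta> z) \<leadsto> g z * trig l \<gamma> \<eta> z" if "z \<in> space mu" for z
   by (intro tendsto_mult limit.hyps(3)[OF that] tendsto_const)
 qed
qed

text \<open>Induction on the second factor; its base case is the preceding induction on the first
  factor against a single trigonometric function.\<close>

lemma trig_gen_mult:
 assumes f: "trig_gen f" and g: "trig_gen g"
 shows "trig_gen (%z. f z * g z)"
 using g
proof (induction rule: trig_gen.induct)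
 case base
 show ?case by (rule trig_gen_mult_trig[OF f])
next
 case (comb g h a b)
 have "(%z. f z * (a * g z + b * h z)) = (%z. a * (f z * g z) + b * (f z * h z))"
  by (simp add: algebra_simps)
 then show ?case using trig_gen.comb[OF comb.IH] by simp
next
 case (limit F B g)
 obtain C where C: "!!z. z \<in> space mu ==> abs (f z) <= C" using trig_gen_bounded[OF f] by auto
 show ?case
 proof (rule trig_gen.limit[OF limit.IH])
  show "abs (f z * F n z) <= C * B" if "z \<in> space mu" for n z
   unfolding abs_mult using C[OF that] limit.hyps(2)[OF that, of n] by (intro mult_mono) auto
  show "(%n. f z * F n z) \<leadsto> f z * g z" if "z \<in> space mu" for z
   by (intro tendsto_mult limit.hyps(3)[OF that] tendsto_const)
 qed
qed

lemma trig_gen_polynomial: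
 fixes p :: "real => real"
 assumes "real_polynomial_function p" "trig_gen f"
 shows "trig_gen (%z. p (f z))"
 using assms(1)
proof induction
 case (linear h)
 have "h (f z) = h 1 * f z" for z using real_bounded_linear linear by (metis mult.commute mult_1)
 then show ?case using trig_gen_scale[OF assms(2)] by simp
qed (auto intro: trig_gen_const trig_gen_add trig_gen_mult)

text \<open>The values of f lie in a bounded interval on which q is a uniform limit of polynomials,
  and polynomials of f belong to the algebra.\<close>

lemma trig_gen_continuous:
 fixes q :: "real => real"
 assumes q: "continuous_on UNIV q" and f: "trig_gen f"
 shows "trig_gen (%z. q (f z))"
proof -
 obtain B where B: "!!z. z \<in> space mu ==> abs (f z) <= B" using trig_gen_bounded[OF f] by auto
 have "\<exists>p. real_polynomial_function p \<and> (\<forall>x\<in>{-B..B}. abs (q x - p x) < 1 / real (Suc n))" for n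
  using Stone_Weierstrass_real_polynomial_function[of "{-B..B}" q "1 / real (Suc n)"]
   continuous_on_subset[OF q] by (metis compact_Icc of_nat_0_less_iff subset_UNIV zero_less_Suc zero_less_divide_1_iff)
 then obtain p where p: "!!n. real_polynomial_function (p n)" "!!n x. x \<in> {-B..B} ==> abs (q x - p n x) < 1 / real (Suc n)"
  by metis
 have "compact (q ` {-B..B})" by (intro compact_continuous_image continuous_on_subset[OF q]) auto
 then have "bounded (q ` {-B..B})" by (rule compact_imp_bounded)
 then obtain C where "\<forall>y\<in>q ` {-B..B}. norm y <= C" unfolding bounded_iff by (rule exE)
 then have C: "abs (q x) <= C" if "x \<in> {-B..B}" for x using that by simp
 have fB: "f z \<in> {-B..B}" if "z \<in> space mu" for z using B[OF that] by auto
 show ?thesis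
 proof (rule trig_gen.limit[of "%n z. p n (f z)" "C + 1"])
  show "trig_gen (%z. p n (f z))" for n by (rule trig_gen_polynomial[OF p(1) f])
  fix z :: "'a phase" assume z: "z \<in> space mu"
  \<comment> \<open>The approximation error 1/(n+1) is at most 1.\<close>
  show "abs (p n (f z)) <= C + 1" for n
  proof -
   have "1 / real (Suc n) <= 1" by simp
   then show ?thesis using p(2)[OF fB[OF z], of n] C[OF fB[OF z]] by linarith
  qed
  show "(%n. p n (f z)) \<leadsto> q (f z)"
  proof (rule LIMSEQ_I)
   fix r :: real assume "r > 0"
   then obtain N where N: "1 / real (Suc N) < r" using nat_approx_posE by blast
   have "norm (p n (f z) - q (f z)) < r" if "n \<ge> N" for n
   proof -
    have "1 / real (Suc n) <= 1 / real (Suc N)" using that by (intro divide_left_mono) auto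
    then show ?thesis using p(2)[OF fB[OF z], of n] N by (simp add: abs_minus_commute)
   qed
   then show "\<exists>no. \<forall>n\<ge>no. norm (p n (f z) - q (f z)) < r" by blast
  qed
 qed
qed

section \<open>The sigma-algebra generated by trigonometric functions\<close>

definition trig_sets :: "'n::finite phase set set" where
 "trig_sets = {A. A \<subseteq> space mu \<and> trig_gen (indicator A)}"

text \<open>For countable unions the finite products of the complementary indicators decrease to the
  indicator of the complement of the union. This works without making the sets disjoint
  first.\<close>

lemma sigma_algebra_trig_sets: "sigma_algebra (space mu) (trig_sets :: 'n::finite phase set set)"
 unfolding sigma_algebra_iff2
proof (intro conjI ballI allI impI)
 show "trig_sets \<subseteq> Pow (space (mu :: 'n phase measure))" by (auto simp: trig_sets_def)
 have "trig_gen (indicator {} :: 'n phase => real)" by (rule trig_gen_cong[OF trig_gen_const[of 0]]) simp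
 then show "{} \<in> (trig_sets :: 'n phase set set)" by (simp add: trig_sets_def)
 fix A :: "'n phase set" assume "A \<in> trig_sets"
 then have A: "trig_gen (indicator A)" by (simp add: trig_sets_def)
 have "trig_gen (indicator (space mu - A))"
  by (rule trig_gen_cong[OF trig_gen_diff[OF trig_gen_const[of 1] A]]) (auto simp: indicator_def)
 then show "space mu - A \<in> trig_sets" by (simp add: trig_sets_def)
next
 fix A :: "nat => 'n phase set" assume "range A \<subseteq> trig_sets"
 then have A: "!!i. A i \<subseteq> space mu" "!!i. trig_gen (indicator (A i))" by (auto simp: trig_sets_def)
 have P: "trig_gen (%z. \<Prod>i<n. 1 - indicator (A i) z)" for n :: nat
 proof (induction n)
  case (Suc n)
  have "trig_gen (%z. (\<Prod>i<n. 1 - indicator (A i) z) * (1 - indicator (A n) z))"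
   by (rule trig_gen_mult[OF Suc trig_gen_diff[OF trig_gen_const A(2)]])
  then show ?case by simp
 qed (simp add: trig_gen_const)
 have "trig_gen (indicator (\<Union>i. A i))"
 proof (rule trig_gen.limit[of "%n z. 1 - (\<Prod>i<n. 1 - indicator (A i) z)" 1])
  show "trig_gen (%z. 1 - (\<Prod>i<n. 1 - indicator (A i) z))" for n
   by (intro trig_gen_diff trig_gen_const P)
  fix z :: "'n phase"
  have "0 <= (\<Prod>i<n. 1 - indicat_real (A i) z)" "(\<Prod>i<n. 1 - indicat_real (A i) z) <= 1" for n
   by (auto intro!: prod_nonneg prod_le_1 simp: indicator_def)
  then show "abs (1 - (\<Prod>i<n. 1 - indicat_real (A i) z)) <= 1" for n
   by (simp add: abs_le_iff)
  show "(%n. 1 - (\<Prod>i<n. 1 - indicat_real (A i) z)) \<leadsto> indicator (\<Union>i. A i) z"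
  proof (cases "z \<in> (\<Union>i. A i)")
   case True
   then obtain i where i: "z \<in> A i" by auto
   have "\<forall>\<^sub>F n in sequentially. 1 - (\<Prod>i<n. 1 - indicat_real (A i) z) = indicator (\<Union>i. A i) z"
    using eventually_gt_at_top[of i]
   proof eventually_elim
    case (elim n)
    then have "(\<Prod>i<n. 1 - indicat_real (A i) z) = 0" using i by (intro prod_zero bexI[of _ i]) auto
    then show ?case using True by simp
   qed
   then show ?thesis by (rule tendsto_eventually)
  next
   case False
   then have "(\<Prod>i<n. 1 - indicat_real (A i) z) = 1" for n by simp
   then show ?thesis using False by simp
  qed
 qed
 then show "(\<Union>i. A i) \<in> trig_sets" using A(1) by (auto simp: trig_sets_def)
qed

definition trig_measure :: "'n::finite phase measure" where
 "trig_measure = sigma (space mu) trig_sets"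

lemma space_trig_measure [simp]: "space trig_measure = space mu"
 unfolding trig_measure_def by (rule space_measure_of) (auto simp: trig_sets_def)

lemma sets_trig_measure: "sets trig_measure = trig_sets"
 unfolding trig_measure_def
 using sigma_algebra.sigma_sets_eq[OF sigma_algebra_trig_sets]
 by (subst sets_measure_of) (auto simp: trig_sets_def)

text \<open>The indicator of {f > a} is the limit of the truncations of n (f - a) to [0,1], which
  are continuous functions of f.\<close>

lemma trig_gen_measurable_trig:
 assumes f: "trig_gen f"
 shows "f \<in> borel_measurable trig_measure"
 unfolding borel_measurable_iff_greater
proof
 fix a :: real
 let ?S = "{w \<in> space trig_measure. a < f w}"
 have "trig_gen (indicator ?S)"
 proof (rule trig_gen.limit[of "%n z. min 1 (max 0 (real n * (f z - a)))" 1])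
  show "trig_gen (%z. min 1 (max 0 (real n * (f z - a))))" for n
   by (rule trig_gen_continuous[of "%t. min 1 (max 0 (real n * (t - a)))", OF _ f])
    (intro continuous_intros)
  fix z :: "'a phase" assume z: "z \<in> space mu"
  show "(%n. min 1 (max 0 (real n * (f z - a)))) \<leadsto> indicator ?S z"
  proof (cases "a < f z")
   case True
   obtain N where N: "1 / (f z - a) < real N" using reals_Archimedean2 by blast
   have "\<forall>\<^sub>F n in sequentially. min 1 (max 0 (real n * (f z - a))) = indicator ?S z"
    using eventually_ge_at_top[of N]
   proof eventually_elim
    case (elim n)
    have "1 <= real N * (f z - a)" using N True by (simp add: field_simps)
    also have "\<dots> <= real n * (f z - a)" using elim True by (intro mult_right_mono) auto
    finally show ?case using True z by (simp add: min_def max_def)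
   qed
   then show ?thesis by (rule tendsto_eventually)
  next
   case False
   then have "real n * (f z - a) <= 0" for n by (simp add: mult_nonneg_nonpos)
   then have "min 1 (max 0 (real n * (f z - a))) = indicator ?S z" for n
    using False by (simp add: max_absorb1)
   then show ?thesis by simp
  qed
 qed (auto simp: min_def max_def)
 then show "?S \<in> sets trig_measure" by (simp add: sets_trig_measure trig_sets_def)
qed

text \<open>A velocity coordinate y is unbounded and so does not itself belong to the algebra; it is
  recovered as the limit of n sin(y/n).\<close>

lemma trig_measure_snd: "(%z. snd z) \<in> measurable trig_measure borel"
proof (subst borel_measurable_euclidean_space, intro ballI)
 fix b :: "real^'a" assume "b \<in> Basis"
 show "(%z. snd z \<bullet> b) \<in> borel_measurable trig_measure"
 proof (rule borel_measurable_LIMSEQ_metric)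
  show "(%z. real (Suc n) * trig (%_. 0) ((1 / real (Suc n)) *\<^sub>R b) (- pi / 2) z) \<in> borel_measurable trig_measure" for n
   by (intro trig_gen_measurable_trig trig_gen_scale trig_gen.base)
  fix z :: "'a phase"
  let ?y = "snd z \<bullet> b"
  have eq: "real (Suc n) * trig (%_. 0) ((1 / real (Suc n)) *\<^sub>R b) (- pi / 2) z = (sin (?y * (1 / real (Suc n))) - sin 0) / (1 / real (Suc n))" for n
   by (simp add: trig_def kdot_def cos_diff inner_commute mult.commute)
  have "((%h. sin (?y * h)) has_real_derivative cos (?y * 0) * ?y) (at 0)"
   by (auto intro!: derivative_eq_intros)
  then have "((%h. (sin (?y * (0 + h)) - sin (?y * 0)) / h) \<longlongrightarrow> ?y) (at 0)"
   unfolding DERIV_def by simp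
  moreover have "filterlim (%n. 1 / real (Suc n)) (at 0) sequentially"
   unfolding filterlim_at using LIMSEQ_Suc[OF lim_1_over_n] by auto
  ultimately have "(%n. (sin (?y * (0 + 1 / real (Suc n))) - sin (?y * 0)) / (1 / real (Suc n))) \<leadsto> ?y"
   by (rule filterlim_compose)
  then show "(%n. real (Suc n) * trig (%_. 0) ((1 / real (Suc n)) *\<^sub>R b) (- pi / 2) z) \<leadsto> ?y"
   unfolding eq by simp
 qed
qed

text \<open>An inverse of the parametrisation of the circle, in terms of cosine and sine. Clamping
  to [-1,1] leaves the value unchanged and makes the arccosine a continuous function on the whole
  line.\<close>

lemma circle_coordinate:
 assumes "0 <= x" "x < 1"
 shows "x = (if 0 <= sin (2 * pi * x) then arccos (max (-1) (min 1 (cos (2 * pi * x)))) / (2 * pi)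
  else 1 - arccos (max (-1) (min 1 (cos (2 * pi * x)))) / (2 * pi))"
proof -
 have m: "max (-1) (min 1 (cos (2 * pi * x))) = cos (2 * pi * x)"
  by (simp add: min_absorb2 max_absorb2)
 show ?thesis
 proof (cases "2 * pi * x <= pi")
  case True
  then have "0 <= sin (2 * pi * x)" using assms by (intro sin_ge_zero) auto
  moreover have "arccos (cos (2 * pi * x)) = 2 * pi * x" using True assms by (intro arccos_cos) auto
  ultimately show ?thesis unfolding m by simp
 next
  case False
  have lt: "2 * pi * x < 2 * pi" using assms by simp
  have "sin (2 * pi * x) < 0" using False lt by (intro sin_lt_zero) auto
  moreover have "cos (2 * pi * x) = cos (2 * pi - 2 * pi * x)" by (simp add: cos_diff)
  moreover have "arccos (cos (2 * pi - 2 * pi * x)) = 2 * pi - 2 * pi * x"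
   using False lt by (intro arccos_cos) auto
  ultimately show ?thesis unfolding m by (simp add: field_simps)
 qed
qed

lemma trig_measure_fst: "(%z::'n::finite phase. fst z) \<in> measurable trig_measure torus"
 unfolding torus_eq
proof (rule measurable_restrict_space2)
 show "(%z. fst z) \<in> space trig_measure \<rightarrow> cube" by (auto simp: space_mu)
 have "(%z::'n phase. fst z) \<in> borel_measurable (trig_measure :: 'n phase measure)"
 proof (subst borel_measurable_euclidean_space, intro ballI)
  fix b :: "real^'n" assume "b \<in> Basis"
  then obtain i where b: "b = axis i 1" by (auto simp: Basis_vec_def)
  \<comment> \<open>The i-th unit wave vector, whose phases are 2\<pi> times the i-th
    coordinate.\<close>
  define k where "k = (%j. if j = i then 1 else 0 :: int)"
  have kx: "kdot k x = 2 * pi * x $ i" for x :: "real^'n"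
   by (simp add: kdot_def k_def if_distrib[of "%a. a * _"] if_distrib[of of_int] cong: if_cong)
  define C where "C = (trig k 0 0 :: 'n phase => real)"
  define S where "S = (trig k 0 (- pi / 2) :: 'n phase => real)"
  have CS: "C z = cos (2 * pi * fst z $ i)" "S z = sin (2 * pi * fst z $ i)" for z
   by (simp_all add: C_def S_def trig_def kx cos_diff)
  have Cm [measurable]: "C \<in> borel_measurable trig_measure" and [measurable]: "S \<in> borel_measurable trig_measure"
   unfolding C_def S_def by (intro trig_gen_measurable_trig trig_gen.base)+
  have "continuous_on UNIV (%y::real. arccos (max (-1) (min 1 y)))"
   by (rule continuous_on_compose2[OF continuous_on_arccos']) (auto intro!: continuous_intros)
  then have am: "(%y::real. arccos (max (-1) (min 1 y))) \<in> borel_measurable borel"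
   by (rule borel_measurable_continuous_onI)
  have [measurable]: "(%z. arccos (max (-1) (min 1 (C z)))) \<in> borel_measurable trig_measure"
   by (rule measurable_compose[OF Cm am])
  have "(%z. if 0 <= S z then arccos (max (-1) (min 1 (C z))) / (2 * pi) else 1 - arccos (max (-1) (min 1 (C z))) / (2 * pi)) \<in> borel_measurable trig_measure"
   by measurable
  moreover have "fst z \<bullet> b = (if 0 <= S z then arccos (max (-1) (min 1 (C z))) / (2 * pi) else 1 - arccos (max (-1) (min 1 (C z))) / (2 * pi))"
   if "z \<in> space trig_measure" for z
  proof -
   have "0 <= fst z $ i" "fst z $ i < 1" using that by (auto simp: cube_def space_mu)
   from circle_coordinate[OF this] show ?thesis unfolding CS b by (simp add: inner_axis)
  qed
  ultimately show "(%z. fst z \<bullet> b) \<in> borel_measurable trig_measure"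
   by (subst measurable_cong) auto
 qed
 then show "(%z::'n phase. fst z) \<in> measurable trig_measure lborel" by simp
qed

text \<open>Both coordinates are measurable for \<open>trig_measure\<close>, so the identity is
  measurable from \<open>trig_measure\<close> to \<open>mu\<close>, and every measurable set belongs
  to \<open>trig_sets\<close>.\<close>

lemma sets_mu_trig: "A \<in> sets mu ==> trig_gen (indicator A)"
proof -
 assume A: "A \<in> sets (mu :: 'a phase measure)"
 have "(%z. (fst z, snd z)) \<in> measurable trig_measure (torus \<Otimes>\<^sub>M gauss)"
  using trig_measure_snd by (intro measurable_Pair trig_measure_fst) (simp add: measurable_cong_sets[OF refl sets_gauss])
 then have "(%z. z) -` A \<inter> space trig_measure \<in> sets trig_measure"
  using A by (intro measurable_sets[of _ _ mu]) (auto simp: mu_def)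
 moreover have "(%z. z) -` A \<inter> space trig_measure = A" using sets.sets_into_space[OF A] by auto
 ultimately show ?thesis by (simp add: sets_trig_measure trig_sets_def)
qed

text \<open>Stated for an arbitrary family because it is used twice: for completeness of the Hermite
  basis and for density of the initial values of the explicit waves.\<close>

lemma trig_total:
 fixes e :: "'j => 'n::finite phase => real"
 assumes e: "!!j. e j \<in> L2 mu" and trig: "!!k \<beta> \<theta>. closed_span mu e (trig k \<beta> \<theta>)" and f: "f \<in> L2 mu"
 shows "closed_span mu e f"
proof -
 have gen: "closed_span mu e g" if "trig_gen g" for g
  using that
 proof (induction rule: trig_gen.induct)
  case (comb g h a b)
  then show ?case by (intro closed_span_comb e)
 next
  case (limit F B g)
  have gL: "g \<in> L2 mu" using trig_gen.limit[OF limit.hyps] by (rule trig_gen_L2)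
  have gB: "abs (g z) <= B" if "z \<in> space mu" for z
   by (rule LIMSEQ_le_const2[OF tendsto_rabs[OF limit.hyps(3)[OF that]]]) (use limit.hyps(2) that in auto)
  show ?case
  proof (rule closed_span_limit[OF e limit.IH gL])
   show "(%n. L2_norm mu (F n -. g)) \<leadsto> 0"
   proof (rule L2_tendsto_dominated)
    show "integrable mu (%_. (2 * B)^2)" by simp
    show "AE z in mu. (norm (F n z - g z))^2 <= (2 * B)^2" for n
    proof (rule AE_I2)
     fix z :: "'n phase" assume z: "z \<in> space mu"
     have "norm (F n z - g z) <= 2 * B"
      using limit.hyps(2)[OF z, of n] gB[OF z] norm_triangle_ineq4[of "F n z" "g z"] by simp
     then show "(norm (F n z - g z))^2 <= (2 * B)^2" by (intro power_mono) auto
    qed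
    show "F n \<in> borel_measurable mu" for n by (rule trig_gen_measurable[OF limit.hyps(1)])
    show "AE z in mu. (%n. F n z) \<leadsto> g z" by (rule AE_I2) (rule limit.hyps(3))
   qed (rule L2_measurable[OF gL])
  qed
 qed (rule trig)
 have simple: "closed_span mu e s" if s: "simple_function mu s" for s :: "'n phase => real"
 proof -
  have "trig_gen (%z. \<Sum>y\<in>s ` space mu. y * indicator (s -` {y} \<inter> space mu) z)"
  proof -
   have 1: "trig_gen (%z. y * indicator (s -` {y} \<inter> space mu) z)" if "y \<in> s ` space mu" for y
    using s that by (intro trig_gen_scale sets_mu_trig) (auto simp: simple_function_def)
   have "trig_gen (%z. \<Sum>y\<in>I. y * indicator (s -` {y} \<inter> space mu) z)" if "I \<subseteq> s ` space mu" for I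
    using that
   proof (induction I rule: infinite_finite_induct)
    case (insert y I)
    have "trig_gen (%z. y * indicator (s -` {y} \<inter> space mu) z + (\<Sum>y\<in>I. y * indicator (s -` {y} \<inter> space mu) z))"
     using insert by (intro trig_gen_add 1) auto
    then show ?case by (simp only: sum.insert[OF insert.hyps])
   qed (simp_all add: trig_gen_const)
   then show ?thesis by blast
  qed
  then have "trig_gen s"
  proof (rule trig_gen_cong)
   fix z :: "'n phase" assume z: "z \<in> space mu"
   have "s z = (\<Sum>y\<in>s ` space mu. indicator (s -` {y} \<inter> space mu) z *\<^sub>R y)"
    by (rule simple_function_indicator_representation_banach[OF s z])
   also have "\<dots> = (\<Sum>y\<in>s ` space mu. y * indicator (s -` {y} \<inter> space mu) z)"
    by (intro sum.cong refl) (simp only: real_scaleR_def mult.commute)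
   finally show "(\<Sum>y\<in>s ` space mu. y * indicator (s -` {y} \<inter> space mu) z) = s z" by (rule sym)
  qed
  then show ?thesis by (rule gen)
 qed
 obtain s where s0: "(\<forall>i::nat. simple_function mu (s i)) \<and> (\<forall>z\<in>space mu. (%i. s i z) \<leadsto> f z) \<and>
   (\<forall>i. \<forall>z\<in>space mu. dist (s i z) 0 <= 2 * dist (f z) 0)"
  using borel_measurable_implies_sequence_metric[OF L2_measurable[OF f], of 0] by (rule exE)
 have s: "simple_function mu (s i)" "z \<in> space mu ==> (%i. s i z) \<leadsto> f z"
   "z \<in> space mu ==> norm (s i z) <= 2 * norm (f z)" for i z
  using s0 by simp_all
 show ?thesis
 proof (rule closed_span_limit[OF e simple[OF s(1)] f])
  show "(%n. L2_norm mu (s n -. f)) \<leadsto> 0"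
  proof (rule L2_tendsto_dominated)
   show "integrable mu (%z. 9 * (norm (f z))^2)" using L2_integrable_sq[OF f] by simp
   show "AE z in mu. (norm (s n z - f z))^2 <= 9 * (norm (f z))^2" for n
   proof (rule AE_I2)
    fix z :: "'n phase" assume z: "z \<in> space mu"
    have "norm (s n z - f z) <= 3 * norm (f z)"
     using s(3)[OF z, of n] norm_triangle_ineq4[of "s n z" "f z"] by simp
    then have "(norm (s n z - f z))^2 <= (3 * norm (f z))^2" by (intro power_mono) auto
    then show "(norm (s n z - f z))^2 <= 9 * (norm (f z))^2" by (simp add: power_mult_distrib)
   qed
   show "s n \<in> borel_measurable mu" for n using s(1) by (rule borel_measurable_simple_function)
  qed (use s(2) L2_measurable[OF f] in \<open>auto intro!: AE_I2\<close>)
 qed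
qed

section \<open>Completeness of the basis\<close>

text \<open>The Hermite recursion expresses \<open>v $ i * nhm m\<close> by neighbouring degrees.
  Iteration puts all powers of \<beta> . v times \<open>cas k\<close> into the span.\<close>

lemma fin_span_ebas_inner:
 assumes "fin_span ebas f"
 shows "fin_span ebas (%z. (\<beta> \<bullet> snd z) * f z)"
proof -
 have base: "fin_span ebas (%z. (\<beta> \<bullet> snd z) * ebas j z)" for j
 proof -
  have "(\<beta> \<bullet> snd z) * ebas j z = (\<Sum>i\<in>UNIV. \<beta> $ i *
    (sqrt (real (Suc (snd j i))) * ebas (fst j, up (snd j) i) z + sqrt (real (snd j i)) * ebas (fst j, dn (snd j) i) z))" for z
  proof -
   have "(\<beta> \<bullet> snd z) * ebas j z = (\<Sum>i\<in>UNIV. \<beta> $ i * (cas (fst j) (fst z) * (snd z $ i * nhm (snd j) (snd z))))"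
    by (simp add: inner_vec_def ebas_def sum_distrib_left sum_distrib_right mult_ac)
   then show ?thesis unfolding nhm_rec by (simp add: ebas_def algebra_simps)
  qed
  then show ?thesis
   by (simp only:) (intro fin_span_sum fin_span_scale fin_span_add fin_span_base)
 qed
 obtain J c where J: "finite J" "f = (%z. \<Sum>j\<in>J. c j * ebas j z)" using assms by (auto simp: fin_span_def)
 have "(%z. (\<beta> \<bullet> snd z) * f z) = (%z. \<Sum>j\<in>J. c j * ((\<beta> \<bullet> snd z) * ebas j z))"
  unfolding J(2) by (simp add: sum_distrib_left mult_ac)
 then show ?thesis by (simp only:) (intro fin_span_sum fin_span_scale base)
qed

text \<open>The coefficient bound 1/m! makes all partial sums at most 2 exp(|\<beta>| |v|), which is
  square-integrable for the Gaussian measure, so the power series converges in L2.\<close>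

lemma closed_span_ebas_series:
 fixes h :: "real => real" and a :: "nat => real"
 assumes sums: "!!x. (%m. a m * x ^ m) sums h x" and a: "!!m. abs (a m) <= 1 / fact m"
  and h: "continuous_on UNIV h" "!!x. abs (h x) <= 1"
 shows "closed_span mu ebas (%z. cas k (fst z) * h (\<beta> \<bullet> snd z))"
proof -
 define G where "G N z = (\<Sum>m<N. a m * (cas k (fst z) * (\<beta> \<bullet> snd z) ^ m))" for N and z :: "'a phase"
 have pw: "fin_span ebas (%z. cas k (fst z) * (\<beta> \<bullet> snd z) ^ m)" for m
 proof (induction m)
  case 0
  have "(%z. cas k (fst z) * (\<beta> \<bullet> snd z) ^ 0) = ebas (k, %_. 0)"
   by (auto simp: ebas_def nhm_def)
  then show ?case by (simp only: fin_span_base)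
 next
  case (Suc m)
  from fin_span_ebas_inner[OF this, of \<beta>] show ?case by (simp add: mult_ac)
 qed
 have GS: "fin_span ebas (G N)" for N
  unfolding G_def by (intro fin_span_sum fin_span_scale pw)
 have pb: "(\<Sum>m<N. abs y ^ m / fact m) <= exp (abs y)" for N and y :: real
 proof -
  have "(%m. abs y ^ m / fact m) sums exp (abs y)"
   using exp_converges[of "abs y"] by (simp add: field_simps)
  then show ?thesis using sum_le_suminf[of "%m. abs y ^ m / fact m" "{..<N}"] by (auto simp: sums_iff)
 qed
 have Gb: "abs (G N (x, v)) <= 2 * exp (norm \<beta> * norm v)" for N x v
 proof -
  have "abs (G N (x, v)) <= (\<Sum>m<N. abs (a m * (cas k x * (\<beta> \<bullet> v) ^ m)))" unfolding G_def by (simp add: sum_abs)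
  also have "\<dots> <= (\<Sum>m<N. 2 * (abs (\<beta> \<bullet> v) ^ m / fact m))"
  proof (rule sum_mono)
   fix m
   have "abs (a m) * (abs (cas k x) * abs (\<beta> \<bullet> v) ^ m) <= (1 / fact m) * (2 * abs (\<beta> \<bullet> v) ^ m)"
    using a[of m] cas_bound[of k x] by (intro mult_mono mult_right_mono) auto
   then show "abs (a m * (cas k x * (\<beta> \<bullet> v) ^ m)) <= 2 * (abs (\<beta> \<bullet> v) ^ m / fact m)"
    by (simp add: abs_mult power_abs)
  qed
  also have "\<dots> = 2 * (\<Sum>m<N. abs (\<beta> \<bullet> v) ^ m / fact m)" by (simp add: sum_distrib_left)
  also have "\<dots> <= 2 * exp (abs (\<beta> \<bullet> v))" using pb[of "\<beta> \<bullet> v" N] by simp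
  also have "\<dots> <= 2 * exp (norm \<beta> * norm v)" using Cauchy_Schwarz_ineq2[of \<beta> v] by simp
  finally show ?thesis .
 qed
 have eb: "exp_bounded (%v::real^'a. 2 * exp (norm \<beta> * norm v))"
  unfolding exp_bounded_def by (intro exI[of _ 2] exI[of _ "norm \<beta>"]) auto
 have hb: "abs (cas k x * h (\<beta> \<bullet> v)) <= 2 * exp (norm \<beta> * norm v)" for x v
 proof -
  have "abs (cas k x) * abs (h (\<beta> \<bullet> v)) <= 2 * 1" using cas_bound h(2) by (intro mult_mono) auto
  also have "\<dots> <= 2 * exp (norm \<beta> * norm v)" by simp
  finally show ?thesis by (simp add: abs_mult)
 qed
 have cont: "continuous_on UNIV (%z::'a phase. cas k (fst z) * h (\<beta> \<bullet> snd z))"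
  by (intro continuous_intros continuous_on_compose2[OF continuous_cas[of UNIV]] continuous_on_compose2[OF h(1)]) auto
 have meas: "(%z::'a phase. cas k (fst z) * h (\<beta> \<bullet> snd z)) \<in> borel_measurable mu"
  by (rule borel_measurable_mu_continuous[OF cont])
 have Gm: "G N \<in> borel_measurable mu" for N
  using fin_span_L2[OF ebas_L2 GS] by (rule L2_measurable)
 show ?thesis
 proof (rule closed_span_limit[OF ebas_L2 closed_span_fin_span[OF ebas_L2 GS]])
  show "(%z. cas k (fst z) * h (\<beta> \<bullet> snd z)) \<in> L2 mu"
   by (rule exp_bounded_L2_mu[OF meas eb]) (simp add: hb)
  show "(%n. L2_norm mu (%z. G n z - cas k (fst z) * h (\<beta> \<bullet> snd z))) \<leadsto> 0"
  proof (rule exp_bounded_L2_mu_tendsto[OF Gm meas eb])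
   fix z :: "'a phase"
   have "(%n. cas k (fst z) * (\<Sum>m<n. a m * (\<beta> \<bullet> snd z) ^ m)) \<leadsto> cas k (fst z) * h (\<beta> \<bullet> snd z)"
    using sums[of "\<beta> \<bullet> snd z"] unfolding sums_def by (rule tendsto_mult_left)
   moreover have "(%n. cas k (fst z) * (\<Sum>m<n. a m * (\<beta> \<bullet> snd z) ^ m)) = (%n. G n z)"
    by (simp add: G_def sum_distrib_left mult_ac)
   ultimately show "(%n. G n z) \<leadsto> cas k (fst z) * h (\<beta> \<bullet> snd z)" by simp
  qed (use Gb hb in auto)
 qed
qed

lemma closed_span_ebas_trig: "closed_span mu ebas (trig k \<beta> \<theta>)"
proof -
 have c: "closed_span mu ebas (%z. cas l (fst z) * cos (\<beta> \<bullet> snd z))" for l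
 proof (rule closed_span_ebas_series[of cos_coeff])
  show "(%m. cos_coeff m * x ^ m) sums cos x" for x using cos_converges[of x] by simp
  show "abs (cos_coeff m) <= 1 / fact m" for m by (simp add: cos_coeff_def)
 qed (auto intro!: continuous_intros)
 have s: "closed_span mu ebas (%z. cas l (fst z) * sin (\<beta> \<bullet> snd z))" for l
 proof (rule closed_span_ebas_series[of sin_coeff])
  show "(%m. sin_coeff m * x ^ m) sums sin x" for x using sin_converges[of x] by simp
  show "abs (sin_coeff m) <= 1 / fact m" for m by (simp add: sin_coeff_def)
 qed (auto intro!: continuous_intros)
 let ?l = "%i. - k i"
 \<comment> \<open>From cos(k.x) = (cas k + cas(-k))/2 and sin(k.x) = (cas k - cas(-k))/2 together
   with the addition theorem; the factors 1 give the sum the shape of nested linear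
   combinations.\<close>
 have eq: "trig k \<beta> \<theta> z =
   1 * ((cos \<theta> - sin \<theta>) / 2 * (cas k (fst z) * cos (\<beta> \<bullet> snd z)) + (- (sin \<theta> + cos \<theta>) / 2) * (cas k (fst z) * sin (\<beta> \<bullet> snd z)))
  + 1 * ((cos \<theta> + sin \<theta>) / 2 * (cas ?l (fst z) * cos (\<beta> \<bullet> snd z)) + (cos \<theta> - sin \<theta>) / 2 * (cas ?l (fst z) * sin (\<beta> \<bullet> snd z)))" for z
  unfolding trig_def cas_def kdot_uminus cos_minus sin_minus cos_add sin_add
  by (simp add: field_simps)
 show ?thesis
  by (subst ext[OF eq]) (intro closed_span_comb ebas_L2 c s)
qed

theorem ebas_complete: "f \<in> L2 mu ==> closed_span mu ebas f"
 by (rule trig_total[OF ebas_L2 closed_span_ebas_trig])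

text \<open>The three parameters packed into one index; these are the values at time 0 of the
  explicit waves.\<close>

definition trig_family :: "('n => int) \<times> (real^'n) \<times> real => 'n::finite phase => real" where
 "trig_family p = trig (fst p) (fst (snd p)) (snd (snd p))"

lemma trig_family_complete: "f \<in> L2 mu ==> closed_span mu trig_family f"
proof (rule trig_total)
 show L: "trig_family j \<in> L2 mu" for j :: "('a => int) \<times> (real^'a) \<times> real"
  by (simp add: trig_family_def trig_L2)
 show "closed_span mu trig_family (trig k \<beta> \<theta>)" for k :: "'a => int" and \<beta> \<theta>
  using closed_span_fin_span[OF L fin_span_base[of trig_family "(k, \<beta>, \<theta>)"]] by (simp add: trig_family_def)
qed

section \<open>Smooth functions\<close>

text \<open>A smooth function of one variable presented together with all its derivatives,
  \<open>E 0\<close> being the function itself.\<close>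

definition deriv_seq :: "(nat => real => real) => bool" where
 "deriv_seq E \<longleftrightarrow> (\<forall>m x. (E m has_real_derivative E (Suc m) x) (at x))"

text \<open>A class closed under directional derivatives, which gives \<open>smooth\<close> by
  induction on the list of directions. The arbitrary index m in \<open>comp\<close> is what makes
  compositions closed under differentiation.\<close>

inductive smooth_gen :: "('a::real_normed_vector => real) => bool" where
 const: "smooth_gen (%_. c)"
| linear: "bounded_linear L ==> smooth_gen L"
| comp: "deriv_seq E ==> smooth_gen f ==> smooth_gen (%x. E m (f x))"
| add: "smooth_gen f ==> smooth_gen g ==> smooth_gen (%x. f x + g x)"
| mult: "smooth_gen f ==> smooth_gen g ==> smooth_gen (%x. f x * g x)"

lemma smooth_gen_derivative:
 "smooth_gen f ==> \<exists>D. (\<forall>x. (f has_derivative D x) (at x)) \<and> (\<forall>b. smooth_gen (%x. D x b))"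
proof (induction rule: smooth_gen.induct)
 case (const c)
 show ?case by (intro exI[of _ "%_ _. 0"]) (auto intro: smooth_gen.const)
next
 case (linear L)
 then show ?case by (intro exI[of _ "%_. L"]) (auto intro: smooth_gen.const bounded_linear_imp_has_derivative)
next
 case (comp E f m)
 then obtain D where D: "!!x. (f has_derivative D x) (at x)" "!!b. smooth_gen (%x. D x b)" by blast
 have d: "((%x. E m (f x)) has_derivative (%b. E (Suc m) (f x) * D x b)) (at x)" for x
 proof -
  have "(E m has_derivative (*) (E (Suc m) (f x))) (at (f x))"
   using comp.hyps(1) by (simp add: deriv_seq_def has_field_derivative_def)
  from has_derivative_compose[OF D(1) this] show ?thesis .
 qed
 show ?case
  by (intro exI[of _ "%x b. E (Suc m) (f x) * D x b"] conjI allI)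
   (rule d, rule smooth_gen.mult[OF smooth_gen.comp[OF comp.hyps] D(2)])
next
 case (add f g)
 then obtain D D' where D: "!!x. (f has_derivative D x) (at x)" "!!b. smooth_gen (%x. D x b)"
  "!!x. (g has_derivative D' x) (at x)" "!!b. smooth_gen (%x. D' x b)" by blast
 show ?case
  by (intro exI[of _ "%x b. D x b + D' x b"] conjI allI)
   (rule has_derivative_add[OF D(1,3)], rule smooth_gen.add[OF D(2,4)])
next
 case (mult f g)
 then obtain D D' where D: "!!x. (f has_derivative D x) (at x)" "!!b. smooth_gen (%x. D x b)"
  "!!x. (g has_derivative D' x) (at x)" "!!b. smooth_gen (%x. D' x b)" by blast
 show ?case
  by (intro exI[of _ "%x b. f x * D' x b + D x b * g x"] conjI allI)
   (rule has_derivative_mult[OF D(1,3)],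
   rule smooth_gen.add[OF smooth_gen.mult[OF mult.hyps(1) D(4)] smooth_gen.mult[OF D(2) mult.hyps(2)]])
qed

lemma smooth_gen_smooth:
 assumes "smooth_gen f"
 shows "smooth f"
proof -
 have "smooth_gen (iter_deriv bs f)" for bs
 proof (induction bs)
  case (Cons b bs)
  then obtain D where D: "!!x. (iter_deriv bs f has_derivative D x) (at x)" "!!b. smooth_gen (%x. D x b)"
   using smooth_gen_derivative by blast
  have "frechet_derivative (iter_deriv bs f) (at x) = D x" for x
   using frechet_derivative_at[OF D(1)] by simp
  then show ?case using D(2) by simp
 qed (simp add: assms)
 then show ?thesis
  unfolding smooth_def differentiable_def using smooth_gen_derivative by blast
qed

lemma smooth_gen_scale: "smooth_gen f ==> smooth_gen (%x. c * f x)"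
 by (intro smooth_gen.mult smooth_gen.const)

lemma smooth_gen_diff: "smooth_gen f ==> smooth_gen g ==> smooth_gen (f -. g)"
 using smooth_gen.add[OF _ smooth_gen_scale[of g "-1"], of f] by simp

lemma smooth_gen_sum: "(!!i. i \<in> I ==> smooth_gen (f i)) ==> smooth_gen (%x. \<Sum>i\<in>I. f i x)"
 by (induction I rule: infinite_finite_induct) (simp_all add: smooth_gen.const smooth_gen.add)

lemma smooth_gen_prod: "(!!i. i \<in> I ==> smooth_gen (f i)) ==> smooth_gen (%x. \<Prod>i\<in>I. f i x)"
 by (induction I rule: infinite_finite_induct) (simp_all add: smooth_gen.const smooth_gen.mult)

lemma smooth_gen_cos: "smooth_gen f ==> smooth_gen (%x. cos (f x + \<theta>))"
proof -
 have "deriv_seq (%m y. cos (y + real m * (pi / 2)))"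
  unfolding deriv_seq_def
 proof (intro allI)
  fix m :: nat and y :: real
  have "y + real (Suc m) * (pi / 2) = (y + real m * (pi / 2)) + pi / 2"
   by (simp add: distrib_right add_ac)
  then have "cos (y + real (Suc m) * (pi / 2)) = - sin (y + real m * (pi / 2))"
   by (simp only: cos_add[of _ "pi / 2"]) simp
  moreover have "((%y. cos (y + c)) has_real_derivative - sin (y + c)) (at y)" for c :: real
   by (auto intro!: derivative_eq_intros)
  ultimately show "((%y. cos (y + real m * (pi / 2))) has_real_derivative cos (y + real (Suc m) * (pi / 2))) (at y)"
   by simp
 qed
 moreover assume "smooth_gen f"
 then have "smooth_gen (%x. f x + \<theta>)" by (intro smooth_gen.add smooth_gen.const)
 ultimately show ?thesis using smooth_gen.comp[of "%m y. cos (y + real m * (pi / 2))" "%x. f x + \<theta>" 0] by simp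
qed

lemma smooth_gen_exp: "smooth_gen f ==> smooth_gen (%x. exp (f x))"
proof -
 have "deriv_seq (%m. exp)" unfolding deriv_seq_def by (auto intro: DERIV_exp)
 then show "smooth_gen f ==> smooth_gen (%x. exp (f x))" using smooth_gen.comp[of "%m. exp" f 0] by simp
qed

lemma smooth_gen_cas: "smooth_gen f ==> smooth_gen (%x. cos (f x) + sin (f x))"
proof -
 assume f: "smooth_gen f"
 have "sin y = cos (y + - pi / 2)" for y :: real by (simp add: cos_diff)
 then show ?thesis using smooth_gen.add[OF smooth_gen_cos[OF f, of 0] smooth_gen_cos[OF f, of "- pi / 2"]] by simp
qed

lemma smooth_gen_nh: "smooth_gen f ==> smooth_gen (%x. nh n (f x))"
proof (induction n "0::real" rule: nh.induct)
 case (3 n)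
 have "nh (Suc (Suc n)) (f x) = (1 / sqrt (real (Suc (Suc n)))) * (f x * nh (Suc n) (f x) + (- sqrt (real (Suc n))) * nh n (f x))" for x
  by simp
 then show ?case
  by (simp only:) (intro smooth_gen_scale smooth_gen.add smooth_gen.mult 3)
qed (simp_all add: smooth_gen.const)

lemma smooth_has_derivative: "smooth f ==> (f has_derivative frechet_derivative f (at x)) (at x)"
 unfolding smooth_def using frechet_derivative_works[of f "at x"] by (metis iter_deriv.simps(1))

lemma smooth_has_dd: "smooth f ==> has_dd f b (%x. frechet_derivative f (at x) b)"
 by (rule has_dd_has_derivative) (rule smooth_has_derivative)

lemma smooth_continuous: "smooth f ==> continuous_on A f"
 by (intro continuous_at_imp_continuous_on ballI has_derivative_continuous[OF smooth_has_derivative])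

lemma smooth_continuous_derivative: "smooth f ==> continuous_on A (%x. frechet_derivative f (at x) b)"
proof (intro continuous_at_imp_continuous_on ballI differentiable_imp_continuous_within)
 fix x assume "smooth f"
 then have "iter_deriv [b] f differentiable (at x)" unfolding smooth_def by blast
 then show "(%x. frechet_derivative f (at x) b) differentiable (at x)" by simp
qed

lemma has_dd_unique: "has_dd f b f' ==> has_dd f b g' ==> f' x = g' x"
 unfolding has_dd_def using DERIV_unique by blast

section \<open>Bump functions\<close>

text \<open>The classical flat function exp(-1/x) with a polynomial factor in 1/x; the factor makes
  the family closed under differentiation.\<close>

definition flat :: "real poly => real => real" where
 "flat p x = (if x > 0 then poly p (inverse x) * exp (- inverse x) else 0)"

text \<open>For x > 0 the derivative of p(1/x) exp(-1/x) is x^(-2) (p - p')(1/x) exp(-1/x).\<close>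

definition flat_deriv :: "real poly => real poly" where
 "flat_deriv p = [:0, 0, 1:] * (p - pderiv p)"

lemma poly_exp_tendsto_0: "((%y::real. poly p y * exp (- y)) \<longlongrightarrow> 0) at_top"
proof -
 have "((%y::real. \<Sum>i\<le>degree p. coeff p i * (y ^ i / exp y)) \<longlongrightarrow> (\<Sum>i\<le>degree p. coeff p i * 0)) at_top"
  by (intro tendsto_sum tendsto_mult tendsto_const tendsto_power_div_exp_0)
 then show ?thesis by (simp add: poly_altdef sum_distrib_right exp_minus divide_inverse mult.assoc)
qed

lemma flat_has_derivative: "(flat p has_real_derivative flat (flat_deriv p) x) (at x)"
proof -
 consider "x > 0" | "x < 0" | "x = 0" by linarith
 then show ?thesis
 proof cases
  case 1
  have "((%x. poly p (inverse x) * exp (- inverse x)) has_real_derivative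
    poly (pderiv p) (inverse x) * (- (inverse x ^ 2)) * exp (- inverse x) + (exp (- inverse x) * (inverse x ^ 2)) * poly p (inverse x)) (at x)"
   using 1
   by (intro DERIV_mult DERIV_chain2[OF poly_DERIV] DERIV_chain2[OF DERIV_exp])
    (auto intro!: derivative_eq_intros simp: power2_eq_square)
  moreover have "poly (pderiv p) (inverse x) * (- (inverse x ^ 2)) * exp (- inverse x) + (exp (- inverse x) * (inverse x ^ 2)) * poly p (inverse x)
    = flat (flat_deriv p) x"
   using 1 by (simp add: flat_def flat_deriv_def algebra_simps power2_eq_square)
  ultimately have "((%x. poly p (inverse x) * exp (- inverse x)) has_real_derivative flat (flat_deriv p) x) (at x)" by simp
  then show ?thesis
   by (rule has_field_derivative_transform_within_open[of _ _ _ "{0<..}"]) (use 1 in \<open>auto simp: flat_def\<close>)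
 next
  case 2
  have "((%x::real. 0) has_real_derivative 0) (at x)" by simp
  then have "(flat p has_real_derivative 0) (at x)"
   by (rule has_field_derivative_transform_within_open[of _ _ _ "{..<0}"]) (use 2 in \<open>auto simp: flat_def\<close>)
  then show ?thesis using 2 by (simp add: flat_def)
 next
  case 3
  have "((%h. flat p h / h) \<longlongrightarrow> 0) (at 0)"
  proof (rule filterlim_split_at)
   show "((%h. flat p h / h) \<longlongrightarrow> 0) (at_left 0)"
    by (rule tendsto_eventually) (auto simp: eventually_at_filter flat_def)
   \<comment> \<open>With y = 1/h the difference quotient at 0 is y p(y) exp(-y), and
     \<open>pCons 0 p\<close> is the polynomial y p(y).\<close>
   have "((%h. poly (pCons 0 p) (inverse h) * exp (- inverse h)) \<longlongrightarrow> 0) (at_right 0)"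
    by (rule filterlim_compose[OF poly_exp_tendsto_0 filterlim_inverse_at_top_right])
   then show "((%h. flat p h / h) \<longlongrightarrow> 0) (at_right 0)"
    by (rule Lim_transform_eventually) (auto simp: eventually_at_filter flat_def divide_inverse)
  qed
  then have "((%h. (flat p (0 + h) - flat p 0) / h) \<longlongrightarrow> 0) (at 0)" by (simp add: flat_def)
  then have "(flat p has_real_derivative 0) (at 0)" by (simp add: DERIV_def)
  then show ?thesis using 3 by (simp add: flat_def)
 qed
qed

lemma deriv_seq_flat: "deriv_seq (%m. flat ((flat_deriv ^^ m) p))"
 unfolding deriv_seq_def by (simp add: flat_has_derivative)

text \<open>The factor \<open>exp 2\<close> normalises the value at 0 to 1.\<close>

definition bump :: "real => real" where
 "bump s = exp 2 * (flat 1 (1 + s) * flat 1 (1 - s))"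

lemma bump_nonneg: "0 <= bump s"
 by (simp add: bump_def flat_def)

lemma bump_0: "bump 0 = 1"
 by (simp add: bump_def flat_def exp_add[symmetric])

lemma bump_pos: "abs s < 1 ==> 0 < bump s"
 by (auto simp: bump_def flat_def abs_less_iff)

lemma bump_outside: "1 <= abs s ==> bump s = 0"
 by (auto simp: bump_def flat_def abs_if split: if_splits)

lemma smooth_gen_bump: "smooth_gen f ==> smooth_gen (%x. bump (f x))"
proof -
 assume f: "smooth_gen f"
 have "smooth_gen (%x. flat 1 (1 + f x))"
  using smooth_gen.comp[OF deriv_seq_flat smooth_gen.add[OF smooth_gen.const[of 1] f], of 0] by simp
 moreover have "smooth_gen (%x. flat 1 (1 - f x))"
  using smooth_gen.comp[OF deriv_seq_flat smooth_gen_diff[OF smooth_gen.const[of 1] f], of 0] by simp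
 ultimately show ?thesis unfolding bump_def by (intro smooth_gen_scale smooth_gen.mult)
qed

text \<open>Successive derivatives are chosen one after the other, each again in the class.\<close>

lemma smooth_gen_deriv_seq:
 fixes f :: "real => real"
 assumes "smooth_gen f"
 obtains E where "deriv_seq E" "E 0 = f"
proof -
 have step: "\<exists>f'. smooth_gen f' \<and> (\<forall>x. (f has_real_derivative f' x) (at x))" if sf: "smooth_gen f" for f :: "real => real"
 proof -
  obtain D where D: "!!x. (f has_derivative D x) (at x)" "!!b. smooth_gen (%x. D x b)"
   using smooth_gen_derivative[OF sf] by blast
  have "D x = (*) (D x 1)" for x
   using real_bounded_linear has_derivative_bounded_linear[OF D(1)[of x]] by (metis mult.commute mult_1)
  then have "(f has_real_derivative D x 1) (at x)" for x
   using D(1)[of x] by (simp add: has_field_derivative_def)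
  then show ?thesis using D(2) by blast
 qed
 have "\<exists>E. \<forall>m. smooth_gen (E m) \<and> (m = 0 \<longrightarrow> E m = f) \<and> (\<forall>x. (E m has_real_derivative E (Suc m) x) (at x))"
 proof -
  have "\<exists>E. \<forall>m::nat. (smooth_gen (E m) \<and> (m = 0 \<longrightarrow> E m = f)) \<and> (\<forall>x. (E m has_real_derivative E (Suc m) x) (at x))"
  proof (rule dependent_nat_choice)
   show "\<exists>x. smooth_gen x \<and> (0 = 0 \<longrightarrow> x = f)" using assms by blast
   show "\<exists>y. (smooth_gen y \<and> (Suc n = 0 \<longrightarrow> y = f)) \<and> (\<forall>xa. (x has_real_derivative y xa) (at xa))"
    if "smooth_gen x \<and> (n = 0 \<longrightarrow> x = f)" for x n
    using step[of x] that by auto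
  qed
  then show ?thesis by auto
 qed
 then show thesis using that unfolding deriv_seq_def by blast
qed

lemma bump_deriv:
 obtains bump' where "!!x. (bump has_real_derivative bump' x) (at x)" "continuous_on UNIV bump'"
proof -
 have "smooth_gen (%x::real. bump x)"
  by (intro smooth_gen_bump smooth_gen.linear bounded_linear_ident)
 then obtain E where E: "deriv_seq E" "E 0 = bump" by (rule smooth_gen_deriv_seq)
 show thesis
 proof (rule that[of "E 1"])
  show "(bump has_real_derivative E 1 x) (at x)" for x using E unfolding deriv_seq_def by (metis One_nat_def)
  have "isCont (E 1) x" for x using E(1) unfolding deriv_seq_def by (metis DERIV_isCont)
  then show "continuous_on UNIV (E 1)" by (simp add: continuous_at_imp_continuous_on)
 qed
qed

definition bump' :: "real => real" where
 "bump' = (SOME f. (\<forall>x. (bump has_real_derivative f x) (at x)) \<and> continuous_on UNIV f)"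

lemma bump'_deriv: "(bump has_real_derivative bump' x) (at x)" and continuous_bump': "continuous_on UNIV bump'"
proof -
 have "\<exists>f. (\<forall>x. (bump has_real_derivative f x) (at x)) \<and> continuous_on UNIV f"
  by (rule bump_deriv) blast
 from someI_ex[OF this] show "(bump has_real_derivative bump' x) (at x)" "continuous_on UNIV bump'"
  unfolding bump'_def by auto
qed

lemma continuous_bump: "continuous_on UNIV bump"
 by (intro continuous_at_imp_continuous_on ballI DERIV_isCont[OF bump'_deriv])

text \<open>Inside the support the exponent is 2 - 1/(1+s) - 1/(1-s) = 2 - 2/(1-s^2), which is at
  most 0.\<close>

lemma bump_le_1: "bump s <= 1"
proof (cases "abs s < 1")
 case True
 then have s: "1 + s > 0" "1 - s > 0" by auto
 have "2 <= inverse (1 + s) + inverse (1 - s)"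
 proof -
  have "inverse (1 + s) + inverse (1 - s) = 2 / ((1 + s) * (1 - s))"
   using s by (simp add: field_simps)
  moreover have "(1 + s) * (1 - s) <= 1" by (simp add: algebra_simps)
  moreover have "0 < (1 + s) * (1 - s)" using s by simp
  ultimately show ?thesis by (simp add: le_divide_eq)
 qed
 then have "exp (2 + (- inverse (1 + s) + - inverse (1 - s))) <= exp 0"
  by (subst exp_le_cancel_iff) linarith
 moreover have "bump s = exp (2 + (- inverse (1 + s) + - inverse (1 - s)))"
  using s by (simp add: bump_def flat_def flip: exp_add)
 ultimately show ?thesis by simp
next
 case False
 then show ?thesis by (simp add: bump_outside)
qed

lemma bump'_outside: "1 < abs s ==> bump' s = 0"
proof -
 assume s: "1 < abs s"
 have "((%_. 0) has_real_derivative bump' s) (at s)"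
 proof (rule has_field_derivative_transform_within_open[OF bump'_deriv])
  show "open {x::real. 1 < abs x}" by (intro open_Collect_less continuous_intros)
 qed (use s bump_outside in auto)
 then show "bump' s = 0" using DERIV_unique[OF _ DERIV_const] by blast
qed

lemma bump'_bounded: "\<exists>C. 0 <= C \<and> (\<forall>s. abs (bump' s) <= C)"
proof -
 have "bounded (bump' ` {-1..1})"
  by (intro compact_imp_bounded compact_continuous_image continuous_on_subset[OF continuous_bump']) auto
 then obtain C where C: "\<forall>y\<in>bump' ` {-1..1}. norm y <= C" unfolding bounded_iff by (rule exE)
 have "abs (bump' s) <= max C 0" for s
 proof (cases "s \<in> {-1..1}")
  case True
  then show ?thesis using C by (auto simp: le_max_iff_disj)
 next
  case False
  then show ?thesis using bump'_outside[of s] by auto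
 qed
 then show ?thesis by (intro exI[of _ "max C 0"]) simp
qed

text \<open>A smooth step is the antiderivative of \<open>bump\<close> divided by its total mass.
  Differences of rescaled steps will be the time cutoffs.\<close>

lemma step_exists:
 obtains E where "deriv_seq E" "!!y. y <= -1 ==> E 0 y = 0" "!!y. 1 <= y ==> E 0 y = 1"
  "!!y. 0 <= E 1 y" "!!y. 1 <= abs y ==> E 1 y = 0"
proof -
 have "smooth_gen (%x::real. bump x)"
  by (intro smooth_gen_bump smooth_gen.linear bounded_linear_ident)
 then obtain B where B: "deriv_seq B" "B 0 = bump" by (rule smooth_gen_deriv_seq)
 have "isCont bump x" for x using bump'_deriv by (rule DERIV_isCont)
 then have "\<exists>F. \<forall>x :: real. - \<infinity> < ereal x \<longrightarrow> ereal x < \<infinity> \<longrightarrow> (F has_vector_derivative bump x) (at x)"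
  by (intro einterval_antiderivative) auto
 then obtain F where F: "!!x. (F has_real_derivative bump x) (at x)"
  by (auto simp: has_real_derivative_iff_has_vector_derivative)
 define c where "c = F 1 - F (-1)"
 have c: "c > 0"
 proof -
  have "F (-1) < F 1"
  proof (rule DERIV_pos_imp_increasing_open[of "-1" 1 F])
   show "\<exists>y. (F has_real_derivative y) (at x) \<and> 0 < y" if "-1 < x" "x < 1" for x
    using F[of x] bump_pos[of x] that by (intro exI[of _ "bump x"]) auto
   show "continuous_on {-1..1} F"
    by (intro continuous_at_imp_continuous_on ballI DERIV_isCont[OF F])
  qed simp
  then show ?thesis by (simp add: c_def)
 qed
 have const: "F y = F z" if "!!x. min y z < x ==> x < max y z ==> 1 <= abs x" for y z
 proof -
  have "F a = F b" if ab: "a < b" "!!x. a < x ==> x < b ==> 1 <= abs x" for a b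
  proof (rule DERIV_isconst_end[symmetric, OF ab(1)])
   show "continuous_on {a..b} F"
    by (intro continuous_at_imp_continuous_on ballI DERIV_isCont[OF F])
   show "(F has_real_derivative 0) (at x)" if "a < x" "x < b" for x
    using F[of x] bump_outside[OF ab(2)[OF that]] by simp
  qed
  then have ab: "F a = F b" if "a < b" "!!x. a < x ==> x < b ==> 1 <= abs x" for a b using that by blast
  show ?thesis
  proof (cases y z rule: linorder_cases)
   case less
   show ?thesis by (rule ab[OF less], rule that) (use less in auto)
  next
   case greater
   show ?thesis by (rule ab[OF greater, symmetric], rule that) (use greater in auto)
  qed simp
 qed
 define E where "E m = (case m of 0 => (%y. (F y - F (-1)) / c) | Suc k => (%y. B k y / c))" for m
 show thesis
 proof (rule that[of E])
  show "deriv_seq E"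
   unfolding deriv_seq_def
  proof (intro allI)
   fix m x
   show "(E m has_real_derivative E (Suc m) x) (at x)"
   proof (cases m)
    case 0
    have "((%y. (F y - F (-1)) / c) has_real_derivative (bump x - 0) / c) (at x)"
     by (intro DERIV_cdivide DERIV_diff F DERIV_const)
    then show ?thesis by (simp add: E_def 0 B(2))
   next
    case (Suc k)
    have "((%y. B k y / c) has_real_derivative B (Suc k) x / c) (at x)"
     using B(1) unfolding deriv_seq_def by (intro DERIV_cdivide) blast
    then show ?thesis by (simp add: E_def Suc)
   qed
  qed
  show "E 0 y = 0" if "y <= -1" for y
   using const[of y "-1"] that by (simp add: E_def)
  show "E 0 y = 1" if "1 <= y" for y
   using const[of y 1] that c by (simp add: E_def c_def)
  show "0 <= E 1 y" for y using bump_nonneg c by (simp add: E_def B(2))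
  show "E 1 y = 0" if "1 <= abs y" for y using bump_outside[OF that] by (simp add: E_def B(2))
 qed
qed

section \<open>Cutoff in velocity\<close>

text \<open>A product over coordinates instead of a radial cutoff, so that smoothness and partial
  derivatives reduce to one variable.\<close>

definition chi :: "real => real^'n::finite => real" where
 "chi R v = (\<Prod>i\<in>UNIV. bump (v $ i / R))"

definition dchi :: "real => 'n => real^'n::finite => real" where
 "dchi R i v = bump' (v $ i / R) / R * (\<Prod>j\<in>UNIV - {i}. bump (v $ j / R))"

lemma prod_bump_bounds: "0 <= (\<Prod>j\<in>I. bump (f j))" "(\<Prod>j\<in>I. bump (f j)) <= 1"
 by (auto intro!: prod_nonneg prod_le_1 bump_nonneg bump_le_1)

lemma chi_bounds: "0 <= chi R v" "chi R v <= 1"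
 unfolding chi_def by (rule prod_bump_bounds)+

lemma has_dd_chi: "has_dd (chi R) (axis i 1) (dchi R i)"
 unfolding has_dd_def
proof
 fix v :: "real^'a"
 let ?P = "\<Prod>j\<in>UNIV - {i}. bump (v $ j / R)"
 have eq: "chi R (v + s *\<^sub>R axis i 1) = bump ((s + v $ i) / R) * ?P" for s
 proof -
  have "(\<Prod>j\<in>UNIV - {i}. bump ((v + s *\<^sub>R axis i 1) $ j / R)) = ?P"
   by (intro prod.cong) (auto simp: axis_def)
  then show ?thesis unfolding chi_def
   by (subst prod.remove[of _ i]) (simp_all add: axis_def add.commute)
 qed
 have "((%s. (s + v $ i) / R) has_real_derivative (1 + 0) / R) (at 0)"
  by (intro DERIV_cdivide DERIV_add DERIV_ident DERIV_const)
 then have "((%s. (s + v $ i) / R) has_real_derivative 1 / R) (at 0)" by simp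
 from DERIV_chain2[OF bump'_deriv this]
 have "((%s. bump ((s + v $ i) / R)) has_real_derivative bump' ((0 + v $ i) / R) * (1 / R)) (at 0)" .
 then have "((%s. bump ((s + v $ i) / R) * ?P) has_real_derivative (bump' ((0 + v $ i) / R) * (1 / R)) * ?P) (at 0)"
  by (rule DERIV_cmult_right)
 then show "((%s. chi R (v + s *\<^sub>R axis i 1)) has_real_derivative dchi R i v) (at 0)"
  by (simp add: eq dchi_def)
qed

lemma continuous_chi: "continuous_on A (chi R)"
proof -
 have "continuous_on A (%v. bump (v $ i * c))" for c i
  by (rule continuous_on_compose2[OF continuous_bump]) (auto intro!: continuous_intros)
 then show ?thesis unfolding chi_def divide_inverse by (rule continuous_on_prod)
qed

lemma continuous_dchi: "continuous_on A (dchi R i)"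
proof -
 have 1: "continuous_on A (%v. bump (v $ i * c))" for c i
  by (rule continuous_on_compose2[OF continuous_bump]) (auto intro!: continuous_intros)
 have 2: "continuous_on A (%v. bump' (v $ i * c))" for c i
  by (rule continuous_on_compose2[OF continuous_bump']) (auto intro!: continuous_intros)
 show ?thesis unfolding dchi_def divide_inverse
  by (intro continuous_on_mult continuous_on_const continuous_on_prod 1 2)
qed

lemma chi_support:
 assumes "R > 0" "norm v > real CARD('n) * R"
 shows "chi R (v :: real^'n::finite) = 0"
proof -
 have "\<exists>i. abs (v $ i) > R"
 proof (rule ccontr)
  assume "\<not> (\<exists>i. abs (v $ i) > R)"
  then have "(\<Sum>i\<in>UNIV. abs (v $ i)) <= (\<Sum>i\<in>(UNIV::'n set). R)" by (intro sum_mono) (auto simp: not_less)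
  then show False using norm_le_l1_cart[of v] assms(2) by simp
 qed
 then obtain i where "abs (v $ i) > R" by (rule exE)
 then have "bump (v $ i / R) = 0" using assms(1) by (intro bump_outside) (simp add: abs_divide)
 then show ?thesis unfolding chi_def by (intro prod_zero) auto
qed

text \<open>The chain rule contributes 1/R and the remaining factors are at most 1, so the error
  caused by the cutoff vanishes as R grows.\<close>

lemma dchi_bound: obtains C where "0 <= C" "!!R i (v::real^'n::finite). R > 0 ==> abs (dchi R i v) <= C / R"
proof -
 obtain C where C: "0 <= C" "!!s. abs (bump' s) <= C" using bump'_bounded by auto
 have "abs (dchi R i v) <= C / R" if "R > 0" for R i and v :: "real^'n"
 proof -
  have "abs (dchi R i v) = abs (bump' (v $ i / R)) / R * (\<Prod>j\<in>UNIV - {i}. bump (v $ j / R))"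
   using that prod_bump_bounds(1)[of "%j. v $ j / R" "UNIV - {i}"]
   by (simp only: dchi_def abs_mult abs_divide abs_of_nonneg)
  also have "\<dots> <= (C / R) * 1"
   using that C prod_bump_bounds[of "%j. v $ j / R" "UNIV - {i}"]
   by (intro mult_mono divide_right_mono) auto
  finally show ?thesis by simp
 qed
 then show thesis using that[of C] C(1) by blast
qed

lemma chi_tendsto: "(%n. chi (real (Suc n)) v) \<leadsto> 1"
proof -
 have b: "(%n. bump (v $ i / real (Suc n))) \<leadsto> bump 0" for i
 proof (rule continuous_on_tendsto_compose[OF continuous_bump])
  have "(%n. v $ i * (1 / real (Suc n))) \<leadsto> v $ i * 0"
   by (intro tendsto_mult tendsto_const LIMSEQ_Suc[OF lim_1_over_n])
  then show "(%n. v $ i / real (Suc n)) \<leadsto> 0" by simp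
 qed auto
 have "(%n. \<Prod>i\<in>UNIV. bump (v $ i / real (Suc n))) \<leadsto> (\<Prod>i\<in>(UNIV::'a set). bump 0)"
  by (rule tendsto_prod) (rule b)
 then show ?thesis by (simp add: chi_def bump_0)
qed

lemma dchi_tendsto: "(%n. dchi (real (Suc n)) i v) \<leadsto> 0"
proof -
 obtain C where C: "0 <= C" "!!R i (v::real^'a). R > 0 ==> abs (dchi R i v) <= C / R" by (rule dchi_bound) (rule that)
 have "(%n. C * (1 / real (Suc n))) \<leadsto> C * 0"
  by (intro tendsto_mult tendsto_const LIMSEQ_Suc[OF lim_1_over_n])
 then have "(%n. C / real (Suc n)) \<leadsto> 0" by simp
 then show ?thesis by (rule Lim_null_comparison[rotated]) (use C(2) in auto)
qed

lemma smooth_gen_chi: "(!!i. smooth_gen (%x. f x $ i)) ==> smooth_gen (%x. chi R (f x))"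
 unfolding chi_def divide_inverse
 by (intro smooth_gen_prod smooth_gen_bump smooth_gen.mult smooth_gen.const)

lemma smooth_gen_nhm: "(!!i. smooth_gen (%x. f x $ i)) ==> smooth_gen (%x. nhm m (f x))"
 unfolding nhm_def by (intro smooth_gen_prod smooth_gen_nh)

lemma smooth_gen_gdens:
 fixes f :: "'a::real_normed_vector => real^'n::finite"
 assumes f: "!!i. smooth_gen (%x. f x $ i)"
 shows "smooth_gen (%x. gdens (f x))"
proof -
 have "smooth_gen (%x. exp ((- 1 / 2) * (\<Sum>i\<in>UNIV. f x $ i * f x $ i)))"
  by (intro smooth_gen_exp smooth_gen_scale smooth_gen_sum smooth_gen.mult f)
 moreover have "(- 1 / 2) * (\<Sum>i\<in>UNIV. v $ i * v $ i) = - (norm v)\<^sup>2 / 2" for v :: "real^'n"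
  by (simp add: power2_norm_eq_inner inner_vec_def)
 ultimately show ?thesis unfolding gdens_def by (intro smooth_gen_scale) simp
qed

section \<open>Weak velocity gradients\<close>

lemma L2_component:
 fixes g :: "'a => real^'n::finite"
 assumes "g \<in> L2 M"
 shows "(%z. g z $ i) \<in> L2 M"
proof (rule L2_dominated)
 have "(%v::real^'n. v $ i) \<in> borel_measurable borel"
  by (intro borel_measurable_continuous_onI continuous_intros)
 from measurable_compose[OF L2_measurable[OF assms] this]
 show "(%z. g z $ i) \<in> borel_measurable M" .
 show "integrable M (%z. (norm (g z))^2)" by (rule L2_integrable_sq[OF assms])
 show "AE z in M. (norm (g z $ i))^2 <= (norm (g z))^2"
  by (intro AE_I2 power_mono) (auto simp: component_le_norm_cart)
qed

lemma L2_vec: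
 fixes g :: "'a => real^'n::finite"
 assumes "!!i. (%z. g z $ i) \<in> L2 M"
 shows "g \<in> L2 M"
proof -
 have m: "g \<in> borel_measurable M"
  using assms by (subst borel_measurable_euclidean_space) (auto simp: Basis_vec_def inner_axis L2_measurable)
 have "integrable M (%z. \<Sum>i\<in>UNIV. (norm (g z $ i))^2)"
  by (intro Bochner_Integration.integrable_sum L2_integrable_sq assms)
 moreover have "(%z. \<Sum>i\<in>UNIV. (norm (g z $ i))^2) = (%z. (norm (g z))^2)"
  by (simp only: power2_norm_eq_inner inner_vec_def)
 ultimately show ?thesis using m by (intro L2_I) simp_all
qed

lemma ip_components:
 fixes f g :: "'a => real^'n::finite"
 assumes "f \<in> L2 M" "g \<in> L2 M"
 shows "ip M f g = (\<Sum>i\<in>UNIV. ip M (%z. f z $ i) (%z. g z $ i))"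
 unfolding ip_def inner_vec_def
 by (rule Bochner_Integration.integral_sum) (intro L2_integrable_inner L2_component assms)

lemma L2_norm_component_le:
 fixes g :: "'a => real^'n::finite"
 assumes "g \<in> L2 M"
 shows "L2_norm M (%z. g z $ i) <= L2_norm M g"
proof (rule power2_le_imp_le)
 have "(L2_norm M (%z. g z $ i))^2 <= (\<Sum>i\<in>UNIV. (L2_norm M (%z. g z $ i))^2)"
  by (rule member_le_sum) auto
 also have "\<dots> = (L2_norm M g)^2" by (simp add: L2_norm_ip ip_components[OF assms assms])
 finally show "(L2_norm M (%z. g z $ i))^2 <= (L2_norm M g)^2" .
qed simp

lemma has_dd_support:
 assumes dd: "has_dd g b g'" and supp: "!!x. norm x > R ==> g x = 0" and x: "norm (x::'a::real_normed_vector) > R"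
 shows "g' x = 0"
proof -
 have "((%s. x + s *\<^sub>R b) \<longlongrightarrow> x + 0 *\<^sub>R b) (at 0)" by (intro tendsto_intros)
 then have "((%s. norm (x + s *\<^sub>R b)) \<longlongrightarrow> norm x) (at 0)" using tendsto_norm by fastforce
 then have "\<forall>\<^sub>F s in at 0. norm (x + s *\<^sub>R b) > R" by (rule order_tendstoD(1)) (rule x)
 then have ev: "\<forall>\<^sub>F s in at 0. g (x + s *\<^sub>R b) = 0" by eventually_elim (rule supp)
 have "((%s. (g (x + (0 + s) *\<^sub>R b) - g (x + 0 *\<^sub>R b)) / s) \<longlongrightarrow> g' x) (at 0)"
  using dd unfolding has_dd_def DERIV_def by blast
 moreover have "((%s. (g (x + (0 + s) *\<^sub>R b) - g (x + 0 *\<^sub>R b)) / s) \<longlongrightarrow> 0) (at 0)"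
  by (rule tendsto_eventually) (use ev supp[OF x] in \<open>auto elim!: eventually_mono\<close>)
 ultimately show ?thesis by (rule tendsto_unique[OF at_neq_bot])
qed

lemma gdens_neq_0: "gdens v \<noteq> 0"
 using gdens_pos[of v] by simp

text \<open>Dividing by the density, which is bounded away from 0 on the support, turns a pairing
  for Lebesgue measure into an inner product in the Gaussian L2 space.\<close>

lemma bounded_support_gauss:
 fixes p q :: "real^'n::finite => real"
 assumes c: "continuous_on UNIV p" and supp: "!!v. norm v > R ==> p v = 0"
 shows "(%v. p v / gdens v) \<in> L2 gauss"
  and "q \<in> L2 gauss ==> (LINT v|lborel. q v * p v) = ip gauss q (%v. p v / gdens v)"
proof -
 have c': "continuous_on UNIV (%v. p v / gdens v)"
  by (intro continuous_intros c continuous_gdens) (simp add: gdens_neq_0)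
 then have m: "(%v. p v / gdens v) \<in> borel_measurable borel" by (rule borel_measurable_continuous_onI)
 have "bounded ((%v. p v / gdens v) ` cball 0 R)"
  by (intro compact_imp_bounded compact_continuous_image continuous_on_subset[OF c']) auto
 then obtain C where C: "\<forall>y\<in>(%v. p v / gdens v) ` cball 0 R. norm y <= C" unfolding bounded_iff by (rule exE)
 have "abs (p v / gdens v) <= max C 0" for v
 proof (cases "norm v <= R")
  case True
  then show ?thesis using C by (auto simp: le_max_iff_disj)
 next
  case False
  then show ?thesis using supp by simp
 qed
 then have "exp_bounded (%v. p v / gdens v)" by (rule exp_bounded_bounded)
 then show "(%v. p v / gdens v) \<in> L2 gauss" by (rule exp_bounded_L2[OF m])
 assume q: "q \<in> L2 gauss"
 then have qm: "q \<in> borel_measurable borel" using L2_measurable[OF q] by (simp add: measurable_cong_sets[OF sets_gauss refl])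
 have "(LINT v|gauss. q v * (p v / gdens v)) = (LINT v|lborel. gdens v * (q v * (p v / gdens v)))"
  using qm m by (intro LINT_gauss) measurable
 also have "(%v. gdens v * (q v * (p v / gdens v))) = (%v. q v * p v)"
  by (simp add: gdens_neq_0)
 finally show "(LINT v|lborel. q v * p v) = ip gauss q (%v. p v / gdens v)" by (simp add: ip_def)
qed

text \<open>In this form the weak gradient is a family of identities between continuous functionals
  on the Gaussian L2 space, so linearity and closedness under limits follow at once.\<close>

lemma H1_gauss_grad_iff:
 "H1_gauss_grad q g \<longleftrightarrow> q \<in> L2 gauss \<and> g \<in> L2 gauss \<and>
  (\<forall>\<psi> i. smooth \<psi> \<and> (\<exists>R. \<forall>v. norm v > R \<longrightarrow> \<psi> v = 0) \<longrightarrow>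
   ip gauss q (%v. frechet_derivative \<psi> (at v) (axis i 1) / gdens v) = - ip gauss (%v. g v $ i) (%v. \<psi> v / gdens v))"
proof -
 have "(LINT v|lborel. q v * frechet_derivative \<psi> (at v) (axis i 1)) = - (LINT v|lborel. g v $ i * \<psi> v)
   \<longleftrightarrow> ip gauss q (%v. frechet_derivative \<psi> (at v) (axis i 1) / gdens v) = - ip gauss (%v. g v $ i) (%v. \<psi> v / gdens v)"
  if q: "q \<in> L2 gauss" and g: "g \<in> L2 gauss" and \<psi>: "smooth \<psi>" and R: "\<exists>R. \<forall>v. norm v > R \<longrightarrow> \<psi> v = 0" for \<psi> i
 proof -
  obtain R where R: "!!v. norm v > R ==> \<psi> v = 0" using R by auto
  have 1: "(LINT v|lborel. g v $ i * \<psi> v) = ip gauss (%v. g v $ i) (%v. \<psi> v / gdens v)"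
   by (rule bounded_support_gauss(2)[OF smooth_continuous[OF \<psi>] R L2_component[OF g]])
  have 2: "(LINT v|lborel. q v * frechet_derivative \<psi> (at v) (axis i 1)) = ip gauss q (%v. frechet_derivative \<psi> (at v) (axis i 1) / gdens v)"
   by (rule bounded_support_gauss(2)[OF smooth_continuous_derivative[OF \<psi>] has_dd_support[OF smooth_has_dd[OF \<psi>] R] q])
  show ?thesis unfolding 1 2 ..
 qed
 then show ?thesis unfolding H1_gauss_grad_def by blast
qed

lemma smooth_bounded_support_L2:
 assumes "smooth \<psi>" "\<exists>R. \<forall>v. norm v > R \<longrightarrow> \<psi> v = 0"
 shows "(%v. \<psi> v / gdens v) \<in> L2 gauss" "(%v. frechet_derivative \<psi> (at v) b / gdens v) \<in> L2 gauss"
proof -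
 obtain R where R: "!!v. norm v > R ==> \<psi> v = 0" using assms(2) by auto
 show "(%v. \<psi> v / gdens v) \<in> L2 gauss"
  by (rule bounded_support_gauss(1)[OF smooth_continuous[OF assms(1)] R])
 show "(%v. frechet_derivative \<psi> (at v) b / gdens v) \<in> L2 gauss"
  by (rule bounded_support_gauss(1)[OF smooth_continuous_derivative[OF assms(1)] has_dd_support[OF smooth_has_dd[OF assms(1)] R]])
qed

lemma H1_gauss_grad_comb:
 assumes "H1_gauss_grad q g" "H1_gauss_grad p h"
 shows "H1_gauss_grad (%v. a * q v + b * p v) (%v. a *\<^sub>R g v + b *\<^sub>R h v)"
proof -
 have L: "q \<in> L2 gauss" "g \<in> L2 gauss" "p \<in> L2 gauss" "h \<in> L2 gauss"
  using assms by (auto simp: H1_gauss_grad_iff)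
 show ?thesis
  unfolding H1_gauss_grad_iff
 proof (intro conjI allI impI)
  show "(%v. a * q v + b * p v) \<in> L2 gauss" by (intro L2_comb L)
  show "(%v. a *\<^sub>R g v + b *\<^sub>R h v) \<in> L2 gauss" by (intro L2_add L2_scaleR L)
  fix \<psi> :: "real^'a => real" and i
  assume \<psi>: "smooth \<psi> \<and> (\<exists>R. \<forall>v. norm v > R \<longrightarrow> \<psi> v = 0)"
  then have S: "(%v. \<psi> v / gdens v) \<in> L2 gauss" "(%v. frechet_derivative \<psi> (at v) (axis i 1) / gdens v) \<in> L2 gauss"
   using smooth_bounded_support_L2 by blast+
  have C: "(%v. g v $ i) \<in> L2 gauss" "(%v. h v $ i) \<in> L2 gauss" by (intro L2_component L)+
  show "ip gauss (%v. a * q v + b * p v) (%v. frechet_derivative \<psi> (at v) (axis i 1) / gdens v) =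
   - ip gauss (%v. (a *\<^sub>R g v + b *\<^sub>R h v) $ i) (%v. \<psi> v / gdens v)"
   using assms \<psi> unfolding H1_gauss_grad_iff
   by (simp add: ip_add_left L2_scale L C S ip_scale_left)
 qed
qed

lemma H1_gauss_grad_limit:
 assumes H: "!!n. H1_gauss_grad (q n) (g n)" and L: "p \<in> L2 gauss" "h \<in> L2 gauss"
  and lim: "(%n. L2_norm gauss (q n -. p)) \<leadsto> 0" "(%n. L2_norm gauss (g n -. h)) \<leadsto> 0"
 shows "H1_gauss_grad p h"
 unfolding H1_gauss_grad_iff
proof (intro conjI allI impI L)
 fix \<psi> :: "real^'a => real" and i
 assume \<psi>: "smooth \<psi> \<and> (\<exists>R. \<forall>v. norm v > R \<longrightarrow> \<psi> v = 0)"
 then have S: "(%v. \<psi> v / gdens v) \<in> L2 gauss" "(%v. frechet_derivative \<psi> (at v) (axis i 1) / gdens v) \<in> L2 gauss"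
  using smooth_bounded_support_L2 by blast+
 have Lq: "q n \<in> L2 gauss" "g n \<in> L2 gauss" for n using H[of n] by (auto simp: H1_gauss_grad_iff)
 have "(%n. L2_norm gauss (%v. g n v $ i - h v $ i)) \<leadsto> 0"
 proof (rule Lim_null_sandwich[OF _ _ lim(2)])
  show "L2_norm gauss (%v. g n v $ i - h v $ i) <= L2_norm gauss (g n -. h)" for n
   using L2_norm_component_le[OF L2_diff[OF Lq(2) L(2)], of n i] by simp
 qed simp
 then have "(%n. - ip gauss (%v. g n v $ i) (%v. \<psi> v / gdens v)) \<leadsto> - ip gauss (%v. h v $ i) (%v. \<psi> v / gdens v)"
  by (intro tendsto_minus ip_tendsto L2_component Lq L S)
 moreover have "(%n. ip gauss (q n) (%v. frechet_derivative \<psi> (at v) (axis i 1) / gdens v)) \<leadsto> ip gauss p (%v. frechet_derivative \<psi> (at v) (axis i 1) / gdens v)"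
  by (intro ip_tendsto Lq L S lim)
 moreover have "ip gauss (q n) (%v. frechet_derivative \<psi> (at v) (axis i 1) / gdens v) = - ip gauss (%v. g n v $ i) (%v. \<psi> v / gdens v)" for n
  using H[of n] \<psi> unfolding H1_gauss_grad_iff by blast
 ultimately show "ip gauss p (%v. frechet_derivative \<psi> (at v) (axis i 1) / gdens v) = - ip gauss (%v. h v $ i) (%v. \<psi> v / gdens v)"
  by (simp add: LIMSEQ_unique)
qed

text \<open>The test functions \<open>\<psi> = nhm m \<cdot> chi R \<cdot> gdens\<close> turn the weak gradient into a relation between
 Hermite coefficients.\<close>

lemma H1_gauss_grad_hermite:
 assumes H: "H1_gauss_grad q g"
 shows "sqrt (real (Suc (m i))) * ip gauss q (nhm (up m i)) = ip gauss (%v. g v $ i) (nhm m)"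
proof -
 have Lq: "q \<in> L2 gauss" and Lg: "(%v. g v $ i) \<in> L2 gauss"
  using H L2_component[of g gauss i] by (auto simp: H1_gauss_grad_def)
 have qm: "q \<in> borel_measurable borel" "(%v. g v $ i) \<in> borel_measurable borel"
  using L2_measurable[OF Lq] L2_measurable[OF Lg] by (simp_all add: measurable_cong_sets[OF sets_gauss refl])
 obtain C where C: "0 <= C" "!!R i (v::real^'a). R > 0 ==> abs (dchi R i v) <= C / R" by (rule dchi_bound) (rule that)
 \<comment> \<open>\<open>A n\<close> is the i-th derivative of the test function divided by
   \<open>gdens\<close>: the derivative of the density and that of \<open>nhm m\<close> combine, by
   the recursion, into the raised Hermite function, and only the derivative of the cutoff is left
   over. \<open>B n\<close> is the test function divided by \<open>gdens\<close>.\<close>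
 define A where "A n v = - sqrt (real (Suc (m i))) * nhm (up m i) v * chi (real (Suc n)) v + nhm m v * dchi (real (Suc n)) i v" for n v
 define B where "B n v = nhm m v * chi (real (Suc n)) v" for n v
 have cA: "continuous_on UNIV (A n)" and cB: "continuous_on UNIV (B n)" for n
  unfolding A_def B_def by (intro continuous_intros continuous_nhm continuous_chi continuous_dchi)+
 have mA: "A n \<in> borel_measurable borel" and mB: "B n \<in> borel_measurable borel" for n
  using cA cB by (auto intro: borel_measurable_continuous_onI)
 have sv: "smooth_gen (%v::real^'a. v $ j)" for j by (intro smooth_gen.linear bounded_linear_vec_nth)
 have eq: "(LINT v|gauss. q v * A n v) = - (LINT v|gauss. g v $ i * B n v)" for n
 proof -
  define \<psi> where "\<psi> v = (nhm m v * chi (real (Suc n)) v) * gdens v" for v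
  have sm: "smooth \<psi>" unfolding \<psi>_def
   by (intro smooth_gen_smooth smooth_gen.mult smooth_gen_nhm smooth_gen_chi smooth_gen_gdens sv)
  have supp: "\<exists>R. \<forall>v. norm v > R \<longrightarrow> \<psi> v = 0"
   using chi_support[of "real (Suc n)"] unfolding \<psi>_def by (intro exI[of _ "real CARD('a) * real (Suc n)"]) auto
  have "has_dd \<psi> (axis i 1) (%v. (sqrt (real (m i)) * nhm (dn m i) v * chi (real (Suc n)) v + nhm m v * dchi (real (Suc n)) i v) * gdens v
    + (nhm m v * chi (real (Suc n)) v) * (- v $ i * gdens v))"
   unfolding \<psi>_def by (intro has_dd_mult has_dd_nhm has_dd_chi has_dd_gdens)
  from has_dd_unique[OF smooth_has_dd[OF sm] this]
  have d: "frechet_derivative \<psi> (at v) (axis i 1) = gdens v * A n v" for v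
  proof -
   have "(nhm m v * chi (real (Suc n)) v) * (- v $ i * gdens v) = - (v $ i * nhm m v) * chi (real (Suc n)) v * gdens v"
    by simp
   then show ?thesis
    using \<open>!!x. frechet_derivative \<psi> (at x) (axis i 1) = _ x\<close>[of v]
    unfolding nhm_rec A_def by (simp add: algebra_simps)
  qed
  have "(LINT v|lborel. q v * frechet_derivative \<psi> (at v) (axis i 1)) = - (LINT v|lborel. g v $ i * \<psi> v)"
   using H sm supp unfolding H1_gauss_grad_def by blast
  moreover have "(LINT v|gauss. q v * A n v) = (LINT v|lborel. gdens v * (q v * A n v))"
   using qm mA by (intro LINT_gauss) measurable
  moreover have "(LINT v|gauss. g v $ i * B n v) = (LINT v|lborel. gdens v * (g v $ i * B n v))"
   using qm mB by (intro LINT_gauss) measurable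
  ultimately show ?thesis by (simp add: d B_def \<psi>_def mult_ac)
 qed
 have [measurable]: "q \<in> borel_measurable gauss" "(%v. g v $ i) \<in> borel_measurable gauss"
  using L2_measurable[OF Lq] L2_measurable[OF Lg] .
 have [measurable]: "A n \<in> borel_measurable gauss" "B n \<in> borel_measurable gauss" "nhm \<beta> \<in> borel_measurable gauss" for n \<beta>
  using mA mB borel_measurable_nhm by (simp_all add: measurable_cong_sets[OF sets_gauss refl])
 define G where "G v = sqrt (real (Suc (m i))) * abs (nhm (up m i) v) + abs (nhm m v) * C" for v
 have eG: "exp_bounded G" unfolding G_def
  by (intro exp_bounded_add exp_bounded_mult exp_bounded_const exp_bounded_abs exp_bounded_nhm)
 have dC: "abs (dchi (real (Suc n)) i v) <= C" for n and v :: "real^'a"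
 proof -
  have "C / real (Suc n) <= C / 1" using C(1) by (intro divide_left_mono) auto
  then show ?thesis using C(2)[of "real (Suc n)" i v] by simp
 qed
 have bA: "abs (A n v) <= G v" for n v
 proof -
  have "abs (sqrt (real (Suc (m i))) * nhm (up m i) v * chi (real (Suc n)) v) <= sqrt (real (Suc (m i))) * abs (nhm (up m i) v) * 1"
   unfolding abs_mult using chi_bounds[of "real (Suc n)" v] by (intro mult_mono) auto
  moreover have "abs (nhm m v * dchi (real (Suc n)) i v) <= abs (nhm m v) * C"
   unfolding abs_mult using dC by (intro mult_left_mono) auto
  ultimately show ?thesis unfolding A_def G_def by linarith
 qed
 have i1: "(%n. LINT v|gauss. q v * A n v) \<leadsto> (LINT v|gauss. q v * (- sqrt (real (Suc (m i))) * nhm (up m i) v))"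
 proof (rule integral_dominated_convergence[where w="%v. abs (q v * G v)"])
  have "G \<in> L2 gauss"
  proof (rule exp_bounded_L2[OF _ eG])
   show "G \<in> borel_measurable borel" unfolding G_def
    by (intro borel_measurable_continuous_onI continuous_intros continuous_nhm)
  qed
  then show "integrable gauss (%v. abs (q v * G v))" by (intro integrable_abs L2_integrable_mult Lq)
  show "AE v in gauss. (%n. q v * A n v) \<leadsto> q v * (- sqrt (real (Suc (m i))) * nhm (up m i) v)"
  proof (rule AE_I2)
   fix v :: "real^'a"
   have "(%n. q v * A n v) \<leadsto> q v * (- sqrt (real (Suc (m i))) * nhm (up m i) v * 1 + nhm m v * 0)"
    unfolding A_def by (intro tendsto_intros chi_tendsto dchi_tendsto)
   then show "(%n. q v * A n v) \<leadsto> q v * (- sqrt (real (Suc (m i))) * nhm (up m i) v)" by simp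
  qed
  show "AE v in gauss. norm (q v * A n v) <= abs (q v * G v)" for n
  proof (rule AE_I2)
   fix v
   have "abs (A n v) <= abs (G v)" using bA[of n v] by linarith
   then show "norm (q v * A n v) <= abs (q v * G v)" by (simp add: abs_mult mult_left_mono)
  qed
  show "(%v. q v * (- sqrt (real (Suc (m i))) * nhm (up m i) v)) \<in> borel_measurable gauss" by measurable
  show "(%v. q v * A n v) \<in> borel_measurable gauss" for n by measurable
 qed
 have i2: "(%n. LINT v|gauss. g v $ i * B n v) \<leadsto> (LINT v|gauss. g v $ i * nhm m v)"
 proof (rule integral_dominated_convergence[where w="%v. abs (g v $ i * nhm m v)"])
  show "integrable gauss (%v. abs (g v $ i * nhm m v))" by (intro integrable_abs L2_integrable_mult Lg nhm_L2)
  show "AE v in gauss. (%n. g v $ i * B n v) \<leadsto> g v $ i * nhm m v"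
  proof (rule AE_I2)
   fix v :: "real^'a"
   have "(%n. g v $ i * B n v) \<leadsto> g v $ i * (nhm m v * 1)"
    unfolding B_def by (intro tendsto_intros chi_tendsto)
   then show "(%n. g v $ i * B n v) \<leadsto> g v $ i * nhm m v" by simp
  qed
  show "AE v in gauss. norm (g v $ i * B n v) <= abs (g v $ i * nhm m v)" for n
  proof (rule AE_I2)
   fix v
   have "abs (B n v) <= abs (nhm m v)" using chi_bounds[of "real (Suc n)" v] by (simp add: B_def abs_mult mult_left_le)
   then show "norm (g v $ i * B n v) <= abs (g v $ i * nhm m v)" by (simp add: abs_mult mult_left_mono)
  qed
  show "(%v. g v $ i * nhm m v) \<in> borel_measurable gauss" by measurable
  show "(%v. g v $ i * B n v) \<in> borel_measurable gauss" for n by measurable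
 qed
 have "(%n. LINT v|gauss. q v * A n v) \<leadsto> - (LINT v|gauss. g v $ i * nhm m v)"
  unfolding eq by (rule tendsto_minus[OF i2])
 from LIMSEQ_unique[OF i1 this]
 have "(LINT v|gauss. q v * (- sqrt (real (Suc (m i))) * nhm (up m i) v)) = - (LINT v|gauss. g v $ i * nhm m v)" .
 moreover have "(%v. q v * (- sqrt (real (Suc (m i))) * nhm (up m i) v)) = (%v. (- sqrt (real (Suc (m i)))) * (q v * nhm (up m i) v))"
  by auto
 ultimately have "(- sqrt (real (Suc (m i)))) * (LINT v|gauss. q v * nhm (up m i) v) = - (LINT v|gauss. g v $ i * nhm m v)"
  by (simp only: integral_mult_right_zero)
 then show ?thesis by (simp add: ip_def)
qed

text \<open>The slice identity multiplied by \<open>cas k\<close> and integrated over the torus.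
  Every coefficient of the gradient is a multiple of a coefficient of u of higher degree.\<close>

lemma has_v_grad_hermite:
 assumes H: "has_v_grad u g"
 shows "sqrt (real (Suc (m i))) * ip mu u (ebas (k, up m i)) = ip mu (%z. g z $ i) (ebas (k, m))"
proof -
 have L: "u \<in> L2 mu" "(%z. g z $ i) \<in> L2 mu" using H L2_component by (auto simp: has_v_grad_def)
 let ?c = "sqrt (real (Suc (m i)))"
 let ?F = "%z. ?c * (u z * ebas (k, up m i) z) - g z $ i * ebas (k, m) z"
 have I: "integrable mu (%z. u z * ebas (k, up m i) z)" "integrable mu (%z. g z $ i * ebas (k, m) z)"
  by (intro L2_integrable_mult L ebas_L2)+
 then have IF: "integrable mu ?F" by auto
 have "AE x in torus. H1_gauss_grad (%v. u (x, v)) (%v. g (x, v))" using H by (simp add: has_v_grad_def)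
 then have "AE x in torus. (LINT v|gauss. ?F (x, v)) = 0"
 proof eventually_elim
  case (elim x)
  have Lx: "(%v. u (x, v)) \<in> L2 gauss" "(%v. g (x, v) $ i) \<in> L2 gauss"
   using elim L2_component[of "%v. g (x, v)" gauss i] by (auto simp: H1_gauss_grad_def)
  have "(LINT v|gauss. ?F (x, v)) = (LINT v|gauss. cas k x * (?c * (u (x, v) * nhm (up m i) v) - g (x, v) $ i * nhm m v))"
   by (simp add: ebas_def algebra_simps)
  also have "\<dots> = cas k x * (?c * (LINT v|gauss. u (x, v) * nhm (up m i) v) - (LINT v|gauss. g (x, v) $ i * nhm m v))"
   using L2_integrable_mult[OF Lx(1) nhm_L2[of "up m i"]] L2_integrable_mult[OF Lx(2) nhm_L2[of m]] by simp
  also have "\<dots> = 0" using H1_gauss_grad_hermite[OF elim, of m i] by (simp add: ip_def)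
  finally show ?case .
 qed
 then have "(LINT x|torus. LINT v|gauss. ?F (x, v)) = 0" by (rule integral_eq_zero_AE)
 then have "(LINT z|mu. ?F z) = 0" using mu_Fubini(1)[OF IF] by simp
 then show ?thesis using I by (simp add: ip_def)
qed

section \<open>Uniqueness, linearity and closedness of the velocity gradient\<close>

lemma has_v_grad_L2: "has_v_grad u g ==> u \<in> L2 mu" "has_v_grad u g ==> g \<in> L2 mu"
 by (auto simp: has_v_grad_def)

text \<open>All basis coefficients of the gradient are determined by those of u, and the basis is
  complete.\<close>

lemma has_v_grad_unique:
 assumes "has_v_grad u g" "has_v_grad u h"
 shows "AE z in mu. g z = h z"
proof -
 have L: "g \<in> L2 mu" "h \<in> L2 mu" using assms by (auto simp: has_v_grad_def)
 have "AE z in mu. g z $ i - h z $ i = 0" for i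
 proof (rule eb.closed_span_orth_eq_0[OF ebas_complete])
  show "(%z. g z $ i - h z $ i) \<in> L2 mu" by (intro L2_diff L2_component L)
  fix j :: "'a idx"
  show "ip mu (%z. g z $ i - h z $ i) (ebas j) = 0"
   using has_v_grad_hermite[OF assms(1), of "snd j" i "fst j"] has_v_grad_hermite[OF assms(2), of "snd j" i "fst j"]
   by (simp add: ip_diff_left L2_component L ebas_L2)
 qed
 then have "AE z in mu. \<forall>i. g z $ i - h z $ i = 0" by (simp add: AE_all_countable)
 then show ?thesis by eventually_elim (simp add: vec_eq_iff)
qed

lemma has_v_grad_comb:
 assumes "has_v_grad u g" "has_v_grad w h"
 shows "has_v_grad (%z. a * u z + b * w z) (%z. a *\<^sub>R g z + b *\<^sub>R h z)"
 unfolding has_v_grad_def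
proof (intro conjI)
 show "(%z. a * u z + b * w z) \<in> L2 mu" using assms by (intro L2_comb) (auto simp: has_v_grad_def)
 show "(%z. a *\<^sub>R g z + b *\<^sub>R h z) \<in> L2 mu" using assms by (intro L2_add L2_scaleR) (auto simp: has_v_grad_def)
 have "AE x in torus. H1_gauss_grad (%v. u (x, v)) (%v. g (x, v))" "AE x in torus. H1_gauss_grad (%v. w (x, v)) (%v. h (x, v))"
  using assms by (auto simp: has_v_grad_def)
 then show "AE x in torus. H1_gauss_grad (%v. a * u (x, v) + b * w (x, v)) (%v. a *\<^sub>R g (x, v) + b *\<^sub>R h (x, v))"
  by eventually_elim (rule H1_gauss_grad_comb)
qed

text \<open>By Fubini the squared slice norms have summable integrals over the torus, so they tend
  to 0 for almost every x.\<close>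

lemma mu_slices_tendsto:
 fixes f :: "nat => 'n::finite phase => 'b::euclidean_space"
 assumes L: "!!n. f n \<in> L2 mu" "g \<in> L2 mu" and rapid: "!!n. L2_norm mu (f n -. g) <= (1/2) ^ n"
 shows "AE x in torus. (%n. L2_norm gauss (%v. f n (x, v) - g (x, v))) \<leadsto> 0"
proof -
 have I: "integrable mu (%z. (norm (f n z - g z))^2)" for n by (intro L2_integrable_sq L2_diff L)
 have "AE x in torus. summable (%n. LINT v|gauss. (norm (f n (x, v) - g (x, v)))^2)"
 proof (rule AE_summable_of_integrals)
  show "integrable torus (%x. LINT v|gauss. (norm (f n (x, v) - g (x, v)))^2)" for n
   using tg.integrable_fst'[OF I[of n, unfolded mu_def]] .
  show "summable (%n. LINT x|torus. LINT v|gauss. (norm (f n (x, v) - g (x, v)))^2)"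
  proof (rule summable_comparison_test')
   show "summable (%n. (1/2::real) ^ n)" by (intro summable_geometric) auto
   fix n :: nat
   have "(LINT x|torus. LINT v|gauss. (norm (f n (x, v) - g (x, v)))^2) = (L2_norm mu (f n -. g))^2"
    unfolding L2_norm_sq by (rule mu_Fubini(1)[OF I])
   also have "\<dots> <= ((1/2) ^ n)^2" by (intro power_mono rapid) simp
   also have "\<dots> <= (1/2::real) ^ n" by (simp add: power2_eq_square mult_le_cancel_left1 power_le_one)
   finally have "(LINT x|torus. LINT v|gauss. (norm (f n (x, v) - g (x, v)))^2) <= (1/2) ^ n" .
   moreover have "0 <= (LINT x|torus. LINT v|gauss. (norm (f n (x, v) - g (x, v)))^2)"
    by (intro integral_nonneg_AE AE_I2) simp
   ultimately show "norm (LINT x|torus. LINT v|gauss. (norm (f n (x, v) - g (x, v)))^2) <= (1/2) ^ n"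
    by simp
  qed
 qed (intro integral_nonneg_AE AE_I2, simp)
 then show ?thesis
 proof eventually_elim
  case (elim x)
  then have "(%n. sqrt (LINT v|gauss. (norm (f n (x, v) - g (x, v)))^2)) \<leadsto> sqrt 0"
   by (intro tendsto_real_sqrt summable_LIMSEQ_zero)
  then show ?case by (simp add: L2_norm_def)
 qed
qed

text \<open>Convergence in \<open>mu\<close> is passed to almost every slice along a common rapid
  subsequence for functions and gradients; there the one-slice limit theorem applies.\<close>

lemma has_v_grad_limit:
 assumes H: "!!n. has_v_grad (u n) (g n)" and L: "w \<in> L2 mu" "h \<in> L2 mu"
  and lim: "(%n. L2_norm mu (u n -. w)) \<leadsto> 0" "(%n. L2_norm mu (g n -. h)) \<leadsto> 0"
 shows "has_v_grad w h"
proof -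
 obtain r :: "nat => nat" where r: "strict_mono r" "!!n. L2_norm mu (u (r n) -. w) <= (1/2)^n"
  by (rule L2_AE_subseq[OF lim(1)]) (rule that)
 have "(%n. L2_norm mu (g (r n) -. h)) \<leadsto> 0"
  using LIMSEQ_subseq_LIMSEQ[OF lim(2) r(1)] by (simp add: o_def)
 then obtain s :: "nat => nat" where s: "strict_mono s" "!!n. L2_norm mu (%z. g (r (s n)) z - h z) <= (1/2)^n"
  by (rule L2_AE_subseq) (rule that)
 \<comment> \<open>Thinning out a second time keeps the rate because \<open>s n\<close> is at least
   n.\<close>
 have u': "L2_norm mu (%z. u (r (s n)) z - w z) <= (1/2)^n" for n
 proof -
  have "(1/2::real) ^ s n <= (1/2) ^ n" using seq_suble[OF s(1), of n] by (intro power_decreasing) auto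
  then show ?thesis using r(2)[of "s n"] by linarith
 qed
 note HL = has_v_grad_L2(1)[OF H] has_v_grad_L2(2)[OF H]
 have A: "AE x in torus. \<forall>n. H1_gauss_grad (%v. u (r (s n)) (x, v)) (%v. g (r (s n)) (x, v))"
  unfolding AE_all_countable using H by (auto simp: has_v_grad_def)
 have B: "AE x in torus. (%n. L2_norm gauss (%v. u (r (s n)) (x, v) - w (x, v))) \<leadsto> 0"
  by (rule mu_slices_tendsto[OF HL(1) L(1) u'])
 have C: "AE x in torus. (%n. L2_norm gauss (%v. g (r (s n)) (x, v) - h (x, v))) \<leadsto> 0"
  by (rule mu_slices_tendsto[OF HL(2) L(2) s(2)])
 have "AE x in torus. H1_gauss_grad (%v. w (x, v)) (%v. h (x, v))"
  using A B C mu_L2_slices[OF L(1)] mu_L2_slices[OF L(2)]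
 proof eventually_elim
  case (elim x)
  show ?case by (rule H1_gauss_grad_limit[OF _ elim(4,5,2,3)]) (use elim(1) in blast)
 qed
 then show ?thesis using L by (simp add: has_v_grad_def)
qed

text \<open>The constant sequence u converges to w in the seminorm, so closedness under limits gives
  the claim.\<close>

lemma has_v_grad_cong_AE:
 assumes H: "has_v_grad u g" and m: "w \<in> borel_measurable mu" and eq: "AE z in mu. u z = w z"
 shows "has_v_grad w g"
proof -
 have L: "u \<in> L2 mu" "g \<in> L2 mu" using H by (auto simp: has_v_grad_def)
 have w: "w \<in> L2 mu"
  by (rule L2_dominated[OF m L2_integrable_sq[OF L(1)]]) (use eq in \<open>auto elim!: eventually_mono\<close>)
 have "L2_norm mu (u -. w) = 0"
  using eq by (subst L2_norm_eq_0_iff[OF L2_diff[OF L(1) w]]) (auto elim!: eventually_mono)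
 then show ?thesis by (intro has_v_grad_limit[of "%_. u" "%_. g", OF H w L(2)]) simp_all
qed

lemma has_v_grad_C1:
 fixes f :: "'n::finite phase => real"
 assumes c: "continuous_on UNIV f" "continuous_on UNIV G"
  and dd: "!!x i. has_dd (%v. f (x, v)) (axis i 1) (%v. G (x, v) $ i)"
  and L: "f \<in> L2 mu" "G \<in> L2 mu"
 shows "has_v_grad f G"
 unfolding has_v_grad_def
proof (intro conjI L)
 show "AE x in torus. H1_gauss_grad (%v. f (x, v)) (%v. G (x, v))"
  using mu_L2_slices[OF L(1)] mu_L2_slices[OF L(2)]
 proof eventually_elim
  case (elim x)
  show ?case
   unfolding H1_gauss_grad_def
  proof (intro conjI elim allI impI)
   fix \<psi> :: "real^'n => real" and i
   assume \<psi>: "smooth \<psi> \<and> (\<exists>R. \<forall>v. norm v > R \<longrightarrow> \<psi> v = 0)"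
   then obtain R where R: "!!v. norm v > R ==> \<psi> v = 0" by auto
   have p: "continuous_on UNIV (%v::real^'n. (x, v))" by (intro continuous_intros)
   have c1: "continuous_on UNIV (%v. f (x, v))" by (rule continuous_on_compose2[OF c(1) p]) simp
   have c2: "continuous_on UNIV (%v. G (x, v) $ i)"
    by (intro continuous_intros continuous_on_compose2[OF c(2) p]) simp
   show "(LINT v|lborel. f (x, v) * frechet_derivative \<psi> (at v) (axis i 1)) = - (LINT v|lborel. G (x, v) $ i * \<psi> v)"
    by (rule lborel_by_parts_compact[OF dd smooth_has_dd c1 c2 smooth_continuous smooth_continuous_derivative R])
     (use \<psi> in auto)
  qed
 qed
qed

definition ebas_grad :: "'n::finite idx => 'n phase => real^'n" where
 "ebas_grad j z = (\<chi> i. sqrt (real (snd j i)) * ebas (fst j, dn (snd j) i) z)"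

lemma has_v_grad_ebas: "has_v_grad (ebas j) (ebas_grad j)"
proof (rule has_v_grad_C1)
 show "continuous_on UNIV (ebas_grad j)"
  unfolding ebas_grad_def by (intro continuous_on_vec_lambda continuous_intros continuous_ebas)
 show "has_dd (%v. ebas j (x, v)) (axis i 1) (%v. ebas_grad j (x, v) $ i)" for x i
  using has_dd_cmult[OF has_dd_nhm[of "snd j" i], of "cas (fst j) x"]
  by (simp add: ebas_def ebas_grad_def mult_ac)
 show "ebas_grad j \<in> L2 mu"
  by (rule L2_vec) (simp add: ebas_grad_def L2_scale ebas_L2)
qed (rule continuous_ebas, rule ebas_L2)

section \<open>The spaces \<open>V\<close> and \<open>V_dual\<close>\<close>

lemma V_has_v_grad:
 assumes "u \<in> V"
 shows "has_v_grad u (Dv u)"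
proof -
 have "\<exists>g. has_v_grad u g" using assms by (simp add: V_def)
 then show ?thesis unfolding Dv_def by (rule someI_ex)
qed

lemma has_v_grad_V: "has_v_grad u g ==> u \<in> V"
 unfolding V_def by blast

lemma V_L2: "u \<in> V ==> u \<in> L2 mu" and Dv_L2: "u \<in> V ==> Dv u \<in> L2 mu"
 using V_has_v_grad has_v_grad_L2 by blast+

lemma Dv_eq: "has_v_grad u g ==> AE z in mu. Dv u z = g z"
 using has_v_grad_unique[OF V_has_v_grad[OF has_v_grad_V]] by blast

lemma V_norm_sq: "(V_norm u)^2 = (L2_norm mu u)^2 + (L2_norm mu (Dv u))^2"
 by (simp add: V_norm_def)

lemma L2_norm_Dv:
 assumes "has_v_grad u g"
 shows "L2_norm mu (Dv u) = L2_norm mu g"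
 by (rule L2_norm_cong_AE[OF L2_measurable[OF Dv_L2[OF has_v_grad_V[OF assms]]]
   L2_measurable[OF has_v_grad_L2(2)[OF assms]] Dv_eq[OF assms]])

lemma V_norm_eq: "has_v_grad u g ==> V_norm u = sqrt ((L2_norm mu u)^2 + (L2_norm mu g)^2)"
 by (simp add: V_norm_def L2_norm_Dv)

lemma V_norm_nonneg: "0 <= V_norm u"
 by (simp add: V_norm_def)

lemma L2_norm_le_V_norm: "L2_norm mu u <= V_norm u" "L2_norm mu (Dv u) <= V_norm u"
 unfolding V_norm_def by (simp_all add: real_le_rsqrt)

lemma L2_norm_comb_le:
 fixes f g :: "'a => 'b::euclidean_space"
 assumes "f \<in> L2 M" "g \<in> L2 M"
 shows "L2_norm M (%z. a *\<^sub>R f z + b *\<^sub>R g z) <= abs a * L2_norm M f + abs b * L2_norm M g"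
 using L2_norm_triangle[OF L2_scaleR[OF assms(1), of a] L2_scaleR[OF assms(2), of b]]
 by (simp only: L2_norm_scaleR)

lemma seminormed_V: "seminormed (V :: ('n::finite phase => real) set) V_norm"
proof
 have "has_v_grad (%z::'n phase. 0 * ebas j z + 0 * ebas j z) (%z. 0 *\<^sub>R ebas_grad j z + 0 *\<^sub>R ebas_grad j z)" for j
  by (intro has_v_grad_comb has_v_grad_ebas)
 then show "(%_. 0) \<in> (V :: ('n phase => real) set)" using has_v_grad_V by simp
 fix u w :: "'n phase => real" and a b :: real
 assume uw: "u \<in> V" "w \<in> V"
 note H = has_v_grad_comb[OF V_has_v_grad[OF uw(1)] V_has_v_grad[OF uw(2)], of a b]
 show "(%z. a * u z + b * w z) \<in> V" by (rule has_v_grad_V[OF H])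
 show "0 <= V_norm u" by (rule V_norm_nonneg)
 have "V_norm (%z. a * u z + b * w z) <= sqrt ((abs a * L2_norm mu u + abs b * L2_norm mu w)^2 + (abs a * L2_norm mu (Dv u) + abs b * L2_norm mu (Dv w))^2)"
  unfolding V_norm_eq[OF H]
  using L2_norm_comb_le[OF V_L2[OF uw(1)] V_L2[OF uw(2)], of a b] L2_norm_comb_le[OF Dv_L2[OF uw(1)] Dv_L2[OF uw(2)], of a b]
  by (intro real_sqrt_le_mono add_mono power_mono) simp_all
 also have "\<dots> <= sqrt ((abs a * L2_norm mu u)^2 + (abs a * L2_norm mu (Dv u))^2) + sqrt ((abs b * L2_norm mu w)^2 + (abs b * L2_norm mu (Dv w))^2)"
  by (rule real_sqrt_sum_squares_triangle_ineq)
 also have "\<dots> = abs a * V_norm u + abs b * V_norm w"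
  by (simp add: V_norm_def power_mult_distrib real_sqrt_mult flip: distrib_left)
 finally show "V_norm (%z. a * u z + b * w z) <= abs a * V_norm u + abs b * V_norm w" .
qed

interpretation V: seminormed "V :: ('n::finite phase => real) set" V_norm by (rule seminormed_V)

lemma Dv_diff:
 assumes "u \<in> V" "w \<in> V"
 shows "AE z in mu. Dv (u -. w) z = Dv u z - Dv w z"
 using Dv_eq[OF has_v_grad_comb[OF V_has_v_grad[OF assms(1)] V_has_v_grad[OF assms(2)], of 1 "-1"]] by simp

lemma ip_Dv_diff_left:
 assumes "u \<in> V" "u' \<in> V" "w \<in> V"
 shows "ip mu (Dv (u -. u')) (Dv w) = ip mu (Dv u) (Dv w) - ip mu (Dv u') (Dv w)"
proof -
 have "ip mu (Dv (u -. u')) (Dv w) = ip mu (Dv u -. Dv u') (Dv w)"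
  using Dv_diff[OF assms(1,2)] assms by (intro ip_cong_AE Dv_L2 L2_diff V.diff_mem) auto
 then show ?thesis using assms by (simp add: ip_diff_left Dv_L2)
qed

lemma ip_Dv_diff_right:
 assumes "u \<in> V" "w \<in> V" "w' \<in> V"
 shows "ip mu (Dv u) (Dv (w -. w')) = ip mu (Dv u) (Dv w) - ip mu (Dv u) (Dv w')"
 using ip_Dv_diff_left[OF assms(2,3,1)] by (simp add: ip_commute)

lemma ip_Dv_comb_right:
 assumes "u \<in> V" "w \<in> V" "w' \<in> V"
 shows "ip mu (Dv u) (Dv (%z. a * w z + b * w' z)) = a * ip mu (Dv u) (Dv w) + b * ip mu (Dv u) (Dv w')"
proof -
 note L = Dv_L2[OF assms(2)] Dv_L2[OF assms(3)]
 have "ip mu (Dv (%z. a * w z + b * w' z)) (Dv u) = ip mu (%z. a *\<^sub>R Dv w z + b *\<^sub>R Dv w' z) (Dv u)"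
  using Dv_eq[OF has_v_grad_comb[OF V_has_v_grad[OF assms(2)] V_has_v_grad[OF assms(3)], of a b]] assms L
  by (intro ip_cong_AE Dv_L2 L2_add L2_scaleR V.comb_mem) auto
 also have "\<dots> = a * ip mu (Dv w) (Dv u) + b * ip mu (Dv w') (Dv u)"
  using L Dv_L2[OF assms(1)] by (simp add: ip_add_left L2_scaleR ip_scaleR_left)
 finally show ?thesis by (simp add: ip_commute)
qed

lemma ip_Dv_bound:
 assumes "u \<in> V" "w \<in> V"
 shows "abs (ip mu (Dv u) (Dv w)) <= V_norm u * V_norm w"
proof -
 have "abs (ip mu (Dv u) (Dv w)) <= L2_norm mu (Dv u) * L2_norm mu (Dv w)"
  by (intro ip_Cauchy_Schwarz Dv_L2 assms)
 also have "\<dots> <= V_norm u * V_norm w"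
  by (intro mult_mono L2_norm_le_V_norm V_norm_nonneg L2_norm_nonneg)
 finally show ?thesis .
qed

lemma V_cong_AE:
 assumes "u \<in> V" "w \<in> borel_measurable mu" "AE z in mu. u z = w z"
 shows "w \<in> V" "V_norm (u -. w) = 0" "AE z in mu. Dv u z = Dv w z"
proof -
 have H: "has_v_grad w (Dv u)" by (rule has_v_grad_cong_AE[OF V_has_v_grad[OF assms(1)] assms(2,3)])
 show wV: "w \<in> V" by (rule has_v_grad_V[OF H])
 have "has_v_grad (%z. 1 * u z + (-1) * w z) (%z. 1 *\<^sub>R Dv u z + (-1) *\<^sub>R Dv u z)"
  by (rule has_v_grad_comb[OF V_has_v_grad[OF assms(1)] H])
 then have D: "has_v_grad (u -. w) (%z. 0)" by simp
 have "L2_norm mu (u -. w) = 0"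
  using assms(3) by (subst L2_norm_eq_0_iff[OF L2_diff[OF V_L2[OF assms(1)] V_L2[OF wV]]]) (auto elim!: eventually_mono)
 then show "V_norm (u -. w) = 0" by (simp add: V_norm_eq[OF D])
 show "AE z in mu. Dv u z = Dv w z" using Dv_eq[OF H] by eventually_elim simp
qed

lemma V_dual_comb:
 "F \<in> V_dual ==> u \<in> V ==> w \<in> V ==> F (%z. a * u z + b * w z) = a * F u + b * F w"
 unfolding V_dual_def by blast

lemma V_dual_diff: "F \<in> V_dual ==> u \<in> V ==> w \<in> V ==> F (u -. w) = F u - F w"
 using V_dual_comb[of F u w 1 "-1"] by simp

lemma V_dual_zero: "F \<in> V_dual ==> F (%_. 0) = 0"
 using V_dual_comb[of F "%_. 0" "%_. 0" 0 0] V.zero_mem by simp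

lemma V_dual_bounded:
 assumes "F \<in> V_dual"
 obtains C where "!!u. u \<in> V ==> abs (F u) <= C * V_norm u"
proof -
 have "\<exists>C. \<forall>u\<in>V. abs (F u) <= C * V_norm u" using assms unfolding V_dual_def by blast
 then obtain C where "\<forall>u\<in>V. abs (F u) <= C * V_norm u" by (rule exE)
 then show thesis by (intro that) blast
qed

lemma V_dual_norm_bdd:
 fixes F :: "('n::finite phase => real) => real"
 assumes "F \<in> V_dual"
 shows "bdd_above ((%u. abs (F u)) ` {u \<in> V. V_norm u <= 1})"
proof -
 obtain C where C: "!!u. u \<in> V ==> abs (F u) <= C * V_norm u" using V_dual_bounded[OF assms] by blast
 show ?thesis
 proof (rule bdd_aboveI2)
  fix u :: "'n phase => real" assume u: "u \<in> {u \<in> V. V_norm u <= 1}"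
  have "abs (F u) <= abs C * V_norm u"
   using C[of u] u mult_right_mono[OF abs_ge_self[of C] V_norm_nonneg[of u]] by auto
  also have "\<dots> <= abs C * 1" using u by (intro mult_left_mono) auto
  finally show "abs (F u) <= abs C" by simp
 qed
qed

lemma V_dual_norm_nonneg:
 assumes "F \<in> V_dual"
 shows "0 <= V_dual_norm F"
proof -
 have "abs (F (%_. 0)) <= V_dual_norm F"
  unfolding V_dual_norm_def
  by (rule cSUP_upper[OF _ V_dual_norm_bdd[OF assms]]) (simp add: V.zero_mem V.N_zero)
 then show ?thesis by linarith
qed

text \<open>Scaling to norm 1 fails when the seminorm of u is 0; there the boundedness in
  \<open>V_dual\<close> forces \<open>F u = 0\<close>.\<close>

lemma V_dual_bound:
 assumes F: "F \<in> V_dual" and u: "u \<in> V"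
 shows "abs (F u) <= V_dual_norm F * V_norm u"
proof (cases "V_norm u = 0")
 case True
 obtain C where C: "!!u. u \<in> V ==> abs (F u) <= C * V_norm u" using V_dual_bounded[OF F] by blast
 show ?thesis using C[OF u] True by simp
next
 case False
 then have p: "V_norm u > 0" using V_norm_nonneg[of u] by linarith
 let ?w = "%z. (1 / V_norm u) * u z"
 have w: "?w \<in> V" by (rule V.scale_mem[OF u])
 have "V_norm ?w <= 1"
  using V.N_comb[OF u u, of "1 / V_norm u" 0] p by simp
 then have "abs (F ?w) <= V_dual_norm F"
  unfolding V_dual_norm_def using w by (intro cSUP_upper[OF _ V_dual_norm_bdd[OF F]]) simp
 moreover have "F ?w = (1 / V_norm u) * F u"
  using V_dual_comb[OF F u u, of "1 / V_norm u" 0] by simp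
 ultimately have "abs (F u) / V_norm u <= V_dual_norm F" using p by (simp add: abs_mult)
 then show ?thesis using p by (simp add: pos_divide_le_eq)
qed

lemma V_dual_norm_le:
 fixes F :: "('n::finite phase => real) => real"
 assumes "0 <= C" "!!u. u \<in> V ==> abs (F u) <= C * V_norm u"
 shows "V_dual_norm F <= C"
 unfolding V_dual_norm_def
proof (rule cSUP_least)
 show "{u :: 'n phase => real. u \<in> V \<and> V_norm u <= 1} \<noteq> {}"     by (rule ex_in_conv[THEN iffD1], rule exI[of _ "%_. 0"]) (simp add: V.zero_mem V.N_zero)
 fix u :: "'n phase => real" assume u: "u \<in> {u \<in> V. V_norm u <= 1}"
 then have "abs (F u) <= C * V_norm u" using assms(2) by simp
 also have "\<dots> <= C * 1" using u assms(1) by (intro mult_left_mono) auto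
 finally show "abs (F u) <= C" by simp
qed

lemma V_dual_I:
 assumes "!!u w a b. u \<in> V ==> w \<in> V ==> F (%z. a * u z + b * w z) = a * F u + b * F w"
  and "!!u. u \<in> V ==> abs (F u) <= C * V_norm u"
 shows "F \<in> V_dual"
 unfolding V_dual_def using assms by blast

lemma seminormed_V_dual: "seminormed (V_dual :: (('n::finite phase => real) => real) set) V_dual_norm"
proof
 show "(%_. 0) \<in> (V_dual :: (('n phase => real) => real) set)" by (rule V_dual_I[where C=0]) auto
 fix F G :: "('n phase => real) => real" and a b :: real
 assume FG: "F \<in> V_dual" "G \<in> V_dual"
 show "0 <= V_dual_norm F" by (rule V_dual_norm_nonneg[OF FG(1)])
 have bd: "abs (a * F u + b * G u) <= (abs a * V_dual_norm F + abs b * V_dual_norm G) * V_norm u" if "u \<in> V" for u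
 proof -
  have "abs (a * F u + b * G u) <= abs a * abs (F u) + abs b * abs (G u)"
   using abs_triangle_ineq[of "a * F u" "b * G u"] by (simp add: abs_mult)
  also have "\<dots> <= abs a * (V_dual_norm F * V_norm u) + abs b * (V_dual_norm G * V_norm u)"
   by (intro add_mono mult_left_mono V_dual_bound FG that) auto
  finally show ?thesis by (simp add: algebra_simps)
 qed
 show "(%u. a * F u + b * G u) \<in> V_dual"
  by (rule V_dual_I[OF _ bd]) (simp add: V_dual_comb[OF FG(1)] V_dual_comb[OF FG(2)] algebra_simps)
 show "V_dual_norm (%u. a * F u + b * G u) <= abs a * V_dual_norm F + abs b * V_dual_norm G"
  by (rule V_dual_norm_le[OF _ bd]) (simp add: V_dual_norm_nonneg FG)
qed

interpretation Vd: seminormed "V_dual :: (('n::finite phase => real) => real) set" V_dual_norm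
 by (rule seminormed_V_dual)

lemma integrable_pairing_dominated:
 fixes f :: "real => real"
 assumes m: "f \<in> borel_measurable (time T)"
  and I: "integrable (time T) (%t. (a t)^2)" "integrable (time T) (%t. (b t)^2)"
  and b: "AE t in time T. abs (f t) <= a t * b t"
 shows "integrable (time T) f"
proof (rule integrable_dominated[OF _ m])
 show "integrable (time T) (%t. (a t)^2 + (b t)^2)" using I by (rule integrable_plus)
 show "AE t in time T. norm (f t) <= norm ((a t)^2 + (b t)^2)"
  using b
 proof eventually_elim
  case (elim t)
  have "2 * (a t * b t) <= (a t)^2 + (b t)^2" using sum_squares_bound[of "a t" "b t"] by (simp add: mult.assoc)
  moreover have "0 <= a t * b t" using elim by linarith
  ultimately show ?case using elim by simp
 qed
qed

lemma integrable_V_dual_V: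
 assumes F: "F \<in> L2_V_dual T" and w: "w \<in> L2_V T"
 shows "integrable (time T) (%t. F t (w t))"
proof (rule integrable_pairing_dominated)
 show "(%t. F t (w t)) \<in> borel_measurable (time T)"
  by (rule strongly_measurable_pairing[OF seminormed_V_dual seminormed_V, where \<beta>="%F u. F u"])
   (use F w in \<open>auto simp: bochner_L2_iff V_dual_bound V_dual_diff\<close>)
 show "integrable (time T) (%t. (V_dual_norm (F t))^2)" "integrable (time T) (%t. (V_norm (w t))^2)"
  using F w by (auto simp: bochner_L2_iff)
 show "AE t in time T. abs (F t (w t)) <= V_dual_norm (F t) * V_norm (w t)"
  using bochner_L2_mem[OF F] bochner_L2_mem[OF w] by eventually_elim (rule V_dual_bound)
qed

lemma integrable_ip_Dv:
 assumes u: "u \<in> L2_V T" and w: "w \<in> L2_V T"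
 shows "integrable (time T) (%t. ip mu (Dv (u t)) (Dv (w t)))"
proof (rule integrable_pairing_dominated)
 show "(%t. ip mu (Dv (u t)) (Dv (w t))) \<in> borel_measurable (time T)"
  by (rule strongly_measurable_pairing[OF seminormed_V seminormed_V, where \<beta>="%u w. ip mu (Dv u) (Dv w)"])
   (use u w in \<open>auto simp: bochner_L2_iff ip_Dv_bound ip_Dv_diff_left ip_Dv_diff_right\<close>)
 show "integrable (time T) (%t. (V_norm (u t))^2)" "integrable (time T) (%t. (V_norm (w t))^2)"
  using u w by (auto simp: bochner_L2_iff)
 show "AE t in time T. abs (ip mu (Dv (u t)) (Dv (w t))) <= V_norm (u t) * V_norm (w t)"
  using bochner_L2_mem[OF u] bochner_L2_mem[OF w] by eventually_elim (rule ip_Dv_bound)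
qed

text \<open>The operator \<Delta>_v - v . D_v in weak form, as a map from V to its dual; the
  equation reads Y u = \<open>A_form u\<close>.\<close>

definition A_form :: "('n::finite phase => real) => ('n phase => real) => real" where
 "A_form u = (%p. - ip mu (Dv u) (Dv p))"

lemma A_form_bound: "u \<in> V ==> p \<in> V ==> abs (A_form u p) <= V_norm u * V_norm p"
 unfolding A_form_def by (simp add: ip_Dv_bound)

lemma A_form_V_dual: "u \<in> V ==> A_form u \<in> V_dual"
 by (rule V_dual_I[OF _ A_form_bound]) (simp_all add: A_form_def ip_Dv_comb_right)

lemma A_form_diff_norm:
 assumes "u \<in> V" "w \<in> V"
 shows "V_dual_norm (%p. A_form u p - A_form w p) <= V_norm (u -. w)"
proof (rule V_dual_norm_le[OF V_norm_nonneg])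
 fix p :: "'a phase => real" assume p: "p \<in> V"
 have "A_form u p - A_form w p = A_form (u -. w) p"
  unfolding A_form_def by (simp add: ip_Dv_diff_left assms p)
 then show "abs (A_form u p - A_form w p) <= V_norm (u -. w) * V_norm p"
  using A_form_bound[OF V.diff_mem[OF assms] p] by simp
qed

lemma A_form_norm: "u \<in> V ==> V_dual_norm (A_form u) <= V_norm u"
 by (rule V_dual_norm_le[OF V_norm_nonneg A_form_bound])

text \<open>The map \<open>A_form\<close> has Lipschitz constant 1 from V to its dual, so it carries
  approximating simple functions to approximating simple functions.\<close>

lemma A_form_L2_V_dual:
 assumes u: "u \<in> L2_V T"
 shows "(%t. A_form (u t)) \<in> L2_V_dual T"
proof -
 have usm: "strongly_measurable V V_norm T u" using u by (simp add: bochner_L2_iff)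
 obtain s where s: "!!n. simple_function (time T) (s n)" "!!n t. 0 < t ==> t < T ==> s n t \<in> V"
  "AE t in time T. (%n::nat. V_norm (s n t -. u t)) \<leadsto> 0"
  by (rule strongly_measurableE[OF usm]) (rule that)
 have sp: "AE t in time T. t \<in> space (time T)" by (rule AE_space)
 have 1: "AE t in time T. (%n. V_dual_norm (%p. A_form (s n t) p - A_form (u t) p)) \<leadsto> 0"
  using s(3) bochner_L2_mem[OF u] sp
 proof eventually_elim
  case (elim t)
  show ?case
  proof (rule Lim_null_sandwich[OF _ _ elim(1)])
   show "0 <= V_dual_norm (%p. A_form (s n t) p - A_form (u t) p)" for n
    using elim s(2)[of t n] by (intro V_dual_norm_nonneg Vd.diff_mem A_form_V_dual) auto
   show "V_dual_norm (%p. A_form (s n t) p - A_form (u t) p) <= V_norm (s n t -. u t)" for n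
    using elim s(2)[of t n] by (intro A_form_diff_norm) auto
  qed
 qed
 have 2: "simple_function (time T) (%t. A_form (s n t))" for n
  by (rule simple_function_compose1[OF s(1)])
 have 3: "AE t in time T. A_form (u t) \<in> V_dual"
  using bochner_L2_mem[OF u] by eventually_elim (rule A_form_V_dual)
 have sm: "strongly_measurable V_dual V_dual_norm T (%t. A_form (u t))"
  unfolding strongly_measurable_def
  by (intro conjI 3 exI[of _ "%n t. A_form (s n t)"] allI ballI 1 2 A_form_V_dual s(2)) auto
 have "integrable (time T) (%t. (V_dual_norm (A_form (u t)))^2)"
 proof (rule integrable_dominated)
  show "integrable (time T) (%t. (V_norm (u t))^2)" using u by (simp add: bochner_L2_iff)
  show "(%t. (V_dual_norm (A_form (u t)))^2) \<in> borel_measurable (time T)"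
   using Vd.strongly_measurable_norm[OF sm] by measurable
  show "AE t in time T. norm ((V_dual_norm (A_form (u t)))^2) <= norm ((V_norm (u t))^2)"
   using bochner_L2_mem[OF u]
   by eventually_elim (simp add: power_mono A_form_norm V_dual_norm_nonneg A_form_V_dual)
 qed
 with sm show ?thesis by (simp add: bochner_L2_iff)
qed

section \<open>Test functions\<close>

lemma L2_mu_continuous_param:
 fixes f :: "real => 'n::finite phase => 'b::euclidean_space"
 assumes m: "!!t. t \<in> S ==> f t \<in> borel_measurable mu"
  and b: "!!t z. t \<in> S ==> z \<in> space mu ==> norm (f t z) <= B"
  and c: "!!z. z \<in> space mu ==> continuous_on S (%t. f t z)" and t: "t \<in> S"
 shows "((%s. L2_norm mu (f s -. f t)) \<longlongrightarrow> 0) (at t within S)"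
 unfolding tendsto_at_iff_sequentially
proof (intro allI impI)
 fix X assume X: "\<forall>i. X i \<in> S - {t}" "X \<leadsto> t"
 have "(%n. L2_norm mu (f (X n) -. f t)) \<leadsto> 0"
 proof (rule L2_tendsto_dominated)
  show "f (X n) \<in> borel_measurable mu" for n using X(1) by (intro m) auto
  show "f t \<in> borel_measurable mu" by (rule m[OF t])
  show "integrable mu (%_. (2 * B)^2)" by simp
  show "AE z in mu. (norm (f (X n) z - f t z))^2 <= (2 * B)^2" for n
  proof (rule AE_I2)
   fix z :: "'n phase" assume z: "z \<in> space mu"
   have "norm (f (X n) z - f t z) <= norm (f (X n) z) + norm (f t z)" by (rule norm_triangle_ineq4)
   also have "\<dots> <= 2 * B" using b[of "X n" z] b[OF t z] X(1) z by auto
   finally show "(norm (f (X n) z - f t z))^2 <= (2 * B)^2" by (intro power_mono) auto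
  qed
  show "AE z in mu. (%n. f (X n) z) \<leadsto> f t z"
  proof (rule AE_I2)
   fix z :: "'n phase" assume z: "z \<in> space mu"
   show "(%n. f (X n) z) \<leadsto> f t z"
    by (rule continuous_on_tendsto_compose[OF c[OF z] X(2) t]) (use X(1) in auto)
  qed
 qed
 then show "((%s. L2_norm mu (f s -. f t)) \<circ> X) \<leadsto> 0" by (simp add: o_def)
qed

lemma C_H_L2: "u \<in> C_H T ==> t \<in> {0..T} ==> u t \<in> L2 mu"
 by (simp add: C_H_def)

lemma C_H_bounded:
 assumes "u \<in> C_H T"
 obtains B where "0 <= B" "!!t. t \<in> {0..T} ==> L2_norm mu (u t) <= B"
proof -
 have "continuous_on {0..T} (%t. L2_norm mu (u t))"
  unfolding continuous_on_def
 proof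
  fix t assume t: "t \<in> {0..T}"
  have "((%s. L2_norm mu (u s) - L2_norm mu (u t)) \<longlongrightarrow> 0) (at t within {0..T})"
  proof (rule Lim_null_comparison)
   show "\<forall>\<^sub>F s in at t within {0..T}. norm (L2_norm mu (u s) - L2_norm mu (u t)) <= L2_norm mu (u s -. u t)"
    using t by (auto simp: eventually_at_filter intro!: always_eventually L2_norm_diff_ineq C_H_L2[OF assms])
   show "((%s. L2_norm mu (u s -. u t)) \<longlongrightarrow> 0) (at t within {0..T})"
    using assms t by (simp add: C_H_def)
  qed
  then show "((%t. L2_norm mu (u t)) \<longlongrightarrow> L2_norm mu (u t)) (at t within {0..T})" by (simp add: LIM_zero_iff)
 qed
 then have "bounded ((%t. L2_norm mu (u t)) ` {0..T})"
  by (intro compact_imp_bounded compact_continuous_image) auto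
 then obtain B where B: "\<forall>y\<in>(%t. L2_norm mu (u t)) ` {0..T}. norm y <= B" unfolding bounded_iff by (rule exE)
 show thesis by (rule that[of "max B 0"]) (use B in \<open>auto simp: le_max_iff_disj\<close>)
qed

lemma C_H_ip_continuous:
 assumes u: "u \<in> C_H T" and g: "g \<in> C_H T"
 shows "continuous_on {0..T} (%t. ip mu (u t) (g t))"
 unfolding continuous_on_def
proof
 fix t assume t: "t \<in> {0..T}"
 obtain B where B: "0 <= B" "!!t. t \<in> {0..T} ==> L2_norm mu (u t) <= B" by (rule C_H_bounded[OF u]) (rule that)
 let ?r = "%s. B * L2_norm mu (g s -. g t) + L2_norm mu (u s -. u t) * L2_norm mu (g t)"
 have "((%s. ip mu (u s) (g s) - ip mu (u t) (g t)) \<longlongrightarrow> 0) (at t within {0..T})"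
 proof (rule Lim_null_comparison)
  have "norm (ip mu (u s) (g s) - ip mu (u t) (g t)) <= ?r s" if s: "s \<in> {0..T}" for s
  proof -
   note L = C_H_L2[OF u s] C_H_L2[OF u t] C_H_L2[OF g s] C_H_L2[OF g t]
   have "ip mu (u s) (g s) - ip mu (u t) (g t) = ip mu (u s) (g s -. g t) + ip mu (u s -. u t) (g t)"
    using L by (simp add: ip_diff_left ip_diff_right)
   moreover have "abs (ip mu (u s) (g s -. g t)) <= L2_norm mu (u s) * L2_norm mu (g s -. g t)"
    using L by (intro ip_Cauchy_Schwarz L2_diff)
   moreover have "\<dots> <= B * L2_norm mu (g s -. g t)" using B(2)[OF s] by (intro mult_right_mono) auto
   moreover have "abs (ip mu (u s -. u t) (g t)) <= L2_norm mu (u s -. u t) * L2_norm mu (g t)"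
    using L by (intro ip_Cauchy_Schwarz L2_diff)
   ultimately show ?thesis unfolding real_norm_def by linarith
  qed
  then show "\<forall>\<^sub>F s in at t within {0..T}. norm (ip mu (u s) (g s) - ip mu (u t) (g t)) <= ?r s"
   by (auto simp: eventually_at_filter)
  have "(?r \<longlongrightarrow> B * 0 + 0 * L2_norm mu (g t)) (at t within {0..T})"
   using u g t by (intro tendsto_intros) (auto simp: C_H_def)
  then show "(?r \<longlongrightarrow> 0) (at t within {0..T})" by simp
 qed
 then show "((%t. ip mu (u t) (g t)) \<longlongrightarrow> ip mu (u t) (g t)) (at t within {0..T})" by (simp add: LIM_zero_iff)
qed

lemma C_H_const: "f \<in> L2 mu ==> (%_. f) \<in> C_H T"
 by (simp add: C_H_def)

lemma C_H_I_bounded: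
 assumes "!!t. t \<in> {0..T} ==> f t \<in> borel_measurable mu"
  and "!!t z. t \<in> {0..T} ==> z \<in> space mu ==> abs (f t z) <= B"
  and "!!z. z \<in> space mu ==> continuous_on {0..T} (%t. f t z)"
 shows "f \<in> C_H T"
 unfolding C_H_def
proof (intro CollectI conjI ballI)
 fix t assume t: "t \<in> {0..T}"
 show "f t \<in> L2 mu" by (rule mu_L2_bounded[OF assms(1)[OF t], of B]) (simp add: assms(2)[OF t])
 show "((%s. L2_norm mu (f s -. f t)) \<longlongrightarrow> 0) (at t within {0..T})"
  by (rule L2_mu_continuous_param[where B=B, OF assms(1) _ assms(3) t]) (simp_all add: assms(2))
qed

text \<open>Dominated convergence turns pointwise continuity in time of the function and its
  gradient into continuity with values in V.\<close>

lemma L2_V_I_bounded: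
 assumes H: "!!t. t \<in> {0..T} ==> has_v_grad (f t) (g t)"
  and b: "!!t z. t \<in> {0..T} ==> z \<in> space mu ==> abs (f t z) <= B"
   "!!t z. t \<in> {0..T} ==> z \<in> space mu ==> norm (g t z) <= B"
  and c: "!!z. z \<in> space mu ==> continuous_on {0..T} (%t. f t z)"
   "!!z. z \<in> space mu ==> continuous_on {0..T} (%t. g t z)"
 shows "f \<in> L2_V T"
proof (rule V.bochner_L2_continuous)
 show "f t \<in> V" if "t \<in> {0..T}" for t using H[OF that] by (rule has_v_grad_V)
 fix t assume t: "t \<in> {0..T}"
 have mf: "f t \<in> borel_measurable mu" if "t \<in> {0..T}" for t by (rule L2_measurable[OF has_v_grad_L2(1)[OF H[OF that]]])
 have mg: "g t \<in> borel_measurable mu" if "t \<in> {0..T}" for t by (rule L2_measurable[OF has_v_grad_L2(2)[OF H[OF that]]])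
 have 1: "((%s. L2_norm mu (f s -. f t)) \<longlongrightarrow> 0) (at t within {0..T})"
  by (rule L2_mu_continuous_param[where B=B, OF mf _ c(1) t]) (simp_all add: b(1))
 have 2: "((%s. L2_norm mu (g s -. g t)) \<longlongrightarrow> 0) (at t within {0..T})"
  by (rule L2_mu_continuous_param[where B=B, OF mg b(2) c(2) t])
 show "((%s. V_norm (f s -. f t)) \<longlongrightarrow> 0) (at t within {0..T})"
 proof (rule Lim_null_comparison)
  have "V_norm (f s -. f t) <= L2_norm mu (f s -. f t) + L2_norm mu (g s -. g t)"
   if s: "s \<in> {0..T}" for s
  proof -
   have "has_v_grad (f s -. f t) (g s -. g t)"
    using has_v_grad_comb[OF H[OF s] H[OF t], of 1 "-1"] by simp
   then show ?thesis unfolding V_norm_eq[OF \<open>has_v_grad (f s -. f t) (g s -. g t)\<close>]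
    by (intro sqrt_sum_squares_le_sum) auto
  qed
  then show "\<forall>\<^sub>F s in at t within {0..T}. norm (V_norm (f s -. f t)) <=
    L2_norm mu (f s -. f t) + L2_norm mu (g s -. g t)"
   by (auto simp: eventually_at_filter V_norm_nonneg)
  show "((%s. L2_norm mu (f s -. f t) + L2_norm mu (g s -. g t)) \<longlongrightarrow> 0) (at t within {0..T})"
   using tendsto_add[OF 1 2] by simp
 qed
qed

lemma has_dd_open_zero:
 assumes dd: "has_dd g b g'" and S: "open S" "x \<in> S" "!!y. y \<in> S ==> g y = 0"
 shows "g' x = 0"
proof -
 have "((%s. x + s *\<^sub>R b) \<longlongrightarrow> x + 0 *\<^sub>R b) (at 0)" by (intro tendsto_intros)
 then have "\<forall>\<^sub>F s in at 0. x + s *\<^sub>R b \<in> S" using S by (intro topological_tendstoD) auto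
 then have ev: "\<forall>\<^sub>F s in at 0. g (x + s *\<^sub>R b) = 0" by eventually_elim (rule S(3))
 have "((%s. (g (x + (0 + s) *\<^sub>R b) - g (x + 0 *\<^sub>R b)) / s) \<longlongrightarrow> g' x) (at 0)"
  using dd unfolding has_dd_def DERIV_def by blast
 moreover have "((%s. (g (x + (0 + s) *\<^sub>R b) - g (x + 0 *\<^sub>R b)) / s) \<longlongrightarrow> 0) (at 0)"
  by (rule tendsto_eventually) (use ev S(3)[OF S(2)] in \<open>auto elim!: eventually_mono\<close>)
 ultimately show ?thesis by (rule tendsto_unique[OF at_neq_bot])
qed

lemma test_fun_smooth: "test_fun T p ==> smooth p"
 by (simp add: test_fun_def)

lemma test_fun_mono: "test_fun \<tau> p ==> \<tau> <= T ==> test_fun T p"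
 unfolding test_fun_def by (meson less_le_trans)

text \<open>On \<open>space mu\<close> the position stays in the unit cube, so a bounded velocity
  support leaves a compact set.\<close>

lemma continuous_bounded_support_cube:
 fixes f :: "real \<times> (real^'n::finite) \<times> (real^'n) => 'b::euclidean_space"
 assumes c: "continuous_on UNIV f" and s: "!!t x v. norm v > R ==> f (t, x, v) = 0"
 shows "\<exists>B. \<forall>t\<in>{0..T}. \<forall>z\<in>space mu. norm (f (t, z)) <= B"
proof -
 have "compact ({0..T} \<times> cbox (0::real^'n) 1 \<times> cball (0::real^'n) R)"
  by (intro compact_Times compact_Icc compact_cbox compact_cball)
 then have "bounded (f ` ({0..T} \<times> cbox (0::real^'n) 1 \<times> cball (0::real^'n) R))"
  by (intro compact_imp_bounded compact_continuous_image continuous_on_subset[OF c]) auto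
 then obtain B where B: "\<forall>y\<in>f ` ({0..T} \<times> cbox (0::real^'n) 1 \<times> cball (0::real^'n) R). norm y <= B"
  unfolding bounded_iff by (rule exE)
 have "norm (f (t, z)) <= max B 0" if t: "t \<in> {0..T}" and z: "z \<in> space mu" for t z
 proof (cases "norm (snd z) <= R")
  case True
  have "fst z \<in> cbox 0 1" using z by (auto simp: space_mu cube_def mem_box_cart less_imp_le)
  then have "(t, fst z, snd z) \<in> {0..T} \<times> cbox (0::real^'n) 1 \<times> cball (0::real^'n) R"
   by (intro SigmaI) (use t True in auto)
  then have "norm (f (t, fst z, snd z)) <= B" using B by blast
  then show ?thesis by simp
 next
  case False
  then have "f (t, fst z, snd z) = 0" by (intro s) simp
  then show ?thesis by simp
 qed
 then show ?thesis by blast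
qed

lemma test_fun_derivative_support:
 assumes q: "test_fun T q"
 obtains R where "!!t x v b. norm v > R ==> q (t, x, v) = 0 \<and> frechet_derivative q (at (t, x, v)) b = 0"
proof -
 have "\<exists>R. \<forall>t x v. q (t, x, v) \<noteq> 0 \<longrightarrow> norm v <= R" using q unfolding test_fun_def by blast
 then obtain R where R: "!!t x v. norm v > R ==> q (t, x, v) = 0" by (metis not_le)
 have "frechet_derivative q (at (t, x, v)) b = 0" if v: "norm v > R" for t x v b
 proof (rule has_dd_open_zero[OF smooth_has_dd[OF test_fun_smooth[OF q]]])
  show "open {p :: real \<times> (real^'a) \<times> (real^'a). R < norm (snd (snd p))}"
   by (intro open_Collect_less continuous_intros)
 qed (use v R in auto)
 then show thesis using R by (intro that[of R]) auto
qed

definition v_grad :: "(real \<times> (real^'n::finite) \<times> (real^'n) => real) => real => 'n phase => real^'n" where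
 "v_grad p t z = (\<chi> i. frechet_derivative p (at (t, z)) (0, 0, axis i 1))"

lemma continuous_on_Pair_time: "continuous_on UNIV f ==> continuous_on UNIV (%z. f (t, z))"
 by (rule continuous_on_compose2[of UNIV f]) (auto intro!: continuous_intros)

lemma continuous_on_time: "continuous_on UNIV f ==> continuous_on A (%t. f (t, z))"
 by (rule continuous_on_compose2[of UNIV f]) (auto intro!: continuous_intros)

lemma smooth_v_grad:
 assumes "smooth p"
 shows "has_dd (%v. p (t, x, v)) (axis i 1) (%v. v_grad p t (x, v) $ i)"
 unfolding has_dd_def
proof
 fix v
 have "((%s. p ((t, x, v) + s *\<^sub>R (0, 0, axis i 1))) has_real_derivative frechet_derivative p (at (t, x, v)) (0, 0, axis i 1)) (at 0)"
  using smooth_has_dd[OF assms, of "(0, 0, axis i 1)"] unfolding has_dd_def by blast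
 then show "((%s. p (t, x, v + s *\<^sub>R axis i 1)) has_real_derivative v_grad p t (x, v) $ i) (at 0)"
  by (simp add: v_grad_def)
qed

lemma test_fun_v_grad_properties:
 assumes q: "test_fun \<tau> q"
 shows "has_v_grad (%z. q (t, z)) (v_grad q t)"
  and "(%t z. q (t, z)) \<in> L2_V T"
proof -
 note sm = test_fun_smooth[OF q]
 obtain R where R: "!!t x v b. norm v > R ==> q (t, x, v) = 0 \<and> frechet_derivative q (at (t, x, v)) b = 0"
  by (rule test_fun_derivative_support[OF q]) (rule that)
 have c1: "continuous_on UNIV q" by (rule smooth_continuous[OF sm])
 have c2: "continuous_on UNIV (%(t, z). v_grad q t z)"
 proof -
  have "continuous_on UNIV (%p. \<chi> i. frechet_derivative q (at p) (0, 0, axis i 1))"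
   by (intro continuous_on_vec_lambda smooth_continuous_derivative[OF sm])
  then show ?thesis by (simp add: v_grad_def case_prod_beta')
 qed
 have R2: "(%(t, z). v_grad q t z) (t, x, v) = 0" if "norm v > R" for t x v
  using R[OF that] by (simp add: v_grad_def vec_eq_iff)
 have R1: "q (t, x, v) = 0" if "norm v > R" for t x v using R[OF that] by simp
 have H: "has_v_grad (%z. q (t, z)) (v_grad q t)" for t
 proof (rule has_v_grad_C1)
  show ca: "continuous_on UNIV (%z. q (t, z))" by (rule continuous_on_Pair_time[OF c1])
  show cb: "continuous_on UNIV (v_grad q t)" using continuous_on_Pair_time[OF c2, of t] by simp
  \<comment> \<open>Moving time t to 0 lets the compactness bound, used on the one-point interval
    {0..0}, cover any single time.\<close>
  have shift: "continuous_on UNIV (%p::real \<times> (real^'a) \<times> (real^'a). (fst p + t, snd p))" by (intro continuous_intros)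
  have "\<exists>B. \<forall>s\<in>{0..0}. \<forall>z\<in>space mu. norm ((%p. q (fst p + t, snd p)) (s, z)) <= B"
   by (rule continuous_bounded_support_cube[OF continuous_on_compose2[OF c1 shift], of R]) (simp_all add: R1)
  then obtain B where B: "\<forall>z\<in>space mu. norm (q (t, z)) <= B" by auto
  show "(%z. q (t, z)) \<in> L2 mu"
   by (rule mu_L2_bounded[OF borel_measurable_mu_continuous[OF ca], of B]) (use B in auto)
  have "\<exists>B. \<forall>s\<in>{0..0}. \<forall>z\<in>space mu. norm ((%p. (%(t, z). v_grad q t z) (fst p + t, snd p)) (s, z)) <= B"
   by (rule continuous_bounded_support_cube[OF continuous_on_compose2[OF c2 shift], of R]) (use R2 in auto)
  then obtain C where C: "\<forall>z\<in>space mu. norm (v_grad q t z) <= C" by auto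
  show "v_grad q t \<in> L2 mu"
   by (rule mu_L2_bounded[OF borel_measurable_mu_continuous[OF cb], of C]) (use C in auto)
 qed (rule smooth_v_grad[OF sm])
 then show "has_v_grad (%z. q (t, z)) (v_grad q t)" .
 obtain B where B: "\<forall>t\<in>{0..T}. \<forall>z\<in>space mu. norm (q (t, z)) <= B"
  using continuous_bounded_support_cube[OF c1 R1] by blast
 obtain C where C: "\<forall>t\<in>{0..T}. \<forall>z\<in>space mu. norm ((%(t, z). v_grad q t z) (t, z)) <= C"
  using continuous_bounded_support_cube[OF c2 R2] by blast
 show "(%t z. q (t, z)) \<in> L2_V T"
 proof (rule L2_V_I_bounded[OF H, where B="max B C"])
  show "abs (q (t, z)) <= max B C" if "t \<in> {0..T}" "z \<in> space mu" for t z
  proof -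
   have "norm (q (t, z)) <= B" using B that by blast
   then show ?thesis by simp
  qed
  show "norm (v_grad q t z) <= max B C" if "t \<in> {0..T}" "z \<in> space mu" for t z
  proof -
   have "norm (v_grad q t z) <= C" using C that by auto
   then show ?thesis by simp
  qed
  show "continuous_on {0..T} (%t. q (t, z))" for z by (rule continuous_on_time[OF c1])
  show "continuous_on {0..T} (%t. v_grad q t z)" for z using continuous_on_time[OF c2, of "{0..T}" z] by simp
 qed
qed

lemma Y_classical_eq:
 assumes "smooth p"
 shows "Y_classical p t (x, v) = frechet_derivative p (at (t, x, v)) (1, v, 0)"
proof -
 interpret D: bounded_linear "frechet_derivative p (at (t, x, v))"
  by (rule has_derivative_bounded_linear[OF smooth_has_derivative[OF assms]])
 show ?thesis using D.add[of "(1, 0, 0)" "(0, v, 0)"] by (simp add: Y_classical_def)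
qed

lemma Y_classical_sum:
 assumes "smooth p"
 shows "Y_classical p t (x, v) = frechet_derivative p (at (t, x, v)) (1, 0, 0) +
  (\<Sum>i\<in>UNIV. v $ i * frechet_derivative p (at (t, x, v)) (0, axis i 1, 0))"
proof -
 interpret D: bounded_linear "frechet_derivative p (at (t, x, v))"
  by (rule has_derivative_bounded_linear[OF smooth_has_derivative[OF assms]])
 have "(\<Sum>i\<in>UNIV. v $ i *\<^sub>R axis i 1) = v"
  by (simp add: vec_eq_iff axis_def if_distrib[of "%y. _ * y"] cong: if_cong)
 then have "(0::real, v, 0::real^'a) = (\<Sum>i\<in>UNIV. v $ i *\<^sub>R (0, axis i 1, 0))"
  by (simp add: prod_eq_iff fst_sum snd_sum)
 then have "frechet_derivative p (at (t, x, v)) (0, v, 0) =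
   frechet_derivative p (at (t, x, v)) (\<Sum>i\<in>UNIV. v $ i *\<^sub>R (0, axis i 1, 0))"
  by (simp only:)
 also have "\<dots> = (\<Sum>i\<in>UNIV. v $ i * frechet_derivative p (at (t, x, v)) (0, axis i 1, 0))"
  by (simp only: D.sum D.scaleR real_scaleR_def)
 finally have "frechet_derivative p (at (t, x, v)) (0, v, 0) = (\<Sum>i\<in>UNIV. v $ i * frechet_derivative p (at (t, x, v)) (0, axis i 1, 0))" .
 then show ?thesis by (simp add: Y_classical_def)
qed

lemma continuous_Y_classical:
 assumes "smooth q"
 shows "continuous_on UNIV (%p. Y_classical q (fst p) (snd p))"
proof -
 have "(%p. Y_classical q (fst p) (snd p)) = (%p. frechet_derivative q (at p) (1, 0, 0) +
  (\<Sum>i\<in>UNIV. snd (snd p) $ i * frechet_derivative q (at p) (0, axis i 1, 0)))"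
  by (auto simp: fun_eq_iff Y_classical_sum[OF assms])
 then show ?thesis
  by (simp only:) (intro continuous_intros smooth_continuous_derivative[OF assms])
qed

lemma test_fun_Y_C_H:
 assumes q: "test_fun \<tau> q"
 shows "Y_classical q \<in> C_H T"
proof -
 note sm = test_fun_smooth[OF q]
 obtain R where R: "!!t x v b. norm v > R ==> q (t, x, v) = 0 \<and> frechet_derivative q (at (t, x, v)) b = 0"
  by (rule test_fun_derivative_support[OF q]) (rule that)
 note c = continuous_Y_classical[OF sm]
 obtain B where B: "\<forall>t\<in>{0..T}. \<forall>z\<in>space mu. norm ((%p. Y_classical q (fst p) (snd p)) (t, z)) <= B"
  using continuous_bounded_support_cube[OF c, of R T] R by (auto simp: Y_classical_eq[OF sm])
 show ?thesis
 proof (rule C_H_I_bounded)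
  show "Y_classical q t \<in> borel_measurable mu" for t
   using continuous_on_Pair_time[OF c, of t] by (intro borel_measurable_mu_continuous) simp
  show "abs (Y_classical q t z) <= B" if "t \<in> {0..T}" "z \<in> space mu" for t z using B that by auto
  show "continuous_on {0..T} (%t. Y_classical q t z)" for z using continuous_on_time[OF c, of "{0..T}" z] by simp
 qed
qed

lemma has_Y_eq:
 assumes "has_Y T u F" "test_fun T p"
 shows "(LINT t|time T. F t (%z. p (t, z))) = - (LINT t|time T. ip mu (u t) (Y_classical p t))"
 using assms unfolding has_Y_def ip_def by simp

text \<open>Continuity in H guarantees that the integrals on the right exist separately, so that
  they may be added.\<close>

lemma has_Y_comb:
 fixes u w :: "real => 'n::finite phase => real"
 assumes u: "u \<in> C_H T" "has_Y T u F" and w: "w \<in> C_H T" "has_Y T w G"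
 shows "has_Y T (%t z. a * u t z + b * w t z) (%t p. a * F t p + b * G t p)"
 unfolding has_Y_def
proof (intro conjI allI impI)
 have F: "F \<in> L2_V_dual T" and G: "G \<in> L2_V_dual T" using u w by (auto simp: has_Y_def)
 show "(%t p. a * F t p + b * G t p) \<in> L2_V_dual T" by (rule Vd.bochner_L2_comb[OF F G])
 fix p :: "real \<times> (real^'n) \<times> (real^'n) => real" assume p: "test_fun T p"
 note P = test_fun_v_grad_properties(2)[OF p, of T] and Y = test_fun_Y_C_H[OF p, of T]
 have I1: "integrable (time T) (%t. ip mu (u t) (Y_classical p t))" "integrable (time T) (%t. ip mu (w t) (Y_classical p t))"
  by (intro integrable_time_continuous C_H_ip_continuous u w Y)+
 have I2: "integrable (time T) (%t. F t (%z. p (t, z)))" "integrable (time T) (%t. G t (%z. p (t, z)))"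
  by (rule integrable_V_dual_V[OF F P], rule integrable_V_dual_V[OF G P])
 have "(LINT t|time T. LINT z|mu. (a * u t z + b * w t z) * Y_classical p t z) =
   (LINT t|time T. a * ip mu (u t) (Y_classical p t) + b * ip mu (w t) (Y_classical p t))"
 proof (rule LINT_cong[OF refl])
  fix t assume "t \<in> space (time T)"
  then have t: "t \<in> {0..T}" by simp
  show "(LINT z|mu. (a * u t z + b * w t z) * Y_classical p t z) = a * ip mu (u t) (Y_classical p t) + b * ip mu (w t) (Y_classical p t)"
   using ip_add_left[OF L2_scale[OF C_H_L2[OF u(1) t]] L2_scale[OF C_H_L2[OF w(1) t]] C_H_L2[OF Y t], of a b]
   unfolding ip_scale_left by (simp add: ip_def)
 qed
 also have "\<dots> = a * (LINT t|time T. ip mu (u t) (Y_classical p t)) + b * (LINT t|time T. ip mu (w t) (Y_classical p t))"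
  using I1 by simp
 finally show "(LINT t|time T. a * F t (%z. p (t, z)) + b * G t (%z. p (t, z))) =
   - (LINT t|time T. LINT z|mu. (a * u t z + b * w t z) * Y_classical p t z)"
  using has_Y_eq[OF u(2) p] has_Y_eq[OF w(2) p] I2 by simp
qed

lemma has_Y_diff:
 assumes "u \<in> C_H T" "has_Y T u F" "w \<in> C_H T" "has_Y T w G"
 shows "has_Y T (%t z. u t z - w t z) (%t p. F t p - G t p)"
 using has_Y_comb[OF assms, of 1 "-1"] by simp

lemma test_fun_vanish:
 assumes q: "test_fun T q" and t: "t <= 0 \<or> T <= t"
 shows "q (t, z) = 0" "Y_classical q t z = 0"
proof -
 have "\<exists>a b. 0 < a \<and> b < T \<and> (\<forall>t x v. q (t, x, v) \<noteq> 0 \<longrightarrow> a <= t \<and> t <= b)"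
  using q unfolding test_fun_def by blast
 then obtain a b where ab0: "0 < a \<and> b < T \<and> (\<forall>t x v. q (t, x, v) \<noteq> 0 \<longrightarrow> a <= t \<and> t <= b)" by (elim exE)
 then have ab: "0 < a" "b < T" "!!t x v. q (t, x, v) \<noteq> 0 ==> a <= t \<and> t <= b" by blast+
 have z: "q p = 0" if "fst p < a \<or> b < fst p" for p
 proof (rule ccontr)
  assume "q p \<noteq> 0"
  then have "q (fst p, fst (snd p), snd (snd p)) \<noteq> 0" by simp
  from ab(3)[OF this] show False using that by auto
 qed
 have tab: "t < a \<or> b < t" using t ab by auto
 show "q (t, z) = 0" using z[of "(t, z)"] tab by simp
 obtain x v where zz: "z = (x, v)" by (cases z)
 have "frechet_derivative q (at (t, x, v)) (1, v, 0) = 0"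
 proof (rule has_dd_open_zero[OF smooth_has_dd[OF test_fun_smooth[OF q]]])
  show "open ({p :: real \<times> (real^'a) \<times> (real^'a). fst p < a} \<union> {p. b < fst p})"
   by (intro open_Un open_Collect_less continuous_intros)
 qed (use tab z in auto)
 then show "Y_classical q t z = 0" by (simp add: zz Y_classical_eq[OF test_fun_smooth[OF q]])
qed

text \<open>A test function on (0,\<tau>) is one on (0,T) that vanishes after \<tau>, so both sides
  of the identity see only the shorter interval.\<close>

lemma has_Y_subset:
 fixes u :: "real => 'n::finite phase => real"
 assumes u: "has_Y T u F" and "\<tau> <= T"
 shows "has_Y \<tau> u F"
 unfolding has_Y_def
proof (intro conjI allI impI)
 show "F \<in> L2_V_dual \<tau>" using u assms(2) by (auto simp: has_Y_def intro: Vd.bochner_L2_subset)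
 fix p :: "real \<times> (real^'n) \<times> (real^'n) => real" assume p: "test_fun \<tau> p"
 have FT: "F \<in> L2_V_dual T" using u by (simp add: has_Y_def)
 have *: "(LINT t|time T. g t) = (LINT t|time \<tau>. g t)"
  if m: "g \<in> borel_measurable (time T)" and "AE t in time T. t \<ge> \<tau> \<longrightarrow> g t = 0" for g :: "real => real"
 proof -
  have "(LINT t|time T. g t) = (LINT t|time T. (if t < \<tau> then g t else 0))"
  proof (rule integral_cong_AE[OF m])
   show ae: "AE t in time T. g t = (if t < \<tau> then g t else 0)" using that(2) by eventually_elim auto
   show "(%t. if t < \<tau> then g t else 0) \<in> borel_measurable (time T)" by (rule borel_measurable_time_AE[OF m ae])
  qed
  then show ?thesis using integrable_time_extend(2)[OF assms(2), of g] by simp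
 qed
 have "(LINT t|time T. F t (%z. p (t, z))) = (LINT t|time \<tau>. F t (%z. p (t, z)))"
 proof (rule *)
  show "(%t. F t (%z. p (t, z))) \<in> borel_measurable (time T)"
   by (rule borel_measurable_integrable[OF integrable_V_dual_V[OF FT test_fun_v_grad_properties(2)[OF p]]])
  show "AE t in time T. t \<ge> \<tau> \<longrightarrow> F t (%z. p (t, z)) = 0"
   using bochner_L2_mem[OF FT]
  proof eventually_elim
   case (elim t)
   have "(%z. p (t, z)) = (%_. 0)" if "t \<ge> \<tau>" using test_fun_vanish(1)[OF p] that by auto
   then show ?case using V_dual_zero[OF elim] by auto
  qed
 qed
 moreover have "(LINT t|time T. LINT z|mu. u t z * Y_classical p t z) = (LINT t|time \<tau>. LINT z|mu. u t z * Y_classical p t z)"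
 proof -
  have "(%t. LINT z|mu. u t z * Y_classical p t z) = (%t. if t < \<tau> then LINT z|mu. u t z * Y_classical p t z else 0)"
   using test_fun_vanish(2)[OF p] by (auto simp: fun_eq_iff)
  then show ?thesis using integrable_time_extend(2)[OF assms(2), of "%t. LINT z|mu. u t z * Y_classical p t z"] by simp
 qed
 ultimately show "(LINT t|time \<tau>. F t (%z. p (t, z))) = - (LINT t|time \<tau>. LINT z|mu. u t z * Y_classical p t z)"
  using u test_fun_mono[OF p assms(2)] by (simp add: has_Y_def)
qed

section \<open>The equation for the basis coefficients\<close>

text \<open>The transport derivative v . D_x of \<open>ebas j\<close>: differentiating
  \<open>cas k\<close> gives \<open>kdot k v\<close> times \<open>cas (- k)\<close>.\<close>

definition Yb :: "'n::finite idx => 'n phase => real" where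
 "Yb j z = kdot (fst j) (snd z) * ebas (%i. - fst j i, snd j) z"

text \<open>Multiplication by a velocity component moves the Hermite degree by exactly one, so
  truncation errors can arise only on the faces of a box of indices.\<close>

lemma Yb_expand:
 "Yb (k, m) z = (\<Sum>i\<in>UNIV. 2 * pi * of_int (k i) *
  (sqrt (real (Suc (m i))) * ebas (%i. - k i, up m i) z + sqrt (real (m i)) * ebas (%i. - k i, dn m i) z))"
proof -
 have "Yb (k, m) z = (\<Sum>i\<in>UNIV. 2 * pi * of_int (k i) * (cas (%i. - k i) (fst z) * (snd z $ i * nhm m (snd z))))"
  by (simp add: Yb_def kdot_def ebas_def sum_distrib_left sum_distrib_right mult_ac)
 then show ?thesis unfolding nhm_rec by (simp add: ebas_def algebra_simps)
qed

lemma Yb_L2: "Yb j \<in> L2 mu"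
proof -
 obtain k m where j: "j = (k, m)" by (cases j)
 have "Yb j = (%z. \<Sum>i\<in>UNIV. 2 * pi * of_int (k i) *
  (sqrt (real (Suc (m i))) * ebas (%i. - k i, up m i) z + sqrt (real (m i)) * ebas (%i. - k i, dn m i) z))"
  unfolding j by (rule ext) (rule Yb_expand)
 then show ?thesis by (simp only:) (intro L2_sum L2_scale L2_comb ebas_L2)
qed

lemma cas_periodic: "cas k (x + axis i 1) = cas k x"
proof -
 have "sin y = cos (y + - pi / 2)" for y :: real by (simp add: cos_diff)
 then show ?thesis
  unfolding cas_def using kdot_periodic[of k x i 0] kdot_periodic[of k x i "- pi / 2"] by simp
qed

text \<open>Hermite functions have unbounded support and are not admissible as test functions; they
  are approximated by their velocity truncations.\<close>

definition vcut :: "nat => ('n::finite phase => real) => 'n phase => real" where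
 "vcut n f z = f z * chi (real (Suc n)) (snd z)"

lemma continuous_chi_snd: "continuous_on A (%z::'n::finite phase. chi R (snd z))"
 by (rule continuous_on_compose2[OF continuous_chi[of UNIV]]) (auto intro!: continuous_intros)

lemma continuous_dchi_snd: "continuous_on A (%z::'n::finite phase. dchi R i (snd z))"
 by (rule continuous_on_compose2[OF continuous_dchi[of UNIV]]) (auto intro!: continuous_intros)

lemma cut_L2_tendsto:
 assumes c: "continuous_on UNIV f" and e: "exp_bounded g" and b: "!!x v. abs (f (x, v)) <= g v"
 shows "vcut n f \<in> L2 mu" "(%n. L2_norm mu (vcut n f -. f)) \<leadsto> 0"
proof -
 have cc: "continuous_on UNIV (vcut n f)" for n
  unfolding vcut_def by (intro continuous_intros c continuous_chi_snd)
 have bb: "norm (vcut n f (x, v)) <= g v" for n x v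
 proof -
  have "abs (f (x, v)) * abs (chi (real (Suc n)) v) <= abs (f (x, v)) * 1"
   using chi_bounds[of "real (Suc n)" v] by (intro mult_left_mono) auto
  then show ?thesis using b[of x v] by (simp add: vcut_def abs_mult)
 qed
 show "vcut n f \<in> L2 mu"
  by (rule exp_bounded_L2_mu[OF borel_measurable_mu_continuous[OF cc] e bb])
 show "(%n. L2_norm mu (vcut n f -. f)) \<leadsto> 0"
 proof (rule exp_bounded_L2_mu_tendsto[OF borel_measurable_mu_continuous[OF cc] borel_measurable_mu_continuous[OF c] e bb])
  show "norm (f (x, v)) <= g v" for x v using b by simp
  fix z
  have "(%n. f z * chi (real (Suc n)) (snd z)) \<leadsto> f z * 1" by (intro tendsto_intros chi_tendsto)
  then show "(%n. vcut n f z) \<leadsto> f z" by (simp add: vcut_def)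
 qed
qed

lemma exp_bounded_kdot: "exp_bounded (%v. abs (kdot k v))"
 unfolding kdot_def by (intro exp_bounded_abs exp_bounded_mult exp_bounded_const exp_bounded_sum exp_bounded_component)

lemma cut_Yb:
 "vcut n (Yb j) \<in> L2 mu" "(%n. L2_norm mu (vcut n (Yb j) -. Yb j)) \<leadsto> 0"
proof -
 have c: "continuous_on UNIV (Yb j)"
  unfolding Yb_def by (intro continuous_intros continuous_ebas)
 have e: "exp_bounded (%v. abs (kdot (fst j) v) * (2 * abs (nhm (snd j) v)))"
  by (intro exp_bounded_mult exp_bounded_kdot exp_bounded_const exp_bounded_abs exp_bounded_nhm)
 have b: "abs (Yb j (x, v)) <= abs (kdot (fst j) v) * (2 * abs (nhm (snd j) v))" for x v
  using ebas_bound[of "(%i. - fst j i, snd j)" x v] by (simp add: Yb_def abs_mult mult_left_mono)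
 show "vcut n (Yb j) \<in> L2 mu" "(%n. L2_norm mu (vcut n (Yb j) -. Yb j)) \<leadsto> 0"
  using cut_L2_tendsto[OF c e b] by blast+
qed

definition cut_grad :: "nat => 'n::finite idx => 'n phase => real^'n" where
 "cut_grad n j z = (\<chi> i. ebas_grad j z $ i * chi (real (Suc n)) (snd z) + ebas j z * dchi (real (Suc n)) i (snd z))"

lemma continuous_ebas_grad: "continuous_on A (ebas_grad j)"
 unfolding ebas_grad_def by (intro continuous_on_vec_lambda continuous_intros continuous_ebas)

text \<open>Convergence has to hold in V and not only in L2, because the functionals
  \<open>F t\<close> are bounded on V alone.\<close>

lemma cut_ebas:
 "has_v_grad (vcut n (ebas j)) (cut_grad n j)" "(%n. V_norm (vcut n (ebas j) -. ebas j)) \<leadsto> 0"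
proof -
 obtain C where C: "0 <= C" "!!R i (v::real^'a). R > 0 ==> abs (dchi R i v) <= C / R" by (rule dchi_bound) (rule that)
 have dC: "abs (dchi (real (Suc n)) i v) <= C" for n i and v :: "real^'a"
 proof -
  have "C / real (Suc n) <= C / 1" using C(1) by (intro divide_left_mono) auto
  then show ?thesis using C(2)[of "real (Suc n)" i v] by simp
 qed
 note L = cut_L2_tendsto[OF continuous_ebas exp_bounded_ebas_bound ebas_bound]
 define g where "g v = (\<Sum>i\<in>UNIV. sqrt (real (snd j i)) * (2 * abs (nhm (dn (snd j) i) v)) + 2 * abs (nhm (snd j) v) * C)" for v
 have eg: "exp_bounded g" unfolding g_def
  by (intro exp_bounded_sum exp_bounded_add exp_bounded_mult exp_bounded_const exp_bounded_abs exp_bounded_nhm)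
 have gb: "abs (ebas_grad j (x, v) $ i) <= sqrt (real (snd j i)) * (2 * abs (nhm (dn (snd j) i) v))" for x v i
  using ebas_bound[of "(fst j, dn (snd j) i)" x v] by (simp add: ebas_grad_def abs_mult mult_left_mono)
 have cg: "continuous_on UNIV (cut_grad n j)" for n
  unfolding cut_grad_def
  by (intro continuous_on_vec_lambda continuous_intros continuous_ebas continuous_ebas_grad continuous_chi_snd continuous_dchi_snd)
 have b1: "norm (cut_grad n j (x, v)) <= g v" for n x v
 proof -
  have "norm (cut_grad n j (x, v)) <= (\<Sum>i\<in>UNIV. abs (cut_grad n j (x, v) $ i))" by (rule norm_le_l1_cart)
  also have "\<dots> <= g v" unfolding g_def
  proof (rule sum_mono)
   fix i
   have "abs (ebas_grad j (x, v) $ i * chi (real (Suc n)) v) <= sqrt (real (snd j i)) * (2 * abs (nhm (dn (snd j) i) v)) * 1"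
    unfolding abs_mult using gb[of x v i] chi_bounds[of "real (Suc n)" v] by (intro mult_mono) auto
   moreover have "abs (ebas j (x, v) * dchi (real (Suc n)) i v) <= 2 * abs (nhm (snd j) v) * C"
    unfolding abs_mult by (intro mult_mono ebas_bound dC) auto
   ultimately show "abs (cut_grad n j (x, v) $ i) <= sqrt (real (snd j i)) * (2 * abs (nhm (dn (snd j) i) v)) + 2 * abs (nhm (snd j) v) * C"
    unfolding cut_grad_def by simp
  qed
  finally show ?thesis .
 qed
 have b2: "norm (ebas_grad j (x, v)) <= g v" for x v
 proof -
  have "norm (ebas_grad j (x, v)) <= (\<Sum>i\<in>UNIV. abs (ebas_grad j (x, v) $ i))" by (rule norm_le_l1_cart)
  also have "\<dots> <= g v" unfolding g_def
  proof (rule sum_mono)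
   fix i
   have "0 <= 2 * abs (nhm (snd j) v) * C" using C(1) by simp
   then show "abs (ebas_grad j (x, v) $ i) <= sqrt (real (snd j i)) * (2 * abs (nhm (dn (snd j) i) v)) + 2 * abs (nhm (snd j) v) * C"
    using gb[of x v i] by linarith
  qed
  finally show ?thesis .
 qed
 have H: "has_v_grad (vcut n (ebas j)) (cut_grad n j)" for n
 proof (rule has_v_grad_C1)
  show "continuous_on UNIV (vcut n (ebas j))"
   unfolding vcut_def by (intro continuous_intros continuous_ebas continuous_chi_snd)
  show "continuous_on UNIV (cut_grad n j)" by (rule cg)
  show "cut_grad n j \<in> L2 mu" by (rule exp_bounded_L2_mu[OF borel_measurable_mu_continuous[OF cg] eg b1])
  show "vcut n (ebas j) \<in> L2 mu" by (rule L(1))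
  fix x i
  have "has_dd (%v. ebas j (x, v)) (axis i 1) (%v. ebas_grad j (x, v) $ i)"
   using has_dd_cmult[OF has_dd_nhm[of "snd j" i], of "cas (fst j) x"]
   by (simp add: ebas_def ebas_grad_def mult_ac)
  from has_dd_mult[OF this has_dd_chi]
  show "has_dd (%v. vcut n (ebas j) (x, v)) (axis i 1) (%v. cut_grad n j (x, v) $ i)"
   by (simp add: vcut_def cut_grad_def)
 qed
 then show "has_v_grad (vcut n (ebas j)) (cut_grad n j)" .
 have G: "(%n. L2_norm mu (cut_grad n j -. ebas_grad j)) \<leadsto> 0"
 proof (rule exp_bounded_L2_mu_tendsto[OF borel_measurable_mu_continuous[OF cg] borel_measurable_mu_continuous[OF continuous_ebas_grad] eg b1 b2])
  fix z
  have "(%n. ebas_grad j z $ i * chi (real (Suc n)) (snd z) + ebas j z * dchi (real (Suc n)) i (snd z)) \<leadsto> ebas_grad j z $ i * 1 + ebas j z * 0" for i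
   by (intro tendsto_intros chi_tendsto dchi_tendsto)
  then show "(%n. cut_grad n j z) \<leadsto> ebas_grad j z"
   by (intro vec_tendstoI) (simp add: cut_grad_def)
 qed
 show "(%n. V_norm (vcut n (ebas j) -. ebas j)) \<leadsto> 0"
 proof (rule Lim_null_sandwich[OF V_norm_nonneg])
  show "V_norm (vcut n (ebas j) -. ebas j) <= L2_norm mu (vcut n (ebas j) -. ebas j) + L2_norm mu (cut_grad n j -. ebas_grad j)" for n
  proof -
   have D: "has_v_grad (vcut n (ebas j) -. ebas j) (cut_grad n j -. ebas_grad j)"
    using has_v_grad_comb[OF H[of n] has_v_grad_ebas[of j], of 1 "-1"] by simp
   show ?thesis unfolding V_norm_eq[OF D] by (intro sqrt_sum_squares_le_sum) auto
  qed
  show "(%n. L2_norm mu (vcut n (ebas j) -. ebas j) + L2_norm mu (cut_grad n j -. ebas_grad j)) \<leadsto> 0"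
   using tendsto_add[OF L(2) G] by simp
 qed
qed

lemma has_dd_of_snd_snd:
 "snd (snd b) = 0 ==> has_dd (%p. h (snd (snd p))) b (%_. 0)"
 by (simp add: has_dd_def)

text \<open>Time derivative and transport do not differentiate in v, so the cutoff passes through
  the derivative and multiplies \<open>Yb j\<close>.\<close>

lemma test_fun_product:
 assumes E: "deriv_seq E" and ab: "0 < a" "b < T" "!!t. E 0 t \<noteq> 0 ==> a <= t \<and> t <= b"
 shows "test_fun T (%p. E 0 (fst p) * vcut n (ebas j) (snd p))"
  and "Y_classical (%p. E 0 (fst p) * vcut n (ebas j) (snd p)) t z = E 1 t * vcut n (ebas j) z + E 0 t * vcut n (Yb j) z"
proof -
 let ?q = "%p. E 0 (fst p) * vcut n (ebas j) (snd p)"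
 have s1: "smooth_gen (%p::real \<times> (real^'a) \<times> (real^'a). kdot (fst j) (fst (snd p)))"
  by (intro smooth_gen.linear bounded_linear_compose[OF bounded_linear_kdot] bounded_linear_compose[OF bounded_linear_fst bounded_linear_snd])
 have s2: "smooth_gen (%p::real \<times> (real^'a) \<times> (real^'a). snd (snd p) $ i)" for i
  by (intro smooth_gen.linear bounded_linear_compose[OF bounded_linear_vec_nth] bounded_linear_compose[OF bounded_linear_snd bounded_linear_snd])
 have "smooth_gen (%p::real \<times> (real^'a) \<times> (real^'a). E 0 (fst p) *
   ((cos (kdot (fst j) (fst (snd p))) + sin (kdot (fst j) (fst (snd p)))) * nhm (snd j) (snd (snd p)) * chi (real (Suc n)) (snd (snd p))))"
  by (rule smooth_gen.mult[OF smooth_gen.comp[OF E smooth_gen.linear[OF bounded_linear_fst]]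
    smooth_gen.mult[OF smooth_gen.mult[OF smooth_gen_cas[OF s1] smooth_gen_nhm[OF s2]] smooth_gen_chi[OF s2]]])
 then have "smooth_gen ?q" by (simp add: vcut_def ebas_def cas_def)
 then have sm: "smooth ?q" by (rule smooth_gen_smooth)
 show "test_fun T ?q"
  unfolding test_fun_def
 proof (intro conjI allI sm exI)
  show "E 0 (fst (t, x + axis i 1, v)) * vcut n (ebas j) (snd (t, x + axis i 1, v)) =
    E 0 (fst (t, x, v)) * vcut n (ebas j) (snd (t, x, v))" for t x v i
   by (simp add: vcut_def ebas_def cas_periodic)
  show "0 < a" "b < T" by fact+
  show "E 0 (fst (t, x, v)) * vcut n (ebas j) (snd (t, x, v)) \<noteq> 0 \<longrightarrow> a <= t \<and> t <= b \<and> norm v <= real CARD('a) * real (Suc n)" for t x v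
   using ab(3)[of t] chi_support[of "real (Suc n)" v] by (auto simp: vcut_def not_le[symmetric])
 qed
 obtain x v where z: "z = (x, v)" by (cases z)
 let ?b = "(1, v, 0) :: real \<times> (real^'a) \<times> (real^'a)"
 have d1: "has_dd (%p. E 0 (fst p)) ?b (%p. E (Suc 0) (fst p) * fst ?b)"
  by (rule has_dd_chain[OF has_dd_linear[OF bounded_linear_fst]]) (use E in \<open>simp add: deriv_seq_def\<close>)
 have "((%y. cos y + sin y) has_real_derivative cos y - sin y) (at y)" for y :: real
  by (auto intro!: derivative_eq_intros)
 moreover have "has_dd (%p. kdot (fst j) (fst (snd p))) ?b (%_. kdot (fst j) (fst (snd ?b)))"
  by (intro has_dd_linear bounded_linear_compose[OF bounded_linear_kdot] bounded_linear_compose[OF bounded_linear_fst bounded_linear_snd])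
 ultimately have d2: "has_dd (%p. cos (kdot (fst j) (fst (snd p))) + sin (kdot (fst j) (fst (snd p)))) ?b
   (%p. (cos (kdot (fst j) (fst (snd p))) - sin (kdot (fst j) (fst (snd p)))) * kdot (fst j) (fst (snd ?b)))"
  by (intro has_dd_chain)
 have d3: "has_dd (%p. (%v. nhm (snd j) v * chi (real (Suc n)) v) (snd (snd p))) ?b (%_. 0)"
  by (rule has_dd_of_snd_snd) simp
 have "has_dd (%p. E 0 (fst p) * ((cos (kdot (fst j) (fst (snd p))) + sin (kdot (fst j) (fst (snd p)))) * (nhm (snd j) (snd (snd p)) * chi (real (Suc n)) (snd (snd p))))) ?b
  (%p. E (Suc 0) (fst p) * fst ?b * ((cos (kdot (fst j) (fst (snd p))) + sin (kdot (fst j) (fst (snd p)))) * (nhm (snd j) (snd (snd p)) * chi (real (Suc n)) (snd (snd p))))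
   + E 0 (fst p) * (((cos (kdot (fst j) (fst (snd p))) - sin (kdot (fst j) (fst (snd p)))) * kdot (fst j) (fst (snd ?b))) * (nhm (snd j) (snd (snd p)) * chi (real (Suc n)) (snd (snd p)))
    + (cos (kdot (fst j) (fst (snd p))) + sin (kdot (fst j) (fst (snd p)))) * 0))"
  by (rule has_dd_mult[OF d1 has_dd_mult[OF d2 d3]])
 moreover have "(%p. E 0 (fst p) * ((cos (kdot (fst j) (fst (snd p))) + sin (kdot (fst j) (fst (snd p)))) * (nhm (snd j) (snd (snd p)) * chi (real (Suc n)) (snd (snd p))))) = ?q"
  by (simp add: vcut_def ebas_def cas_def mult.assoc)
 ultimately have "has_dd ?q ?b
  (%p. E (Suc 0) (fst p) * fst ?b * ((cos (kdot (fst j) (fst (snd p))) + sin (kdot (fst j) (fst (snd p)))) * (nhm (snd j) (snd (snd p)) * chi (real (Suc n)) (snd (snd p))))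
   + E 0 (fst p) * (((cos (kdot (fst j) (fst (snd p))) - sin (kdot (fst j) (fst (snd p)))) * kdot (fst j) (fst (snd ?b))) * (nhm (snd j) (snd (snd p)) * chi (real (Suc n)) (snd (snd p)))
    + (cos (kdot (fst j) (fst (snd p))) + sin (kdot (fst j) (fst (snd p)))) * 0))" by (simp only:)
 from has_dd_unique[OF smooth_has_dd[OF sm] this, of "(t, x, v)"]
 show "Y_classical ?q t z = E 1 t * vcut n (ebas j) z + E 0 t * vcut n (Yb j) z"
  unfolding z Y_classical_eq[OF sm] by (simp add: vcut_def ebas_def Yb_def cas_def kdot_uminus mult_ac)
qed

lemma deriv_seq_continuous: "deriv_seq E ==> continuous_on A (E m)"
 unfolding deriv_seq_def by (intro continuous_at_imp_continuous_on ballI) (metis DERIV_isCont)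

lemma integrable_V_dual_norm:
 assumes "F \<in> L2_V_dual T"
 shows "integrable (time T) (%t. V_dual_norm (F t))"
proof (rule integrable_dominated)
 interpret T: finite_measure "time T" by (rule finite_measure_time)
 show "integrable (time T) (%t. 1 + (V_dual_norm (F t))^2)" using assms by (simp add: bochner_L2_iff)
 show "(%t. V_dual_norm (F t)) \<in> borel_measurable (time T)"
  using assms by (intro Vd.strongly_measurable_norm) (simp add: bochner_L2_iff)
 have "abs x <= 1 + x\<^sup>2" for x :: real
 proof -
  have "0 <= (abs x - 1)^2 + abs x" by simp
  then show ?thesis by (simp add: power2_eq_square algebra_simps)
 qed
 then show "AE t in time T. norm (V_dual_norm (F t)) <= norm (1 + (V_dual_norm (F t))^2)" by simp
qed

lemma compact_bound:
 fixes f :: "real => real"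
 assumes "continuous_on {a..b} f"
 obtains C where "0 <= C" "!!t. t \<in> {a..b} ==> abs (f t) <= C"
proof -
 have "bounded (f ` {a..b})" by (intro compact_imp_bounded compact_continuous_image assms) auto
 then obtain C where C: "\<forall>y\<in>f ` {a..b}. norm y <= C" unfolding bounded_iff by (rule exE)
 show thesis by (rule that[of "max C 0"]) (use C in \<open>auto simp: le_max_iff_disj\<close>)
qed

lemma convergent_real_bounded:
 fixes X :: "nat => real"
 assumes "X \<leadsto> L"
 obtains B where "0 <= B" "!!n. abs (X n) <= B"
proof -
 have "Bseq X" using assms by (intro convergent_imp_Bseq convergentI)
 then obtain K where "K > 0" "\<forall>n. norm (X n) <= K" by (rule BseqE)
 then show thesis by (intro that[of K]) auto
qed

text \<open>The weak form of c' = F(e_j) + <w, v . D_x e_j> for the coefficient c = <w, e_j>.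
  Truncated basis functions are used as test functions and the truncation is removed by dominated
  convergence on both sides.\<close>

lemma coefficient_equation:
 assumes w: "w \<in> C_H T" and Y: "has_Y T w F"
  and E: "deriv_seq E" and ab: "0 < a" "b < T" "!!t. E 0 t \<noteq> 0 ==> a <= t \<and> t <= b"
 shows "(LINT t|time T. E 0 t * (F t (ebas j) + ip mu (w t) (Yb j))) = - (LINT t|time T. E 1 t * ip mu (w t) (ebas j))"
proof -
 interpret T: finite_measure "time T" by (rule finite_measure_time)
 have F: "F \<in> L2_V_dual T" using Y by (simp add: has_Y_def)
 let ?q = "%n p. E 0 (fst p) * vcut n (ebas j) (snd p)"
 note P = test_fun_product[OF E ab]
 have cutV: "vcut n (ebas j) \<in> V" for n by (rule has_v_grad_V[OF cut_ebas(1)])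
 have ebV: "ebas j \<in> V" by (rule has_v_grad_V[OF has_v_grad_ebas])
 have cutL: "vcut n (ebas j) \<in> L2 mu" for n by (rule V_L2[OF cutV])
 have cE: "continuous_on {0..T} (E m)" for m by (rule deriv_seq_continuous[OF E])
 obtain C0 where C0: "0 <= C0" "!!t. t \<in> {0..T} ==> abs (E 0 t) <= C0" by (rule compact_bound[OF cE[of 0]]) (rule that)
 obtain C1 where C1: "0 <= C1" "!!t. t \<in> {0..T} ==> abs (E 1 t) <= C1" by (rule compact_bound[OF cE[of 1]]) (rule that)
 obtain W where W: "0 <= W" "!!t. t \<in> {0..T} ==> L2_norm mu (w t) <= W" by (rule C_H_bounded[OF w]) (rule that)
 have lim1: "(%n. L2_norm mu (vcut n (ebas j) -. ebas j)) \<leadsto> 0"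
  by (rule cut_L2_tendsto(2)[OF continuous_ebas exp_bounded_ebas_bound ebas_bound])
 have Vbd: "(%n. V_norm (vcut n (ebas j))) \<leadsto> V_norm (ebas j)"
 proof -
  have "(%n. V_norm (vcut n (ebas j)) - V_norm (ebas j)) \<leadsto> 0"
   by (rule Lim_null_comparison[OF _ cut_ebas(2)[of j]]) (simp add: V.N_diff_ineq[OF cutV ebV])
  then show ?thesis by (simp add: LIM_zero_iff)
 qed
 obtain B where B: "0 <= B" "!!n. abs (V_norm (vcut n (ebas j))) <= B" by (rule convergent_real_bounded[OF Vbd]) (rule that)
 obtain B' where B': "0 <= B'" "!!n. abs (L2_norm mu (vcut n (Yb j))) <= B'"
  by (rule convergent_real_bounded[OF L2_norm_tendsto[OF cut_Yb(1) Yb_L2 cut_Yb(2)]]) (rule that)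
 have eq: "(LINT t|time T. F t (%z. ?q n (t, z))) = - (LINT t|time T. E 1 t * ip mu (w t) (vcut n (ebas j)) + E 0 t * ip mu (w t) (vcut n (Yb j)))" for n
 proof -
  have "(LINT t|time T. ip mu (w t) (Y_classical (?q n) t)) = (LINT t|time T. E 1 t * ip mu (w t) (vcut n (ebas j)) + E 0 t * ip mu (w t) (vcut n (Yb j)))"
  proof (rule LINT_cong[OF refl])
   fix t assume "t \<in> space (time T)"
   then have t: "t \<in> {0..T}" by simp
   have "Y_classical (?q n) t = (%z. E 1 t * vcut n (ebas j) z + E 0 t * vcut n (Yb j) z)" by (rule ext) (rule P(2))
   then show "ip mu (w t) (Y_classical (?q n) t) = E 1 t * ip mu (w t) (vcut n (ebas j)) + E 0 t * ip mu (w t) (vcut n (Yb j))"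
    using C_H_L2[OF w t] cutL[of n] cut_Yb(1)[of n j]
    by (simp add: ip_add_right L2_scale ip_scale_right)
  qed
  then show ?thesis using has_Y_eq[OF Y P(1)[of n j]] by simp
 qed
 have l1: "(%n. LINT t|time T. F t (%z. ?q n (t, z))) \<leadsto> (LINT t|time T. E 0 t * F t (ebas j))"
 proof (rule integral_dominated_convergence[where w="%t. C0 * (V_dual_norm (F t) * B)"])
  have i0: "integrable (time T) (%t. F t (ebas j))"
   by (rule integrable_V_dual_V[OF F V.bochner_L2_continuous]) (simp_all add: ebV V.N_zero)
  show "(%t. E 0 t * F t (ebas j)) \<in> borel_measurable (time T)"
   using borel_measurable_time_continuous[OF deriv_seq_continuous[OF E, of _ 0]] borel_measurable_integrable[OF i0] by measurable
  show "(%t. F t (%z. ?q n (t, z))) \<in> borel_measurable (time T)" for n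
   by (rule borel_measurable_integrable[OF integrable_V_dual_V[OF F test_fun_v_grad_properties(2)[OF P(1)]]])
  show "integrable (time T) (%t. C0 * (V_dual_norm (F t) * B))" using integrable_V_dual_norm[OF F] by simp
  have sc: "AE t in time T. \<forall>n. F t (%z. ?q n (t, z)) = E 0 t * F t (vcut n (ebas j))"
   using bochner_L2_mem[OF F]
  proof eventually_elim
   case (elim t)
   show ?case
   proof
    fix n
    show "F t (%z. ?q n (t, z)) = E 0 t * F t (vcut n (ebas j))"
     using V_dual_comb[OF elim cutV[of n] cutV[of n], of "E 0 t" 0] by simp
   qed
  qed
  show "AE t in time T. (%n. F t (%z. ?q n (t, z))) \<leadsto> E 0 t * F t (ebas j)"
   using sc bochner_L2_mem[OF F]
  proof eventually_elim
   case (elim t)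
   have "(%n. F t (vcut n (ebas j)) - F t (ebas j)) \<leadsto> 0"
   proof (rule Lim_null_comparison)
    have "norm (F t (vcut n (ebas j)) - F t (ebas j)) <= V_dual_norm (F t) * V_norm (vcut n (ebas j) -. ebas j)" for n
     using V_dual_bound[OF elim(2) V.diff_mem[OF cutV[of n] ebV]] V_dual_diff[OF elim(2) cutV[of n] ebV] by simp
    then show "\<forall>\<^sub>F n in sequentially. norm (F t (vcut n (ebas j)) - F t (ebas j)) <= V_dual_norm (F t) * V_norm (vcut n (ebas j) -. ebas j)"
     by simp
    show "(%n. V_dual_norm (F t) * V_norm (vcut n (ebas j) -. ebas j)) \<leadsto> 0"
     by (rule tendsto_mult_right_zero[OF cut_ebas(2)])
   qed
   then have "(%n. F t (vcut n (ebas j))) \<leadsto> F t (ebas j)" by (simp add: LIM_zero_iff)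
   then have "(%n. E 0 t * F t (vcut n (ebas j))) \<leadsto> E 0 t * F t (ebas j)" by (rule tendsto_mult_left)
   then show ?case using elim(1) by simp
  qed
  have sp: "AE t in time T. t \<in> space (time T)" by (rule AE_space)
  show "AE t in time T. norm (F t (%z. ?q n (t, z))) <= C0 * (V_dual_norm (F t) * B)" for n
   using sc bochner_L2_mem[OF F] sp
  proof eventually_elim
   case (elim t)
   have "abs (F t (vcut n (ebas j))) <= V_dual_norm (F t) * V_norm (vcut n (ebas j))" by (rule V_dual_bound[OF elim(2) cutV])
   also have "\<dots> <= V_dual_norm (F t) * B"
    using B(2)[of n] V_dual_norm_nonneg[OF elim(2)] by (intro mult_left_mono) auto
   finally have "abs (E 0 t) * abs (F t (vcut n (ebas j))) <= C0 * (V_dual_norm (F t) * B)"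
    using C0(2)[of t] elim(3) C0(1) by (intro mult_mono) auto
   then show ?case using elim(1) by (simp add: abs_mult)
  qed
 qed
 have cw: "continuous_on {0..T} (%t. ip mu (w t) f)" if "f \<in> L2 mu" for f
  by (rule C_H_ip_continuous[OF w C_H_const[OF that]])
 have l2: "(%n. LINT t|time T. E 1 t * ip mu (w t) (vcut n (ebas j)) + E 0 t * ip mu (w t) (vcut n (Yb j)))
   \<leadsto> (LINT t|time T. E 1 t * ip mu (w t) (ebas j) + E 0 t * ip mu (w t) (Yb j))"
 proof (rule integral_dominated_convergence[where w="%t. C1 * (W * B) + C0 * (W * B')"])
  have m: "(%t. E 1 t * ip mu (w t) f + E 0 t * ip mu (w t) g) \<in> borel_measurable (time T)" if "f \<in> L2 mu" "g \<in> L2 mu" for f g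
   by (intro borel_measurable_integrable integrable_time_continuous continuous_intros cE cw that)
  show "(%t. E 1 t * ip mu (w t) (ebas j) + E 0 t * ip mu (w t) (Yb j)) \<in> borel_measurable (time T)" by (rule m[OF ebas_L2 Yb_L2])
  show "(%t. E 1 t * ip mu (w t) (vcut n (ebas j)) + E 0 t * ip mu (w t) (vcut n (Yb j))) \<in> borel_measurable (time T)" for n by (rule m[OF cutL cut_Yb(1)])
  show "integrable (time T) (%t. C1 * (W * B) + C0 * (W * B'))" by simp
  show "AE t in time T. (%n. E 1 t * ip mu (w t) (vcut n (ebas j)) + E 0 t * ip mu (w t) (vcut n (Yb j)))
    \<leadsto> E 1 t * ip mu (w t) (ebas j) + E 0 t * ip mu (w t) (Yb j)"
  proof (rule AE_time)
   fix t assume "0 < t" "t < T"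
   then have t: "t \<in> {0..T}" by simp
   show "(%n. E 1 t * ip mu (w t) (vcut n (ebas j)) + E 0 t * ip mu (w t) (vcut n (Yb j)))
    \<leadsto> E 1 t * ip mu (w t) (ebas j) + E 0 t * ip mu (w t) (Yb j)"
    unfolding ip_commute[of mu "w t"]
    by (intro tendsto_add tendsto_mult tendsto_const ip_tendsto cutL ebas_L2 C_H_L2[OF w t] lim1 cut_Yb Yb_L2)
  qed
  show "AE t in time T. norm (E 1 t * ip mu (w t) (vcut n (ebas j)) + E 0 t * ip mu (w t) (vcut n (Yb j))) <= C1 * (W * B) + C0 * (W * B')" for n
  proof (rule AE_time)
   fix t assume "0 < t" "t < T"
   then have t: "t \<in> {0..T}" by simp
   have Bn: "L2_norm mu (vcut n (ebas j)) <= B"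
    using order_trans[OF L2_norm_le_V_norm(1) abs_le_D1[OF B(2)]] .
   have "abs (ip mu (w t) (vcut n (ebas j))) <= L2_norm mu (w t) * L2_norm mu (vcut n (ebas j))" by (intro ip_Cauchy_Schwarz C_H_L2[OF w t] cutL)
   also have "\<dots> <= W * B" using W t L2_norm_nonneg[of mu "vcut n (ebas j)"] Bn by (intro mult_mono) auto
   finally have 1: "abs (E 1 t * ip mu (w t) (vcut n (ebas j))) <= C1 * (W * B)" unfolding abs_mult using C1 t by (intro mult_mono) auto
   have "abs (ip mu (w t) (vcut n (Yb j))) <= L2_norm mu (w t) * L2_norm mu (vcut n (Yb j))" by (intro ip_Cauchy_Schwarz C_H_L2[OF w t] cut_Yb)
   also have "\<dots> <= W * B'" using W t B' B'(2)[of n] by (intro mult_mono) auto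
   finally have 2: "abs (E 0 t * ip mu (w t) (vcut n (Yb j))) <= C0 * (W * B')" unfolding abs_mult using C0 t by (intro mult_mono) auto
   show "norm (E 1 t * ip mu (w t) (vcut n (ebas j)) + E 0 t * ip mu (w t) (vcut n (Yb j))) <= C1 * (W * B) + C0 * (W * B')"
    using 1 2 unfolding real_norm_def by linarith
  qed
 qed
 have "(LINT t|time T. E 0 t * F t (ebas j)) = - (LINT t|time T. E 1 t * ip mu (w t) (ebas j) + E 0 t * ip mu (w t) (Yb j))"
  by (rule LIMSEQ_unique[OF l1]) (unfold eq, rule tendsto_minus[OF l2])
 moreover have I1: "integrable (time T) (%t. E 1 t * ip mu (w t) (ebas j))" and I2: "integrable (time T) (%t. E 0 t * ip mu (w t) (Yb j))"
  by (intro integrable_time_continuous continuous_intros cE cw ebas_L2 Yb_L2)+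
 moreover have I3: "integrable (time T) (%t. E 0 t * F t (ebas j))"
 proof (rule integrable_dominated)
  have i0: "integrable (time T) (%t. F t (ebas j))"
   by (rule integrable_V_dual_V[OF F V.bochner_L2_continuous]) (simp_all add: ebV V.N_zero)
  then show "integrable (time T) (%t. C0 * F t (ebas j))" by simp
  show "(%t. E 0 t * F t (ebas j)) \<in> borel_measurable (time T)"
   using borel_measurable_time_continuous[OF deriv_seq_continuous[OF E, of _ 0]] borel_measurable_integrable[OF i0] by measurable
  show "AE t in time T. norm (E 0 t * F t (ebas j)) <= norm (C0 * F t (ebas j))"
   using C0 by (intro AE_time) (auto simp: abs_mult intro!: mult_right_mono)
 qed
 ultimately show ?thesis by (simp add: distrib_left)
qed

section \<open>The energy identity\<close>

lemma time_integral_FTC: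
 assumes "0 <= T" "!!t. (G has_real_derivative g t) (at t)" "continuous_on {0..T} g"
 shows "(LINT t|time T. g t) = G T - G 0"
proof -
 have "(g has_integral G T - G 0) {0..T}"
  using assms(2) by (intro fundamental_theorem_of_calculus assms(1))
   (auto simp: has_real_derivative_iff_has_vector_derivative[symmetric] intro: has_field_derivative_at_within)
 then have "integral {0<..<T} g = G T - G 0"
  by (simp add: integral_open_interval_real[symmetric] integral_unique)
 moreover have "(LINT t|time T. g t) = integral {0<..<T} g"
  by (rule lebesgue_integral_eq_integral[OF integrable_time_continuous[OF assms(3)]]) simp
 ultimately show ?thesis by simp
qed

text \<open>The derivative of the rescaled step is nonnegative, has integral 1 and vanishes outside
  the interval of radius \<delta> around a, so integration against it is an average over that
  interval.\<close>

lemma step_average: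
 assumes S: "deriv_seq S" "!!y. y <= -1 ==> S 0 y = 0" "!!y. 1 <= y ==> S 0 y = 1"
   "!!y. 0 <= S 1 y" "!!y. 1 <= abs y ==> S 1 y = 0"
  and f: "continuous_on {0..T} f" and a: "0 < \<delta>" "\<delta> <= a" "a + \<delta> <= T"
  and \<epsilon>: "!!t. t \<in> {0..T} ==> abs (t - a) <= \<delta> ==> abs (f t - c) <= \<epsilon>"
 shows "abs ((LINT t|time T. S 1 ((t - a) / \<delta>) / \<delta> * f t) - c) <= \<epsilon>"
proof -
 have d: "((%t. S m ((t - a) / \<delta>)) has_real_derivative S (Suc m) ((t - a) / \<delta>) / \<delta>) (at t)" for m t
 proof -
  have "((%t. (t - a) / \<delta>) has_real_derivative 1 / \<delta>) (at t)"
   using a(1) by (auto intro!: derivative_eq_intros)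
  moreover have "(S m has_real_derivative S (Suc m) ((t - a) / \<delta>)) (at ((t - a) / \<delta>))"
   using S(1) by (simp add: deriv_seq_def)
  ultimately show ?thesis using DERIV_chain2 by fastforce
 qed
 let ?s = "%t. S 1 ((t - a) / \<delta>) / \<delta>"
 have cS: "continuous_on A (%t. S 1 ((t - a) / \<delta>))" for A
  using DERIV_isCont[OF d[of 1]] by (simp add: continuous_at_imp_continuous_on)
 then have cs: "continuous_on A ?s" for A using a(1) by (intro continuous_on_divide continuous_intros) auto
 have "(LINT t|time T. ?s t) = S 0 ((T - a) / \<delta>) - S 0 ((0 - a) / \<delta>)"
  using d[of 0] a by (intro time_integral_FTC cs) auto
 moreover have "1 <= (T - a) / \<delta>" "(0 - a) / \<delta> <= -1" using a by (auto simp: field_simps)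
 ultimately have one: "(LINT t|time T. ?s t) = 1" using S(2,3) by simp
 have I: "integrable (time T) ?s" "integrable (time T) (%t. ?s t * f t)"
  by (intro integrable_time_continuous cs continuous_on_mult f)+
 have I': "integrable (time T) (%t. ?s t * f t - ?s t * c)" "integrable (time T) (%t. \<epsilon> * ?s t)"
  by (intro integrable_minus I integrable_mult_left integrable_mult_right)+
 have "(LINT t|time T. ?s t * f t) - c = (LINT t|time T. ?s t * f t - ?s t * c)"
  unfolding LINT_diff[OF I(2) integrable_mult_left[OF I(1)]] integral_mult_left_zero one by simp
 also have "abs (\<dots>) <= (LINT t|time T. \<epsilon> * ?s t)"
 proof -
  have "norm (LINT t|time T. ?s t * f t - ?s t * c) <= (LINT t|time T. norm (?s t * f t - ?s t * c))"
   by (rule integral_norm_bound)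
  also have "\<dots> <= (LINT t|time T. \<epsilon> * ?s t)"
  proof (rule integral_mono)
   fix t assume "t \<in> space (time T)"
   then have t: "t \<in> {0..T}" by simp
   have s0: "0 <= ?s t" using S(4) a(1) by simp
   have "?s t * abs (f t - c) <= ?s t * \<epsilon>"
   proof (cases "abs (t - a) <= \<delta>")
    case True then show ?thesis using \<epsilon>[OF t] s0 by (intro mult_left_mono) auto
   next
    case False
    then have "1 <= abs ((t - a) / \<delta>)" using a(1) by simp
    then have "?s t = 0" using S(5) by simp
    then show ?thesis by (simp only: mult_zero_left order_refl)
   qed
   moreover have "norm (?s t * f t - ?s t * c) = ?s t * abs (f t - c)"
    using s0 by (simp only: right_diff_distrib[symmetric] real_norm_def abs_mult abs_of_nonneg)
   ultimately show "norm (?s t * f t - ?s t * c) <= \<epsilon> * ?s t" by (simp add: mult.commute)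
  qed (use I' in simp_all)
  finally show ?thesis by simp
 qed
 also have "\<dots> = \<epsilon>" unfolding integral_mult_right_zero one by simp
 finally show ?thesis by simp
qed

text \<open>Test with smooth trapezoids that rise near 0 and fall near s: the left side tends to the
  integral of g, the right side to the difference of averages of f at s and at 0.\<close>

lemma time_FTC_weak:
 fixes f g :: "real => real"
 assumes f: "continuous_on {0..T} f" and g: "integrable (time T) g"
  and weak: "!!E a b. deriv_seq E ==> 0 < a ==> b < T ==> (!!t. E 0 t \<noteq> 0 ==> a <= t \<and> t <= b) ==>
   (LINT t|time T. E 0 t * g t) = - (LINT t|time T. E 1 t * f t)"
  and s: "s \<in> {0<..T}"
 shows "(LINT t|time s. g t) = f s - f 0"
proof -
 obtain S where S: "deriv_seq S" "!!y. y <= -1 ==> S 0 y = 0" "!!y. 1 <= y ==> S 0 y = 1"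
  "!!y. 0 <= S 1 y" "!!y. 1 <= abs y ==> S 1 y = 0" by (rule step_exists) (rule that)
 have mono: "S 0 x <= S 0 y" if "x <= y" for x y
  using S(1,4) that by (intro DERIV_nonneg_imp_nondecreasing[of x y "S 0"]) (auto simp: deriv_seq_def)
 have S0: "0 <= S 0 y" "S 0 y <= 1" for y
  using mono[of "min y (-1)" y] mono[of y "max y 1"] S(2)[of "min y (-1)"] S(3)[of "max y 1"] by auto
 \<comment> \<open>The 5 makes \<open>5 * \<delta> n\<close> at most s, which separates the rising
   edge centred at \<open>a n\<close>, at distance \<open>2 * \<delta> n\<close> from 0, from the
   falling edge centred at \<open>b n\<close>, as far from s.\<close>
 define \<delta> where "\<delta> n = s / (real n + 5)" for n
 define a where "a n = 2 * \<delta> n" for n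
 define b where "b n = s - 2 * \<delta> n" for n
 \<comment> \<open>The power of \<open>\<delta> n\<close> is the chain rule factor of the m-th
   derivative.\<close>
 define E where "E n m t = (S m ((t - a n) / \<delta> n) - S m ((t - b n) / \<delta> n)) / \<delta> n ^ m" for n m t
 have \<delta>: "0 < \<delta> n" "5 * \<delta> n <= s" for n
  using s mult_left_mono[of 5 "real n + 5" s] by (auto simp: \<delta>_def field_simps)
 have \<delta>0: "\<delta> \<leadsto> 0" unfolding \<delta>_def by real_asymp
 have E: "deriv_seq (E n)" for n
  unfolding deriv_seq_def
 proof (intro allI)
  fix m :: nat and t :: real
  have d: "((%t. S m ((t - c) / \<delta> n)) has_real_derivative S (Suc m) ((t - c) / \<delta> n) * (1 / \<delta> n)) (at t)" for c
  proof (rule DERIV_chain2[where f="S m" and g="%t. (t - c) / \<delta> n"])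
   show "(S m has_real_derivative S (Suc m) ((t - c) / \<delta> n)) (at ((t - c) / \<delta> n))" using S(1) by (simp add: deriv_seq_def)
   show "((%t. (t - c) / \<delta> n) has_real_derivative 1 / \<delta> n) (at t)" using \<delta>(1)[of n] by (auto intro!: derivative_eq_intros)
  qed
  show "(E n m has_real_derivative E n (Suc m) t) (at t)"
   unfolding E_def by (rule DERIV_cong[OF DERIV_cdivide[OF DERIV_diff[OF d d]]]) (simp add: diff_divide_distrib)
 qed
 have supp: "\<delta> n <= t \<and> t <= s - \<delta> n" if "E n 0 t \<noteq> 0" for n t
 proof (rule ccontr)
  assume "\<not> (\<delta> n <= t \<and> t <= s - \<delta> n)"
  then have "t - a n <= - \<delta> n \<and> t - b n <= - \<delta> n \<or> t - a n \<ge> \<delta> n \<and> t - b n \<ge> \<delta> n"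
   using \<delta>[of n] unfolding a_def b_def by linarith
  then have "(t - a n) / \<delta> n <= -1 \<and> (t - b n) / \<delta> n <= -1 \<or> (t - a n) / \<delta> n \<ge> 1 \<and> (t - b n) / \<delta> n \<ge> 1"
   using \<delta>(1)[of n] by (auto simp: field_simps)
  then have "E n 0 t = 0" using S(2,3) by (auto simp: E_def)
  then show False using that by simp
 qed
 have E1: "E n 0 t = 1" if "3 * \<delta> n <= t" "t <= s - 3 * \<delta> n" for n t
 proof -
  have "(t - a n) / \<delta> n \<ge> 1" "(t - b n) / \<delta> n <= -1"
   using that \<delta>(1)[of n] by (auto simp: a_def b_def field_simps)
  then show ?thesis using S(2,3) by (simp add: E_def)
 qed
 have eq: "(LINT t|time T. E n 0 t * g t) = - (LINT t|time T. E n 1 t * f t)" for n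
  using \<delta>[of n] s by (intro weak[OF E, of "\<delta> n" "s - \<delta> n"] supp) auto
 have l1: "(%n. LINT t|time T. E n 0 t * g t) \<leadsto> (LINT t|time T. (if t < s then g t else 0))"
 proof (rule integral_dominated_convergence[where w="%t. norm (g t)"])
  show "(%t. E n 0 t * g t) \<in> borel_measurable (time T)" for n
   by (rule borel_measurable_times[OF borel_measurable_time_continuous[OF deriv_seq_continuous[OF E]] borel_measurable_integrable[OF g]])
  have "integrable (time T) (%t. if t < s then g t else 0)"
   using integrable_time_extend(1)[of s T g] integrable_time_subset[OF g, of s] s by simp
  then show "(%t. if t < s then g t else 0) \<in> borel_measurable (time T)" by (rule borel_measurable_integrable)
  show "integrable (time T) (%t. norm (g t))" using g by simp
  show "AE t in time T. (%n. E n 0 t * g t) \<leadsto> (if t < s then g t else 0)"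
  proof (rule AE_time)
   fix t :: real assume t: "0 < t"
   show "(%n. E n 0 t * g t) \<leadsto> (if t < s then g t else 0)"
   proof (cases "t < s")
    case True
    have "\<forall>\<^sub>F n in sequentially. 3 * \<delta> n < min t (s - t)"
     using t True by (intro order_tendstoD(2)[OF tendsto_mult_right_zero[OF \<delta>0]]) auto
    then have "\<forall>\<^sub>F n in sequentially. E n 0 t * g t = g t" by eventually_elim (simp add: E1)
    then show ?thesis using True by (simp add: tendsto_eventually)
   next
    case False
    then have "E n 0 t = 0" for n using supp[of n t] \<delta>(1)[of n] by fastforce
    then show ?thesis using False by simp
   qed
  qed
  show "AE t in time T. norm (E n 0 t * g t) <= norm (g t)" for n
  proof (rule AE_I2)
   fix t :: real
   have "abs (E n 0 t) <= 1" using S0[of "(t - a n) / \<delta> n"] S0[of "(t - b n) / \<delta> n"] by (simp add: E_def abs_le_iff)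
   then have "abs (E n 0 t) * abs (g t) <= 1 * abs (g t)" by (intro mult_right_mono) auto
   then show "norm (E n 0 t * g t) <= norm (g t)" by (simp add: abs_mult)
  qed
 qed
 have av: "(%n. LINT t|time T. S 1 ((t - p n) / \<delta> n) / \<delta> n * f t) \<leadsto> f q"
  if p: "!!n. \<delta> n <= p n" "!!n. p n + \<delta> n <= T" "p \<leadsto> q" and q: "q \<in> {0..T}" for p q
 proof (rule LIMSEQ_I)
  fix \<epsilon> :: real assume "0 < \<epsilon>"
  then have "0 < \<epsilon> / 2" by simp
  with f q obtain d where d: "d > 0" "!!t. t \<in> {0..T} ==> dist t q < d ==> dist (f t) (f q) < \<epsilon> / 2"
   unfolding continuous_on_iff by meson
  have "(%n. abs (p n - q) + \<delta> n) \<leadsto> abs (q - q) + 0" by (intro tendsto_intros p \<delta>0)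
  then have "\<forall>\<^sub>F n in sequentially. abs (p n - q) + \<delta> n < d" using d(1) by (intro order_tendstoD(2)) auto
  then obtain n0 where n0: "!!n. n \<ge> n0 ==> abs (p n - q) + \<delta> n < d" unfolding eventually_sequentially by auto
  show "\<exists>n0. \<forall>n\<ge>n0. norm ((LINT t|time T. S 1 ((t - p n) / \<delta> n) / \<delta> n * f t) - f q) < \<epsilon>"
  proof (intro exI allI impI)
   fix n assume n: "n \<ge> n0"
   have "abs ((LINT t|time T. S 1 ((t - p n) / \<delta> n) / \<delta> n * f t) - f q) <= \<epsilon> / 2"
   proof (rule step_average[OF S f \<delta>(1) p(1) p(2)])
    fix t assume t: "t \<in> {0..T}" "abs (t - p n) <= \<delta> n"
    then have "dist t q < d" using n0[OF n] unfolding dist_real_def by linarith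
    then show "abs (f t - f q) <= \<epsilon> / 2" using d(2)[OF t(1)] by (simp add: dist_real_def)
   qed
   then show "norm ((LINT t|time T. S 1 ((t - p n) / \<delta> n) / \<delta> n * f t) - f q) < \<epsilon>" using \<open>0 < \<epsilon>\<close> by simp
  qed
 qed
 have ab: "a \<leadsto> 0" "b \<leadsto> s"
  using tendsto_mult_right_zero[OF \<delta>0, of 2] tendsto_diff[OF tendsto_const tendsto_mult_right_zero[OF \<delta>0, of 2], of s]
  by (simp_all add: a_def[abs_def] b_def[abs_def])
 have la: "(%n. LINT t|time T. S 1 ((t - a n) / \<delta> n) / \<delta> n * f t) \<leadsto> f 0"
 proof (rule av[OF _ _ ab(1)])
  show "\<delta> n <= a n" "a n + \<delta> n <= T" for n using \<delta>[of n] s by (auto simp: a_def)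
 qed (use s in auto)
 have lb: "(%n. LINT t|time T. S 1 ((t - b n) / \<delta> n) / \<delta> n * f t) \<leadsto> f s"
 proof (rule av[OF _ _ ab(2)])
  show "\<delta> n <= b n" "b n + \<delta> n <= T" for n using \<delta>[of n] s by (auto simp: b_def)
 qed (use s in auto)
 have split: "- (LINT t|time T. E n 1 t * f t) =
   (LINT t|time T. S 1 ((t - b n) / \<delta> n) / \<delta> n * f t) - (LINT t|time T. S 1 ((t - a n) / \<delta> n) / \<delta> n * f t)" for n
 proof -
  have c: "continuous_on A (S 1)" for A by (rule deriv_seq_continuous[OF S(1)])
  have I: "integrable (time T) (%t. S 1 ((t - p) / \<delta> n) / \<delta> n * f t)" for p
   using \<delta>(1)[of n]
   by (intro integrable_time_continuous continuous_on_mult f continuous_on_divide continuous_on_compose2[OF c[of UNIV]] continuous_intros) auto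
  show ?thesis
   unfolding LINT_diff[OF I I, symmetric] Bochner_Integration.integral_minus[symmetric]
   by (simp add: E_def diff_divide_distrib left_diff_distrib)
 qed
 have "(LINT t|time T. (if t < s then g t else 0)) = f s - f 0"
  by (rule LIMSEQ_unique[OF l1]) (unfold eq split, rule tendsto_diff[OF lb la])
 then show ?thesis using integrable_time_extend(2)[of s T g] s by simp
qed

text \<open>With g merely integrable, the product rule is replaced by Fubini: integrating g(t) g(r)
  over the triangle r < t in both orders gives g(t) (f(t) - f(0)) on one side and g(r) (f(T) - f(r))
  on the other.\<close>

lemma time_square_FTC:
 fixes f g :: "real => real"
 assumes f: "continuous_on {0..T} f" and g: "integrable (time T) g" and T: "0 < T"
  and FTC: "!!s. s \<in> {0<..T} ==> (LINT t|time s. g t) = f s - f 0"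
 shows "(f T)^2 - (f 0)^2 = 2 * (LINT t|time T. f t * g t)"
proof -
 interpret T: finite_measure "time T" by (rule finite_measure_time)
 interpret P: pair_sigma_finite "time T" "time T" ..
 have gm [measurable]: "g \<in> borel_measurable (time T)" using g by (rule borel_measurable_integrable)
 have idm [measurable]: "(%t::real. t) \<in> borel_measurable (time T)"
  by (rule borel_measurable_time_continuous) (rule continuous_on_id)
 let ?K = "%t r. if r < t then g t * g r else 0"
 have Im: "integrable (time T) (%r. if r < t then g r else 0)" "integrable (time T) (%r. if t < r then g r else 0)" for t
  by (rule integrable_dominated[OF g], (measurable)[1], rule AE_I2, simp)+
 have K: "integrable (time T \<Otimes>\<^sub>M time T) (case_prod ?K)"
 proof (rule P.Fubini_integrable)
  show "case_prod ?K \<in> borel_measurable (time T \<Otimes>\<^sub>M time T)" by measurable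
  show "AE t in time T. integrable (time T) (%r. case (t, r) of (t, r) => ?K t r)"
  proof (rule AE_I2)
   fix t
   have "(%r. ?K t r) = (%r. g t * (if r < t then g r else 0))" by auto
   then show "integrable (time T) (%r. case (t, r) of (t, r) => ?K t r)" using Im(1)[of t] by simp
  qed
  show "integrable (time T) (%t. LINT r|time T. norm (case (t, r) of (t, r) => ?K t r))"
  proof (rule integrable_dominated)
   show "integrable (time T) (%t. abs (g t) * (LINT r|time T. abs (g r)))" using g by simp
   show "(%t. LINT r|time T. norm (case (t, r) of (t, r) => ?K t r)) \<in> borel_measurable (time T)" by measurable
   show "AE t in time T. norm (LINT r|time T. norm (case (t, r) of (t, r) => ?K t r)) <= norm (abs (g t) * (LINT r|time T. abs (g r)))"
   proof (rule AE_I2)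
    fix t
    have "(LINT r|time T. abs (?K t r)) <= (LINT r|time T. abs (g t) * abs (g r))"
    proof (rule integral_mono)
     have "(%r. ?K t r) = (%r. g t * (if r < t then g r else 0))" by auto
     then show "integrable (time T) (%r. abs (?K t r))" using Im(1)[of t] by simp
    qed (use g in \<open>auto simp: abs_mult\<close>)
    then show "norm (LINT r|time T. norm (case (t, r) of (t, r) => ?K t r)) <= norm (abs (g t) * (LINT r|time T. abs (g r)))"
     by (simp add: abs_of_nonneg)
   qed
  qed
 qed
 have in1: "(LINT r|time T. ?K t r) = g t * (f t - f 0)" if "t \<in> {0<..<T}" for t
 proof -
  have "(%r. ?K t r) = (%r. g t * (if r < t then g r else 0))" by auto
  then show ?thesis using integrable_time_extend(2)[of t T g] FTC[of t] that by simp
 qed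
 have in2: "(LINT t|time T. ?K t r) = g r * (f T - f r)" if r: "r \<in> {0<..<T}" for r
 proof -
  have "(LINT t|time T. g t) = (LINT t|time T. (if t < r then g t else 0) + (if r < t then g t else 0))"
  proof (rule integral_cong_AE)
   have "AE t in lebesgue. t \<noteq> r" by (rule AE_I'[of "{r}"]) auto
   then have "AE t in time T. t \<noteq> r" by (subst AE_restrict_space_iff) auto
   then show "AE t in time T. g t = (if t < r then g t else 0) + (if r < t then g t else 0)" by eventually_elim auto
  qed measurable
  also have "\<dots> = (LINT t|time r. g t) + (LINT t|time T. (if r < t then g t else 0))"
   using integrable_time_extend(2)[of r T g] r by (subst LINT_add[OF Im]) simp
  finally have "(LINT t|time T. (if r < t then g t else 0)) = f T - f r"
   using FTC[of T] FTC[of r] r T by simp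
  moreover have "(%t. ?K t r) = (%t. g r * (if r < t then g t else 0))" by auto
  ultimately show ?thesis by simp
 qed
 have fg: "integrable (time T) (%t. f t * g t)"
 proof -
  obtain C where C: "0 <= C" "!!t. t \<in> {0..T} ==> abs (f t) <= C" by (rule compact_bound[OF f]) (rule that)
  show ?thesis
  proof (rule integrable_dominated)
   show "integrable (time T) (%t. C * g t)" using g by (rule integrable_mult_right)
   show "(%t. f t * g t) \<in> borel_measurable (time T)"
    by (rule borel_measurable_times[OF borel_measurable_integrable[OF integrable_time_continuous[OF f]] gm])
   show "AE t in time T. norm (f t * g t) <= norm (C * g t)"
    by (rule AE_time) (use C in \<open>simp add: abs_mult mult_right_mono\<close>)
  qed
 qed
 have "(LINT t|time T. g t * (f t - f 0)) = (LINT t|time T. LINT r|time T. ?K t r)"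
  using in1 by (intro LINT_cong) auto
 also have "\<dots> = (LINT r|time T. LINT t|time T. ?K t r)" by (rule P.Fubini_integral[OF K, symmetric])
 also have "\<dots> = (LINT r|time T. g r * (f T - f r))"
  using in2 by (intro LINT_cong) auto
 finally have "(LINT t|time T. f t * g t - f 0 * g t) = (LINT t|time T. f T * g t - f t * g t)"
  by (simp add: algebra_simps)
 then have "(LINT t|time T. f t * g t) - f 0 * (LINT t|time T. g t) = f T * (LINT t|time T. g t) - (LINT t|time T. f t * g t)"
  using fg g by (simp add: LINT_diff)
 then show ?thesis using FTC[of T] T by (simp add: power2_eq_square algebra_simps)
qed

section \<open>Transport terms on boxes of indices\<close>

text \<open>By Bessel's inequality the squared coefficients over all the disjoint sets together have
  a finite sum.\<close>

lemma (in orthonormal_system) disjoint_coefficients_tendsto: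
 assumes f: "f \<in> L2 M" and fin: "!!n. finite (D n)" and disj: "disjoint_family D"
 shows "(%n. \<Sum>j\<in>D n. (ip M f (e j))^2) \<leadsto> 0"
proof (rule summable_LIMSEQ_zero, rule summableI_nonneg_bounded)
 show "0 <= (\<Sum>j\<in>D n. (ip M f (e j))^2)" for n by (intro sum_nonneg) auto
 fix n
 have "(\<Sum>m<n. \<Sum>j\<in>D m. (ip M f (e j))^2) = (\<Sum>j\<in>(\<Union>m<n. D m). (ip M f (e j))^2)"
  using fin disj by (intro sum.UNION_disjoint[symmetric]) (auto simp: disjoint_family_on_def)
 also have "\<dots> <= (L2_norm M f)^2" using fin by (intro Bessel f) auto
 finally show "(\<Sum>m<n. \<Sum>j\<in>D m. (ip M f (e j))^2) <= (L2_norm M f)^2" .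
qed

text \<open>Separate bounds for frequencies and degrees, so that M can be chosen after N.\<close>

definition box :: "nat => nat => 'n::finite idx set" where
 "box N M = {k. \<forall>i. abs (k i) <= int N} \<times> {m. \<forall>i. m i <= M}"

definition face :: "nat => 'n => nat => 'n::finite idx set" where
 "face N i M = {k. \<forall>l. abs (k l) <= int N} \<times> {m. (\<forall>l. m l <= M) \<and> m i = M}"

lemma finite_cube:
 "finite {k :: 'n::finite => int. \<forall>i. abs (k i) <= int N}" "finite {m :: 'n::finite => nat. \<forall>i. m i <= M}"
proof -
 have "{k :: 'n => int. \<forall>i. abs (k i) <= int N} = PiE UNIV (%_. {- int N..int N})" by (simp add: PiE_UNIV_domain Pi_def set_eq_iff abs_le_iff minus_le_iff conj_commute)
 then show "finite {k :: 'n => int. \<forall>i. abs (k i) <= int N}" by (simp add: finite_PiE)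
 have "{m :: 'n => nat. \<forall>i. m i <= M} = PiE UNIV (%_. {..M})" by (auto simp: PiE_UNIV_domain)
 then show "finite {m :: 'n => nat. \<forall>i. m i <= M}" by (simp add: finite_PiE)
qed

lemma finite_box: "finite (box N M)"
 unfolding box_def by (intro finite_cartesian_product finite_cube)

lemma finite_face: "finite (face N i M)"
 by (rule finite_subset[OF _ finite_box[of N M]]) (auto simp: face_def box_def)

lemma box_exhausts:
 assumes "!!n. n <= M n"
 shows "\<forall>\<^sub>F n in sequentially. j \<in> box n (M n)"
proof -
 obtain k a where j: "j = (k, a)" by (cases j)
 let ?m = "Max (range (%i. nat (abs (k i))) \<union> range a)"
 have m: "nat (abs (k i)) <= ?m" "a i <= ?m" for i by (auto intro!: Max_ge)
 show ?thesis
 proof (rule eventually_sequentiallyI)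
  fix n assume n: "?m <= n"
  have "abs (k i) <= int n" "a i <= M n" for i
   using m[of i] n assms[of n] by linarith+
  then show "j \<in> box n (M n)" by (simp add: box_def j)
 qed
qed

lemma sum_uminus_cube:
 "(\<Sum>k\<in>{k :: 'n::finite => int. \<forall>i. abs (k i) <= int N}. f (%i. - k i)) = (\<Sum>k\<in>{k. \<forall>i. abs (k i) <= int N}. f k :: real)"
 by (rule sum.reindex_bij_witness[where i="%k i. - k i" and j="%k i. - k i"]) auto

text \<open>The transport contribution to the energy of the coefficients in J. The name anticipates
  that for a box only its faces contribute.\<close>

definition boundary_term :: "'n::finite idx set => ('n phase => real) => real" where
 "boundary_term J u = (\<Sum>j\<in>J. ip mu u (ebas j) * ip mu u (Yb j))"

text \<open>Transport being skew-symmetric, all terms with both indices inside the box cancel in pairs.\<close>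

lemma boundary_term_face:
 assumes u: "has_v_grad u g"
 shows "boundary_term (box N M) u =
  (\<Sum>i\<in>UNIV. \<Sum>(k, m)\<in>face N i M. 2 * pi * of_int (k i) * (ip mu u (ebas (k, m)) * ip mu (%z. g z $ i) (ebas (%l. - k l, m))))"
proof -
 let ?K = "{k :: 'a => int. \<forall>i. abs (k i) <= int N}" and ?A = "{m :: 'a => nat. \<forall>i. m i <= M}"
 define c where "c k m = ip mu u (ebas (k, m))" for k m
 define G where "G i k m = ip mu (%z. g z $ i) (ebas (k, m))" for i k m
 note uL = has_v_grad_L2(1)[OF u]
 have Gc: "sqrt (real (Suc (m i))) * c k (up m i) = G i k m" for k m i
  unfolding c_def G_def by (rule has_v_grad_hermite[OF u])
 have Y: "ip mu u (Yb (k, m)) = (\<Sum>i\<in>UNIV. 2 * pi * of_int (k i) *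
  (G i (%l. - k l) m + sqrt (real (m i)) * c (%l. - k l) (dn m i)))" for k m
 proof -
  have "Yb (k, m) = (%z. \<Sum>i\<in>UNIV. 2 * pi * of_int (k i) *
   (sqrt (real (Suc (m i))) * ebas (%i. - k i, up m i) z + sqrt (real (m i)) * ebas (%i. - k i, dn m i) z))"
   by (rule ext) (rule Yb_expand)
  then show ?thesis
   by (simp add: ip_sum_right L2_scale L2_comb ebas_L2 uL ip_scale_right ip_add_right Gc[symmetric] c_def)
 qed
 \<comment> \<open>Reindexing by the lowered degree turns the lowering terms into gradient
   coefficients; since raised indices must stay in the box, the degree M is missing on the
   right.\<close>
 have per_i: "(\<Sum>m\<in>?A. sqrt (real (m i)) * c k m * c (%l. - k l) (dn m i))
   = (\<Sum>m\<in>{m\<in>?A. m i < M}. G i k m * c (%l. - k l) m)" for k i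
 proof -
  have "(\<Sum>m\<in>?A. sqrt (real (m i)) * c k m * c (%l. - k l) (dn m i))
   = (\<Sum>m\<in>{m\<in>?A. 0 < m i}. sqrt (real (m i)) * c k m * c (%l. - k l) (dn m i))"
   by (intro sum.mono_neutral_right finite_cube) auto
  also have "\<dots> = (\<Sum>m\<in>{m\<in>?A. m i < M}. G i k m * c (%l. - k l) m)"
  proof (rule sum.reindex_bij_witness[where i="%m. up m i" and j="%m. dn m i"])
   fix m assume m: "m \<in> {m\<in>?A. 0 < m i}"
   then show "up (dn m i) i = m" by (simp add: up_dn)
   have "dn m i l <= M" for l using m by (auto simp: dn_def le_diff_conv intro: le_trans)
   moreover have "dn m i i < M" using m by (simp add: less_le_trans[OF diff_less])
   ultimately show "dn m i \<in> {m\<in>?A. m i < M}" by simp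
   show "G i k (dn m i) * c (%l. - k l) (dn m i) = sqrt (real (m i)) * c k m * c (%l. - k l) (dn m i)"
    using m Gc[of "dn m i" i k] by (simp add: up_dn)
  qed (auto simp: up_def dn_def)
  finally show ?thesis .
 qed
 have i_sum: "(\<Sum>k\<in>?K. \<Sum>m\<in>?A. of_int (k i) * (c k m * (G i (%l. - k l) m + sqrt (real (m i)) * c (%l. - k l) (dn m i))))
  = (\<Sum>k\<in>?K. \<Sum>m\<in>{m\<in>?A. m i = M}. of_int (k i) * (c k m * G i (%l. - k l) m))" for i
 proof -
  have "(\<Sum>k\<in>?K. \<Sum>m\<in>?A. of_int (k i) * (sqrt (real (m i)) * c k m * c (%l. - k l) (dn m i)))
   = (\<Sum>k\<in>?K. of_int (k i) * (\<Sum>m\<in>{m\<in>?A. m i < M}. G i k m * c (%l. - k l) m))"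
   by (simp only: sum_distrib_left[symmetric] per_i)
  \<comment> \<open>Replacing k by -k changes the sign and exchanges the two factors, so these terms
    cancel the raising terms with \<open>m i < M\<close>.\<close>
  also have "\<dots> = (\<Sum>k\<in>?K. - of_int (k i) * (\<Sum>m\<in>{m\<in>?A. m i < M}. c k m * G i (%l. - k l) m))"
   using sum_uminus_cube[where f="%k. - of_int (k i) * (\<Sum>m\<in>{m\<in>?A. m i < M}. c k m * G i (%l. - k l) m)"]
   by (simp add: mult.commute)
  finally have 1: "(\<Sum>k\<in>?K. \<Sum>m\<in>?A. of_int (k i) * (sqrt (real (m i)) * c k m * c (%l. - k l) (dn m i)))
   = - (\<Sum>k\<in>?K. \<Sum>m\<in>{m\<in>?A. m i < M}. of_int (k i) * (c k m * G i (%l. - k l) m))"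
   by (simp add: sum_distrib_left sum_negf)
  have 2: "(\<Sum>m\<in>?A. h m) = (\<Sum>m\<in>{m\<in>?A. m i < M}. h m) + (\<Sum>m\<in>{m\<in>?A. m i = M}. h m)" for h :: "('a => nat) => real"
  proof -
   have "sum h ?A = sum h ({m\<in>?A. m i < M} \<union> {m\<in>?A. m i = M})"
    by (rule arg_cong[where f="sum h"]) (auto simp: le_less)
   also have "\<dots> = (\<Sum>m\<in>{m\<in>?A. m i < M}. h m) + (\<Sum>m\<in>{m\<in>?A. m i = M}. h m)"
    by (rule sum.union_disjoint) (use finite_cube(2)[of M] in auto)
   finally show ?thesis .
  qed
  have "(\<Sum>k\<in>?K. \<Sum>m\<in>?A. of_int (k i) * (c k m * (G i (%l. - k l) m + sqrt (real (m i)) * c (%l. - k l) (dn m i))))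
   = (\<Sum>k\<in>?K. \<Sum>m\<in>?A. of_int (k i) * (c k m * G i (%l. - k l) m))
   + (\<Sum>k\<in>?K. \<Sum>m\<in>?A. of_int (k i) * (sqrt (real (m i)) * c k m * c (%l. - k l) (dn m i)))"
   by (simp add: sum.distrib[symmetric] algebra_simps)
  then show ?thesis unfolding 1 by (simp add: 2 sum.distrib)
 qed
 have "boundary_term (box N M) u = (\<Sum>k\<in>?K. \<Sum>m\<in>?A. c k m * ip mu u (Yb (k, m)))"
  unfolding boundary_term_def box_def sum.cartesian_product c_def by (intro sum.cong) auto
 also have "\<dots> = (\<Sum>i\<in>UNIV. 2 * pi * (\<Sum>k\<in>?K. \<Sum>m\<in>?A. of_int (k i) * (c k m * (G i (%l. - k l) m + sqrt (real (m i)) * c (%l. - k l) (dn m i)))))"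
 proof -
  have "c k m * ip mu u (Yb (k, m)) =
   (\<Sum>i\<in>UNIV. 2 * pi * (of_int (k i) * (c k m * (G i (%l. - k l) m + sqrt (real (m i)) * c (%l. - k l) (dn m i)))))" for k m
   unfolding Y sum_distrib_left by (intro sum.cong) (auto simp: mult_ac)
  then have "(\<Sum>k\<in>?K. \<Sum>m\<in>?A. c k m * ip mu u (Yb (k, m))) = (\<Sum>k\<in>?K. \<Sum>m\<in>?A. \<Sum>i\<in>UNIV. 2 * pi * (of_int (k i) * (c k m * (G i (%l. - k l) m + sqrt (real (m i)) * c (%l. - k l) (dn m i)))))"
   by simp
  also have "\<dots> = (\<Sum>k\<in>?K. \<Sum>i\<in>UNIV. \<Sum>m\<in>?A. 2 * pi * (of_int (k i) * (c k m * (G i (%l. - k l) m + sqrt (real (m i)) * c (%l. - k l) (dn m i)))))"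
   by (intro sum.cong refl) (rule sum.swap)
  also have "\<dots> = (\<Sum>i\<in>UNIV. \<Sum>k\<in>?K. \<Sum>m\<in>?A. 2 * pi * (of_int (k i) * (c k m * (G i (%l. - k l) m + sqrt (real (m i)) * c (%l. - k l) (dn m i)))))"
   by (rule sum.swap)
  finally show ?thesis by (simp only: sum_distrib_left)
 qed
 also have "\<dots> = (\<Sum>i\<in>UNIV. 2 * pi * (\<Sum>k\<in>?K. \<Sum>m\<in>{m\<in>?A. m i = M}. of_int (k i) * (c k m * G i (%l. - k l) m)))"
  by (simp only: i_sum)
 also have "\<dots> = (\<Sum>i\<in>UNIV. \<Sum>(k, m)\<in>face N i M. 2 * pi * of_int (k i) * (c k m * G i (%l. - k l) m))"
  unfolding face_def sum_distrib_left sum.cartesian_product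
  by (intro sum.cong refl) (auto simp: mult_ac)
 finally show ?thesis unfolding c_def G_def .
qed

text \<open>Each product is at most half the sum of the squares, the frequency factor is at most
  2\<pi>N, and the face is invariant under k to -k.\<close>

lemma boundary_term_bound:
 assumes u: "has_v_grad u g"
 shows "abs (boundary_term (box N M) u) <= (\<Sum>i\<in>UNIV. pi * real N *
  ((\<Sum>j\<in>face N i M. (ip mu u (ebas j))^2) + (\<Sum>j\<in>face N i M. (ip mu (%z. g z $ i) (ebas j))^2)))"
proof -
 define c where "c k m = ip mu u (ebas (k, m))" for k m
 define G where "G i k m = ip mu (%z. g z $ i) (ebas (k, m))" for i k m
 have "abs (boundary_term (box N M) u) <= (\<Sum>i\<in>UNIV. \<Sum>(k, m)\<in>face N i M. pi * real N * ((c k m)^2 + (G i (%l. - k l) m)^2))"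
  unfolding boundary_term_face[OF u] c_def[symmetric] G_def[symmetric]
 proof (intro order_trans[OF sum_abs] sum_mono)
  fix i and j :: "'a idx" assume "j \<in> face N i M"
  then obtain k m where j: "j = (k, m)" and k: "abs (k i) <= int N" by (auto simp: face_def)
  have "abs (real_of_int (k i)) <= real N" using k by linarith
  then have "abs (2 * pi * of_int (k i)) <= 2 * pi * real N" by (simp add: abs_mult)
  moreover have "abs (c k m * G i (%l. - k l) m) <= ((c k m)^2 + (G i (%l. - k l) m)^2) / 2"
   using sum_squares_bound[of "abs (c k m)" "abs (G i (%l. - k l) m)"] by (simp add: abs_mult)
  ultimately have "abs (2 * pi * of_int (k i)) * abs (c k m * G i (%l. - k l) m) <=
    (2 * pi * real N) * (((c k m)^2 + (G i (%l. - k l) m)^2) / 2)"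
   by (intro mult_mono) auto
  then show "abs (case j of (k, m) => 2 * pi * of_int (k i) * (c k m * G i (%l. - k l) m))
    <= (case j of (k, m) => pi * real N * ((c k m)^2 + (G i (%l. - k l) m)^2))"
   by (simp add: j abs_mult)
 qed
 also have "\<dots> = (\<Sum>i\<in>UNIV. pi * real N * ((\<Sum>j\<in>face N i M. (ip mu u (ebas j))^2) + (\<Sum>j\<in>face N i M. (ip mu (%z. g z $ i) (ebas j))^2)))"
 proof (rule sum.cong[OF refl])
  fix i
  have "(\<Sum>(k, m)\<in>face N i M. (G i (%l. - k l) m)^2) = (\<Sum>j\<in>face N i M. (ip mu (%z. g z $ i) (ebas j))^2)"
   unfolding G_def
   by (rule sum.reindex_bij_witness[where i="%(k, m). (%l. - k l, m)" and j="%(k, m). (%l. - k l, m)"])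
    (auto simp: face_def)
  moreover have "(\<Sum>(k, m)\<in>face N i M. (c k m)^2) = (\<Sum>j\<in>face N i M. (ip mu u (ebas j))^2)"
   unfolding c_def by (intro sum.cong) auto
  ultimately show "(\<Sum>(k, m)\<in>face N i M. pi * real N * ((c k m)^2 + (G i (%l. - k l) m)^2)) =
   pi * real N * ((\<Sum>j\<in>face N i M. (ip mu u (ebas j))^2) + (\<Sum>j\<in>face N i M. (ip mu (%z. g z $ i) (ebas j))^2))"
   by (simp add: case_prod_unfold sum_distrib_left[symmetric] sum.distrib)
 qed
 finally show ?thesis .
qed

text \<open>With N fixed, the faces for different M are disjoint, so their coefficient sums tend to
  0.\<close>

lemma boundary_term_tendsto:
 assumes u: "u \<in> V"
 shows "(%M. boundary_term (box N M) u) \<leadsto> 0"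
proof (rule Lim_null_comparison)
 note H = V_has_v_grad[OF u]
 let ?B = "%M. \<Sum>i\<in>UNIV. pi * real N * ((\<Sum>j\<in>face N i M. (ip mu u (ebas j))^2) + (\<Sum>j\<in>face N i M. (ip mu (%z. Dv u z $ i) (ebas j))^2))"
 show "\<forall>\<^sub>F M in sequentially. norm (boundary_term (box N M) u) <= ?B M"
  using boundary_term_bound[OF H] by simp
 have d: "disjoint_family (face N i)" for i :: 'a by (auto simp: disjoint_family_on_def face_def)
 have "?B \<leadsto> (\<Sum>i\<in>(UNIV::'a set). pi * real N * (0 + 0))"
  by (intro tendsto_intros eb.disjoint_coefficients_tendsto finite_face d V_L2[OF u] L2_component Dv_L2[OF u])
 then show "?B \<leadsto> 0" by simp
qed

text \<open>A bound uniform in M and integrable in time, needed to exchange the limit in M with the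
  time integral.\<close>

lemma boundary_term_le:
 fixes u :: "'n::finite phase => real"
 assumes u: "u \<in> V"
 shows "abs (boundary_term (box N M) u) <= real CARD('n) * (pi * real N) * (V_norm u)^2"
proof -
 have "abs (boundary_term (box N M) u) <= (\<Sum>i\<in>(UNIV::'n set). pi * real N * ((L2_norm mu u)^2 + (L2_norm mu (Dv u))^2))"
 proof (rule order_trans[OF boundary_term_bound[OF V_has_v_grad[OF u]]], intro sum_mono mult_left_mono add_mono)
  fix i :: 'n
  show "(\<Sum>j\<in>face N i M. (ip mu u (ebas j))^2) <= (L2_norm mu u)^2"
   by (intro eb.Bessel finite_face V_L2[OF u])
  have "(\<Sum>j\<in>face N i M. (ip mu (%z. Dv u z $ i) (ebas j))^2) <= (L2_norm mu (%z. Dv u z $ i))^2"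
   by (intro eb.Bessel finite_face L2_component Dv_L2[OF u])
  also have "\<dots> <= (L2_norm mu (Dv u))^2" by (intro power_mono L2_norm_component_le Dv_L2[OF u]) auto
  finally show "(\<Sum>j\<in>face N i M. (ip mu (%z. Dv u z $ i) (ebas j))^2) <= (L2_norm mu (Dv u))^2" .
 qed auto
 then show ?thesis by (simp add: V_norm_sq)
qed

section \<open>Projections onto finitely many basis functions in V\<close>

lemma has_v_grad_sum_ebas:
 "has_v_grad (%z. \<Sum>j\<in>J. c j * ebas j z) (%z. \<Sum>j\<in>J. c j *\<^sub>R ebas_grad j z)"
proof (induction J rule: infinite_finite_induct)
 case (insert j J)
 then show ?case using has_v_grad_comb[OF has_v_grad_ebas[of j] insert.IH, of "c j" 1] by simp
next
 case empty
 show ?case using has_v_grad_comb[OF has_v_grad_ebas has_v_grad_ebas, of 0 undefined 0 undefined] by simp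
next
 case (infinite J)
 then show ?case using has_v_grad_comb[OF has_v_grad_ebas has_v_grad_ebas, of 0 undefined 0 undefined] by simp
qed

text \<open>The indices that occur in the i-th derivative of a combination over J.\<close>

definition dn_idx :: "'n::finite idx set => 'n => 'n idx set" where
 "dn_idx J i = {(k, \<beta>). (k, up \<beta> i) \<in> J}"

lemma finite_dn_idx: "finite J ==> finite (dn_idx J i)"
proof (rule finite_subset)
 show "dn_idx J i \<subseteq> (%(k, m). (k, dn m i)) ` J"
  by (auto simp: dn_idx_def image_iff intro!: bexI[of _ "(_, up _ i)"])
qed simp

text \<open>Differentiation commutes with projection up to a shift of the index set. Hence
  projections are contractions in V and converge in V, which lets \<open>F t\<close> be applied to
  them.\<close>

lemma proj_has_v_grad:
 assumes u: "has_v_grad u g" and J: "finite J"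
 shows "has_v_grad (eb.proj J u) (%z. \<chi> i. eb.proj (dn_idx J i) (%z. g z $ i) z)"
proof -
 have "(\<Sum>j\<in>J. ip mu u (ebas j) *\<^sub>R ebas_grad j z) $ i = eb.proj (dn_idx J i) (%z. g z $ i) z" for z i
 proof -
  have "(\<Sum>j\<in>J. ip mu u (ebas j) *\<^sub>R ebas_grad j z) $ i =
   (\<Sum>(k, m)\<in>J. ip mu u (ebas (k, m)) * (sqrt (real (m i)) * ebas (k, dn m i) z))"
   by (simp add: sum_component ebas_grad_def case_prod_unfold)
  also have "\<dots> = (\<Sum>(k, m)\<in>{(k, m)\<in>J. 0 < m i}. ip mu u (ebas (k, m)) * (sqrt (real (m i)) * ebas (k, dn m i) z))"
   using J by (intro sum.mono_neutral_right) auto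
  also have "\<dots> = (\<Sum>j\<in>dn_idx J i. ip mu (%z. g z $ i) (ebas j) * ebas j z)"
  proof (rule sum.reindex_bij_witness[where i="%(k, m). (k, up m i)" and j="%(k, m). (k, dn m i)"], goal_cases)
   case (5 a)
   then obtain k m where a: "a = (k, m)" "0 < m i" by auto
   show ?case using has_v_grad_hermite[OF u, of "dn m i" i k] a by (simp add: up_dn mult.commute)
  qed (auto simp: dn_idx_def up_dn)
  finally show ?thesis by (simp add: eb.proj_def)
 qed
 then have "(%z. \<Sum>j\<in>J. ip mu u (ebas j) *\<^sub>R ebas_grad j z) = (%z. \<chi> i. eb.proj (dn_idx J i) (%z. g z $ i) z)"
  by (simp add: vec_eq_iff fun_eq_iff)
 then show ?thesis using has_v_grad_sum_ebas[where J=J and c="%j. ip mu u (ebas j)"] by (simp add: eb.proj_def)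
qed

lemma L2_norm_sq_components:
 fixes g :: "'a => real^'n::finite"
 assumes "g \<in> L2 M"
 shows "(L2_norm M g)^2 = (\<Sum>i\<in>UNIV. (L2_norm M (%z. g z $ i))^2)"
 by (simp add: L2_norm_ip ip_components[OF assms assms])

lemma V_norm_proj_le:
 assumes u: "u \<in> V" and J: "finite J"
 shows "eb.proj J u \<in> V" "V_norm (eb.proj J u) <= V_norm u"
proof -
 note H = V_has_v_grad[OF u]
 note P = proj_has_v_grad[OF H J]
 show "eb.proj J u \<in> V" by (rule has_v_grad_V[OF P])
 have "(\<Sum>i\<in>UNIV. (L2_norm mu (eb.proj (dn_idx J i) (%z. Dv u z $ i)))^2) <= (\<Sum>i\<in>UNIV. (L2_norm mu (%z. Dv u z $ i))^2)"
  by (intro sum_mono power_mono eb.norm_proj_le finite_dn_idx J L2_component Dv_L2[OF u]) auto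
 then have "(L2_norm mu (%z. \<chi> i. eb.proj (dn_idx J i) (%z. Dv u z $ i) z))^2 <= (L2_norm mu (Dv u))^2"
  using L2_norm_sq_components[OF has_v_grad_L2(2)[OF P]] L2_norm_sq_components[OF Dv_L2[OF u]] by simp
 moreover have "(L2_norm mu (eb.proj J u))^2 <= (L2_norm mu u)^2"
  by (intro power_mono eb.norm_proj_le J V_L2[OF u]) auto
 ultimately show "V_norm (eb.proj J u) <= V_norm u"
  unfolding V_norm_eq[OF P] V_norm_eq[OF H] by (intro real_sqrt_le_mono add_mono)
qed

lemma V_norm_proj_tendsto:
 assumes u: "u \<in> V" and J: "!!n. finite (J n)" "!!j. \<forall>\<^sub>F n in sequentially. j \<in> J n"
 shows "(%n. V_norm (eb.proj (J n) u -. u)) \<leadsto> 0"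
proof -
 note H = V_has_v_grad[OF u]
 note P = proj_has_v_grad[OF H J(1)]
 let ?p = "%n z. \<chi> i. eb.proj (dn_idx (J n) i) (%z. Dv u z $ i) z"
 have D: "has_v_grad (eb.proj (J n) u -. u) (?p n -. Dv u)" for n
  using has_v_grad_comb[OF P H, of 1 n "-1"] by simp
 have ex: "\<forall>\<^sub>F n in sequentially. j \<in> dn_idx (J n) i" for j i
  using J(2)[of "(fst j, up (snd j) i)"] by eventually_elim (simp add: dn_idx_def case_prod_unfold)
 have t1: "(%n. L2_norm mu (eb.proj (J n) u -. u)) \<leadsto> 0"
  by (rule eb.proj_tendsto[OF ebas_complete[OF V_L2[OF u]] J])
 have t2: "(%n. L2_norm mu (%z. eb.proj (dn_idx (J n) i) (%z. Dv u z $ i) z - Dv u z $ i)) \<leadsto> 0" for i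
  by (rule eb.proj_tendsto[OF ebas_complete[OF L2_component[OF Dv_L2[OF u]]] finite_dn_idx[OF J(1)] ex])
 have eq: "V_norm (eb.proj (J n) u -. u) = sqrt ((L2_norm mu (eb.proj (J n) u -. u))^2 +
  (\<Sum>i\<in>UNIV. (L2_norm mu (%z. eb.proj (dn_idx (J n) i) (%z. Dv u z $ i) z - Dv u z $ i))^2))" for n
  unfolding V_norm_eq[OF D] L2_norm_sq_components[OF has_v_grad_L2(2)[OF D]] by simp
 have "(%n. V_norm (eb.proj (J n) u -. u)) \<leadsto> sqrt (0\<^sup>2 + (\<Sum>i\<in>(UNIV::'a set). 0\<^sup>2))"
  unfolding eq by (intro tendsto_intros t1 t2)
 then show ?thesis by simp
qed

lemma V_dual_sum:
 assumes "F \<in> V_dual" "!!j. e j \<in> V"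
 shows "F (%z. \<Sum>j\<in>J. c j * e j z) = (\<Sum>j\<in>J. c j * F (e j))"
proof (induction J rule: infinite_finite_induct)
 case (insert j J)
 have "(%z. \<Sum>j\<in>J. c j * e j z) \<in> V" using insert(1)
 proof (induction J rule: finite_induct)
  case (insert i I)
  then show ?case using V.comb_mem[OF assms(2)[of i] insert(3), of "c i" 1] by simp
 qed (simp add: V.zero_mem)
 from V_dual_comb[OF assms(1) assms(2) this, of "c j" j 1] insert show ?case by simp
qed (simp_all add: V_dual_zero[OF assms(1)])

section \<open>Summation over the basis and passage to the limit\<close>

text \<open>The coefficient equation is a weak differential equation in time; its right side is
  integrable, so the rule for squares applies to each coefficient.\<close>

lemma energy_identity_basis:
 assumes w: "w \<in> C_H T" and Y: "has_Y T w F" and T: "0 < T"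
 shows "(ip mu (w T) (ebas j))^2 - (ip mu (w 0) (ebas j))^2 =
   2 * (LINT t|time T. ip mu (w t) (ebas j) * (F t (ebas j) + ip mu (w t) (Yb j)))"
  and "integrable (time T) (%t. ip mu (w t) (ebas j) * (F t (ebas j)))"
proof -
 have F: "F \<in> L2_V_dual T" using Y by (simp add: has_Y_def)
 have ebV: "ebas j \<in> V" by (rule has_v_grad_V[OF has_v_grad_ebas])
 have cw: "continuous_on {0..T} (%t. ip mu (w t) f)" if "f \<in> L2 mu" for f
  by (rule C_H_ip_continuous[OF w C_H_const[OF that]])
 have iF: "integrable (time T) (%t. F t (ebas j))"
  by (rule integrable_V_dual_V[OF F V.bochner_L2_continuous]) (simp_all add: ebV V.N_zero)
 have g: "integrable (time T) (%t. F t (ebas j) + ip mu (w t) (Yb j))"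
  by (rule integrable_plus[OF iF integrable_time_continuous[OF cw[OF Yb_L2]]])
 show "(ip mu (w T) (ebas j))^2 - (ip mu (w 0) (ebas j))^2 =
   2 * (LINT t|time T. ip mu (w t) (ebas j) * (F t (ebas j) + ip mu (w t) (Yb j)))"
  by (rule time_square_FTC[OF cw[OF ebas_L2] g T], rule time_FTC_weak[OF cw[OF ebas_L2] g])
   (rule coefficient_equation[OF w Y])
 obtain C where C: "0 <= C" "!!t. t \<in> {0..T} ==> abs (ip mu (w t) (ebas j)) <= C"
  by (rule compact_bound[OF cw[OF ebas_L2]]) (rule that)
 show "integrable (time T) (%t. ip mu (w t) (ebas j) * (F t (ebas j)))"
 proof (rule integrable_dominated)
  show "integrable (time T) (%t. C * F t (ebas j))" using iF by (rule integrable_mult_right)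
  show "(%t. ip mu (w t) (ebas j) * F t (ebas j)) \<in> borel_measurable (time T)"
   by (rule borel_measurable_times[OF borel_measurable_integrable[OF integrable_time_continuous[OF cw[OF ebas_L2]]] borel_measurable_integrable[OF iF]])
  show "AE t in time T. norm (ip mu (w t) (ebas j) * F t (ebas j)) <= norm (C * F t (ebas j))"
   by (rule AE_time) (use C in \<open>simp add: abs_mult mult_right_mono\<close>)
 qed
qed

lemma continuous_boundary_term:
 assumes w: "w \<in> C_H T"
 shows "integrable (time T) (%t. boundary_term J (w t))"
 unfolding boundary_term_def
 by (intro integrable_time_continuous continuous_intros C_H_ip_continuous[OF w] C_H_const ebas_L2 Yb_L2)

text \<open>For each N the time integral tends to 0 as M grows, so some M at least N makes it
  smaller than the prescribed tolerance.\<close>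

lemma boundary_term_small:
 fixes w :: "real => 'n::finite phase => real"
 assumes w: "w \<in> C_H T" "w \<in> L2_V T"
 shows "\<exists>M\<ge>N. abs (LINT t|time T. boundary_term (box N M) (w t)) <= 1 / real (Suc N)"
proof -
 have "(%M. LINT t|time T. boundary_term (box N M) (w t)) \<leadsto> (LINT t|time T. 0)"
 proof (rule integral_dominated_convergence[where w="%t. real CARD('n) * (pi * real N) * (V_norm (w t))^2"])
  show "(%t. boundary_term (box N M) (w t)) \<in> borel_measurable (time T)" for M
   by (rule borel_measurable_integrable[OF continuous_boundary_term[OF w(1)]])
  show "integrable (time T) (%t. real CARD('n) * (pi * real N) * (V_norm (w t))^2)"
   using w(2) by (intro integrable_mult_right) (simp add: bochner_L2_iff)
  show "AE t in time T. (%M. boundary_term (box N M) (w t)) \<leadsto> 0"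
   using bochner_L2_mem[OF w(2)] by eventually_elim (rule boundary_term_tendsto)
  show "AE t in time T. norm (boundary_term (box N M) (w t)) <= real CARD('n) * (pi * real N) * (V_norm (w t))^2" for M
   using bochner_L2_mem[OF w(2)] by eventually_elim (unfold real_norm_def, rule boundary_term_le)
 qed simp
 then have "\<forall>\<^sub>F M in sequentially. abs (LINT t|time T. boundary_term (box N M) (w t)) < 1 / real (Suc N)"
  by (intro order_tendstoD(2)[OF tendsto_rabs_zero]) simp_all
 moreover have "\<forall>\<^sub>F M in sequentially. N <= M" by (rule eventually_ge_at_top)
 ultimately have "\<forall>\<^sub>F M in sequentially. N <= M \<and> abs (LINT t|time T. boundary_term (box N M) (w t)) <= 1 / real (Suc N)"
  by eventually_elim simp
 then show ?thesis by (rule eventually_happens'[OF sequentially_bot])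
qed

lemma integrable_dual_norm_mult_norm:
 assumes F: "F \<in> L2_V_dual T" and w: "w \<in> L2_V T"
 shows "integrable (time T) (%t. V_dual_norm (F t) * V_norm (w t))"
proof (rule integrable_pairing_dominated)
 show "(%t. V_dual_norm (F t) * V_norm (w t)) \<in> borel_measurable (time T)"
  using F w by (intro borel_measurable_times Vd.strongly_measurable_norm V.strongly_measurable_norm) (simp_all add: bochner_L2_iff)
 show "AE t in time T. abs (V_dual_norm (F t) * V_norm (w t)) <= V_dual_norm (F t) * V_norm (w t)"
  using bochner_L2_mem[OF F] by eventually_elim (simp add: V_dual_norm_nonneg V_norm_nonneg)
qed (use F w in \<open>simp_all add: bochner_L2_iff\<close>)

theorem energy_identity:
 fixes w :: "real => 'n::finite phase => real"
 assumes w: "w \<in> C_H T" "w \<in> L2_V T" and Y: "has_Y T w F" and T: "0 < T"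
 shows "(LINT t|time T. F t (w t)) = 1/2 * (L2_norm mu (w T))^2 - 1/2 * (L2_norm mu (w 0))^2"
proof -
 have F: "F \<in> L2_V_dual T" using Y by (simp add: has_Y_def)
 have "\<exists>M. \<forall>N. N <= M N \<and> abs (LINT t|time T. boundary_term (box N (M N)) (w t)) <= 1 / real (Suc N)"
  using boundary_term_small[OF w] by (intro choice allI)
 then obtain M where M: "!!N. N <= M N" "!!N. abs (LINT t|time T. boundary_term (box N (M N)) (w t)) <= 1 / real (Suc N)" by auto
 \<comment> \<open>Because \<open>M N\<close> is at least N, these boxes exhaust all
   indices.\<close>
 define J :: "nat => 'n idx set" where "J N = box N (M N)" for N
 have J: "finite (J N)" "\<forall>\<^sub>F N in sequentially. j \<in> J N" for N j
  using finite_box box_exhausts[OF M(1)] by (simp_all add: J_def)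
 have ebV: "ebas j \<in> V" for j :: "'n idx" by (rule has_v_grad_V[OF has_v_grad_ebas])
 have T0: "0 \<in> {0..T}" "T \<in> {0..T}" using T by auto
 have lim0: "(%N. \<Sum>j\<in>J N. (ip mu (w t) (ebas j))^2) \<leadsto> (L2_norm mu (w t))\<^sup>2" if "t \<in> {0..T}" for t
  by (rule eb.norm_proj_tendsto[OF ebas_complete[OF C_H_L2[OF w(1) that]] J])
 let ?s = "%N t. \<Sum>j\<in>J N. ip mu (w t) (ebas j) * F t (ebas j)"
 have proj: "AE t in time T. \<forall>N. ?s N t = F t (eb.proj (J N) (w t))"
  using bochner_L2_mem[OF F] by eventually_elim (unfold eb.proj_def, intro allI, rule V_dual_sum[OF _ ebV, symmetric])
 have I: "integrable (time T) (?s N)" for N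
  by (rule Bochner_Integration.integrable_sum) (rule energy_identity_basis(2)[OF w(1) Y T])
 \<comment> \<open>Contraction of the projections in V gives the dominating function, the product of
   the dual norm and the V norm.\<close>
 have lim1: "(%N. LINT t|time T. ?s N t) \<leadsto> (LINT t|time T. F t (w t))"
 proof (rule integral_dominated_convergence[OF _ _ integrable_dual_norm_mult_norm[OF F w(2)]])
  show "(%t. F t (w t)) \<in> borel_measurable (time T)" by (rule borel_measurable_integrable[OF integrable_V_dual_V[OF F w(2)]])
  show "?s N \<in> borel_measurable (time T)" for N by (rule borel_measurable_integrable[OF I])
  show "AE t in time T. (%N. ?s N t) \<leadsto> F t (w t)"
   using proj bochner_L2_mem[OF F] bochner_L2_mem[OF w(2)]
  proof eventually_elim
   case (elim t)
   have "(%N. ?s N t - F t (w t)) \<leadsto> 0"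
   proof (rule Lim_null_comparison)
    have "norm (?s N t - F t (w t)) <= V_dual_norm (F t) * V_norm (eb.proj (J N) (w t) -. w t)" for N
    proof -
     note P = V_norm_proj_le(1)[OF elim(3) J(1)[of N]]
     have "?s N t - F t (w t) = F t (eb.proj (J N) (w t) -. w t)"
      using elim(1) V_dual_diff[OF elim(2) P elim(3)] by simp
     then show ?thesis using V_dual_bound[OF elim(2) V.diff_mem[OF P elim(3)]] by simp
    qed
    then show "\<forall>\<^sub>F N in sequentially. norm (?s N t - F t (w t)) <= V_dual_norm (F t) * V_norm (eb.proj (J N) (w t) -. w t)"
     by simp
    show "(%N. V_dual_norm (F t) * V_norm (eb.proj (J N) (w t) -. w t)) \<leadsto> 0"
     by (rule tendsto_mult_right_zero[OF V_norm_proj_tendsto[OF elim(3) J]])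
   qed
   then show ?case by (simp add: LIM_zero_iff)
  qed
  show "AE t in time T. norm (?s N t) <= V_dual_norm (F t) * V_norm (w t)" for N
   using proj bochner_L2_mem[OF F] bochner_L2_mem[OF w(2)]
  proof eventually_elim
   case (elim t)
   have "norm (?s N t) <= V_dual_norm (F t) * V_norm (eb.proj (J N) (w t))"
    using elim(1) V_dual_bound[OF elim(2) V_norm_proj_le(1)[OF elim(3) J(1)[of N]]] by simp
   also have "\<dots> <= V_dual_norm (F t) * V_norm (w t)"
    by (intro mult_left_mono V_norm_proj_le(2)[OF elim(3) J(1)] V_dual_norm_nonneg[OF elim(2)])
   finally show ?case .
  qed
 qed
 have eq: "(\<Sum>j\<in>J N. (ip mu (w T) (ebas j))^2) - (\<Sum>j\<in>J N. (ip mu (w 0) (ebas j))^2) =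
   2 * (LINT t|time T. ?s N t) + 2 * (LINT t|time T. boundary_term (J N) (w t))" for N
 proof -
  have I2: "integrable (time T) (%t. ip mu (w t) (ebas j) * ip mu (w t) (Yb j))" for j
   by (intro integrable_time_continuous continuous_intros C_H_ip_continuous[OF w(1)] C_H_const ebas_L2 Yb_L2)
  note I1 = energy_identity_basis(2)[OF w(1) Y T]
  have "(\<Sum>j\<in>J N. (ip mu (w T) (ebas j))^2) - (\<Sum>j\<in>J N. (ip mu (w 0) (ebas j))^2) =
   (\<Sum>j\<in>J N. 2 * ((LINT t|time T. ip mu (w t) (ebas j) * F t (ebas j)) + (LINT t|time T. ip mu (w t) (ebas j) * ip mu (w t) (Yb j))))"
   by (simp only: sum_subtractf[symmetric] energy_identity_basis(1)[OF w(1) Y T] distrib_left LINT_add[OF I1 I2])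
  then show ?thesis
   unfolding boundary_term_def by (simp add: I1 I2 sum.distrib sum_distrib_left[symmetric])
 qed
 have lim2: "(%N. LINT t|time T. boundary_term (J N) (w t)) \<leadsto> 0"
 proof (rule Lim_null_comparison)
  show "\<forall>\<^sub>F N in sequentially. norm (LINT t|time T. boundary_term (J N) (w t)) <= 1 / real (Suc N)"
   using M(2) by (simp add: J_def)
 qed (rule LIMSEQ_Suc[OF lim_1_over_n])
 have "(L2_norm mu (w T))^2 - (L2_norm mu (w 0))^2 = 2 * (LINT t|time T. F t (w t)) + 2 * 0"
  by (rule LIMSEQ_unique[OF tendsto_diff[OF lim0[OF T0(2)] lim0[OF T0(1)]]])
   (unfold eq, intro tendsto_add tendsto_mult_left lim1 lim2)
 then show ?thesis by simp
qed

section \<open>Explicit solutions\<close>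

lemma ip_Dv_eq:
 assumes "has_v_grad u g" "has_v_grad w h"
 shows "ip mu (Dv u) (Dv w) = ip mu g h"
 by (rule ip_cong_AE[OF Dv_L2[OF has_v_grad_V[OF assms(1)]] has_v_grad_L2(2)[OF assms(1)]
   Dv_L2[OF has_v_grad_V[OF assms(2)]] has_v_grad_L2(2)[OF assms(2)] Dv_eq[OF assms(1)] Dv_eq[OF assms(2)]])

lemma has_dd_periodic:
 assumes dd: "has_dd f b f'" and per: "!!x. f (x + e) = f x"
 shows "f' (x + e) = f' x"
proof (rule DERIV_unique)
 show "((%s. f (x + s *\<^sub>R b)) has_real_derivative f' x) (at 0)" using dd by (simp add: has_dd_def)
 have "(%s. f (x + e + s *\<^sub>R b)) = (%s. f (x + s *\<^sub>R b))"
  using per[of "x + _ *\<^sub>R b"] by (simp add: add_ac)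
 then show "((%s. f (x + s *\<^sub>R b)) has_real_derivative f' (x + e)) (at 0)"
  using dd unfolding has_dd_def by metis
qed

text \<open>After the shift x to x + t v, which preserves \<open>mu\<close> at each time, H becomes
  the time derivative of h along a trajectory; its time integral vanishes because h does at both
  ends.\<close>

lemma transport_integral_eq_0:
 fixes H h :: "real \<times> (real^'n::finite) \<times> (real^'n) => real"
 assumes c: "continuous_on UNIV H" and supp: "!!t x v. norm v > R ==> H (t, x, v) = 0"
  and per: "!!t x v i. H (t, x + axis i 1, v) = H (t, x, v)"
  and d: "!!t x v. ((%s. h (s, x + s *\<^sub>R v, v)) has_real_derivative H (t, x + t *\<^sub>R v, v)) (at t)"
  and h: "!!z. h (0, z) = 0" "!!z. h (T, z) = 0" and T: "0 <= T"
 shows "(LINT t|time T. LINT z|mu. H (t, z)) = 0"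
proof -
 interpret T: finite_measure "time T" by (rule finite_measure_time)
 interpret P: pair_sigma_finite "time T" "mu :: 'n phase measure" ..
 interpret F: finite_measure "time T \<Otimes>\<^sub>M (mu :: 'n phase measure)"
  by (rule finite_measure_pair_measure) (rule mu.finite_measure_axioms, rule finite_measure_time)
 let ?K = "%p. H (fst p, fst (snd p) + fst p *\<^sub>R snd (snd p), snd (snd p))"
 have cK: "continuous_on UNIV ?K"
  by (rule continuous_on_compose2[OF c]) (auto intro!: continuous_intros)
 obtain B where B: "\<forall>t\<in>{0..T}. \<forall>z\<in>space mu. norm (?K (t, z)) <= B"
  using continuous_bounded_support_cube[OF cK, of R T] supp by auto
 obtain B' where B': "\<forall>t\<in>{0..T}. \<forall>z\<in>space mu. norm (H (t, z)) <= B'"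
  using continuous_bounded_support_cube[OF c, of R T] supp by auto
 \<comment> \<open>A shifted position leaves the cube; periodicity brings it back, so the bound on
   the cube holds everywhere.\<close>
 have bd: "abs (H (t, z)) <= B'" if t: "t \<in> {0..T}" for t z
 proof -
  have "H (t, fst z, snd z) = H (t, (\<chi> i. frac (fst z $ i)) + zvec (%i. \<lfloor>fst z $ i\<rfloor>), snd z)"
   by (simp add: zvec_def vec_eq_iff frac_def plus_vec_def)
  also have "\<dots> = H (t, (\<chi> i. frac (fst z $ i)), snd z)"
   by (rule periodic_zvec[where g="%x. H (t, x, snd z)"]) (rule per)
  finally have "H (t, z) = H (t, (\<chi> i. frac (fst z $ i)), snd z)" by simp
  moreover have "((\<chi> i. frac (fst z $ i)), snd z) \<in> space mu"
   by (simp add: space_mu cube_def frac_lt_1)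
  ultimately show ?thesis using B' t by simp
 qed
 have shift: "(LINT z|mu. ?K (t, z)) = (LINT z|mu. H (t, z))" if "t \<in> {0..T}" for t
 proof -
  have "(%z. H (t, z)) \<in> borel_measurable borel"
   by (rule borel_measurable_continuous_onI) (rule continuous_on_Pair_time[OF c])
  then show ?thesis using mu_kinetic_shift[of "%z. H (t, z)" B' t] bd[OF that] per by simp
 qed
 have idT: "(%t. t) \<in> measurable (time T) borel"
  by (rule borel_measurable_time_continuous) (rule continuous_on_id)
 have idM: "(%z. z) \<in> measurable (mu :: 'n phase measure) borel"
  by (rule borel_measurable_mu) simp
 have "(%p. (fst p, snd p)) \<in> measurable (time T \<Otimes>\<^sub>M mu) (borel \<Otimes>\<^sub>M borel :: (real \<times> 'n phase) measure)"
  by (intro measurable_Pair measurable_compose[OF measurable_fst idT] measurable_compose[OF measurable_snd idM])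
 then have "(%p. p) \<in> measurable (time T \<Otimes>\<^sub>M mu) (borel :: (real \<times> 'n phase) measure)"
  unfolding borel_prod by simp
 from measurable_compose[OF this borel_measurable_continuous_onI[OF cK]]
 have K: "?K \<in> borel_measurable (time T \<Otimes>\<^sub>M mu)" .
 have I: "integrable (time T \<Otimes>\<^sub>M mu) (case_prod (%t z. ?K (t, z)))"
 proof (rule F.integrable_const_bound[of _ B])
  show "case_prod (%t z. ?K (t, z)) \<in> borel_measurable (time T \<Otimes>\<^sub>M mu)" using K by (simp add: case_prod_unfold)
  show "AE p in time T \<Otimes>\<^sub>M mu. norm (case p of (t, z) => ?K (t, z)) <= B"
   using B by (intro AE_I2) (auto simp: space_pair_measure)
 qed
 have "(LINT t|time T. LINT z|mu. H (t, z)) = (LINT t|time T. LINT z|mu. ?K (t, z))"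
  by (rule LINT_cong[OF refl], rule shift[symmetric]) simp
 also have "\<dots> = (LINT z|mu. LINT t|time T. ?K (t, z))" by (rule P.Fubini_integral[OF I, symmetric])
 also have "\<dots> = (LINT z|(mu :: 'n phase measure). 0::real)"
 proof (rule LINT_cong[OF refl])
  fix z :: "'n phase"
  have "(LINT t|time T. ?K (t, z)) = h (T, fst z + T *\<^sub>R snd z, snd z) - h (0, fst z + 0 *\<^sub>R snd z, snd z)"
  proof (rule time_integral_FTC[OF T])
   show "((%t. h (t, fst z + t *\<^sub>R snd z, snd z)) has_real_derivative ?K (t, z)) (at t)" for t
    using d[of "fst z" "snd z" t] by simp
   show "continuous_on {0..T} (%t. ?K (t, z))" by (rule continuous_on_time[OF cK])
  qed
  then show "(LINT t|time T. ?K (t, z)) = 0" using h by simp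
 qed
 finally show ?thesis by simp
qed

definition kvec :: "('n => int) => real^'n::finite" where
 "kvec k = (\<chi> i. 2 * pi * of_int (k i))"

lemma kdot_kvec: "kdot k x = kvec k \<bullet> x"
 by (simp add: kdot_def kvec_def inner_vec_def sum_distrib_left mult_ac)

context
 fixes k :: "'n::finite => int" and \<beta>\<^sub>0 :: "real^'n" and \<theta> :: real
begin

text \<open>With the phase \<open>\<psi> = 2\<pi>k \<cdot> x + \<beta>(t) \<cdot> v + \<theta>\<close>, the function \<open>a(t) cos \<psi>\<close> solves the equation
 if and only if \<open>\<beta>' = - \<beta> - 2\<pi>k\<close> and \<open>a' = - |\<beta>|\<^sup>2 a\<close>.\<close>

definition freq :: "real => real^'n" where
 "freq t = exp (- t) *\<^sub>R (\<beta>\<^sub>0 + kvec k) - kvec k"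

text \<open>With p = \<open>\<beta>\<^sub>0 + kvec k\<close> and q = \<open>kvec k\<close>, the
  squared frequency at time s is exp(-2s) p.p - 2 exp(-s) p.q + q.q; the exponent is minus its
  integral from 0 to t.\<close>

definition amp :: "real => real" where
 "amp t = exp (- ((\<beta>\<^sub>0 + kvec k) \<bullet> (\<beta>\<^sub>0 + kvec k) * (1 - exp (- 2 * t)) / 2
   - 2 * ((\<beta>\<^sub>0 + kvec k) \<bullet> kvec k) * (1 - exp (- t)) + kvec k \<bullet> kvec k * t))"

definition ph :: "real => 'n phase => real" where
 "ph t z = kdot k (fst z) + freq t \<bullet> snd z + \<theta>"

definition wave :: "real => 'n phase => real" where
 "wave t z = amp t * cos (ph t z)"

definition wave_grad :: "real => 'n phase => real^'n" where
 "wave_grad t z = (- amp t * sin (ph t z)) *\<^sub>R freq t"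

text \<open>Both the derivative of the wave along free transport and \<Delta>_v minus v . D_v
  applied to it; the equality of the two is the equation.\<close>

definition wave_Y :: "real => 'n phase => real" where
 "wave_Y t z = amp t * ((freq t \<bullet> snd z) * sin (ph t z) - (freq t \<bullet> freq t) * cos (ph t z))"

lemma wave_0: "wave 0 = trig k \<beta>\<^sub>0 \<theta>"
 by (simp add: fun_eq_iff wave_def amp_def ph_def freq_def trig_def)

lemma freq_deriv: "(freq has_vector_derivative - freq t - kvec k) (at t)"
 unfolding freq_def[abs_def]
 by (auto intro!: derivative_eq_intros simp: has_real_derivative_iff_has_vector_derivative[symmetric])

lemma amp_deriv: "(amp has_real_derivative - (freq t \<bullet> freq t) * amp t) (at t)"
proof -
 have "exp (- 2 * t) = exp (- t) * exp (- t)" by (simp add: exp_add[symmetric])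
 then show ?thesis
  unfolding amp_def[abs_def]
  by (auto intro!: derivative_eq_intros simp: freq_def inner_diff_left inner_diff_right inner_commute algebra_simps)
qed

lemma wave_Y_deriv:
 "((%s. wave s (x + s *\<^sub>R v, v)) has_real_derivative wave_Y t (x + t *\<^sub>R v, v)) (at t)"
proof -
 have f: "((%s. freq s \<bullet> v) has_real_derivative (- freq t - kvec k) \<bullet> v) (at t)"
  using bounded_linear.has_vector_derivative[OF bounded_linear_inner_left freq_deriv, of v]
  by (simp add: has_real_derivative_iff_has_vector_derivative)
 have "((%s. kdot k (x + s *\<^sub>R v)) has_real_derivative kvec k \<bullet> v) (at t)"
  unfolding kdot_add kdot_scale by (auto intro!: derivative_eq_intros simp: kdot_kvec)
 then have "((%s. ph s (x + s *\<^sub>R v, v)) has_real_derivative - (freq t \<bullet> v)) (at t)"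
  unfolding ph_def using f by (auto intro!: derivative_eq_intros simp: inner_diff_left)
 then show ?thesis
  unfolding wave_def wave_Y_def
  by (auto intro!: derivative_eq_intros amp_deriv simp: algebra_simps)
qed

lemma continuous_amp: "continuous_on A amp"
 unfolding amp_def[abs_def] by (intro continuous_intros) auto

lemma continuous_freq: "continuous_on A freq"
 unfolding freq_def[abs_def] by (intro continuous_intros)

lemma continuous_wave:
 "continuous_on UNIV (%p. wave (fst p) (snd p))" "continuous_on UNIV (%p. wave_grad (fst p) (snd p))"
 "continuous_on UNIV (%p. wave_Y (fst p) (snd p))"
proof -
 note a = continuous_on_compose2[OF continuous_amp[of UNIV] continuous_on_fst[OF continuous_on_id]]
  and f = continuous_on_compose2[OF continuous_freq[of UNIV] continuous_on_fst[OF continuous_on_id]]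
 have p: "continuous_on UNIV (%p::real \<times> 'n phase. ph (fst p) (snd p))"
  unfolding ph_def by (intro continuous_intros f) auto
 show "continuous_on UNIV (%p. wave (fst p) (snd p))" "continuous_on UNIV (%p. wave_grad (fst p) (snd p))"
  "continuous_on UNIV (%p. wave_Y (fst p) (snd p))"
  unfolding wave_def wave_grad_def wave_Y_def by (intro continuous_intros a f p; simp)+
qed

lemma wave_bounds:
 obtains B where "!!t z. t \<in> {0..T} ==> abs (wave t z) <= B" "!!t z. t \<in> {0..T} ==> norm (wave_grad t z) <= B"
proof -
 obtain A where A: "0 <= A" "!!t. t \<in> {0..T} ==> abs (amp t) <= A" by (rule compact_bound[OF continuous_amp]) (rule that)
 have "continuous_on {0..T} (%t. amp t * norm (freq t))" by (intro continuous_intros continuous_amp continuous_freq)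
 then obtain C where C: "0 <= C" "!!t. t \<in> {0..T} ==> abs (amp t * norm (freq t)) <= C" by (rule compact_bound) (rule that)
 show thesis
 proof (rule that[of "max A C"])
  fix t :: real and z :: "'n phase" assume t: "t \<in> {0..T}"
  have "abs (amp t) * abs (cos (ph t z)) <= A * 1" using A t by (intro mult_mono) auto
  then show "abs (wave t z) <= max A C" by (simp add: wave_def abs_mult)
  have "abs (amp t * norm (freq t)) * abs (sin (ph t z)) <= C * 1" using C t by (intro mult_mono) auto
  then show "norm (wave_grad t z) <= max A C" by (simp add: wave_grad_def abs_mult mult_ac)
 qed
qed

lemma has_dd_wave_grad:
 "has_dd (%v. wave t (x, v)) (axis i 1) (%v. wave_grad t (x, v) $ i)"
 "has_dd (%v. wave_grad t (x, v) $ i) (axis i 1) (%v. - amp t * (freq t $ i)^2 * cos (ph t (x, v)))"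
 unfolding has_dd_def wave_def wave_grad_def ph_def
 by (auto intro!: derivative_eq_intros simp: inner_add_right inner_axis power2_eq_square)

lemma has_v_grad_wave:
 assumes "t \<in> {0..T}"
 shows "has_v_grad (wave t) (wave_grad t)"
proof (rule has_v_grad_C1)
 obtain B where B: "!!t z. t \<in> {0..T} ==> abs (wave t z) <= B" "!!t z. t \<in> {0..T} ==> norm (wave_grad t z) <= B"
  by (rule wave_bounds[of T]) (rule that)
 show c: "continuous_on UNIV (wave t)" "continuous_on UNIV (wave_grad t)"
  using continuous_on_Pair_time[OF continuous_wave(1), of t] continuous_on_Pair_time[OF continuous_wave(2), of t] by simp_all
 show "wave t \<in> L2 mu" "wave_grad t \<in> L2 mu"
  using B(1)[OF assms] B(2)[OF assms]
  by (auto intro!: mu_L2_bounded[of _ B] borel_measurable_mu_continuous c)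
qed (rule has_dd_wave_grad(1))

lemma wave_spaces: "wave \<in> C_H T" "wave \<in> L2_V T"
proof -
 obtain B where B: "!!t z. t \<in> {0..T} ==> abs (wave t z) <= B" "!!t z. t \<in> {0..T} ==> norm (wave_grad t z) <= B"
  by (rule wave_bounds[of T]) (rule that)
 have c: "continuous_on {0..T} (%t. wave t z)" "continuous_on {0..T} (%t. wave_grad t z)" for z
  using continuous_on_time[OF continuous_wave(1), of _ z] continuous_on_time[OF continuous_wave(2), of _ z] by simp_all
 show "wave \<in> C_H T"
  by (rule C_H_I_bounded[OF L2_measurable[OF has_v_grad_L2(1)[OF has_v_grad_wave]] B(1) c(1)])
 show "wave \<in> L2_V T"
  by (rule L2_V_I_bounded[OF has_v_grad_wave B c])
qed

text \<open>Gaussian integration by parts in each velocity slice moves the derivative from the test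
  function to the wave and produces the drift term.\<close>

lemma wave_by_parts:
 assumes q: "test_fun T q" and t: "t \<in> {0..T}"
 shows "ip mu (wave_grad t) (v_grad q t) = - ip mu (wave_Y t) (%z. q (t, z))"
proof -
 note sm = test_fun_smooth[OF q]
 obtain R where R: "!!t x v b. norm v > R ==> q (t, x, v) = 0 \<and> frechet_derivative q (at (t, x, v)) b = 0"
  by (rule test_fun_derivative_support[OF q]) (rule that)
 have cq: "continuous_on UNIV (%z. q (t, z))" by (rule continuous_on_Pair_time[OF smooth_continuous[OF sm]])
 have cv: "continuous_on UNIV (v_grad q t)"
  unfolding v_grad_def by (intro continuous_on_vec_lambda continuous_on_Pair_time smooth_continuous_derivative[OF sm])
 have cG: "continuous_on UNIV (wave_grad t)" "continuous_on UNIV (wave_Y t)"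
  using continuous_on_Pair_time[OF continuous_wave(2), of t] continuous_on_Pair_time[OF continuous_wave(3), of t] by simp_all
 have cc: "continuous_on UNIV (%z. cos (ph t z))"
  unfolding ph_def by (intro continuous_intros)
 have bdd: "\<exists>B. \<forall>z\<in>space mu. norm (f z) <= B"
  if c: "continuous_on UNIV f" and s: "!!x v. norm v > R ==> f (x, v) = 0" for f :: "'n phase => real"
 proof -
  have "continuous_on UNIV (%p::real \<times> 'n phase. f (snd p))" by (rule continuous_on_compose2[OF c]) (auto intro!: continuous_intros)
  from continuous_bounded_support_cube[OF this, of R T] obtain B where "\<forall>t\<in>{0..T}. \<forall>z\<in>space mu. norm (f z) <= B" using s by auto
  then show ?thesis using t by blast
 qed
 have int: "integrable mu f" if c: "continuous_on UNIV f" and s: "!!x v. norm v > R ==> f (x, v) = 0" for f :: "'n phase => real"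
 proof -
  obtain B where "\<forall>z\<in>space mu. norm (f z) <= B" using bdd[OF c s] by blast
  then show ?thesis by (intro mu.integrable_const_bound[of _ B] borel_measurable_mu_continuous c AE_I2) auto
 qed
 have slice: "exp_bounded (%v. f (x, v))" "continuous_on UNIV (%v. f (x, v))"
  if c: "continuous_on UNIV f" and s: "!!x v. norm v > R ==> f (x, v) = 0" and x: "x \<in> cube" for f :: "'n phase => real" and x
 proof -
  obtain B where B: "\<forall>z\<in>space mu. norm (f z) <= B" using bdd[OF c s] by blast
  show "exp_bounded (%v. f (x, v))" by (rule exp_bounded_bounded[of _ B]) (use B x in \<open>simp add: space_mu\<close>)
  show "continuous_on UNIV (%v. f (x, v))" by (rule continuous_on_compose2[OF c]) (auto intro!: continuous_intros)
 qed
 \<comment> \<open>\<open>g' i\<close> is the i-th velocity derivative of \<open>g i\<close>;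
   summing \<open>g' i - v $ i * g i\<close> over i gives exactly the integrand to be shown to have
   integral 0.\<close>
 define g where "g i z = wave_grad t z $ i * q (t, z)" for i z
 define g' where "g' i z = (- amp t * (freq t $ i)^2 * cos (ph t z)) * q (t, z) + wave_grad t z $ i * v_grad q t z $ i" for i z
 have cg: "continuous_on UNIV (g i)" "continuous_on UNIV (g' i)" for i
  unfolding g_def g'_def by (intro continuous_intros cG cq cv cc)+
 have sg: "g i (x, v) = 0" "g' i (x, v) = 0" if "norm v > R" for i x v
  using R[OF that] by (simp_all add: g_def g'_def v_grad_def)
 have dg: "has_dd (%v. g i (x, v)) (axis i 1) (%v. g' i (x, v))" for i x
  unfolding g_def g'_def by (rule has_dd_mult[OF has_dd_wave_grad(2) smooth_v_grad[OF sm]])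
 have zero: "(LINT v|gauss. (\<Sum>i\<in>UNIV. g' i (x, v) - v $ i * g i (x, v))) = 0" if x: "x \<in> cube" for x
 proof -
  note s1 = slice[OF cg(1) sg(1) x] and s2 = slice[OF cg(2) sg(2) x]
  have i1: "integrable gauss (%v. g' i (x, v))" for i
   using s2[of i] by (intro exp_bounded_integrable borel_measurable_continuous_onI)
  have i2: "integrable gauss (%v. v $ i * g i (x, v))" for i
   using s1[of i] by (intro exp_bounded_integrable borel_measurable_continuous_onI exp_bounded_mult exp_bounded_component continuous_intros)
  show ?thesis
   using gauss_by_parts[OF dg s1(2) s2(2) s1(1) s2(1)] i1 i2 by (simp add: LINT_diff)
 qed
 let ?s = "%z. wave_grad t z \<bullet> v_grad q t z + wave_Y t z * q (t, z)"
 have I: "integrable mu (%z. wave_grad t z \<bullet> v_grad q t z)" "integrable mu (%z. wave_Y t z * q (t, z))"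
  by (rule int; (intro continuous_intros cG cq cv | use R in \<open>simp add: v_grad_def inner_vec_def\<close>))+
 have "?s z = (\<Sum>i\<in>UNIV. g' i z - snd z $ i * g i z)" for z
  by (simp add: g_def g'_def wave_Y_def wave_grad_def inner_vec_def sum.distrib sum_subtractf sum_distrib_left sum_distrib_right
    power2_eq_square algebra_simps sum_negf)
 then have "(LINT z|mu. ?s z) = (LINT x|torus. LINT v|gauss. (\<Sum>i\<in>UNIV. g' i (x, v) - v $ i * g i (x, v)))"
  using mu_Fubini(1)[OF integrable_plus[OF I]] by simp
 also have "\<dots> = (LINT x|(torus :: (real^'n) measure). 0::real)"
  by (rule LINT_cong[OF refl]) (simp add: zero)
 finally show ?thesis using I by (simp add: ip_def)
qed

text \<open>The product of wave and test function vanishes at both end times, so its derivative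
  along transport integrates to 0; the part falling on the wave is then rewritten by
  \<open>wave_by_parts\<close>.\<close>

lemma wave_weak:
 assumes q: "test_fun T q" and T: "0 <= T"
 shows "(LINT t|time T. ip mu (wave_grad t) (v_grad q t)) = (LINT t|time T. ip mu (wave t) (Y_classical q t))"
proof -
 note sm = test_fun_smooth[OF q]
 obtain R where R: "!!t x v b. norm v > R ==> q (t, x, v) = 0 \<and> frechet_derivative q (at (t, x, v)) b = 0"
  by (rule test_fun_derivative_support[OF q]) (rule that)
 let ?h = "%p. wave (fst p) (snd p) * q p"
 let ?H = "%p. wave_Y (fst p) (snd p) * q p + wave (fst p) (snd p) * Y_classical q (fst p) (snd p)"
 have perq: "q (t, x + axis i 1, v) = q (t, x, v)" for t x v i using q by (simp add: test_fun_def)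
 have perY: "Y_classical q t (x + axis i 1, v) = Y_classical q t (x, v)" for t x v i
  unfolding Y_classical_eq[OF sm]
  using has_dd_periodic[OF smooth_has_dd[OF sm, of "(1, v, 0)"], of "(0, axis i 1, 0)" "(t, x, v)"] perq by auto
 have perph: "cos (ph t (x + axis i 1, v)) = cos (ph t (x, v))" "sin (ph t (x + axis i 1, v)) = sin (ph t (x, v))" for t x v i
 proof -
  have s: "sin y = cos (y + - pi / 2)" for y :: real by (simp add: cos_diff)
  show "cos (ph t (x + axis i 1, v)) = cos (ph t (x, v))" "sin (ph t (x + axis i 1, v)) = sin (ph t (x, v))"
   unfolding s ph_def using kdot_periodic[of k x i "freq t \<bullet> v + \<theta>"] kdot_periodic[of k x i "freq t \<bullet> v + \<theta> + - pi / 2"]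
   by (simp_all add: algebra_simps)
 qed
 have "(LINT t|time T. LINT z|mu. ?H (t, z)) = 0"
 proof (rule transport_integral_eq_0[where h="?h" and R=R, OF _ _ _ _ _ _ T])
  show "continuous_on UNIV ?H"
   by (intro continuous_intros continuous_wave smooth_continuous[OF sm] continuous_Y_classical[OF sm])
  show "?H (t, x, v) = 0" if "norm v > R" for t x v using R[OF that] by (simp add: Y_classical_eq[OF sm])
  show "?H (t, x + axis i 1, v) = ?H (t, x, v)" for t x v i
   by (simp add: wave_def wave_Y_def perph perq perY)
  show "?h (0, z) = 0" "?h (T, z) = 0" for z using test_fun_vanish(1)[OF q] T by simp_all
  fix t and x v :: "real^'n"
  have "((%s. (s, x + s *\<^sub>R v, v)) has_derivative (%s. s *\<^sub>R (1, v, 0))) (at t)"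
   by (auto intro!: derivative_eq_intros)
  from has_derivative_compose[OF this smooth_has_derivative[OF sm]]
  have "((%s. q (s, x + s *\<^sub>R v, v)) has_derivative (%s. frechet_derivative q (at (t, x + t *\<^sub>R v, v)) (s *\<^sub>R (1, v, 0)))) (at t)" .
  then have "((%s. q (s, x + s *\<^sub>R v, v)) has_real_derivative Y_classical q t (x + t *\<^sub>R v, v)) (at t)"
   unfolding Y_classical_eq[OF sm] has_field_derivative_def
   by (rule has_derivative_eq_rhs) (rule ext, simp only: linear_cmul[OF has_derivative_linear[OF smooth_has_derivative[OF sm]]] real_scaleR_def mult.commute)
  from DERIV_mult[OF wave_Y_deriv this]
  show "((%s. ?h (s, x + s *\<^sub>R v, v)) has_real_derivative ?H (t, x + t *\<^sub>R v, v)) (at t)"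
   by (simp add: algebra_simps)
 qed
 also have "(LINT t|time T. LINT z|mu. ?H (t, z)) = (LINT t|time T. ip mu (wave t) (Y_classical q t) - ip mu (wave_grad t) (v_grad q t))"
 proof (rule LINT_cong[OF refl])
  fix t assume "t \<in> space (time T)"
  then have t: "t \<in> {0..T}" by simp
  have "integrable mu (%z. wave t z * Y_classical q t z)"
   by (rule L2_integrable_mult[OF C_H_L2[OF wave_spaces(1) t] C_H_L2[OF test_fun_Y_C_H[OF q] t]])
  moreover have "integrable mu (%z. wave_Y t z * q (t, z))"
  proof (rule L2_integrable_mult)
   show "(%z. q (t, z)) \<in> L2 mu" by (rule has_v_grad_L2(1)[OF test_fun_v_grad_properties(1)[OF q]])
   show "wave_Y t \<in> L2 mu"
   proof (rule exp_bounded_L2_mu)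
    show "wave_Y t \<in> borel_measurable mu"
     using continuous_on_Pair_time[OF continuous_wave(3), of t] by (intro borel_measurable_mu_continuous) simp
    show "exp_bounded (%v. abs (amp t) * (abs (freq t \<bullet> v) + freq t \<bullet> freq t))"
     by (intro exp_bounded_mult exp_bounded_add exp_bounded_const exp_bounded_abs exp_bounded_inner)
    fix x v
    have "abs ((freq t \<bullet> v) * sin (ph t (x, v))) <= abs (freq t \<bullet> v) * 1" "abs ((freq t \<bullet> freq t) * cos (ph t (x, v))) <= freq t \<bullet> freq t * 1"
     unfolding abs_mult by (intro mult_mono; simp)+
    then have "abs ((freq t \<bullet> v) * sin (ph t (x, v)) - (freq t \<bullet> freq t) * cos (ph t (x, v))) <= abs (freq t \<bullet> v) + freq t \<bullet> freq t"
     by linarith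
    then show "norm (wave_Y t (x, v)) <= abs (amp t) * (abs (freq t \<bullet> v) + freq t \<bullet> freq t)"
     by (simp add: wave_Y_def abs_mult mult_left_mono)
   qed
  qed
  ultimately show "(LINT z|mu. ?H (t, z)) = ip mu (wave t) (Y_classical q t) - ip mu (wave_grad t) (v_grad q t)"
   unfolding wave_by_parts[OF q t] by (simp add: ip_def)
 qed
 also have "\<dots> = (LINT t|time T. ip mu (wave t) (Y_classical q t)) - (LINT t|time T. ip mu (wave_grad t) (v_grad q t))"
 proof (rule LINT_diff)
  show "integrable (time T) (%t. ip mu (wave t) (Y_classical q t))"
   by (intro integrable_time_continuous C_H_ip_continuous wave_spaces test_fun_Y_C_H[OF q])
  have "integrable (time T) (%t. ip mu (Dv (wave t)) (Dv (%z. q (t, z))))"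
   by (rule integrable_ip_Dv[OF wave_spaces(2) test_fun_v_grad_properties(2)[OF q]])
  also have "?this \<longleftrightarrow> integrable (time T) (%t. ip mu (wave_grad t) (v_grad q t))"
  proof (rule Bochner_Integration.integrable_cong[OF refl])
   fix t assume "t \<in> space (time T)"
   then have t: "t \<in> {0..T}" by simp
   note H = has_v_grad_wave[OF t] test_fun_v_grad_properties(1)[OF q, of t]
   show "ip mu (Dv (wave t)) (Dv (%z. q (t, z))) = ip mu (wave_grad t) (v_grad q t)"
    by (rule ip_Dv_eq[OF H])
  qed
  finally show "integrable (time T) (%t. ip mu (wave_grad t) (v_grad q t))" .
 qed
 finally show ?thesis by simp
qed

lemma wave_has_Y:
 assumes T: "0 <= T"
 shows "has_Y T wave (%t. A_form (wave t))"
 unfolding has_Y_def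
proof (intro conjI allI impI A_form_L2_V_dual wave_spaces)
 fix p :: "real \<times> (real^'n) \<times> (real^'n) => real" assume p: "test_fun T p"
 have "(LINT t|time T. A_form (wave t) (%z. p (t, z))) = (LINT t|time T. - ip mu (wave_grad t) (v_grad p t))"
 proof (rule LINT_cong[OF refl])
  fix t assume "t \<in> space (time T)"
  then have t: "t \<in> {0..T}" by simp
  note H = has_v_grad_wave[OF t] test_fun_v_grad_properties(1)[OF p, of t]
  have "ip mu (Dv (wave t)) (Dv (%z. p (t, z))) = ip mu (wave_grad t) (v_grad p t)"
   by (rule ip_Dv_eq[OF H])
  then show "A_form (wave t) (%z. p (t, z)) = - ip mu (wave_grad t) (v_grad p t)" by (simp add: A_form_def)
 qed
 then show "(LINT t|time T. A_form (wave t) (%z. p (t, z))) = - (LINT t|time T. LINT z|mu. wave t z * Y_classical p t z)"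
  using wave_weak[OF p T] by (simp add: ip_def)
qed

end

section \<open>Existence\<close>

lemma L2_complete_summable:
 fixes f :: "nat => 'a => 'b::euclidean_space"
 assumes L: "!!n. f n \<in> L2 M" and b: "!!n. L2_norm M (f (Suc n) -. f n) <= a n" and a: "summable a"
 shows "\<exists>g\<in>L2 M. (%n. L2_norm M (f n -. g)) \<leadsto> 0"
proof -
 have step: "L2_norm M (f (n + k) -. f n) <= sum a {n..<n + k}" for n k
 proof (induction k)
  case (Suc k)
  have "L2_norm M (f (n + Suc k) -. f n) <= L2_norm M (%x. f (Suc (n + k)) x - f (n + k) x) + L2_norm M (f (n + k) -. f n)"
   using L2_norm_triangle_diff[OF L[of "Suc (n + k)"] L[of "n + k"] L[of n]] by simp
  then show ?case using Suc b[of "n + k"] by simp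
 qed (simp add: L2_norm_zero)
 have C: "\<exists>N. \<forall>m\<ge>N. \<forall>n\<ge>N. L2_norm M (f m -. f n) < e" if e: "e > 0" for e
 proof -
  obtain N where N: "!!m n. m \<ge> N ==> norm (sum a {m..<n}) < e"
   using a e unfolding summable_Cauchy by meson
  have *: "L2_norm M (f m -. f n) < e" if "n \<ge> N" "m \<ge> n" for m n
   using step[of n "m - n"] N[of n m] that by simp
  have "L2_norm M (f m -. f n) < e" if "n \<ge> N" "m \<ge> N" for m n
   using *[of m n] *[of n m] that L2_norm_minus_commute[of M "f m" "f n"] by (cases "n <= m") auto
  then show ?thesis by blast
 qed
 obtain g where "g \<in> L2 M" "(%n. L2_norm M (f n -. g)) \<leadsto> 0"
  by (rule L2_complete[of f M, OF L C]) (assumption, rule that)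
 then show ?thesis by blast
qed

lemma C_H_comb:
 assumes u: "u \<in> C_H T" and w: "w \<in> C_H T"
 shows "(%t z. a * u t z + b * w t z) \<in> C_H T"
 unfolding C_H_def
proof (intro CollectI conjI ballI)
 fix t assume t: "t \<in> {0..T}"
 show "(%z. a * u t z + b * w t z) \<in> L2 mu" by (rule L2_comb[OF C_H_L2[OF u t] C_H_L2[OF w t]])
 show "((%s. L2_norm mu (%z. (a * u s z + b * w s z) - (a * u t z + b * w t z))) \<longlongrightarrow> 0) (at t within {0..T})"
 proof (rule Lim_null_comparison)
  have "norm (L2_norm mu (%z. (a * u s z + b * w s z) - (a * u t z + b * w t z)))
   <= abs a * L2_norm mu (u s -. u t) + abs b * L2_norm mu (w s -. w t)" if s: "s \<in> {0..T}" for s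
   using L2_norm_comb_le[OF L2_diff[OF C_H_L2[OF u s] C_H_L2[OF u t]] L2_diff[OF C_H_L2[OF w s] C_H_L2[OF w t]], of a b]
   by (simp add: algebra_simps)
  then show "\<forall>\<^sub>F s in at t within {0..T}. norm (L2_norm mu (%z. (a * u s z + b * w s z) - (a * u t z + b * w t z)))
   <= abs a * L2_norm mu (u s -. u t) + abs b * L2_norm mu (w s -. w t)"
   by (auto simp: eventually_at_filter)
  have "((%s. abs a * L2_norm mu (u s -. u t) + abs b * L2_norm mu (w s -. w t)) \<longlongrightarrow> abs a * 0 + abs b * 0) (at t within {0..T})"
   using u w t by (intro tendsto_intros) (auto simp: C_H_def)
  then show "((%s. abs a * L2_norm mu (u s -. u t) + abs b * L2_norm mu (w s -. w t)) \<longlongrightarrow> 0) (at t within {0..T})"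
   by simp
 qed
qed

lemma C_H_diff: "u \<in> C_H T ==> w \<in> C_H T ==> (%t z. u t z - w t z) \<in> C_H T"
 using C_H_comb[of u T w 1 "-1"] by simp

lemma C_H_subset: "u \<in> C_H T ==> \<tau> <= T ==> u \<in> C_H \<tau>"
 unfolding C_H_def by (auto intro: tendsto_within_subset[of _ _ _ "{0..T}"])

text \<open>Only the action on V matters. This allows the functional of a combination to be
  rewritten, since \<open>A_form\<close> is linear on V but not on arbitrary functions.\<close>

lemma has_Y_cong:
 fixes u :: "real => 'n::finite phase => real"
 assumes Y: "has_Y T u F" and G: "G \<in> L2_V_dual T" and eq: "AE t in time T. \<forall>p\<in>V. F t p = G t p"
 shows "has_Y T u G"
 unfolding has_Y_def
proof (intro conjI allI impI G)
 fix p :: "real \<times> (real^'n) \<times> (real^'n) => real" assume p: "test_fun T p"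
 have F: "F \<in> L2_V_dual T" using Y by (simp add: has_Y_def)
 note P = test_fun_v_grad_properties(2)[OF p, of T]
 have "(LINT t|time T. G t (%z. p (t, z))) = (LINT t|time T. F t (%z. p (t, z)))"
 proof (rule integral_cong_AE)
  show "AE t in time T. G t (%z. p (t, z)) = F t (%z. p (t, z))"
   using eq bochner_L2_mem[OF P] by eventually_elim simp
 qed (rule borel_measurable_integrable[OF integrable_V_dual_V[OF G P]],
   rule borel_measurable_integrable[OF integrable_V_dual_V[OF F P]])
 then show "(LINT t|time T. G t (%z. p (t, z))) = - (LINT t|time T. LINT z|mu. u t z * Y_classical p t z)"
  using Y p by (simp add: has_Y_def)
qed

text \<open>A weak solution with the functional fixed as \<open>A_form (u t)\<close> instead of an
  existentially given F; this form is stable under combinations and limits.\<close>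

definition kfp :: "real => (real => 'n::finite phase => real) => bool" where
 "kfp T u \<longleftrightarrow> u \<in> C_H T \<and> u \<in> L2_V T \<and> has_Y T u (%t. A_form (u t))"

lemma A_form_comb:
 assumes "u \<in> V" "w \<in> V" "p \<in> V"
 shows "A_form (%z. a * u z + b * w z) p = a * A_form u p + b * A_form w p"
 unfolding A_form_def ip_commute[of mu _ "Dv p"] ip_Dv_comb_right[OF assms(3,1,2)] by simp

lemma kfp_comb:
 assumes u: "kfp T u" and w: "kfp T w"
 shows "kfp T (%t z. a * u t z + b * w t z)"
proof -
 have uw: "u \<in> C_H T" "u \<in> L2_V T" "has_Y T u (%t. A_form (u t))" "w \<in> C_H T" "w \<in> L2_V T" "has_Y T w (%t. A_form (w t))"
  using u w by (auto simp: kfp_def)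
 note L = V.bochner_L2_comb[OF uw(2,5), of a b]
 have "has_Y T (%t z. a * u t z + b * w t z) (%t. A_form (%z. a * u t z + b * w t z))"
 proof (rule has_Y_cong[OF has_Y_comb[OF uw(1,3,4,6)] A_form_L2_V_dual[OF L]])
  show "AE t in time T. \<forall>p\<in>V. a * A_form (u t) p + b * A_form (w t) p = A_form (%z. a * u t z + b * w t z) p"
   using bochner_L2_mem[OF uw(2)] bochner_L2_mem[OF uw(5)] by eventually_elim (simp add: A_form_comb)
 qed
 then show ?thesis unfolding kfp_def using C_H_comb[OF uw(1,4)] L by simp
qed

lemma kfp_diff: "kfp T u ==> kfp T w ==> kfp T (%t z. u t z - w t z)"
 using kfp_comb[of T u w 1 "-1"] by simp

lemma kfp_fin_span:
 assumes f: "fin_span trig_family f" and T: "0 <= T"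
 shows "\<exists>u. kfp T u \<and> u 0 = f"
proof -
 obtain J c where J: "finite J" "f = (%z. \<Sum>j\<in>J. c j * trig_family j z)" using f unfolding fin_span_def by blast
 have w: "kfp T (wave k \<beta> \<theta>)" for k :: "'a => int" and \<beta> \<theta>
  unfolding kfp_def using wave_spaces wave_has_Y[OF T] by blast
 have z: "kfp T (%t (z :: 'a phase). 0 :: real)"
  using kfp_comb[OF w w, of 0 undefined undefined undefined 0 undefined undefined undefined] by simp
 have "\<exists>u. kfp T u \<and> u 0 = (%z. \<Sum>j\<in>J. c j * trig_family j z)"
  using J(1)
 proof (induction J rule: finite_induct)
  case empty
  show ?case using z by (intro exI[of _ "%t z. 0"]) simp
 next
  case (insert j J)
  then obtain u where u: "kfp T u" "u 0 = (%z. \<Sum>j\<in>J. c j * trig_family j z)" by blast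
  let ?w = "wave (fst j) (fst (snd j)) (snd (snd j))"
  have "kfp T (%t z. c j * ?w t z + 1 * u t z)" by (rule kfp_comb[OF w u(1)])
  moreover have "(%z. c j * ?w 0 z + 1 * u 0 z) = (%z. \<Sum>j\<in>insert j J. c j * trig_family j z)"
   using insert by (simp add: u(2) wave_0 trig_family_def)
  ultimately show ?case by (intro exI[of _ "%t z. c j * ?w t z + 1 * u t z"]) simp
 qed
 then show ?thesis using J(2) by simp
qed

lemma LINT_time_const: "0 <= T ==> (LINT t|time T. c) = T * c" for c :: real
 by (simp add: measure_restrict_space)

lemma A_form_self: "A_form u u = - (L2_norm mu (Dv u))\<^sup>2"
 by (simp add: A_form_def L2_norm_ip)

text \<open>With F = \<open>A_form\<close> the energy identity bounds the norm at every time and the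
  dissipation by the initial norm. In the constant, T comes from integrating the norm bound over
  time and 1 bounds the dissipation.\<close>

lemma kfp_energy:
 assumes u: "kfp T u" and T: "0 < T"
 shows "s \<in> {0..T} ==> L2_norm mu (u s) <= L2_norm mu (u 0)"
  and "(%t. V_norm (u t)) \<in> L2 (time T)"
  and "L2_norm (time T) (%t. V_norm (u t)) <= sqrt (T + 1) * L2_norm mu (u 0)"
proof -
 have uu: "u \<in> C_H T" "u \<in> L2_V T" "has_Y T u (%t. A_form (u t))" using u by (auto simp: kfp_def)
 have en: "(LINT t|time s. (L2_norm mu (Dv (u t)))^2) = 1/2 * (L2_norm mu (u 0))^2 - 1/2 * (L2_norm mu (u s))^2"
  if s: "0 < s" "s <= T" for s
  using energy_identity[OF C_H_subset[OF uu(1) s(2)] V.bochner_L2_subset[OF uu(2) s(2)] has_Y_subset[OF uu(3) s(2)] s(1)]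
  by (simp add: A_form_self)
 show le: "L2_norm mu (u s) <= L2_norm mu (u 0)" if s: "s \<in> {0..T}" for s
 proof (cases "s = 0")
  case False
  have "0 <= (LINT t|time s. (L2_norm mu (Dv (u t)))^2)" by (rule integral_nonneg_AE) simp
  moreover have "0 < s" "s <= T" using s False by auto
  ultimately have "(L2_norm mu (u s))^2 <= (L2_norm mu (u 0))^2" using en[of s] by linarith
  then show ?thesis by (rule power2_le_imp_le) simp
 qed simp
 show L: "(%t. V_norm (u t)) \<in> L2 (time T)"
  using uu(2) by (intro L2_I V.strongly_measurable_norm) (simp_all add: bochner_L2_iff)
 have I1: "integrable (time T) (%t. (L2_norm mu (u t))^2)"
  unfolding L2_norm_ip by (intro integrable_time_continuous C_H_ip_continuous uu)
 have I2: "integrable (time T) (%t. (L2_norm mu (Dv (u t)))^2)"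
  unfolding L2_norm_ip by (rule integrable_ip_Dv[OF uu(2,2)])
 have "(LINT t|time T. (L2_norm mu (u t))^2) <= (LINT t|time T. (L2_norm mu (u 0))^2)"
 proof (rule integral_mono[OF I1])
  show "integrable (time T) (%t. (L2_norm mu (u 0))^2)" by (rule integrable_time_continuous) (rule continuous_on_const)
  show "(L2_norm mu (u t))^2 <= (L2_norm mu (u 0))^2" if "t \<in> space (time T)" for t
   using le[of t] that by (intro power_mono) auto
 qed
 then have "(LINT t|time T. (L2_norm mu (u t))^2) <= T * (L2_norm mu (u 0))^2" unfolding LINT_time_const[OF less_imp_le[OF T]] .
 moreover have "(LINT t|time T. (L2_norm mu (Dv (u t)))^2) <= (L2_norm mu (u 0))^2"
  unfolding en[OF T order_refl] using zero_le_power2[of "L2_norm mu (u T)"] zero_le_power2[of "L2_norm mu (u 0)"] by linarith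
 ultimately have "(LINT t|time T. (V_norm (u t))^2) <= (T + 1) * (L2_norm mu (u 0))^2"
  unfolding V_norm_sq by (simp add: LINT_add[OF I1 I2] algebra_simps)
 then have "sqrt (LINT t|time T. (V_norm (u t))^2) <= sqrt ((T + 1) * (L2_norm mu (u 0))^2)" by (rule real_sqrt_le_mono)
 then show "L2_norm (time T) (%t. V_norm (u t)) <= sqrt (T + 1) * L2_norm mu (u 0)"
  by (simp add: L2_norm_def[of "time T"] real_sqrt_mult)
qed

text \<open>The energy estimate for differences transfers the rate of the initial values to all
  times uniformly and to the V norm in mean square. The limit is built at every time in H and shown
  to lie in V at almost every time.\<close>

lemma kfp_limit:
 fixes u :: "nat => real => 'n::finite phase => real"
 assumes u: "!!n. kfp T (u n)" and T: "0 < T" and f: "f \<in> L2 mu"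
  and lim: "!!n. L2_norm mu (u n 0 -. f) <= (1/2) ^ n"
 shows "\<exists>w. kfp T w \<and> (AE z in mu. w 0 z = f z)"
proof -
 interpret TM: finite_measure "time T" by (rule finite_measure_time)
 have uu: "u n \<in> C_H T" "u n \<in> L2_V T" "has_Y T (u n) (%t. A_form (u n t))" for n using u by (auto simp: kfp_def)
 have T0: "0 \<in> {0..T}" using T by simp
 have init: "L2_norm mu (u m 0 -. u n 0) <= 2 * (1/2) ^ n" if "n <= m" for m n
 proof -
  have "L2_norm mu (u m 0 -. u n 0) <= L2_norm mu (u m 0 -. f) + L2_norm mu (f -. u n 0)"
   by (rule L2_norm_triangle_diff[OF C_H_L2[OF uu(1) T0] f C_H_L2[OF uu(1) T0]])
  moreover have "(1/2::real) ^ m <= (1/2) ^ n" using that by (intro power_decreasing) auto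
  ultimately show ?thesis using lim[of m] lim[of n] L2_norm_minus_commute[of mu f "u n 0"] by linarith
 qed
 have H: "L2_norm mu (u m s -. u n s) <= 2 * (1/2) ^ n" if "n <= m" "s \<in> {0..T}" for m n s
  using kfp_energy(1)[OF kfp_diff[OF u u] T that(2)] init[OF that(1)] by (rule order_trans)
 \<comment> \<open>The square root is the constant of the energy estimate; the 2 comes from
   comparing two initial values through f.\<close>
 define C where "C = 2 * sqrt (T + 1)"
 have C0: "0 <= C" using T by (simp add: C_def)
 have N: "(%t. V_norm (u m t -. u n t)) \<in> L2 (time T)" for m n by (rule kfp_energy(2)[OF kfp_diff[OF u u] T])
 have NC: "L2_norm (time T) (%t. V_norm (u m t -. u n t)) <= C * (1/2) ^ n" if "n <= m" for m n
 proof -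
  have "L2_norm (time T) (%t. V_norm (u m t -. u n t)) <= sqrt (T + 1) * L2_norm mu (u m 0 -. u n 0)"
   by (rule kfp_energy(3)[OF kfp_diff[OF u u] T])
  also have "\<dots> <= sqrt (T + 1) * (2 * (1/2) ^ n)" using T by (intro mult_left_mono init that) auto
  finally show ?thesis by (simp add: C_def mult_ac)
 qed
 have sm: "summable (%n. c * (1/2::real) ^ n)" for c by (intro summable_mult summable_geometric) simp
 \<comment> \<open>The limit is taken separately at each time, including the end points, because
   values at single times are needed for continuity and for the initial condition.\<close>
 have "\<exists>w. w \<in> L2 mu \<and> (%n. L2_norm mu (u n t -. w)) \<leadsto> 0" if t: "t \<in> {0..T}" for t
  using L2_complete_summable[where f="%n. u n t", OF C_H_L2[OF uu(1) t] H[OF _ t] sm] by auto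
 then have "\<forall>t. \<exists>w. t \<in> {0..T} \<longrightarrow> w \<in> L2 mu \<and> (%n. L2_norm mu (u n t -. w)) \<leadsto> 0" by blast
 then have "\<exists>w. \<forall>t. t \<in> {0..T} \<longrightarrow> w t \<in> L2 mu \<and> (%n. L2_norm mu (u n t -. w t)) \<leadsto> 0" by (rule choice)
 then obtain w where wL: "!!t. t \<in> {0..T} ==> w t \<in> L2 mu"
  and wlim: "!!t. t \<in> {0..T} ==> (%n. L2_norm mu (u n t -. w t)) \<leadsto> 0" by blast
 \<comment> \<open>Sending m to infinity keeps the rate independent of t, so the limit inherits
   continuity in time.\<close>
 have wb: "L2_norm mu (u n t -. w t) <= 2 * (1/2) ^ n" if t: "t \<in> {0..T}" for n t
 proof (rule LIMSEQ_le_const)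
  show "(%m. 2 * (1/2) ^ n + L2_norm mu (u m t -. w t)) \<leadsto> 2 * (1/2) ^ n"
   using tendsto_add[OF tendsto_const wlim[OF t], of "2 * (1/2) ^ n"] by simp
  show "\<exists>N. \<forall>m\<ge>N. L2_norm mu (u n t -. w t) <= 2 * (1/2) ^ n + L2_norm mu (u m t -. w t)"
  proof (intro exI[of _ n] allI impI)
   fix m assume "n <= m"
   then show "L2_norm mu (u n t -. w t) <= 2 * (1/2) ^ n + L2_norm mu (u m t -. w t)"
    using L2_norm_triangle_diff[OF C_H_L2[OF uu(1)[of n] t] C_H_L2[OF uu(1)[of m] t] wL[OF t]] H[of n m t] t
     L2_norm_minus_commute[of mu "u n t" "u m t"] by linarith
  qed
 qed
 have wC: "w \<in> C_H T"
  unfolding C_H_def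
 proof (intro CollectI conjI ballI wL)
  fix t assume t: "t \<in> {0..T}"
  show "((%s. L2_norm mu (w s -. w t)) \<longlongrightarrow> 0) (at t within {0..T})"
  proof (rule tendstoI)
   fix e :: real assume e: "0 < e"
   have "(%n. 4 * (1/2::real) ^ n) \<leadsto> 0" by real_asymp
   then have "\<forall>\<^sub>F n in sequentially. 4 * (1/2::real) ^ n < e / 2" by (rule order_tendstoD(2)) (use e in simp)
   then obtain n where n: "4 * (1/2::real) ^ n < e / 2" by (meson eventually_happens' sequentially_bot)
   have "((%s. L2_norm mu (u n s -. u n t)) \<longlongrightarrow> 0) (at t within {0..T})" using uu(1)[of n] t by (simp add: C_H_def)
   then have "\<forall>\<^sub>F s in at t within {0..T}. L2_norm mu (u n s -. u n t) < e / 2" using e by (intro order_tendstoD(2)) auto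
   moreover have "\<forall>\<^sub>F s in at t within {0..T}. s \<in> {0..T}" by (auto simp: eventually_at_filter)
   ultimately show "\<forall>\<^sub>F s in at t within {0..T}. dist (L2_norm mu (w s -. w t)) 0 < e"
   proof eventually_elim
    case (elim s)
    note L = wL[OF elim(2)] wL[OF t] C_H_L2[OF uu(1)[of n] elim(2)] C_H_L2[OF uu(1)[of n] t]
    have "L2_norm mu (w s -. w t) <= L2_norm mu (w s -. u n s) + L2_norm mu (u n s -. w t)"
     by (rule L2_norm_triangle_diff[OF L(1,3,2)])
    moreover have "L2_norm mu (u n s -. w t) <= L2_norm mu (u n s -. u n t) + L2_norm mu (u n t -. w t)"
     by (rule L2_norm_triangle_diff[OF L(3,4,2)])
    ultimately have "L2_norm mu (w s -. w t) < e"
     using elim(1) n wb[OF elim(2), of n] wb[OF t, of n] L2_norm_minus_commute[of mu "w s" "u n s"] by linarith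
    then show ?case by simp
   qed
  qed
 qed
 \<comment> \<open>Consecutive distances in V have summable time integrals, so at almost every time
   they are summable; the gradients then converge in L2 and closedness puts \<open>w t\<close> into
   V.\<close>
 have "AE t in time T. summable (%n. V_norm (u (Suc n) t -. u n t))"
 proof (rule AE_summable_of_integrals)
  have one: "(%_. 1 :: real) \<in> L2 (time T)" by (rule L2_I) simp_all
  show I: "integrable (time T) (%t. V_norm (u (Suc n) t -. u n t))" for n
   using L2_integrable_mult[OF N one, of "Suc n" n] by simp
  show "0 <= V_norm (u (Suc n) t -. u n t)" for n t by (rule V_norm_nonneg)
  show "summable (%n. LINT t|time T. V_norm (u (Suc n) t -. u n t))"
  proof (rule summable_comparison_test'[OF sm])
   fix n :: nat
   have "abs (ip (time T) (%t. V_norm (u (Suc n) t -. u n t)) (%_. 1)) <=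
     L2_norm (time T) (%t. V_norm (u (Suc n) t -. u n t)) * L2_norm (time T) (%_. 1 :: real)"
    by (rule ip_Cauchy_Schwarz[OF N one])
   also have "\<dots> <= (C * (1/2) ^ n) * L2_norm (time T) (%_. 1 :: real)" by (intro mult_right_mono NC) auto
   finally show "norm (LINT t|time T. V_norm (u (Suc n) t -. u n t)) <= (C * L2_norm (time T) (%_. 1 :: real)) * (1/2) ^ n"
    by (simp add: ip_def mult_ac)
  qed
 qed
 moreover have "AE t in time T. \<forall>n. u n t \<in> V"
  unfolding AE_all_countable using bochner_L2_mem[OF uu(2)] by blast
 moreover have "AE t in time T. t \<in> {0..T}" by (rule AE_time) simp
 ultimately have wV: "AE t in time T. w t \<in> V \<and> (%n. V_norm (u n t -. w t)) \<leadsto> 0"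
 proof eventually_elim
  case (elim t)
  note uV = elim(2)[rule_format]
  have b: "L2_norm mu (%z. Dv (u (Suc n) t) z - Dv (u n t) z) <= V_norm (u (Suc n) t -. u n t)" for n
  proof -
   have "has_v_grad (u (Suc n) t -. u n t) (%z. Dv (u (Suc n) t) z - Dv (u n t) z)"
    using has_v_grad_comb[OF V_has_v_grad[OF uV[of "Suc n"]] V_has_v_grad[OF uV[of n]], of 1 "-1"] by simp
   from L2_norm_Dv[OF this] show ?thesis using L2_norm_le_V_norm(2) by metis
  qed
  obtain h where h: "h \<in> L2 mu" "(%n. L2_norm mu (Dv (u n t) -. h)) \<leadsto> 0"
   using L2_complete_summable[where f="%n. Dv (u n t)", OF Dv_L2[OF uV] b elim(1)] by blast
  have W: "has_v_grad (w t) h"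
   by (rule has_v_grad_limit[OF V_has_v_grad[OF uV] wL[OF elim(3)] h(1) wlim[OF elim(3)] h(2)])
  have D: "has_v_grad (u n t -. w t) (Dv (u n t) -. h)" for n
   using has_v_grad_comb[OF V_has_v_grad[OF uV[of n]] W, of 1 "-1"] by simp
  have "(%n. V_norm (u n t -. w t)) \<leadsto> sqrt (0\<^sup>2 + 0\<^sup>2)"
   unfolding V_norm_eq[OF D] by (intro tendsto_intros wlim[OF elim(3)] h(2))
  then show ?case using has_v_grad_V[OF W] by simp
 qed
 have smu: "strongly_measurable V V_norm T (u n)" for n using uu(2)[of n] by (simp add: bochner_L2_iff)
 have smw: "strongly_measurable V V_norm T w"
 proof (rule V.strongly_measurable_limit[OF smu])
  show "AE t in time T. w t \<in> V" using wV by eventually_elim (rule conjunct1)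
  show "AE t in time T. (%n. V_norm (u n t -. w t)) \<leadsto> 0" using wV by eventually_elim (rule conjunct2)
 qed
 have smd: "strongly_measurable V V_norm T (%t z. u n t z - w t z)" for n
  using V.strongly_measurable_comb[OF smu smw, of 1 n "-1"] by simp
 \<comment> \<open>Fatou's lemma in time as m tends to infinity gives the mean square rate for the
   distance to w.\<close>
 have D: "(%t. V_norm (u n t -. w t)) \<in> L2 (time T)"
   "L2_norm (time T) (%t. V_norm (u n t -. w t)) <= C * (1/2) ^ n" for n
 proof -
  have l: "AE t in time T. (%m. V_norm (u m t -. u n t)) \<leadsto> V_norm (u n t -. w t)"
   using wV \<open>AE t in time T. \<forall>n. u n t \<in> V\<close>
  proof eventually_elim
   case (elim t)
   note uV = elim(2)[rule_format] and wtV = conjunct1[OF elim(1)]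
   have "(%m. V_norm (u m t -. u n t) - V_norm (u n t -. w t)) \<leadsto> 0"
   proof (rule Lim_null_comparison[OF _ conjunct2[OF elim(1)]])
    have "norm (V_norm (u m t -. u n t) - V_norm (u n t -. w t)) <= V_norm (u m t -. w t)" for m
     using V.N_triangle_diff[OF uV[of m] wtV uV[of n]] V.N_triangle_diff[OF uV[of n] uV[of m] wtV]
      V.N_minus_commute[OF uV[of n] wtV] V.N_minus_commute[OF uV[of n] uV[of m]] by (simp add: abs_le_iff)
    then show "\<forall>\<^sub>F m in sequentially. norm (V_norm (u m t -. u n t) - V_norm (u n t -. w t)) <= V_norm (u m t -. w t)"
     by simp
   qed
   then show ?case by (simp add: LIM_zero_iff)
  qed
  show "(%t. V_norm (u n t -. w t)) \<in> L2 (time T)"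
   "L2_norm (time T) (%t. V_norm (u n t -. w t)) <= C * (1/2) ^ n"
   by (rule L2_Fatou[OF N V.strongly_measurable_norm[OF smd] l NC], assumption)+
 qed
 have DV: "(%t z. u n t z - w t z) \<in> L2_V T" for n
  using smd L2_integrable_sq[OF D(1)[of n]] by (simp add: bochner_L2_iff)
 have wLV: "w \<in> L2_V T" using V.bochner_L2_diff[OF uu(2) DV[of 0], of 0] by simp
 have wY: "has_Y T w (%t. A_form (w t))"
  unfolding has_Y_def
 proof (intro conjI allI impI A_form_L2_V_dual wLV)
  fix p :: "real \<times> (real^'n) \<times> (real^'n) => real" assume p: "test_fun T p"
  note P = test_fun_v_grad_properties(2)[OF p, of T] and Y = test_fun_Y_C_H[OF p, of T]
  have PL: "(%t. V_norm (%z. p (t, z))) \<in> L2 (time T)"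
   using P by (intro L2_I V.strongly_measurable_norm) (simp_all add: bochner_L2_iff)
  have iA: "integrable (time T) (%t. A_form (x t) (%z. p (t, z)))" if "x \<in> L2_V T" for x
   by (rule integrable_V_dual_V[OF A_form_L2_V_dual[OF that] P])
  have "(%n. (LINT t|time T. A_form (u n t) (%z. p (t, z))) - (LINT t|time T. A_form (w t) (%z. p (t, z)))) \<leadsto> 0"
  proof (rule Lim_null_comparison)
   have "norm ((LINT t|time T. A_form (u n t) (%z. p (t, z))) - (LINT t|time T. A_form (w t) (%z. p (t, z))))
     <= (C * L2_norm (time T) (%t. V_norm (%z. p (t, z)))) * (1/2) ^ n" for n
   proof -
    have "(LINT t|time T. A_form (u n t) (%z. p (t, z))) - (LINT t|time T. A_form (w t) (%z. p (t, z)))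
     = (LINT t|time T. A_form (u n t) (%z. p (t, z)) - A_form (w t) (%z. p (t, z)))"
     by (rule LINT_diff[OF iA[OF uu(2)] iA[OF wLV], symmetric])
    also have "norm \<dots> <= (LINT t|time T. norm (A_form (u n t) (%z. p (t, z)) - A_form (w t) (%z. p (t, z))))"
     by (rule integral_norm_bound)
    also have "\<dots> <= (LINT t|time T. V_norm (u n t -. w t) * V_norm (%z. p (t, z)))"
    proof (rule integral_mono_AE)
     show "integrable (time T) (%t. norm (A_form (u n t) (%z. p (t, z)) - A_form (w t) (%z. p (t, z))))"
      by (intro integrable_norm integrable_minus iA uu wLV)
     show "integrable (time T) (%t. V_norm (u n t -. w t) * V_norm (%z. p (t, z)))"
      by (rule L2_integrable_mult[OF D(1) PL])
     show "AE t in time T. norm (A_form (u n t) (%z. p (t, z)) - A_form (w t) (%z. p (t, z))) <= V_norm (u n t -. w t) * V_norm (%z. p (t, z))"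
      using bochner_L2_mem[OF uu(2)[of n]] bochner_L2_mem[OF wLV] bochner_L2_mem[OF P]
     proof eventually_elim
      case (elim t)
      have "A_form (u n t) (%z. p (t, z)) - A_form (w t) (%z. p (t, z)) = A_form (u n t -. w t) (%z. p (t, z))"
       using A_form_comb[OF elim(1,2,3), of 1 "-1"] by simp
      then show ?case using A_form_bound[OF V.diff_mem[OF elim(1,2)] elim(3)] by simp
     qed
    qed
    also have "\<dots> = ip (time T) (%t. V_norm (u n t -. w t)) (%t. V_norm (%z. p (t, z)))" by (simp add: ip_def)
    also have "\<dots> <= L2_norm (time T) (%t. V_norm (u n t -. w t)) * L2_norm (time T) (%t. V_norm (%z. p (t, z)))"
     using ip_Cauchy_Schwarz[OF D(1) PL, of n] by linarith
    also have "\<dots> <= (C * (1/2) ^ n) * L2_norm (time T) (%t. V_norm (%z. p (t, z)))" by (intro mult_right_mono D(2)) auto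
    finally show ?thesis by (simp add: mult_ac)
   qed
   then show "\<forall>\<^sub>F n in sequentially. norm ((LINT t|time T. A_form (u n t) (%z. p (t, z))) - (LINT t|time T. A_form (w t) (%z. p (t, z))))
     <= (C * L2_norm (time T) (%t. V_norm (%z. p (t, z)))) * (1/2) ^ n" by simp
   show "(%n. (C * L2_norm (time T) (%t. V_norm (%z. p (t, z)))) * (1/2) ^ n) \<leadsto> 0" by (rule summable_LIMSEQ_zero[OF sm])
  qed
  then have l1: "(%n. LINT t|time T. A_form (u n t) (%z. p (t, z))) \<leadsto> (LINT t|time T. A_form (w t) (%z. p (t, z)))"
   by (simp add: LIM_zero_iff)
  obtain B where B: "0 <= B" "!!t. t \<in> {0..T} ==> L2_norm mu (Y_classical p t) <= B" by (rule C_H_bounded[OF Y]) (rule that)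
  have "(%n. LINT t|time T. ip mu (u n t) (Y_classical p t)) \<leadsto> (LINT t|time T. ip mu (w t) (Y_classical p t))"
  proof (rule integral_dominated_convergence[where w="%_. (L2_norm mu (u 0 0) + 4) * B"])
   show "(%t. ip mu (w t) (Y_classical p t)) \<in> borel_measurable (time T)" "(%t. ip mu (u n t) (Y_classical p t)) \<in> borel_measurable (time T)" for n
    by (intro borel_measurable_integrable integrable_time_continuous C_H_ip_continuous wC uu Y)+
   show "AE t in time T. (%n. ip mu (u n t) (Y_classical p t)) \<leadsto> ip mu (w t) (Y_classical p t)"
   proof (rule AE_time)
    fix t assume "0 < t" "t < T"
    then have t: "t \<in> {0..T}" by simp
    show "(%n. ip mu (u n t) (Y_classical p t)) \<leadsto> ip mu (w t) (Y_classical p t)"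
     by (rule ip_tendsto[OF C_H_L2[OF uu(1) t] wL[OF t] C_H_L2[OF Y t] wlim[OF t]])
   qed
   show "AE t in time T. norm (ip mu (u n t) (Y_classical p t)) <= (L2_norm mu (u 0 0) + 4) * B" for n
   proof (rule AE_time)
    fix t assume "0 < t" "t < T"
    then have t: "t \<in> {0..T}" by simp
    have "L2_norm mu (u n t) <= L2_norm mu (u 0 t) + L2_norm mu (u n t -. u 0 t)"
     using L2_norm_diff_ineq[OF C_H_L2[OF uu(1)[of n] t] C_H_L2[OF uu(1)[of 0] t]] by linarith
    then have "L2_norm mu (u n t) <= L2_norm mu (u 0 0) + 4"
     using kfp_energy(1)[OF u[of 0] T t] H[of 0 n t] t by simp
    then have "L2_norm mu (u n t) * L2_norm mu (Y_classical p t) <= (L2_norm mu (u 0 0) + 4) * B"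
     by (intro mult_mono B t) auto
    then show "norm (ip mu (u n t) (Y_classical p t)) <= (L2_norm mu (u 0 0) + 4) * B"
     using ip_Cauchy_Schwarz[OF C_H_L2[OF uu(1)[of n] t] C_H_L2[OF Y t]] by simp
   qed
  qed simp
  then have l2: "(%n. LINT t|time T. A_form (u n t) (%z. p (t, z))) \<leadsto> - (LINT t|time T. ip mu (w t) (Y_classical p t))"
   unfolding has_Y_eq[OF uu(3) p] by (rule tendsto_minus)
  show "(LINT t|time T. A_form (w t) (%z. p (t, z))) = - (LINT t|time T. LINT z|mu. w t z * Y_classical p t z)"
   using LIMSEQ_unique[OF l1 l2] by (simp add: ip_def)
 qed
 have "L2_norm mu (w 0 -. f) <= 0"
 proof (rule LIMSEQ_le_const)
  show "(%n. 3 * (1/2::real) ^ n) \<leadsto> 0" by real_asymp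
  show "\<exists>N. \<forall>n\<ge>N. L2_norm mu (w 0 -. f) <= 3 * (1/2) ^ n"
  proof (intro exI allI impI)
   fix n
   show "L2_norm mu (w 0 -. f) <= 3 * (1/2) ^ n"
    using L2_norm_triangle_diff[OF wL[OF T0] C_H_L2[OF uu(1)[of n] T0] f] wb[OF T0, of n] lim[of n]
     L2_norm_minus_commute[of mu "w 0" "u n 0"] by linarith
  qed
 qed
 then have "L2_norm mu (w 0 -. f) = 0" by (simp add: order_antisym)
 then have "AE z in mu. w 0 z - f z = 0" using L2_norm_eq_0_iff[OF L2_diff[OF wL[OF T0] f]] by simp
 then have "AE z in mu. w 0 z = f z" by eventually_elim simp
 then show ?thesis using wC wLV wY unfolding kfp_def by blast
qed

theorem kfp_exists:
 assumes f: "f \<in> L2 mu" and T: "0 < T"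
 shows "\<exists>u. kfp T u \<and> (AE z in mu. u 0 z = f z)"
proof -
 have "\<exists>u. kfp T u \<and> L2_norm mu (u 0 -. f) <= (1/2) ^ n" for n
 proof -
  obtain g where g: "fin_span trig_family g" "L2_norm mu (f -. g) < (1/2) ^ n"
   using closed_span_approx[OF trig_family_complete[OF f], of "(1/2) ^ n"] by auto
  obtain u where "kfp T u" "u 0 = g" using kfp_fin_span[OF g(1), of T] T by auto
  then show ?thesis using g(2) L2_norm_minus_commute[of mu f g] by (intro exI[of _ u]) auto
 qed
 then have "\<exists>u. \<forall>n. kfp T (u n) \<and> L2_norm mu (u n 0 -. f) <= (1/2) ^ n" by (intro choice allI)
 then obtain u where "!!n. kfp T (u n)" "!!n. L2_norm mu (u n 0 -. f) <= (1/2) ^ n" by blast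
 then show ?thesis using kfp_limit[OF _ T f, of u] by blast
qed

section \<open>The two notions of solution\<close>

lemma H1_kin_I: "u \<in> L2_V T ==> has_Y T u F ==> u \<in> H1_kin T"
 unfolding H1_kin_def by blast

lemma kfp_energy_weak_solution:
 assumes "kfp T u" "AE z in mu. u 0 z = u0 z"
 shows "energy_weak_solution T u0 u"
proof -
 have uu: "u \<in> C_H T" "u \<in> L2_V T" "has_Y T u (%t. A_form (u t))" using assms(1) by (auto simp: kfp_def)
 have "(LINT t|time T. A_form (u t) (p t)) + (LINT t|time T. LINT z|mu. Dv (u t) z \<bullet> Dv (p t) z) = 0" for p
  by (simp add: A_form_def ip_def)
 then show ?thesis
  unfolding energy_weak_solution_def using uu H1_kin_I[OF uu(2,3)] assms(2)
  by (intro conjI IntI exI[of _ "%t. A_form (u t)"] ballI)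
qed

lemma LINT_Dv_sq_diff:
 assumes "u \<in> V" "w \<in> V"
 shows "(LINT z|mu. (norm (Dv u z))^2 - (norm (Dv w z))^2) = ip mu (Dv u) (Dv u) - ip mu (Dv w) (Dv w)"
 using assms by (simp add: L2_norm_ip[symmetric] L2_norm_sq LINT_diff L2_integrable_sq Dv_L2)

lemma LINT_Dv_time:
 assumes w: "w \<in> L2_V T" and u: "u \<in> L2_V T"
 shows "(LINT t|time T. LINT z|mu. (norm (Dv (w t) z))^2 - (norm (Dv (u t) z))^2) =
  (LINT t|time T. ip mu (Dv (w t)) (Dv (w t)) - ip mu (Dv (u t)) (Dv (u t)))"
proof (rule integral_cong_AE)
 have eq: "AE t in time T. ip mu (Dv (w t)) (Dv (w t)) - ip mu (Dv (u t)) (Dv (u t)) = (LINT z|mu. (norm (Dv (w t) z))^2 - (norm (Dv (u t) z))^2)"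
  using bochner_L2_mem[OF w] bochner_L2_mem[OF u] by eventually_elim (simp add: LINT_Dv_sq_diff)
 show m: "(%t. ip mu (Dv (w t)) (Dv (w t)) - ip mu (Dv (u t)) (Dv (u t))) \<in> borel_measurable (time T)"
  by (intro borel_measurable_integrable integrable_minus integrable_ip_Dv w u)
 show "(%t. LINT z|mu. (norm (Dv (w t) z))^2 - (norm (Dv (u t) z))^2) \<in> borel_measurable (time T)"
  by (rule borel_measurable_time_AE[OF m eq])
 show "AE t in time T. (LINT z|mu. (norm (Dv (w t) z))^2 - (norm (Dv (u t) z))^2) = ip mu (Dv (w t)) (Dv (w t)) - ip mu (Dv (u t)) (Dv (u t))"
  using eq by eventually_elim simp
qed

text \<open>Completing the square. The surplus on the right is the convexity gap of the Dirichlet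
  energy and accounts for the inequality in the variational formulation.\<close>

lemma ip_Dv_square:
 assumes u: "u \<in> V" and w: "w \<in> V"
 shows "1/2 * (ip mu (Dv w) (Dv w) - ip mu (Dv u) (Dv u)) - ip mu (Dv u) (Dv (w -. u)) =
  1/2 * (L2_norm mu (Dv (w -. u)))^2"
proof -
 have "ip mu (Dv (w -. u)) (Dv (w -. u)) = ip mu (Dv w) (Dv w) - 2 * ip mu (Dv u) (Dv w) + ip mu (Dv u) (Dv u)"
  using ip_Dv_diff_left[OF w u V.diff_mem[OF w u]] ip_Dv_diff_right[OF w w u] ip_Dv_diff_right[OF u w u]
   ip_commute[of mu "Dv w" "Dv u"] by simp
 then show ?thesis unfolding L2_norm_ip ip_Dv_diff_right[OF u w u] by (simp add: field_simps)
qed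

lemma C_H_initial_norm:
 assumes "u \<in> C_H T" "w \<in> C_H T" "0 <= T" "u0 \<in> L2 mu" "AE z in mu. u 0 z = u0 z"
 shows "L2_norm mu (w 0 -. u 0) = L2_norm mu (w 0 -. u0)"
proof (rule L2_norm_cong_AE)
 have 0: "0 \<in> {0..T}" using assms(3) by simp
 show "(w 0 -. u 0) \<in> borel_measurable mu" "(w 0 -. u0) \<in> borel_measurable mu"
  by (intro L2_measurable L2_diff C_H_L2[OF assms(1) 0] C_H_L2[OF assms(2) 0] assms(4))+
 show "AE z in mu. w 0 z - u 0 z = w 0 z - u0 z" using assms(5) by eventually_elim simp
qed

lemma energy_weak_imp_variational:
 fixes u :: "real => 'n::finite phase => real"
 assumes u: "energy_weak_solution T u0 u" and u0: "u0 \<in> L2 mu"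
 shows "variational_solution T u0 u"
proof -
 have uu: "u \<in> C_H T" "u \<in> L2_V T" "AE z in mu. u 0 z = u0 z" using u by (auto simp: energy_weak_solution_def H1_kin_def)
 obtain F where F: "has_Y T u F"
  and weak: "!!p. p \<in> L2_V T ==> (LINT t|time T. F t (p t)) + (LINT t|time T. LINT z|mu. Dv (u t) z \<bullet> Dv (p t) z) = 0"
  using u unfolding energy_weak_solution_def by blast
 have "(LINT t|time \<tau>. G t (w t -. u t))
    + 1/2 * (LINT t|time \<tau>. LINT z|mu. (norm (Dv (w t) z))^2 - (norm (Dv (u t) z))^2)
   \<ge> 1/2 * (L2_norm mu (w \<tau> -. u \<tau>))^2 - 1/2 * (L2_norm mu (w 0 -. u0))^2"
  if \<tau>: "\<tau> \<in> {0<..T}" and w: "w \<in> H1_kin \<tau> \<inter> C_H \<tau>" and G: "has_Y \<tau> w G" for \<tau> w G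
 proof -
  have t: "0 < \<tau>" "\<tau> <= T" using \<tau> by auto
  have ww: "w \<in> C_H \<tau>" "w \<in> L2_V \<tau>" using w by (auto simp: H1_kin_def)
  note uC = C_H_subset[OF uu(1) t(2)] and uV = V.bochner_L2_subset[OF uu(2) t(2)] and uY = has_Y_subset[OF F t(2)]
  let ?e = "%t z. w t z - u t z"
  have e: "?e \<in> C_H \<tau>" "?e \<in> L2_V \<tau>" by (rule C_H_diff[OF ww(1) uC], rule V.bochner_L2_diff[OF ww(2) uV])
  have FL: "F \<in> L2_V_dual \<tau>" and GL: "G \<in> L2_V_dual \<tau>" using uY G by (auto simp: has_Y_def)
  note IF = integrable_V_dual_V[OF FL e(2)] and IG = integrable_V_dual_V[OF GL e(2)]
  have "(LINT t|time \<tau>. G t (?e t) - F t (?e t)) = 1/2 * (L2_norm mu (?e \<tau>))^2 - 1/2 * (L2_norm mu (?e 0))^2"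
   by (rule energy_identity[OF e has_Y_diff[OF ww(1) G uC uY] t(1)])
  then have 1: "(LINT t|time \<tau>. G t (?e t)) = (LINT t|time \<tau>. F t (?e t)) +
    (1/2 * (L2_norm mu (?e \<tau>))^2 - 1/2 * (L2_norm mu (w 0 -. u0))^2)"
   using LINT_diff[OF IG IF] C_H_initial_norm[OF uC ww(1) less_imp_le[OF t(1)] u0 uu(3)] by simp
  \<comment> \<open>The weak formulation is tested over (0,T), so w - u is extended by zero after
    \<tau>; every functional in the dual vanishes on the zero function.\<close>
  let ?p = "%t. if t < \<tau> then ?e t else (%_. 0)"
  have "(LINT t|time T. F t (?p t)) = (LINT t|time T. (if t < \<tau> then F t (?e t) else 0))"
  proof (rule integral_cong_AE)
   have FT: "F \<in> L2_V_dual T" using F by (simp add: has_Y_def)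
   show "(%t. F t (?p t)) \<in> borel_measurable (time T)"
    by (rule borel_measurable_integrable[OF integrable_V_dual_V[OF FT V.bochner_L2_extend[OF e(2) t(2)]]])
   show "(%t. if t < \<tau> then F t (?e t) else 0) \<in> borel_measurable (time T)"
    using IF integrable_time_extend(1)[OF t(2), of "%t. F t (?e t)"] by (intro borel_measurable_integrable) simp
   show "AE t in time T. F t (?p t) = (if t < \<tau> then F t (?e t) else 0)"
    using bochner_L2_mem[OF FT] by eventually_elim (simp add: V_dual_zero)
  qed
  also have "\<dots> = (LINT t|time \<tau>. F t (?e t))" by (rule integrable_time_extend(2)[OF t(2)])
  finally have 2: "(LINT t|time T. F t (?p t)) = (LINT t|time \<tau>. F t (?e t))" .
  have z: "ip mu (Dv (u t)) (Dv (%_. 0)) = 0" if "u t \<in> V" for t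
   using ip_Dv_diff_right[OF that that that] by simp
  have "(LINT t|time T. ip mu (Dv (u t)) (Dv (?p t))) = (LINT t|time T. (if t < \<tau> then ip mu (Dv (u t)) (Dv (?e t)) else 0))"
  proof (rule integral_cong_AE)
   show "(%t. ip mu (Dv (u t)) (Dv (?p t))) \<in> borel_measurable (time T)"
    by (rule borel_measurable_integrable[OF integrable_ip_Dv[OF uu(2) V.bochner_L2_extend[OF e(2) t(2)]]])
   show "(%t. if t < \<tau> then ip mu (Dv (u t)) (Dv (?e t)) else 0) \<in> borel_measurable (time T)"
    using integrable_ip_Dv[OF uV e(2)] integrable_time_extend(1)[OF t(2), of "%t. ip mu (Dv (u t)) (Dv (?e t))"]
    by (intro borel_measurable_integrable) simp
   show "AE t in time T. ip mu (Dv (u t)) (Dv (?p t)) = (if t < \<tau> then ip mu (Dv (u t)) (Dv (?e t)) else 0)"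
    using bochner_L2_mem[OF uu(2)] by eventually_elim (simp add: z)
  qed
  also have "\<dots> = (LINT t|time \<tau>. ip mu (Dv (u t)) (Dv (?e t)))" by (rule integrable_time_extend(2)[OF t(2)])
  finally have 3: "(LINT t|time \<tau>. F t (?e t)) = - (LINT t|time \<tau>. ip mu (Dv (u t)) (Dv (?e t)))"
   using weak[OF V.bochner_L2_extend[OF e(2) t(2)]] 2 by (simp add: ip_def)
  let ?s = "%t. 1/2 * (ip mu (Dv (w t)) (Dv (w t)) - ip mu (Dv (u t)) (Dv (u t))) - ip mu (Dv (u t)) (Dv (?e t))"
  have I: "integrable (time \<tau>) (%t. ip mu (Dv (w t)) (Dv (w t)))" "integrable (time \<tau>) (%t. ip mu (Dv (u t)) (Dv (u t)))"
   "integrable (time \<tau>) (%t. ip mu (Dv (u t)) (Dv (?e t)))"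
   by (intro integrable_ip_Dv ww uV e)+
  \<comment> \<open>The discarded term is half the integral of |D_v(w - u)|^2.\<close>
  have "0 <= (LINT t|time \<tau>. ?s t)"
  proof (rule integral_nonneg_AE)
   show "AE t in time \<tau>. 0 <= ?s t"
    using bochner_L2_mem[OF uV] bochner_L2_mem[OF ww(2)] by eventually_elim (unfold ip_Dv_square, simp)
  qed
  then have 4: "(LINT t|time \<tau>. ip mu (Dv (u t)) (Dv (?e t))) <= 1/2 * (LINT t|time \<tau>. ip mu (Dv (w t)) (Dv (w t)) - ip mu (Dv (u t)) (Dv (u t)))"
   using I by simp
  have "(LINT t|time \<tau>. LINT z|mu. (norm (Dv (w t) z))^2 - (norm (Dv (u t) z))^2) =
    (LINT t|time \<tau>. ip mu (Dv (w t)) (Dv (w t)) - ip mu (Dv (u t)) (Dv (u t)))"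
   using LINT_Dv_time[OF ww(2) uV] .
  then show ?thesis using 1 3 4 by simp
 qed
 then show ?thesis unfolding variational_solution_def using uu by blast
qed

lemma variational_unique:
 fixes u w :: "real => 'n::finite phase => real"
 assumes w: "variational_solution T u0 w" and u0: "u0 \<in> L2 mu"
  and u: "kfp T u" "AE z in mu. u 0 z = u0 z"
 shows "eq_C_H T w u"
 unfolding eq_C_H_def
proof
 fix \<tau> assume \<tau>: "\<tau> \<in> {0..T}"
 have uu: "u \<in> C_H T" "u \<in> L2_V T" "has_Y T u (%t. A_form (u t))" using u(1) by (auto simp: kfp_def)
 have ww: "w \<in> C_H T" "w \<in> L2_V T" "AE z in mu. w 0 z = u0 z" using w by (auto simp: variational_solution_def)
 note var = w[unfolded variational_solution_def, THEN conjunct2, THEN conjunct2, THEN bspec, of \<tau>]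
 show "AE z in mu. w \<tau> z = u \<tau> z"
 proof (cases "\<tau> = 0")
  case True
  show ?thesis unfolding True using ww(3) u(2) by eventually_elim simp
 next
  case False
  then have t: "0 < \<tau>" "\<tau> <= T" using \<tau> by auto
  note uC = C_H_subset[OF uu(1) t(2)] and uV = V.bochner_L2_subset[OF uu(2) t(2)] and uY = has_Y_subset[OF uu(3) t(2)]
   and wC = C_H_subset[OF ww(1) t(2)] and wV = V.bochner_L2_subset[OF ww(2) t(2)]
  let ?e = "%t z. u t z - w t z"
  have e: "?e \<in> L2_V \<tau>" by (rule V.bochner_L2_diff[OF uV wV])
  have a: "1/2 * (L2_norm mu (?e \<tau>))^2 - 1/2 * (L2_norm mu (u 0 -. u0))^2 <=
   (LINT t|time \<tau>. A_form (u t) (?e t)) + 1/2 * (LINT t|time \<tau>. LINT z|mu. (norm (Dv (u t) z))^2 - (norm (Dv (w t) z))^2)"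
   by (rule var[THEN bspec, OF _ IntI[OF H1_kin_I[OF uV uY] uC], THEN spec, THEN mp, OF _ uY]) (use t in simp)
  have b: "L2_norm mu (u 0 -. u0) = 0"
  proof (subst L2_norm_eq_0_iff)
   show "(u 0 -. u0) \<in> L2 mu" by (rule L2_diff[OF C_H_L2[OF uC] u0]) (use t in simp)
   show "AE z in mu. u 0 z - u0 z = 0" using u(2) by eventually_elim simp
  qed
  \<comment> \<open>For the solution u as competitor the left side equals minus half the integral of
    |D_v(u - w)|^2, by the same completion of the square with the roles exchanged.\<close>
  have c: "(LINT t|time \<tau>. A_form (u t) (?e t)) + 1/2 * (LINT t|time \<tau>. LINT z|mu. (norm (Dv (u t) z))^2 - (norm (Dv (w t) z))^2) <= 0"
  proof -
   have I: "integrable (time \<tau>) (%t. ip mu (Dv (u t)) (Dv (u t)))" "integrable (time \<tau>) (%t. ip mu (Dv (w t)) (Dv (w t)))"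
    "integrable (time \<tau>) (%t. ip mu (Dv (u t)) (Dv (?e t)))"
    by (intro integrable_ip_Dv wV uV e)+
   have "(LINT t|time \<tau>. 1/2 * (ip mu (Dv (u t)) (Dv (u t)) - ip mu (Dv (w t)) (Dv (w t))) - ip mu (Dv (u t)) (Dv (?e t))) <= (LINT t|time \<tau>. 0)"
   proof (rule integral_mono_AE)
    show "AE t in time \<tau>. 1/2 * (ip mu (Dv (u t)) (Dv (u t)) - ip mu (Dv (w t)) (Dv (w t))) - ip mu (Dv (u t)) (Dv (?e t)) <= 0"
     using bochner_L2_mem[OF uV] bochner_L2_mem[OF wV]
    proof eventually_elim
     case (elim t)
     have "1/2 * (ip mu (Dv (u t)) (Dv (u t)) - ip mu (Dv (w t)) (Dv (w t))) - ip mu (Dv (u t)) (Dv (?e t)) =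
       - (1/2 * (L2_norm mu (Dv (w t -. u t)))^2)"
      using ip_Dv_square[OF elim] ip_Dv_diff_right[OF elim(1) elim(2,1)] ip_Dv_diff_right[OF elim(1) elim(1,2)] by (simp add: field_simps)
     then show ?case by simp
    qed
   qed (use I in simp_all)
   then have "1/2 * (LINT t|time \<tau>. ip mu (Dv (u t)) (Dv (u t)) - ip mu (Dv (w t)) (Dv (w t))) <= (LINT t|time \<tau>. ip mu (Dv (u t)) (Dv (?e t)))"
    using I by simp
   then show ?thesis unfolding LINT_Dv_time[OF uV wV] by (simp add: A_form_def)
  qed
  have "(L2_norm mu (?e \<tau>))^2 <= 0" using order_trans[OF a c] b by simp
  then have "L2_norm mu (?e \<tau>) = 0" by simp
  moreover have "?e \<tau> \<in> L2 mu" by (rule L2_diff[OF C_H_L2[OF uC] C_H_L2[OF wC]]) (use t in simp_all)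
  ultimately have "AE z in mu. ?e \<tau> z = 0" by (simp add: L2_norm_eq_0_iff)
  then show ?thesis by eventually_elim simp
 qed
qed

text \<open>A variational solution is only known to agree with u almost everywhere at each time.
  Both the function under Y and the gradient inside \<open>A_form\<close> have to be
  exchanged.\<close>

lemma kfp_cong:
 fixes u w :: "real => 'n::finite phase => real"
 assumes u: "kfp T u" and w: "w \<in> C_H T" "w \<in> L2_V T" and eq: "eq_C_H T w u"
 shows "kfp T w"
proof -
 have uu: "u \<in> C_H T" "u \<in> L2_V T" "has_Y T u (%t. A_form (u t))" using u by (auto simp: kfp_def)
 have ae: "AE z in mu. w t z = u t z" if "t \<in> {0..T}" for t using eq that by (simp add: eq_C_H_def)
 have "has_Y T w (%t. A_form (u t))"
  unfolding has_Y_def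
 proof (intro conjI allI impI A_form_L2_V_dual uu)
  fix p :: "real \<times> (real^'n) \<times> (real^'n) => real" assume p: "test_fun T p"
  have "(LINT t|time T. ip mu (u t) (Y_classical p t)) = (LINT t|time T. ip mu (w t) (Y_classical p t))"
  proof (rule LINT_cong[OF refl])
   fix t assume "t \<in> space (time T)"
   then have t: "t \<in> {0..T}" by simp
   note L = C_H_L2[OF uu(1) t] C_H_L2[OF w(1) t] C_H_L2[OF test_fun_Y_C_H[OF p] t]
   show "ip mu (u t) (Y_classical p t) = ip mu (w t) (Y_classical p t)"
    by (rule ip_cong_AE[OF L(1,2,3,3)]) (use ae[OF t] in \<open>auto elim: eventually_mono\<close>)
  qed
  then show "(LINT t|time T. A_form (u t) (%z. p (t, z))) = - (LINT t|time T. LINT z|mu. w t z * Y_classical p t z)"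
   using has_Y_eq[OF uu(3) p] by (simp add: ip_def)
 qed
 then have "has_Y T w (%t. A_form (w t))"
 proof (rule has_Y_cong[OF _ A_form_L2_V_dual[OF w(2)]])
  have sp: "AE t in time T. t \<in> {0..T}" by (rule AE_time) simp
  show "AE t in time T. \<forall>p\<in>V. A_form (u t) p = A_form (w t) p"
   using sp bochner_L2_mem[OF uu(2)] bochner_L2_mem[OF w(2)]
  proof eventually_elim
   case (elim t)
   have D: "AE z in mu. Dv (w t) z = Dv (u t) z"
    by (rule V_cong_AE(3)[OF elim(3) L2_measurable[OF V_L2[OF elim(2)]] ae[OF elim(1)]])
   show ?case
   proof
    fix p :: "'n phase => real" assume "p \<in> V"
    then show "A_form (u t) p = A_form (w t) p"
     unfolding A_form_def
     using ip_cong_AE[OF Dv_L2[OF elim(3)] Dv_L2[OF elim(2)] Dv_L2 Dv_L2 D AE_I2[OF refl]] by simp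
   qed
  qed
 qed
 then show ?thesis using w by (simp add: kfp_def)
qed

theorem proposition1p6:
 fixes T :: real and u0 :: "'n::finite phase \<Rightarrow> real"
 assumes "0 < T" and "u0 \<in> L2 mu"
 shows "(\<exists>u. energy_weak_solution T u0 u
      \<and> (\<forall>w. energy_weak_solution T u0 w \<longrightarrow> eq_C_H T w u)
      \<and> variational_solution T u0 u
      \<and> (\<forall>w. variational_solution T u0 w \<longrightarrow> eq_C_H T w u))
   \<and> (\<forall>u. energy_weak_solution T u0 u \<longleftrightarrow> variational_solution T u0 u)"
proof -
 obtain u where u: "kfp T u" "AE z in mu. u 0 z = u0 z" using kfp_exists[OF assms(2,1)] by blast
 have weak: "energy_weak_solution T u0 u" by (rule kfp_energy_weak_solution[OF u])
 have uniq: "variational_solution T u0 w ==> eq_C_H T w u" for w by (rule variational_unique[OF _ assms(2) u])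
 have imp: "energy_weak_solution T u0 w ==> variational_solution T u0 w" for w
  by (rule energy_weak_imp_variational[OF _ assms(2)])
 have conv: "energy_weak_solution T u0 w" if w: "variational_solution T u0 w" for w
 proof (rule kfp_energy_weak_solution)
  show "kfp T w" by (rule kfp_cong[OF u(1) _ _ uniq[OF w]]) (use w in \<open>simp_all add: variational_solution_def\<close>)
  show "AE z in mu. w 0 z = u0 z" using w by (simp add: variational_solution_def)
 qed
 \<comment> \<open>Uniqueness of energy weak solutions also comes from \<open>uniq\<close>, since
   each of them is a variational solution by \<open>imp\<close>.\<close>
 show ?thesis using weak imp conv uniq by blast
qed

end
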